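(* Let $R$ be a commutative Noetherian ring, $\mathfrak a$ a proper ideal of $R$, and $M$ an RCMF $R$-module with respect to $\mathfrak a$. Then $M_{\mathfrak p}$ is an RCMF $R_{\mathfrak p}$-module with respect to $\mathfrak aR_{\mathfrak p}$ for any prime ideal $\mathfrak p\in\operatorname{Supp}_R(M)\cap V(\mathfrak a)$.
   Context: $H^i_{\mathfrak a}(-)$ denotes local cohomology with respect to $\mathfrak a$ and $\operatorname{cd}(\mathfrak a,M)=\sup\{i\in\mathbb Z\mid H^i_{\mathfrak a}(M)\neq0\}$ (so the zero module has $\operatorname{cd}=-\infty$). $V(\mathfrak a)$ is the set of primes containing $\mathfrak a$. Cohomological dimension filtration (cd-filtration): for a finitely generated $R$-module $M$ with $c=\operatorname{cd}(\mathfrak a,M)$, it is the increasing filtration $\{M_i\}_{i=0}^c$ of submodules in which $M_i$ is the largest submodule of $M$ with $\operatorname{cd}(\mathfrak a,M_i)\le i$. Relative Cohen-Macaulay: a finitely generated $R$-module $N$ is relative Cohen-Macaulay with respect to $\mathfrak a$ if there is precisely one $i$ with $H^i_{\mathfrak a}(N)\ne0$ (equivalently $\operatorname{grade}(\mathfrak a,N)=\operatorname{cd}(\mathfrak a,N)$). RCMF (relative Cohen-Macaulay filtered): a finitely generated $R$-module $M$ with cd-filtration $\{M_i\}_{i=0}^c$, $c=\operatorname{cd}(\mathfrak a,M)$, is RCMF with respect to $\mathfrak a$ if for all $1\le i\le c$ the module $M_i/M_{i-1}$ is either zero or relative Cohen-Macaulay with respect to $\mathfrak a$ with $\operatorname{cd}(\mathfrak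 a,M_i/M_{i-1})=i$. *)

theory Defs
  imports "HOL-Algebra.Module" "HOL-Algebra.Ideal_Product" "HOL-Algebra.Ring_Divisibility"
    "HOL-Library.Extended_Real"
begin

section \<open>Modules\<close>

definition zero_module :: "('r, 'm, 'y) module_scheme \<Rightarrow> bool"
  where "zero_module M \<longleftrightarrow> carrier M = {\<zero>\<^bsub>M\<^esub>}"

definition finitely_generated :: "('r, 'x) ring_scheme \<Rightarrow> ('r, 'm, 'y) module_scheme \<Rightarrow> bool"
  where "finitely_generated R M \<longleftrightarrow> module R M \<and>
    (\<exists>A. finite A \<and> A \<subseteq> carrier M \<and> \<Inter>{H. submodule H R M \<and> A \<subseteq> H} = carrier M)"

definition mod_hom ::
  "('r, 'x) ring_scheme \<Rightarrow> ('r, 'm, 'y) module_scheme \<Rightarrow> ('r, 'n, 'z) module_scheme \<Rightarrow> ('m \<Rightarrow> 'n) set"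
  where "mod_hom R M N = {f \<in> carrier M \<rightarrow> carrier N.
    (\<forall>x\<in>carrier M. \<forall>y\<in>carrier M. f (x \<oplus>\<^bsub>M\<^esub> y) = f x \<oplus>\<^bsub>N\<^esub> f y) \<and>
    (\<forall>r\<in>carrier R. \<forall>x\<in>carrier M. f (r \<odot>\<^bsub>M\<^esub> x) = r \<odot>\<^bsub>N\<^esub> f x)}"

text \<open>The multiplication and unit that the record type of modules inherits from rings carry no
  meaning for a module; they are left \<^const>\<open>undefined\<close> below.\<close>

definition quotient_module :: "('r, 'm, 'y) module_scheme \<Rightarrow> 'm set \<Rightarrow> ('r, 'm set) module"
  where "quotient_module M N =
    \<lparr>carrier = a_rcosets\<^bsub>M\<^esub> N, monoid.mult = undefined, one = undefined, zero = N, add = set_add M,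
     smult = (\<lambda>r C. \<Union>x\<in>C. N +>\<^bsub>M\<^esub> (r \<odot>\<^bsub>M\<^esub> x))\<rparr>"

section \<open>Local cohomology\<close>

text \<open>Only test modules \<open>B\<close> with the same element type as \<open>E\<close> can be quantified over. As soon as
  this type is at least as large as the ring, a copy of the ring is among them, and by Baer's
  criterion the extension property then holds for modules of every element type. This is the case
  for the universe type used for resolutions below.\<close>

definition injective_module :: "('r, 'x) ring_scheme \<Rightarrow> ('r, 'u) module \<Rightarrow> bool"
  where "injective_module R E \<longleftrightarrow> module R E \<and>
    (\<forall>(B :: ('r, 'u) module) A. \<forall>f. module R B \<and> submodule A R B \<and> f \<in> mod_hom R (B\<lparr>carrier := A\<rparr>) E
       \<longrightarrow> (\<exists>g\<in>mod_hom R B E. \<forall>x\<in>A. g x = f x))"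

text \<open>\<open>0 \<rightarrow> M \<rightarrow> I 0 \<rightarrow> I 1 \<rightarrow> \<dots>\<close> with augmentation \<open>e\<close> and differentials \<open>d i : I i \<rightarrow> I (i + 1)\<close>.\<close>

definition injective_resolution ::
  "('r, 'x) ring_scheme \<Rightarrow> ('r, 'm, 'y) module_scheme \<Rightarrow>
   (nat \<Rightarrow> ('r, 'u) module) \<Rightarrow> ('m \<Rightarrow> 'u) \<Rightarrow> (nat \<Rightarrow> 'u \<Rightarrow> 'u) \<Rightarrow> bool"
  where "injective_resolution R M I e d \<longleftrightarrow>
    (\<forall>i. injective_module R (I i)) \<and>
    e \<in> mod_hom R M (I 0) \<and> (\<forall>i. d i \<in> mod_hom R (I i) (I (Suc i))) \<and>
    inj_on e (carrier M) \<and>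
    e ` carrier M = {x \<in> carrier (I 0). d 0 x = \<zero>\<^bsub>I 1\<^esub>} \<and>
    (\<forall>i. d i ` carrier (I i) = {x \<in> carrier (I (Suc i)). d (Suc i) x = \<zero>\<^bsub>I (Suc (Suc i))\<^esub>})"

definition torsion_part :: "('r, 'x) ring_scheme \<Rightarrow> 'r set \<Rightarrow> ('r, 'm, 'y) module_scheme \<Rightarrow> 'm set"
  where "torsion_part R \<aa> M =
    {x \<in> carrier M. \<exists>n::nat. \<forall>r \<in> \<aa> [^]\<^bsub>ideals_set R\<^esub> n. r \<odot>\<^bsub>M\<^esub> x = \<zero>\<^bsub>M\<^esub>}"

text \<open>An element type large enough for injective resolutions of modules \<open>M\<close> over rings \<open>R\<close>, where
  \<open>'r\<close> and \<open>'m\<close> are the element types of \<open>R\<close> and \<open>M\<close>. Every module \<open>X\<close> embeds into the injective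
  module of additive maps from \<open>R\<close> to \<open>D\<close>, where \<open>D\<close> is a divisible group containing \<open>X\<close> of
  cardinality at most \<open>max(|X|, \<aleph>\<^sub>0)\<close>. If \<open>\<kappa> = max(|'m|, \<aleph>\<^sub>0)\<close>, the universe has cardinality
  \<open>\<kappa>\<^bsup>|'r|\<^esup>\<close>, and this bound is preserved under \<open>X \<mapsto> Hom(R, D)\<close> and under quotients.\<close>

type_synonym ('r, 'm) resolution_univ = "'r \<Rightarrow> nat \<times> 'm"

text \<open>The \<open>i\<close>-th right derived functor of the \<open>\<aa>\<close>-torsion functor.\<close>

definition local_cohomology ::
  "('r, 'x) ring_scheme \<Rightarrow> 'r set \<Rightarrow> ('r, 'm, 'y) module_scheme \<Rightarrow> nat \<Rightarrow>
   ('r, ('r, 'm) resolution_univ set) module"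
  where "local_cohomology R \<aa> M i =
    (let (I, e, d) = (SOME (I :: nat \<Rightarrow> ('r, ('r, 'm) resolution_univ) module, e, d).
                        injective_resolution R M I e d);
         Z = {x \<in> torsion_part R \<aa> (I i). d i x = \<zero>\<^bsub>I (Suc i)\<^esub>};
         B = (if i = 0 then {\<zero>\<^bsub>I 0\<^esub>} else d (i - 1) ` torsion_part R \<aa> (I (i - 1)))
     in quotient_module ((I i)\<lparr>carrier := Z\<rparr>) B)"

text \<open>The supremum of the empty set is \<open>-\<infinity>\<close>.\<close>

definition cd :: "('r, 'x) ring_scheme \<Rightarrow> 'r set \<Rightarrow> ('r, 'm, 'y) module_scheme \<Rightarrow> ereal"
  where "cd R \<aa> M = Sup {ereal (real i) | i. \<not> zero_module (local_cohomology R \<aa> M i)}"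

section \<open>Relative Cohen-Macaulay filtered modules\<close>

definition relative_Cohen_Macaulay ::
  "('r, 'x) ring_scheme \<Rightarrow> 'r set \<Rightarrow> ('r, 'm, 'y) module_scheme \<Rightarrow> bool"
  where "relative_Cohen_Macaulay R \<aa> N \<longleftrightarrow>
    finitely_generated R N \<and> (\<exists>!i. \<not> zero_module (local_cohomology R \<aa> N i))"

text \<open>Only the values \<open>F i\<close> with \<open>0 \<le> i \<le> cd R \<aa> M\<close> belong to the filtration.\<close>

definition cd_filtration ::
  "('r, 'x) ring_scheme \<Rightarrow> 'r set \<Rightarrow> ('r, 'm, 'y) module_scheme \<Rightarrow> (nat \<Rightarrow> 'm set) \<Rightarrow> bool"
  where "cd_filtration R \<aa> M F \<longleftrightarrow>
    (\<forall>i. ereal (real i) \<le> cd R \<aa> M \<longrightarrow>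
      submodule (F i) R M \<and> cd R \<aa> (M\<lparr>carrier := F i\<rparr>) \<le> ereal (real i) \<and>
      (\<forall>N. submodule N R M \<and> cd R \<aa> (M\<lparr>carrier := N\<rparr>) \<le> ereal (real i) \<longrightarrow> N \<subseteq> F i))"

definition RCMF :: "('r, 'x) ring_scheme \<Rightarrow> 'r set \<Rightarrow> ('r, 'm, 'y) module_scheme \<Rightarrow> bool"
  where "RCMF R \<aa> M \<longleftrightarrow> finitely_generated R M \<and>
    (\<exists>F. cd_filtration R \<aa> M F \<and>
      (\<forall>i. 1 \<le> i \<and> ereal (real i) \<le> cd R \<aa> M \<longrightarrow>
        (let Q = quotient_module (M\<lparr>carrier := F i\<rparr>) (F (i - 1))
         in zero_module Q \<or> relative_Cohen_Macaulay R \<aa> Q \<and> cd R \<aa> Q = ereal (real i))))"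

section \<open>Localization\<close>

definition regular_module :: "('r, 'x) ring_scheme \<Rightarrow> ('r, 'r) module"
  where "regular_module R =
    \<lparr>carrier = carrier R, monoid.mult = monoid.mult R, one = \<one>\<^bsub>R\<^esub>, zero = \<zero>\<^bsub>R\<^esub>, add = add R, smult = monoid.mult R\<rparr>"

definition fraction ::
  "'r set \<Rightarrow> ('r, 'm, 'y) module_scheme \<Rightarrow> 'm \<Rightarrow> 'r \<Rightarrow> ('m \<times> 'r) set"
  where "fraction S M m s =
    {(m', s'). m' \<in> carrier M \<and> s' \<in> S \<and>
       (\<exists>t\<in>S. t \<odot>\<^bsub>M\<^esub> (s' \<odot>\<^bsub>M\<^esub> m) = t \<odot>\<^bsub>M\<^esub> (s \<odot>\<^bsub>M\<^esub> m'))}"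

definition localized_module ::
  "('r, 'x) ring_scheme \<Rightarrow> 'r set \<Rightarrow> ('r, 'm, 'y) module_scheme \<Rightarrow>
   (('r \<times> 'r) set, ('m \<times> 'r) set) module"
  where "localized_module R S M =
    \<lparr>carrier = {fraction S M m s | m s. m \<in> carrier M \<and> s \<in> S},
     monoid.mult = undefined, one = undefined,
     zero = fraction S M \<zero>\<^bsub>M\<^esub> \<one>\<^bsub>R\<^esub>,
     add = (\<lambda>U V. \<Union>(m, s)\<in>U. \<Union>(n, t)\<in>V.
              fraction S M (t \<odot>\<^bsub>M\<^esub> m \<oplus>\<^bsub>M\<^esub> s \<odot>\<^bsub>M\<^esub> n) (s \<otimes>\<^bsub>R\<^esub> t)),
     smult = (\<lambda>Q U. \<Union>(r, s)\<in>Q. \<Union>(m, t)\<in>U. fraction S M (r \<odot>\<^bsub>M\<^esub> m) (s \<otimes>\<^bsub>R\<^esub> t))\<rparr>"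

definition localized_ring :: "('r, 'x) ring_scheme \<Rightarrow> 'r set \<Rightarrow> ('r \<times> 'r) set ring"
  where "localized_ring R S =
    (let L = localized_module R S (regular_module R)
     in \<lparr>carrier = carrier L, monoid.mult = smult L, one = fraction S (regular_module R) \<one>\<^bsub>R\<^esub> \<one>\<^bsub>R\<^esub>,
         zero = \<zero>\<^bsub>L\<^esub>, add = add L\<rparr>)"

definition ring_at :: "('r, 'x) ring_scheme \<Rightarrow> 'r set \<Rightarrow> ('r \<times> 'r) set ring"
  where "ring_at R \<pp> = localized_ring R (carrier R - \<pp>)"

definition module_at ::
  "('r, 'x) ring_scheme \<Rightarrow> 'r set \<Rightarrow> ('r, 'm, 'y) module_scheme \<Rightarrow>
   (('r \<times> 'r) set, ('m \<times> 'r) set) module"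
  where "module_at R \<pp> M = localized_module R (carrier R - \<pp>) M"

definition extended_ideal_at :: "('r, 'x) ring_scheme \<Rightarrow> 'r set \<Rightarrow> 'r set \<Rightarrow> ('r \<times> 'r) set set"
  where "extended_ideal_at R \<pp> \<aa> =
    Idl\<^bsub>ring_at R \<pp>\<^esub> ((\<lambda>r. fraction (carrier R - \<pp>) (regular_module R) r \<one>\<^bsub>R\<^esub>) ` \<aa>)"

definition Supp :: "('r, 'x) ring_scheme \<Rightarrow> ('r, 'm, 'y) module_scheme \<Rightarrow> 'r set set"
  where "Supp R M = {\<pp>. primeideal \<pp> R \<and> \<not> zero_module (module_at R \<pp> M)}"

definition primes_containing :: "('r, 'x) ring_scheme \<Rightarrow> 'r set \<Rightarrow> 'r set set"
  where "primes_containing R \<aa> = {\<pp>. primeideal \<pp> R \<and> \<aa> \<subseteq> \<pp>}"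

end

theory Submission
  imports Defs "HOL-Algebra.Free_Abelian_Groups" "HOL-Computational_Algebra.Group_Closure"
begin

text \<open>Let \<open>ys\<close> generate \<open>\<aa>\<close>. The vanishing of \<open>H\<^sup>i\<close> of a module is equivalent to an elementary condition
  on Koszul complexes: every degree \<open>i\<close> cocycle for the powers \<open>ys\<^sup>n\<close> becomes a coboundary for some
  higher powers \<open>ys\<^bsup>n+m\<^esup>\<close>. Both sides satisfy the same dimension shift along an injective resolution,
  because over a Noetherian ring the Koszul condition holds in positive degrees for injective modules.

  The Koszul condition passes to localizations. Hence \<open>(M\<^sub>i)\<^sub>\<pp>\<close> has cohomological dimension at most \<open>i\<close>,
  and \<open>(M\<^sub>i/M\<^sub>i\<^sub>-\<^sub>1)\<^sub>\<pp>\<close> has cohomology in degree \<open>i\<close> only. That \<open>(M\<^sub>i)\<^sub>\<pp>\<close> is the largest such submodule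
  follows by descending along the filtration from a vanishing statement over a Noetherian local ring: a
  homomorphism \<open>f : N \<rightarrow> Q\<close> to a finitely generated module is zero if the cohomology of \<open>N\<close> vanishes in
  all degrees \<open>\<ge> j\<close> and that of \<open>Q\<close> in all degrees \<open>< j\<close>. For this, an element \<open>w\<close> of \<open>N\<close> is extended to a
  cocycle of the total complex of two Koszul complexes; its components of degree \<open>\<ge> j\<close> are cleared over
  \<open>N\<close>, and after applying \<open>f\<close> those of degree \<open>< j\<close> are cleared over \<open>Q\<close>. What remains shows that \<open>f w\<close>
  lies in \<open>ys\<^sup>n Q\<close> for every \<open>n\<close>, so it is zero by Krull's intersection theorem. The case \<open>f = id\<close> shows
  that a nonzero \<open>Q\<close> has some nonzero cohomology.\<close>

section \<open>Modules and homomorphisms\<close>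

context module begin

lemma smult_r_diff:
  assumes "a \<in> carrier R" "x \<in> carrier M" "y \<in> carrier M"
  shows "a \<odot>\<^bsub>M\<^esub> (x \<ominus>\<^bsub>M\<^esub> y) = a \<odot>\<^bsub>M\<^esub> x \<ominus>\<^bsub>M\<^esub> a \<odot>\<^bsub>M\<^esub> y"
  using assms by (simp add: a_minus_def smult_r_distr smult_r_minus)

lemma smult_l_diff:
  assumes "a \<in> carrier R" "b \<in> carrier R" "x \<in> carrier M"
  shows "(a \<ominus> b) \<odot>\<^bsub>M\<^esub> x = a \<odot>\<^bsub>M\<^esub> x \<ominus>\<^bsub>M\<^esub> b \<odot>\<^bsub>M\<^esub> x"
  using assms by (simp add: a_minus_def smult_l_distr smult_l_minus)

lemma smult_left_commute:
  assumes "a \<in> carrier R" "b \<in> carrier R" "x \<in> carrier M"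
  shows "a \<odot>\<^bsub>M\<^esub> (b \<odot>\<^bsub>M\<^esub> x) = b \<odot>\<^bsub>M\<^esub> (a \<odot>\<^bsub>M\<^esub> x)"
  using assms by (metis smult_assoc1 R.m_comm)

lemma diff_zero [simp]: "x \<in> carrier M \<Longrightarrow> x \<ominus>\<^bsub>M\<^esub> \<zero>\<^bsub>M\<^esub> = x"
  and diff_self [simp]: "x \<in> carrier M \<Longrightarrow> x \<ominus>\<^bsub>M\<^esub> x = \<zero>\<^bsub>M\<^esub>"
  and diff_add_cancel [simp]: "x \<in> carrier M \<Longrightarrow> y \<in> carrier M \<Longrightarrow> (x \<ominus>\<^bsub>M\<^esub> y) \<oplus>\<^bsub>M\<^esub> y = x"
  and add_diff_cancel [simp]: "x \<in> carrier M \<Longrightarrow> y \<in> carrier M \<Longrightarrow> (x \<oplus>\<^bsub>M\<^esub> y) \<ominus>\<^bsub>M\<^esub> y = x"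
  and uminus_zero [simp]: "\<ominus>\<^bsub>M\<^esub> \<zero>\<^bsub>M\<^esub> = \<zero>\<^bsub>M\<^esub>"
  using M.r_neg[of "\<zero>\<^bsub>M\<^esub>"] by (simp_all add: a_minus_def M.r_neg M.l_neg M.a_assoc)

lemma diff_eq_zero_iff: "x \<in> carrier M \<Longrightarrow> y \<in> carrier M \<Longrightarrow> x \<ominus>\<^bsub>M\<^esub> y = \<zero>\<^bsub>M\<^esub> \<longleftrightarrow> x = y"
  by (metis diff_add_cancel diff_self M.l_zero)

lemma smult_power_mono_zero:
  assumes "y \<in> carrier R" "x \<in> carrier M" "(y [^] (n::nat)) \<odot>\<^bsub>M\<^esub> x = \<zero>\<^bsub>M\<^esub>" "n \<le> m"
  shows "(y [^] m) \<odot>\<^bsub>M\<^esub> x = \<zero>\<^bsub>M\<^esub>"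
proof -
  have "y [^] m = (y [^] (m - n)) \<otimes> (y [^] n)"
    using assms by (simp add: R.nat_pow_mult)
  then show ?thesis using assms by (simp add: smult_assoc1)
qed

lemma submodule_closedI:
  assumes "H \<subseteq> carrier M" "\<zero>\<^bsub>M\<^esub> \<in> H"
    and "\<And>x y. x \<in> H \<Longrightarrow> y \<in> H \<Longrightarrow> x \<oplus>\<^bsub>M\<^esub> y \<in> H"
    and "\<And>a x. a \<in> carrier R \<Longrightarrow> x \<in> H \<Longrightarrow> a \<odot>\<^bsub>M\<^esub> x \<in> H"
  shows "submodule H R M"
proof (rule submoduleI[OF assms(1,2) _ assms(3,4)])
  fix x assume x: "x \<in> H"
  have "\<ominus>\<^bsub>M\<^esub> x = (\<ominus> \<one>) \<odot>\<^bsub>M\<^esub> x" using x assms(1) by (simp add: smult_l_minus subsetD)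
  then show "\<ominus>\<^bsub>M\<^esub> x \<in> H" using assms(4)[OF _ x] by simp
qed

lemma submodule_zero: "submodule H R M \<Longrightarrow> \<zero>\<^bsub>M\<^esub> \<in> H"
  using submodule.axioms(1) subgroup.one_closed by fastforce

lemma submodule_diff: "submodule H R M \<Longrightarrow> x \<in> H \<Longrightarrow> y \<in> H \<Longrightarrow> x \<ominus>\<^bsub>M\<^esub> y \<in> H"
  unfolding a_minus_def using submoduleE(3,5) by blast

lemma submodule_subset: "submodule H R M \<Longrightarrow> x \<in> H \<Longrightarrow> x \<in> carrier M"
  using submoduleE(1) by blast

lemma submodule_module: "submodule H R M \<Longrightarrow> module R (M\<lparr>carrier := H\<rparr>)"
  by (rule submodule.submodule_is_module[OF _ module_axioms])

lemma submodule_of_submodule: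
  assumes "submodule G R M" "submodule H R M" "G \<subseteq> H"
  shows "submodule G R (M\<lparr>carrier := H\<rparr>)"
proof -
  interpret H: module R "M\<lparr>carrier := H\<rparr>" by (rule submodule_module[OF assms(2)])
  show ?thesis
    by (rule H.submodule_closedI) (use submodule_zero submoduleE(4,5) assms in auto)
qed

lemma zero_submodule: "submodule {\<zero>\<^bsub>M\<^esub>} R M"
  by (rule submoduleI) auto

lemma submodule_Int:
  assumes "submodule H R M" "submodule K R M"
  shows "submodule (H \<inter> K) R M"
  by (rule submodule_closedI)
    (use assms submodule_zero submoduleE(4,5) submodule_subset in auto)

lemma set_addI: "h \<in> H \<Longrightarrow> k \<in> K \<Longrightarrow> h \<oplus>\<^bsub>M\<^esub> k \<in> H <+>\<^bsub>M\<^esub> K"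
  by (auto simp: set_add_def')

lemma set_addE:
  assumes "x \<in> H <+>\<^bsub>M\<^esub> K"
  obtains h k where "h \<in> H" "k \<in> K" "x = h \<oplus>\<^bsub>M\<^esub> k"
  using assms by (auto simp: set_add_def')

lemma submodule_set_add:
  assumes "submodule H R M" "submodule K R M"
  shows "submodule (H <+>\<^bsub>M\<^esub> K) R M"
proof (rule submodule_closedI)
  note H = submoduleE[OF assms(1)] and K = submoduleE[OF assms(2)]
  note [simp] = subsetD[OF H(1)] subsetD[OF K(1)]
  show "H <+>\<^bsub>M\<^esub> K \<subseteq> carrier M" by (auto elim!: set_addE)
  show "\<zero>\<^bsub>M\<^esub> \<in> H <+>\<^bsub>M\<^esub> K"
    using set_addI[OF submodule_zero[OF assms(1)] submodule_zero[OF assms(2)]] by simp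
  show "x \<oplus>\<^bsub>M\<^esub> y \<in> H <+>\<^bsub>M\<^esub> K" if x: "x \<in> H <+>\<^bsub>M\<^esub> K" and y: "y \<in> H <+>\<^bsub>M\<^esub> K" for x y
  proof -
    obtain h k where hk: "h \<in> H" "k \<in> K" "x = h \<oplus>\<^bsub>M\<^esub> k" using x by (rule set_addE)
    obtain h' k' where hk': "h' \<in> H" "k' \<in> K" "y = h' \<oplus>\<^bsub>M\<^esub> k'" using y by (rule set_addE)
    have "x \<oplus>\<^bsub>M\<^esub> y = (h \<oplus>\<^bsub>M\<^esub> h') \<oplus>\<^bsub>M\<^esub> (k \<oplus>\<^bsub>M\<^esub> k')"
      using hk hk' by (simp add: M.a_ac)
    then show ?thesis using set_addI[OF H(5)[OF hk(1) hk'(1)] K(5)[OF hk(2) hk'(2)]] by simp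
  qed
  show "a \<odot>\<^bsub>M\<^esub> x \<in> H <+>\<^bsub>M\<^esub> K" if a: "a \<in> carrier R" and x: "x \<in> H <+>\<^bsub>M\<^esub> K" for a x
  proof -
    obtain h k where hk: "h \<in> H" "k \<in> K" "x = h \<oplus>\<^bsub>M\<^esub> k" using x by (rule set_addE)
    then show ?thesis using set_addI[OF H(4)[OF a hk(1)] K(4)[OF a hk(2)]] a
      by (simp add: smult_r_distr)
  qed
qed

lemma set_add_upper1:
  assumes "submodule H R M" "submodule K R M"
  shows "H \<subseteq> H <+>\<^bsub>M\<^esub> K"
proof
  fix x assume "x \<in> H"
  then show "x \<in> H <+>\<^bsub>M\<^esub> K"
    using set_addI[of x H "\<zero>\<^bsub>M\<^esub>" K] submodule_zero[OF assms(2)] submodule_subset[OF assms(1)] by simp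
qed

lemma set_add_upper2:
  assumes "submodule H R M" "submodule K R M"
  shows "K \<subseteq> H <+>\<^bsub>M\<^esub> K"
proof
  fix x assume "x \<in> K"
  then show "x \<in> H <+>\<^bsub>M\<^esub> K"
    using set_addI[of "\<zero>\<^bsub>M\<^esub>" H x K] submodule_zero[OF assms(1)] submodule_subset[OF assms(2)] by simp
qed

lemma scaled_submodule:
  assumes "r \<in> carrier R"
  shows "submodule ((\<lambda>x. r \<odot>\<^bsub>M\<^esub> x) ` carrier M) R M"
proof (rule submodule_closedI)
  show "\<zero>\<^bsub>M\<^esub> \<in> (\<lambda>x. r \<odot>\<^bsub>M\<^esub> x) ` carrier M"
    using assms by (intro image_eqI[of _ _ "\<zero>\<^bsub>M\<^esub>"]) auto
  show "a \<odot>\<^bsub>M\<^esub> x \<in> (\<lambda>x. r \<odot>\<^bsub>M\<^esub> x) ` carrier M"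
    if "a \<in> carrier R" "x \<in> (\<lambda>x. r \<odot>\<^bsub>M\<^esub> x) ` carrier M" for a x
    using that assms by (auto simp: smult_left_commute[of a r])
qed (use assms in \<open>auto simp flip: smult_r_distr\<close>)

lemma cyclic_submodule:
  assumes "g \<in> carrier M"
  shows "submodule ((\<lambda>r. r \<odot>\<^bsub>M\<^esub> g) ` carrier R) R M"
proof (rule submodule_closedI)
  show "\<zero>\<^bsub>M\<^esub> \<in> (\<lambda>r. r \<odot>\<^bsub>M\<^esub> g) ` carrier R" using assms by (intro image_eqI[of _ _ "\<zero>"]) auto
qed (use assms in \<open>auto simp flip: smult_l_distr smult_assoc1\<close>)

end

locale module_homomorphism = M: module R M + N: module R N
  for R (structure) and M and N +
  fixes f
  assumes hom: "f \<in> mod_hom R M N"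
begin

lemma closed [simp]: "x \<in> carrier M \<Longrightarrow> f x \<in> carrier N"
  and add [simp]: "x \<in> carrier M \<Longrightarrow> y \<in> carrier M \<Longrightarrow> f (x \<oplus>\<^bsub>M\<^esub> y) = f x \<oplus>\<^bsub>N\<^esub> f y"
  and smult [simp]: "r \<in> carrier R \<Longrightarrow> x \<in> carrier M \<Longrightarrow> f (r \<odot>\<^bsub>M\<^esub> x) = r \<odot>\<^bsub>N\<^esub> f x"
  using hom by (auto simp: mod_hom_def)

lemma zero [simp]: "f \<zero>\<^bsub>M\<^esub> = \<zero>\<^bsub>N\<^esub>"
  using smult[of \<zero> "\<zero>\<^bsub>M\<^esub>"] by simp

lemma uminus [simp]: "x \<in> carrier M \<Longrightarrow> f (\<ominus>\<^bsub>M\<^esub> x) = \<ominus>\<^bsub>N\<^esub> f x"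
  using smult[of "\<ominus> \<one>" x] by (simp add: M.smult_l_minus N.smult_l_minus)

lemma diff [simp]: "x \<in> carrier M \<Longrightarrow> y \<in> carrier M \<Longrightarrow> f (x \<ominus>\<^bsub>M\<^esub> y) = f x \<ominus>\<^bsub>N\<^esub> f y"
  by (simp add: a_minus_def)

lemma inj_on_iff: "inj_on f (carrier M) \<longleftrightarrow> (\<forall>x\<in>carrier M. f x = \<zero>\<^bsub>N\<^esub> \<longrightarrow> x = \<zero>\<^bsub>M\<^esub>)"
proof
  assume "inj_on f (carrier M)"
  then show "\<forall>x\<in>carrier M. f x = \<zero>\<^bsub>N\<^esub> \<longrightarrow> x = \<zero>\<^bsub>M\<^esub>"
    by (metis M.M.zero_closed inj_onD zero)
next
  assume ker: "\<forall>x\<in>carrier M. f x = \<zero>\<^bsub>N\<^esub> \<longrightarrow> x = \<zero>\<^bsub>M\<^esub>"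
  show "inj_on f (carrier M)"
  proof (rule inj_onI)
    fix x y assume "x \<in> carrier M" "y \<in> carrier M" "f x = f y"
    then show "x = y" using ker[rule_format, of "x \<ominus>\<^bsub>M\<^esub> y"] by (simp add: M.diff_eq_zero_iff)
  qed
qed

lemma preimage_submodule:
  "submodule H R M \<Longrightarrow> submodule K R N \<Longrightarrow> submodule {x \<in> H. f x \<in> K} R M"
  by (rule M.submodule_closedI)
    (auto simp: M.submodule_zero N.submodule_zero M.submodule_subset M.submoduleE(4,5)
      N.submoduleE(4,5))

lemma image_submodule:
  assumes "submodule H R M"
  shows "submodule (f ` H) R N"
proof (rule N.submodule_closedI)
  show "\<zero>\<^bsub>N\<^esub> \<in> f ` H" using M.submodule_zero[OF assms] zero by (metis imageI)
qed (use M.submodule_subset[OF assms] M.submoduleE(4,5)[OF assms] in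
    \<open>auto simp flip: add smult\<close>)

end

lemma mod_hom_comp: "f \<in> mod_hom R L M \<Longrightarrow> g \<in> mod_hom R M N \<Longrightarrow> (\<lambda>x. g (f x)) \<in> mod_hom R L N"
  by (auto simp: mod_hom_def Pi_def)

lemma mod_hom_restrict:
  "f \<in> mod_hom R (M\<lparr>carrier := H\<rparr>) N \<Longrightarrow> G \<subseteq> H \<Longrightarrow> f \<in> mod_hom R (M\<lparr>carrier := G\<rparr>) N"
  unfolding mod_hom_def by (auto simp: subset_iff)

lemma mod_hom_inclusion: "H \<subseteq> carrier M \<Longrightarrow> (\<lambda>x. x) \<in> mod_hom R (M\<lparr>carrier := H\<rparr>) M"
  by (auto simp: mod_hom_def)

lemma mod_hom_inv_into:
  assumes "module R M" "f \<in> mod_hom R M N" "bij_betw f (carrier M) (carrier N)"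
  shows "inv_into (carrier M) f \<in> mod_hom R N M"
proof -
  interpret M: module R M by fact
  note f = assms(2)[unfolded mod_hom_def, simplified]
  let ?g = "inv_into (carrier M) f"
  have gf: "?g (f x) = x" if "x \<in> carrier M" for x
    using assms(3) that by (simp add: bij_betw_inv_into_left)
  have N: "carrier N = f ` carrier M" using assms(3) by (simp add: bij_betw_def)
  have "?g (f x \<oplus>\<^bsub>N\<^esub> f y) = x \<oplus>\<^bsub>M\<^esub> y" if "x \<in> carrier M" "y \<in> carrier M" for x y
    using that gf[of "x \<oplus>\<^bsub>M\<^esub> y"] f by simp
  moreover have "?g (r \<odot>\<^bsub>N\<^esub> f x) = r \<odot>\<^bsub>M\<^esub> x" if "r \<in> carrier R" "x \<in> carrier M" for r x
    using that gf[of "r \<odot>\<^bsub>M\<^esub> x"] f by simp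
  ultimately show ?thesis by (auto simp: mod_hom_def N gf)
qed

text \<open>The structure of \<open>N\<close> is determined by the surjection \<open>h\<close>, so the module axioms are inherited.\<close>

lemma module_surjective_image:
  assumes "module R M" and surj: "h ` carrier M = carrier N" and zero: "h \<zero>\<^bsub>M\<^esub> = \<zero>\<^bsub>N\<^esub>"
    and add: "\<And>x y. x \<in> carrier M \<Longrightarrow> y \<in> carrier M \<Longrightarrow> h x \<oplus>\<^bsub>N\<^esub> h y = h (x \<oplus>\<^bsub>M\<^esub> y)"
    and smult: "\<And>r x. r \<in> carrier R \<Longrightarrow> x \<in> carrier M \<Longrightarrow> r \<odot>\<^bsub>N\<^esub> h x = h (r \<odot>\<^bsub>M\<^esub> x)"
  shows "module_homomorphism R M N h"
proof -
  interpret M: module R M by fact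
  have all: "(\<forall>y\<in>carrier N. P y) \<longleftrightarrow> (\<forall>x\<in>carrier M. P (h x))" for P
    unfolding surj[symmetric] by blast
  have "\<forall>y\<in>carrier N. \<exists>z\<in>carrier N. z \<oplus>\<^bsub>N\<^esub> y = \<zero>\<^bsub>N\<^esub>"
    unfolding all
  proof
    fix x assume "x \<in> carrier M"
    then show "\<exists>z\<in>carrier N. z \<oplus>\<^bsub>N\<^esub> h x = \<zero>\<^bsub>N\<^esub>"
      unfolding surj[symmetric]
      by (intro bexI[of _ "h (\<ominus>\<^bsub>M\<^esub> x)"]) (simp_all add: add zero[symmetric] M.M.l_neg)
  qed
  moreover have "\<forall>x\<in>carrier N. \<forall>y\<in>carrier N. x \<oplus>\<^bsub>N\<^esub> y \<in> carrier N"
    unfolding all unfolding surj[symmetric] by (auto simp: add)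
  moreover have "\<forall>y\<in>carrier N. \<forall>r\<in>carrier R. r \<odot>\<^bsub>N\<^esub> y \<in> carrier N"
    unfolding all unfolding surj[symmetric] by (auto simp: smult)
  moreover have "\<forall>x\<in>carrier N. \<forall>y\<in>carrier N. \<forall>z\<in>carrier N. x \<oplus>\<^bsub>N\<^esub> y \<oplus>\<^bsub>N\<^esub> z = x \<oplus>\<^bsub>N\<^esub> (y \<oplus>\<^bsub>N\<^esub> z)"
    "\<forall>x\<in>carrier N. \<forall>y\<in>carrier N. x \<oplus>\<^bsub>N\<^esub> y = y \<oplus>\<^bsub>N\<^esub> x"
    "\<forall>x\<in>carrier N. \<zero>\<^bsub>N\<^esub> \<oplus>\<^bsub>N\<^esub> x = x"
    "\<forall>x\<in>carrier N. \<one>\<^bsub>R\<^esub> \<odot>\<^bsub>N\<^esub> x = x"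
    "\<forall>x\<in>carrier N. \<forall>y\<in>carrier N. \<forall>r\<in>carrier R. r \<odot>\<^bsub>N\<^esub> (x \<oplus>\<^bsub>N\<^esub> y) = r \<odot>\<^bsub>N\<^esub> x \<oplus>\<^bsub>N\<^esub> r \<odot>\<^bsub>N\<^esub> y"
    "\<forall>x\<in>carrier N. \<forall>r\<in>carrier R. \<forall>s\<in>carrier R. (r \<oplus>\<^bsub>R\<^esub> s) \<odot>\<^bsub>N\<^esub> x = r \<odot>\<^bsub>N\<^esub> x \<oplus>\<^bsub>N\<^esub> s \<odot>\<^bsub>N\<^esub> x"
    "\<forall>x\<in>carrier N. \<forall>r\<in>carrier R. \<forall>s\<in>carrier R. (r \<otimes>\<^bsub>R\<^esub> s) \<odot>\<^bsub>N\<^esub> x = r \<odot>\<^bsub>N\<^esub> (s \<odot>\<^bsub>N\<^esub> x)"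
    unfolding all
    by (simp_all add: add smult zero[symmetric] M.M.a_ac M.smult_r_distr
        M.smult_l_distr M.smult_assoc1)
  moreover have "\<zero>\<^bsub>N\<^esub> \<in> carrier N" by (metis M.M.zero_closed imageI surj zero)
  ultimately have "module R N"
    by (intro moduleI abelian_groupI M.R.is_cring) simp_all
  moreover have "h \<in> mod_hom R M N" using surj by (auto simp: mod_hom_def add smult)
  ultimately show ?thesis
    by (intro module_homomorphism.intro module_homomorphism_axioms.intro assms(1))
qed

definition image_module :: "('r, 'm, 'y) module_scheme \<Rightarrow> ('m \<Rightarrow> 'n) \<Rightarrow> ('r, 'n) module"
  where "image_module M h = (let g = inv_into (carrier M) h in
    \<lparr>carrier = h ` carrier M, monoid.mult = undefined, one = undefined, ring.zero = h \<zero>\<^bsub>M\<^esub>,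
     add = (\<lambda>x y. h (g x \<oplus>\<^bsub>M\<^esub> g y)), smult = (\<lambda>r x. h (r \<odot>\<^bsub>M\<^esub> g x))\<rparr>)"

lemma image_module:
  assumes "module R M" "inj_on h (carrier M)"
  shows "module_homomorphism R M (image_module M h) h"
    and "bij_betw h (carrier M) (carrier (image_module M h))"
  using assms
  by (auto intro!: module_surjective_image inj_on_imp_bij_betw simp: image_module_def Let_def)

lemma quotient_module_hom:
  assumes "module R M" "submodule G R M"
  shows "module_homomorphism R M (quotient_module M G) (\<lambda>x. G +>\<^bsub>M\<^esub> x)"
proof (rule module_surjective_image[OF assms(1)])
  interpret M: module R M by fact
  interpret G: abelian_subgroup G M
    by (rule abelian_subgroupI3[OF additive_subgroup.intro[OF submodule.axioms(1)[OF assms(2)]]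
          M.M.abelian_group_axioms])
  note GE = M.submoduleE[OF assms(2)]
  show "(\<lambda>x. G +>\<^bsub>M\<^esub> x) ` carrier M = carrier (quotient_module M G)"
    by (auto simp: quotient_module_def A_RCOSETS_def RCOSETS_def a_r_coset_def)
  show "G +>\<^bsub>M\<^esub> \<zero>\<^bsub>M\<^esub> = \<zero>\<^bsub>quotient_module M G\<^esub>"
    using GE(1) by (simp add: quotient_module_def M.M.a_coset_add_zero)
  show "(G +>\<^bsub>M\<^esub> x) \<oplus>\<^bsub>quotient_module M G\<^esub> (G +>\<^bsub>M\<^esub> y) = G +>\<^bsub>M\<^esub> (x \<oplus>\<^bsub>M\<^esub> y)"
    if "x \<in> carrier M" "y \<in> carrier M" for x y
    using G.a_rcos_sum[OF that] by (simp add: quotient_module_def)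
  show "r \<odot>\<^bsub>quotient_module M G\<^esub> (G +>\<^bsub>M\<^esub> x) = G +>\<^bsub>M\<^esub> (r \<odot>\<^bsub>M\<^esub> x)"
    if r: "r \<in> carrier R" and x: "x \<in> carrier M" for r x
  proof -
    have "G +>\<^bsub>M\<^esub> (r \<odot>\<^bsub>M\<^esub> z) = G +>\<^bsub>M\<^esub> (r \<odot>\<^bsub>M\<^esub> x)" if z: "z \<in> G +>\<^bsub>M\<^esub> x" for z
    proof (rule G.a_repr_independence'[symmetric])
      obtain g where g: "g \<in> G" "z = g \<oplus>\<^bsub>M\<^esub> x" using z by (auto simp: a_r_coset_def')
      then have "r \<odot>\<^bsub>M\<^esub> z = r \<odot>\<^bsub>M\<^esub> g \<oplus>\<^bsub>M\<^esub> r \<odot>\<^bsub>M\<^esub> x"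
        using r x by (simp add: M.smult_r_distr)
      then show "r \<odot>\<^bsub>M\<^esub> z \<in> G +>\<^bsub>M\<^esub> (r \<odot>\<^bsub>M\<^esub> x)"
        using GE(4)[OF r g(1)] by (auto simp: a_r_coset_def')
    qed (use r x in simp)
    moreover have "x \<in> G +>\<^bsub>M\<^esub> x" by (rule G.a_rcos_self[OF x])
    ultimately have "(\<Union>z\<in>G +>\<^bsub>M\<^esub> x. G +>\<^bsub>M\<^esub> (r \<odot>\<^bsub>M\<^esub> z)) = G +>\<^bsub>M\<^esub> (r \<odot>\<^bsub>M\<^esub> x)" by blast
    then show ?thesis by (simp add: quotient_module_def)
  qed
qed

lemma quotient_module_surj: "(\<lambda>x. G +>\<^bsub>M\<^esub> x) ` carrier M = carrier (quotient_module M G)"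
  by (auto simp: quotient_module_def A_RCOSETS_def RCOSETS_def a_r_coset_def)

lemma quotient_module_zero_iff:
  assumes "module R M" "submodule G R M" "x \<in> carrier M"
  shows "G +>\<^bsub>M\<^esub> x = \<zero>\<^bsub>quotient_module M G\<^esub> \<longleftrightarrow> x \<in> G"
proof -
  interpret M: module R M by fact
  interpret G: abelian_subgroup G M
    by (rule abelian_subgroupI3[OF additive_subgroup.intro[OF submodule.axioms(1)[OF assms(2)]]
          M.M.abelian_group_axioms])
  have "G +>\<^bsub>M\<^esub> x = G \<longleftrightarrow> x \<in> G"
    using G.a_rcos_self[OF assms(3)] G.a_rcos_const by auto
  then show ?thesis by (simp add: quotient_module_def)
qed

lemma zero_module_quotient_iff:
  assumes "module R M" "submodule H R M" "submodule G R M" "G \<subseteq> H"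
  shows "zero_module (quotient_module (M\<lparr>carrier := H\<rparr>) G) \<longleftrightarrow> H \<subseteq> G"
proof -
  interpret M: module R M by fact
  let ?H = "M\<lparr>carrier := H\<rparr>"
  have G: "submodule G R ?H" by (rule M.submodule_of_submodule[OF assms(3,2,4)])
  interpret q: module_homomorphism R ?H "quotient_module ?H G" "\<lambda>x. G +>\<^bsub>?H\<^esub> x"
    by (rule quotient_module_hom[OF M.submodule_module[OF assms(2)] G])
  have "zero_module (quotient_module ?H G) \<longleftrightarrow>
      (\<forall>x\<in>H. G +>\<^bsub>?H\<^esub> x = \<zero>\<^bsub>quotient_module ?H G\<^esub>)"
    unfolding zero_module_def quotient_module_surj[symmetric]
    using M.submoduleE(2)[OF assms(2)] by auto
  then show ?thesis using quotient_module_zero_iff[OF q.M.module_axioms G] by auto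
qed

lemma (in module) zero_module_finitely_generated:
  assumes "zero_module M"
  shows "finitely_generated R M"
proof -
  have "\<Inter>{H. submodule H R M} = carrier M"
    using carrier_is_submodule submodule_zero assms by (auto simp: zero_module_def)
  then show ?thesis unfolding finitely_generated_def
    by (intro conjI module_axioms exI[of _ "{}"]) simp_all
qed

section \<open>Noetherian modules\<close>

lemma (in cring) ideal_closedI:
  assumes "I \<subseteq> carrier R" "\<zero> \<in> I" "\<And>a b. a \<in> I \<Longrightarrow> b \<in> I \<Longrightarrow> a \<oplus> b \<in> I"
    and "\<And>a r. a \<in> I \<Longrightarrow> r \<in> carrier R \<Longrightarrow> r \<otimes> a \<in> I"
  shows "ideal I R"
proof (rule idealI)
  have "\<ominus> a \<in> I" if "a \<in> I" for a
    using assms(4)[OF that, of "\<ominus> \<one>"] that assms(1) by (simp add: l_minus subsetD)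
  then show "subgroup I (add_monoid R)"
    by (intro add.subgroupI) (use assms in \<open>auto simp flip: a_inv_def\<close>)
  fix a x assume ax: "a \<in> I" "x \<in> carrier R"
  show "x \<otimes> a \<in> I" by (rule assms(4)[OF ax])
  then show "a \<otimes> x \<in> I" using ax assms(1) m_comm[of a x] by auto
qed (rule ring_axioms)

text \<open>As for ideals in \<^locale>\<open>noetherian_ring\<close>, the ascending chain condition is expressed by arbitrary
  chains.\<close>

definition noetherian_submodule ::
  "('r, 'x) ring_scheme \<Rightarrow> ('r, 'm, 'y) module_scheme \<Rightarrow> 'm set \<Rightarrow> bool"
  where "noetherian_submodule R M X \<longleftrightarrow> submodule X R M \<and>
    (\<forall>C. C \<noteq> {} \<longrightarrow> subset.chain {H. submodule H R M \<and> H \<subseteq> X} C \<longrightarrow> \<Union>C \<in> C)"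

lemma noetherian_submoduleD:
  assumes "noetherian_submodule R M X" "C \<noteq> {}"
    and "subset.chain {H. submodule H R M \<and> H \<subseteq> X} C"
  shows "\<Union>C \<in> C"
  using assms by (simp add: noetherian_submodule_def)

lemma subset_chain_image:
  assumes "subset.chain \<A> C" "\<And>H. H \<in> C \<Longrightarrow> f H \<in> \<B>"
    and "\<And>H K. H \<in> C \<Longrightarrow> K \<in> C \<Longrightarrow> H \<subseteq> K \<Longrightarrow> f H \<subseteq> f K"
  shows "subset.chain \<B> (f ` C)"
  unfolding subset_chain_def
proof (intro conjI ballI)
  show "f ` C \<subseteq> \<B>" using assms(2) by blast
  fix X Y assume "X \<in> f ` C" "Y \<in> f ` C"
  then obtain H K where HK: "H \<in> C" "K \<in> C" "X = f H" "Y = f K" by blast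
  then have "H \<subseteq> K \<or> K \<subseteq> H" using assms(1) by (simp add: subset_chain_def)
  then show "X \<subseteq> Y \<or> Y \<subseteq> X" using HK assms(3) by auto
qed

context module begin

definition coefficient_ideal :: "'c set \<Rightarrow> 'c \<Rightarrow> 'c set \<Rightarrow> 'a set"
  where "coefficient_ideal X g H = {r \<in> carrier R. \<exists>x\<in>X. x \<oplus>\<^bsub>M\<^esub> r \<odot>\<^bsub>M\<^esub> g \<in> H}"

lemma coefficient_idealI:
  "r \<in> carrier R \<Longrightarrow> x \<in> X \<Longrightarrow> x \<oplus>\<^bsub>M\<^esub> r \<odot>\<^bsub>M\<^esub> g \<in> H \<Longrightarrow> r \<in> coefficient_ideal X g H"
  unfolding coefficient_ideal_def by blast

lemma coefficient_ideal_mono: "H \<subseteq> K \<Longrightarrow> coefficient_ideal X g H \<subseteq> coefficient_ideal X g K"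
  by (auto simp: coefficient_ideal_def)

lemma ideal_coefficient_ideal:
  assumes X: "submodule X R M" and H: "submodule H R M" and g: "g \<in> carrier M"
  shows "ideal (coefficient_ideal X g H) R"
proof (rule R.ideal_closedI)
  note [simp] = submodule_subset[OF X]
  show "coefficient_ideal X g H \<subseteq> carrier R" by (auto simp: coefficient_ideal_def)
  have "\<zero>\<^bsub>M\<^esub> \<oplus>\<^bsub>M\<^esub> \<zero> \<odot>\<^bsub>M\<^esub> g \<in> H" using submodule_zero[OF H] g by simp
  then show "\<zero> \<in> coefficient_ideal X g H"
    using submodule_zero[OF X] by (auto simp: coefficient_ideal_def)
next
  note [simp] = submodule_subset[OF X]
  fix a b assume "a \<in> coefficient_ideal X g H" "b \<in> coefficient_ideal X g H"
  then obtain x y where a: "a \<in> carrier R" "x \<in> X" "x \<oplus>\<^bsub>M\<^esub> a \<odot>\<^bsub>M\<^esub> g \<in> H"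
    and b: "b \<in> carrier R" "y \<in> X" "y \<oplus>\<^bsub>M\<^esub> b \<odot>\<^bsub>M\<^esub> g \<in> H"
    by (auto simp: coefficient_ideal_def)
  have "(x \<oplus>\<^bsub>M\<^esub> y) \<oplus>\<^bsub>M\<^esub> (a \<oplus> b) \<odot>\<^bsub>M\<^esub> g = (x \<oplus>\<^bsub>M\<^esub> a \<odot>\<^bsub>M\<^esub> g) \<oplus>\<^bsub>M\<^esub> (y \<oplus>\<^bsub>M\<^esub> b \<odot>\<^bsub>M\<^esub> g)"
    using a b g by (simp add: smult_l_distr M.a_ac)
  then show "a \<oplus> b \<in> coefficient_ideal X g H"
    using submoduleE(5)[OF H a(3) b(3)] submoduleE(5)[OF X a(2) b(2)] a(1) b(1)
    by (intro coefficient_idealI[of _ "x \<oplus>\<^bsub>M\<^esub> y"]) simp_all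
next
  note [simp] = submodule_subset[OF X]
  fix a r assume "a \<in> coefficient_ideal X g H" and r: "r \<in> carrier R"
  then obtain x where a: "a \<in> carrier R" "x \<in> X" "x \<oplus>\<^bsub>M\<^esub> a \<odot>\<^bsub>M\<^esub> g \<in> H"
    by (auto simp: coefficient_ideal_def)
  have "r \<odot>\<^bsub>M\<^esub> x \<oplus>\<^bsub>M\<^esub> (r \<otimes> a) \<odot>\<^bsub>M\<^esub> g = r \<odot>\<^bsub>M\<^esub> (x \<oplus>\<^bsub>M\<^esub> a \<odot>\<^bsub>M\<^esub> g)"
    using a r g by (simp add: smult_r_distr smult_assoc1)
  then show "r \<otimes> a \<in> coefficient_ideal X g H"
    using submoduleE(4)[OF H r a(3)] submoduleE(4)[OF X r a(2)] a(1) r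
    by (intro coefficient_idealI[of _ "r \<odot>\<^bsub>M\<^esub> x"]) simp_all
qed

lemma submodule_subset_by_coefficients:
  assumes X: "submodule X R M" and H: "submodule H R M" and K: "submodule K R M"
    and g: "g \<in> carrier M" and "H \<subseteq> K" "K \<inter> X \<subseteq> H"
    and KX: "K \<subseteq> X <+>\<^bsub>M\<^esub> ((\<lambda>r. r \<odot>\<^bsub>M\<^esub> g) ` carrier R)"
    and coeffs: "coefficient_ideal X g K \<subseteq> coefficient_ideal X g H"
  shows "K \<subseteq> H"
proof
  fix z assume z: "z \<in> K"
  then obtain x r where xr: "x \<in> X" "r \<in> carrier R" "z = x \<oplus>\<^bsub>M\<^esub> r \<odot>\<^bsub>M\<^esub> g"
    using KX by (auto elim!: set_addE)
  then have "r \<in> coefficient_ideal X g H"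
    using z coeffs by (auto simp: coefficient_ideal_def)
  then obtain y where y: "y \<in> X" "y \<oplus>\<^bsub>M\<^esub> r \<odot>\<^bsub>M\<^esub> g \<in> H" by (auto simp: coefficient_ideal_def)
  have carr: "x \<in> carrier M" "y \<in> carrier M" "r \<odot>\<^bsub>M\<^esub> g \<in> carrier M"
    using xr y g submodule_subset[OF X] by auto
  have "x \<ominus>\<^bsub>M\<^esub> y = z \<ominus>\<^bsub>M\<^esub> (y \<oplus>\<^bsub>M\<^esub> r \<odot>\<^bsub>M\<^esub> g)"
  proof -
    have "z \<ominus>\<^bsub>M\<^esub> (y \<oplus>\<^bsub>M\<^esub> r \<odot>\<^bsub>M\<^esub> g) = (x \<ominus>\<^bsub>M\<^esub> y) \<oplus>\<^bsub>M\<^esub> (r \<odot>\<^bsub>M\<^esub> g \<ominus>\<^bsub>M\<^esub> r \<odot>\<^bsub>M\<^esub> g)"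
      unfolding xr(3) a_minus_def using carr
      by (simp only: M.minus_add M.a_inv_closed M.a_closed M.a_ac)
    then show ?thesis using carr by simp
  qed
  then have "x \<ominus>\<^bsub>M\<^esub> y \<in> K"
    using submodule_diff[OF K z] y(2) \<open>H \<subseteq> K\<close> by auto
  then have "x \<ominus>\<^bsub>M\<^esub> y \<in> H" using submodule_diff[OF X xr(1) y(1)] \<open>K \<inter> X \<subseteq> H\<close> by blast
  then have "(x \<ominus>\<^bsub>M\<^esub> y) \<oplus>\<^bsub>M\<^esub> (y \<oplus>\<^bsub>M\<^esub> r \<odot>\<^bsub>M\<^esub> g) \<in> H" using submoduleE(5)[OF H] y(2) by blast
  then show "z \<in> H" unfolding xr(3) using carr by (simp flip: M.a_assoc)
qed

lemma noetherian_submodule_zero: "noetherian_submodule R M {\<zero>\<^bsub>M\<^esub>}"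
  unfolding noetherian_submodule_def
proof (intro conjI allI impI zero_submodule)
  fix C assume C: "C \<noteq> {}" "subset.chain {H. submodule H R M \<and> H \<subseteq> {\<zero>\<^bsub>M\<^esub>}} C"
  then have "H = {\<zero>\<^bsub>M\<^esub>}" if "H \<in> C" for H
    using that submodule_zero unfolding subset_chain_def by blast
  then have "C = {{\<zero>\<^bsub>M\<^esub>}}" using C(1) by blast
  then show "\<Union>C \<in> C" by simp
qed

lemma noetherian_submodule_add_cyclic:
  assumes "noetherian_ring R" "noetherian_submodule R M X" and g: "g \<in> carrier M"
  shows "noetherian_submodule R M (X <+>\<^bsub>M\<^esub> ((\<lambda>r. r \<odot>\<^bsub>M\<^esub> g) ` carrier R))"
    (is "noetherian_submodule R M ?Y")
  unfolding noetherian_submodule_def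
proof (intro conjI allI impI)
  have X: "submodule X R M" using assms(2) by (simp add: noetherian_submodule_def)
  show "submodule ?Y R M" by (rule submodule_set_add[OF X cyclic_submodule[OF g]])
  fix C assume "C \<noteq> {}" and chain: "subset.chain {H. submodule H R M \<and> H \<subseteq> ?Y} C"
  have C: "submodule H R M" "H \<subseteq> ?Y" if "H \<in> C" for H
    using chain that by (auto simp: subset_chain_def)
  have "subset.chain {H. submodule H R M \<and> H \<subseteq> X} ((\<lambda>H. H \<inter> X) ` C)"
    by (rule subset_chain_image[OF chain]) (use C submodule_Int[OF _ X] in auto)
  then have "\<Union>((\<lambda>H. H \<inter> X) ` C) \<in> (\<lambda>H. H \<inter> X) ` C"
    by (rule noetherian_submoduleD[OF assms(2), rotated]) (simp add: \<open>C \<noteq> {}\<close>)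
  then obtain H_tr where H_tr: "H_tr \<in> C" "\<And>K. K \<in> C \<Longrightarrow> K \<inter> X \<subseteq> H_tr" by blast
  have "subset.chain {I. ideal I R} (coefficient_ideal X g ` C)"
    by (rule subset_chain_image[OF chain])
      (use C ideal_coefficient_ideal[OF X _ g] coefficient_ideal_mono in auto)
  then have "\<Union>(coefficient_ideal X g ` C) \<in> coefficient_ideal X g ` C"
    by (rule noetherian_ring.ideal_chain_is_trivial[OF assms(1), rotated])
      (simp add: \<open>C \<noteq> {}\<close>)
  then obtain H_co where H_co: "H_co \<in> C"
      "\<And>K. K \<in> C \<Longrightarrow> coefficient_ideal X g K \<subseteq> coefficient_ideal X g H_co" by blast
  have "H_tr \<subseteq> H_co \<or> H_co \<subseteq> H_tr" using H_tr(1) H_co(1) chain by (simp add: subset_chain_def)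
  then obtain H where H: "H \<in> C" "H_tr \<subseteq> H" "H_co \<subseteq> H" using H_tr(1) H_co(1) by auto
  have "K \<subseteq> H" if K: "K \<in> C" for K
  proof (cases "H \<subseteq> K")
    case True
    then show ?thesis
    proof (rule submodule_subset_by_coefficients[OF X C(1)[OF H(1)] C(1)[OF K] g _ _ C(2)[OF K]])
      show "K \<inter> X \<subseteq> H" using H_tr(2)[OF K] H(2) by (rule subset_trans)
      show "coefficient_ideal X g K \<subseteq> coefficient_ideal X g H"
        using H_co(2)[OF K] coefficient_ideal_mono[OF H(3)] by (rule subset_trans)
    qed
  next
    case False
    moreover have "H \<subseteq> K \<or> K \<subseteq> H" using chain H(1) K by (simp add: subset_chain_def)
    ultimately show ?thesis by blast
  qed
  then have "\<Union>C = H" using H(1) by blast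
  then show "\<Union>C \<in> C" using H(1) by simp
qed

lemma finite_subset_noetherian_submodule:
  assumes "noetherian_ring R" "finite A" "A \<subseteq> carrier M"
  shows "\<exists>X. noetherian_submodule R M X \<and> A \<subseteq> X"
  using assms(2,3)
proof (induction A rule: finite_induct)
  case empty
  then show ?case using noetherian_submodule_zero by blast
next
  case (insert g A)
  then obtain X where X: "noetherian_submodule R M X" "A \<subseteq> X" and g: "g \<in> carrier M" by auto
  then have "submodule X R M" by (simp add: noetherian_submodule_def)
  note sub = this cyclic_submodule[OF g]
  have "g \<in> (\<lambda>r. r \<odot>\<^bsub>M\<^esub> g) ` carrier R" using g by (intro image_eqI[of _ _ \<one>]) auto
  then have "insert g A \<subseteq> X <+>\<^bsub>M\<^esub> ((\<lambda>r. r \<odot>\<^bsub>M\<^esub> g) ` carrier R)"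
    using X(2) set_add_upper1[OF sub] set_add_upper2[OF sub] by blast
  then show ?case using noetherian_submodule_add_cyclic[OF assms(1) X(1) g] by blast
qed

end

theorem finitely_generated_noetherian:
  assumes "noetherian_ring R" "finitely_generated R M"
  shows "noetherian_submodule R M (carrier M)"
proof -
  interpret module R M using assms(2) by (simp add: finitely_generated_def)
  obtain A where A: "finite A" "A \<subseteq> carrier M" "\<Inter>{H. submodule H R M \<and> A \<subseteq> H} = carrier M"
    using assms(2) by (auto simp: finitely_generated_def)
  obtain X where X: "noetherian_submodule R M X" "A \<subseteq> X"
    using finite_subset_noetherian_submodule[OF assms(1) A(1,2)] by blast
  then have "submodule X R M" by (simp add: noetherian_submodule_def)
  then have "X = carrier M" using A(3) X(2) submoduleE(1) by blast
  then show ?thesis using X(1) by simp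
qed

lemma noetherian_maximal_submodule:
  assumes "noetherian_submodule R M (carrier M)" "H\<^sub>0 \<in> C" "\<And>H. H \<in> C \<Longrightarrow> submodule H R M"
    and "module R M"
  obtains H where "H \<in> C" "\<And>K. K \<in> C \<Longrightarrow> H \<subseteq> K \<Longrightarrow> K = H"
proof -
  have "\<exists>H\<in>C. \<forall>K\<in>C. H \<subseteq> K \<longrightarrow> K = H"
  proof (rule subset_Zorn_nonempty)
    fix D assume "D \<noteq> {}" and D: "subset.chain C D"
    then have "D \<subseteq> C" by (simp add: subset_chain_def)
    have "subset.chain {H. submodule H R M \<and> H \<subseteq> carrier M} D"
      using D assms(3) module.submoduleE(1)[OF assms(4)] by (auto simp: subset_chain_def)
    then have "\<Union>D \<in> D" by (rule noetherian_submoduleD[OF assms(1) \<open>D \<noteq> {}\<close>])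
    then show "\<Union>D \<in> C" using \<open>D \<subseteq> C\<close> by (rule subsetD[rotated])
  qed (use assms(2) in blast)
  then show thesis using that by blast
qed

lemma noetherian_increasing_stable:
  assumes "noetherian_submodule R M (carrier M)" "module R M"
    and "\<And>n::nat. submodule (H n) R M" "\<And>n. H n \<subseteq> H (Suc n)"
  obtains k where "H (Suc k) = H k"
proof -
  obtain K where K: "K \<in> range H" "\<And>L. L \<in> range H \<Longrightarrow> K \<subseteq> L \<Longrightarrow> L = K"
    by (rule noetherian_maximal_submodule[OF assms(1), of "H 0" "range H"]) (use assms(2,3) in auto)
  then obtain k where "K = H k" by blast
  then show thesis using K(2)[of "H (Suc k)"] assms(4)[of k] that by blast
qed

definition jacobson_radical :: "('r, 'x) ring_scheme \<Rightarrow> 'r set"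
  where "jacobson_radical R =
    {y \<in> carrier R. \<forall>r\<in>carrier R. \<one>\<^bsub>R\<^esub> \<ominus>\<^bsub>R\<^esub> r \<otimes>\<^bsub>R\<^esub> y \<in> Units R}"

context module begin

lemma jacobson_radical_smult_maximal:
  assumes L: "submodule L R M" and P: "submodule P R M" "P \<subseteq> L"
    and max: "\<And>K. submodule K R M \<Longrightarrow> P \<subseteq> K \<Longrightarrow> K \<subseteq> L \<Longrightarrow> K = P \<or> K = L"
    and y: "y \<in> jacobson_radical R" and u: "u \<in> L"
  shows "y \<odot>\<^bsub>M\<^esub> u \<in> P"
proof (rule ccontr)
  assume "y \<odot>\<^bsub>M\<^esub> u \<notin> P"
  have yR: "y \<in> carrier R" and uM: "u \<in> carrier M"
    using y u submodule_subset[OF L] by (auto simp: jacobson_radical_def)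
  have yu: "y \<odot>\<^bsub>M\<^esub> u \<in> L" "y \<odot>\<^bsub>M\<^esub> u \<in> carrier M" using submoduleE(4)[OF L yR u] yR uM by auto
  let ?C = "(\<lambda>r. r \<odot>\<^bsub>M\<^esub> (y \<odot>\<^bsub>M\<^esub> u)) ` carrier R"
  note C = cyclic_submodule[OF yu(2)]
  have "y \<odot>\<^bsub>M\<^esub> u \<in> ?C" using yu(2) by (intro image_eqI[of _ _ \<one>]) auto
  then have "y \<odot>\<^bsub>M\<^esub> u \<in> P <+>\<^bsub>M\<^esub> ?C" using set_add_upper2[OF P(1) C] by blast
  moreover have "P <+>\<^bsub>M\<^esub> ?C \<subseteq> L"
    using P(2) submoduleE(4,5)[OF L] yu(1) by (auto elim!: set_addE)
  ultimately have "P <+>\<^bsub>M\<^esub> ?C = L"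
    using max[OF submodule_set_add[OF P(1) C] set_add_upper1[OF P(1) C]] \<open>y \<odot>\<^bsub>M\<^esub> u \<notin> P\<close> by blast
  then have "u \<in> P <+>\<^bsub>M\<^esub> ?C" using u by simp
  then obtain p r where p: "p \<in> P" "r \<in> carrier R" "u = p \<oplus>\<^bsub>M\<^esub> r \<odot>\<^bsub>M\<^esub> (y \<odot>\<^bsub>M\<^esub> u)"
    by (auto elim!: set_addE)
  let ?e = "\<one> \<ominus> r \<otimes> y"
  have e: "?e \<in> Units R" using y p(2) by (auto simp: jacobson_radical_def)
  have "?e \<odot>\<^bsub>M\<^esub> u = u \<ominus>\<^bsub>M\<^esub> r \<odot>\<^bsub>M\<^esub> (y \<odot>\<^bsub>M\<^esub> u)"
    using p(2) yR uM by (simp add: smult_l_diff smult_assoc1)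
  also have "\<dots> = (p \<oplus>\<^bsub>M\<^esub> r \<odot>\<^bsub>M\<^esub> (y \<odot>\<^bsub>M\<^esub> u)) \<ominus>\<^bsub>M\<^esub> r \<odot>\<^bsub>M\<^esub> (y \<odot>\<^bsub>M\<^esub> u)"
    using p(3) by simp
  also have "\<dots> = p" using p(1,2) yu(2) submodule_subset[OF P(1)] by simp
  finally have "inv ?e \<odot>\<^bsub>M\<^esub> (?e \<odot>\<^bsub>M\<^esub> u) \<in> P"
    using submoduleE(4)[OF P(1) R.Units_inv_closed[OF e] p(1)] by simp
  moreover have "inv ?e \<odot>\<^bsub>M\<^esub> (?e \<odot>\<^bsub>M\<^esub> u) = u"
    using e R.Units_closed[OF e] uM by (simp flip: smult_assoc1)
  ultimately have "u \<in> P" by simp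
  then show False using \<open>y \<odot>\<^bsub>M\<^esub> u \<notin> P\<close> submoduleE(4)[OF P(1) yR] by blast
qed

lemma power_smult_in_maximal:
  assumes noeth: "noetherian_submodule R M (carrier M)"
    and L: "submodule L R M" and H: "submodule H R M"
    and max: "\<And>K. submodule K R M \<Longrightarrow> H \<subseteq> K \<Longrightarrow> K \<inter> L = H \<inter> L \<Longrightarrow> K = H"
    and y: "y \<in> carrier R" and yL: "\<And>u. u \<in> L \<Longrightarrow> y \<odot>\<^bsub>M\<^esub> u \<in> H"
  shows "\<exists>n::nat. \<forall>x\<in>carrier M. (y [^] n) \<odot>\<^bsub>M\<^esub> x \<in> H"
proof -
  define C where "C k = {x \<in> carrier M. (y [^] (k::nat)) \<odot>\<^bsub>M\<^esub> x \<in> H}" for k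
  have power_Suc: "(y [^] Suc k) \<odot>\<^bsub>M\<^esub> x = y \<odot>\<^bsub>M\<^esub> ((y [^] k) \<odot>\<^bsub>M\<^esub> x)" if "x \<in> carrier M" for k :: nat and x
    using that y by (simp add: smult_assoc1 smult_left_commute[of "y [^] k" y])
  obtain k where k: "C (Suc k) = C k"
  proof (rule noetherian_increasing_stable[OF noeth module_axioms])
    show "submodule (C n) R M" for n
      by (rule submodule_closedI)
        (use y submodule_zero[OF H] submoduleE(4,5)[OF H] in
          \<open>auto simp: C_def smult_r_distr smult_left_commute[of "y [^] n"]\<close>)
    show "C n \<subseteq> C (Suc n)" for n using power_Suc submoduleE(4)[OF H y] by (auto simp: C_def)
  qed
  let ?Y = "(\<lambda>x. (y [^] k) \<odot>\<^bsub>M\<^esub> x) ` carrier M"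
  have Y: "submodule ?Y R M" by (rule scaled_submodule) (use y in simp)
  have "(H <+>\<^bsub>M\<^esub> ?Y) \<inter> L \<subseteq> H"
  proof
    fix e assume "e \<in> (H <+>\<^bsub>M\<^esub> ?Y) \<inter> L"
    then obtain h x where e: "e \<in> L" "h \<in> H" "x \<in> carrier M" "e = h \<oplus>\<^bsub>M\<^esub> (y [^] k) \<odot>\<^bsub>M\<^esub> x"
      by (auto elim!: set_addE)
    have h: "h \<in> carrier M" using e(2) by (rule submodule_subset[OF H])
    have "y \<odot>\<^bsub>M\<^esub> e = (y [^] Suc k) \<odot>\<^bsub>M\<^esub> x \<oplus>\<^bsub>M\<^esub> y \<odot>\<^bsub>M\<^esub> h"
      unfolding e(4) power_Suc[OF e(3)] using e(3) h y by (simp add: smult_r_distr M.a_comm)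
    then have "(y [^] Suc k) \<odot>\<^bsub>M\<^esub> x = y \<odot>\<^bsub>M\<^esub> e \<ominus>\<^bsub>M\<^esub> y \<odot>\<^bsub>M\<^esub> h" using e(3) h y by simp
    also have "\<dots> \<in> H" by (intro submodule_diff[OF H] yL e submoduleE(4)[OF H] y)
    finally have "x \<in> C k" using e(3) unfolding k[symmetric] by (simp add: C_def)
    then show "e \<in> H" using e submoduleE(5)[OF H] by (simp add: C_def)
  qed
  then have "H <+>\<^bsub>M\<^esub> ?Y = H"
    using set_add_upper1[OF H Y] by (intro max submodule_set_add[OF H Y]) auto
  then show ?thesis using set_add_upper2[OF H Y] by blast
qed

text \<open>Let \<open>P\<close> be maximal among the proper submodules of \<open>L\<close> and \<open>H\<close> maximal with \<open>H \<inter> L = P\<close>. Then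
    \<open>H\<close>
  contains \<open>y\<^sup>n M\<close> for all \<open>y \<in> Y\<close> and large \<open>n\<close>, but not \<open>L\<close>.\<close>

theorem krull_intersection:
  assumes noeth: "noetherian_submodule R M (carrier M)"
    and Y: "finite Y" "Y \<subseteq> jacobson_radical R" and L: "submodule L R M"
    and powers: "\<And>n H. submodule H R M \<Longrightarrow>
      (\<And>y x. y \<in> Y \<Longrightarrow> x \<in> carrier M \<Longrightarrow> (y [^] (n::nat)) \<odot>\<^bsub>M\<^esub> x \<in> H) \<Longrightarrow> L \<subseteq> H"
  shows "L = {\<zero>\<^bsub>M\<^esub>}"
proof (rule ccontr)
  assume "L \<noteq> {\<zero>\<^bsub>M\<^esub>}"
  let ?\<P> = "{P. submodule P R M \<and> P \<subset> L}"
  obtain P where P: "P \<in> ?\<P>" "\<And>K. K \<in> ?\<P> \<Longrightarrow> P \<subseteq> K \<Longrightarrow> K = P"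
  proof (rule noetherian_maximal_submodule[OF noeth])
    show "{\<zero>\<^bsub>M\<^esub>} \<in> ?\<P>" using zero_submodule submodule_zero[OF L] \<open>L \<noteq> {\<zero>\<^bsub>M\<^esub>}\<close> by auto
  qed (use module_axioms in auto)
  let ?\<H> = "{H. submodule H R M \<and> H \<inter> L = P}"
  obtain H where H: "H \<in> ?\<H>" "\<And>K. K \<in> ?\<H> \<Longrightarrow> H \<subseteq> K \<Longrightarrow> K = H"
    by (rule noetherian_maximal_submodule[OF noeth, of P ?\<H>]) (use P(1) module_axioms in auto)
  have "y \<odot>\<^bsub>M\<^esub> u \<in> H" if "y \<in> Y" "u \<in> L" for y u
    using jacobson_radical_smult_maximal[OF L, of P y u] P that Y(2) H(1) by blast
  then have "\<exists>n::nat. \<forall>x\<in>carrier M. (y [^] n) \<odot>\<^bsub>M\<^esub> x \<in> H" if "y \<in> Y" for y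
    using power_smult_in_maximal[OF noeth L, of H y] H that Y(2)
    by (auto simp: jacobson_radical_def)
  then obtain k where k: "\<And>y x. y \<in> Y \<Longrightarrow> x \<in> carrier M \<Longrightarrow> (y [^] (k y :: nat)) \<odot>\<^bsub>M\<^esub> x \<in> H" by metis
  have "(y [^] Max (k ` Y)) \<odot>\<^bsub>M\<^esub> x \<in> H" if y: "y \<in> Y" and x: "x \<in> carrier M" for y x
  proof -
    have "k y \<le> Max (k ` Y)" and yR: "y \<in> carrier R"
      using y Y by (auto simp: jacobson_radical_def)
    then have "y [^] Max (k ` Y) = (y [^] k y) \<otimes> (y [^] (Max (k ` Y) - k y))"
      by (simp add: R.nat_pow_mult)
    then show ?thesis using k[OF y, of "(y [^] (Max (k ` Y) - k y)) \<odot>\<^bsub>M\<^esub> x"] yR x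
      by (simp add: smult_assoc1)
  qed
  then have "L \<subseteq> H" using powers H(1) by blast
  then show False using H(1) P(1) by blast
qed

end

section \<open>Directed systems of cochain complexes\<close>

text \<open>The \<open>n\<close>-th complex has differentials \<open>d n : K p \<rightarrow> K (p + 1)\<close>, and \<open>\<tau> m\<close> is the transition
  map from the \<open>n\<close>-th to the \<open>(n + m)\<close>-th complex. A cocycle is \<open>null\<close> if its class in the colimit of
  the cohomology modules vanishes.\<close>

locale complex_system =
  fixes R :: "('r, 'x) ring_scheme" (structure) and K :: "int \<Rightarrow> ('r, 'k) module"
    and d :: "nat \<Rightarrow> 'k \<Rightarrow> 'k" and \<tau> :: "nat \<Rightarrow> 'k \<Rightarrow> 'k"
  assumes module_K: "module R (K p)"
    and d_hom: "d n \<in> mod_hom R (K p) (K (p + 1))"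
    and \<tau>_hom: "\<tau> m \<in> mod_hom R (K p) (K p)"
    and d_d: "w \<in> carrier (K p) \<Longrightarrow> d n (d n w) = \<zero>\<^bsub>K (p + 1 + 1)\<^esub>"
    and d_\<tau>: "w \<in> carrier (K p) \<Longrightarrow> d (n + m) (\<tau> m w) = \<tau> m (d n w)"
    and \<tau>_\<tau>: "w \<in> carrier (K p) \<Longrightarrow> \<tau> m (\<tau> k w) = \<tau> (k + m) w"
begin

sublocale K: module R "K p" for p
  by (rule module_K)

sublocale d: module_homomorphism R "K p" "K (p + 1)" "d n" for p n
  by unfold_locales (rule d_hom)

sublocale \<tau>: module_homomorphism R "K p" "K p" "\<tau> m" for p m
  by unfold_locales (rule \<tau>_hom)

definition cocycles :: "int \<Rightarrow> nat \<Rightarrow> 'k set"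
  where "cocycles p n = {w \<in> carrier (K p). d n w = \<zero>\<^bsub>K (p + 1)\<^esub>}"

definition null :: "int \<Rightarrow> nat \<Rightarrow> 'k \<Rightarrow> bool"
  where "null p n w \<longleftrightarrow> (\<exists>m. \<exists>v\<in>carrier (K (p - 1)). \<tau> m w = d (n + m) v)"

definition acyclic :: "int \<Rightarrow> bool"
  where "acyclic p \<longleftrightarrow> (\<forall>n. \<forall>w\<in>cocycles p n. null p n w)"

lemma cocycles_closed: "w \<in> cocycles p n \<Longrightarrow> w \<in> carrier (K p)"
  and cocycles_d: "w \<in> cocycles p n \<Longrightarrow> d n w = \<zero>\<^bsub>K (p + 1)\<^esub>"
  by (auto simp: cocycles_def)

lemma coboundary_closed: "v \<in> carrier (K (p - 1)) \<Longrightarrow> d n v \<in> carrier (K p)"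
  using d.closed[of v "p - 1" n] by simp

lemma coboundary_cocycle: "v \<in> carrier (K (p - 1)) \<Longrightarrow> d n v \<in> cocycles p n"
  using d_d[of v "p - 1" n] by (simp add: cocycles_def coboundary_closed)

lemma cocycles_\<tau>: "w \<in> cocycles p n \<Longrightarrow> \<tau> m w \<in> cocycles p (n + m)"
  by (auto simp: cocycles_def d_\<tau>)

lemma cocycles_diff: "v \<in> cocycles p n \<Longrightarrow> w \<in> cocycles p n \<Longrightarrow> v \<ominus>\<^bsub>K p\<^esub> w \<in> cocycles p n"
  by (simp add: cocycles_def)

lemma acyclicI: "(\<And>n w. w \<in> cocycles p n \<Longrightarrow> null p n w) \<Longrightarrow> acyclic p"
  by (simp add: acyclic_def)

lemma acyclicD:
  assumes "acyclic p" "w \<in> cocycles p n"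
  obtains m v where "v \<in> carrier (K (p - 1))" "\<tau> m w = d (n + m) v"
  using assms unfolding acyclic_def null_def by blast

lemma nullI: "v \<in> carrier (K (p - 1)) \<Longrightarrow> \<tau> m w = d (n + m) v \<Longrightarrow> null p n w"
  unfolding null_def by blast

lemma null_coboundary: "v \<in> carrier (K (p - 1)) \<Longrightarrow> null p n (d n v)"
  by (rule nullI[of "\<tau> 0 v" _ 0]) (auto simp: d_\<tau>[of v "p - 1" n 0, simplified])

lemma null_zero: "null p n \<zero>\<^bsub>K p\<^esub>"
  using null_coboundary[of "\<zero>\<^bsub>K (p - 1)\<^esub>" p n] d.zero[of n "p - 1"] by simp

lemma null_\<tau>:
  assumes "w \<in> carrier (K p)" "null p n w"
  shows "null p (n + m) (\<tau> m w)"
proof -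
  obtain k v where v: "v \<in> carrier (K (p - 1))" "\<tau> k w = d (n + k) v"
    using assms(2) by (auto simp: null_def)
  have "\<tau> k (\<tau> m w) = \<tau> m (\<tau> k w)" using assms(1) by (simp add: \<tau>_\<tau> add.commute)
  also have "\<dots> = d (n + m + k) (\<tau> m v)"
    using d_\<tau>[OF v(1), of "n + k" m] v(2) by (simp add: add_ac)
  finally show ?thesis using v(1) by (intro nullI[of "\<tau> m v" p k]) simp_all
qed

lemma null_uniform:
  assumes "finite S" "\<forall>s\<in>S. w s \<in> carrier (K p) \<and> null p n (w s)"
  shows "\<exists>m. \<forall>s\<in>S. \<exists>v\<in>carrier (K (p - 1)). \<tau> m (w s) = d (n + m) v"
  using assms
proof (induction S rule: finite_induct)
  case (insert s S)
  then obtain m where m: "\<forall>s\<in>S. \<exists>v\<in>carrier (K (p - 1)). \<tau> m (w s) = d (n + m) v" by auto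
  obtain k u where k: "u \<in> carrier (K (p - 1))" "\<tau> k (w s) = d (n + k) u"
    using insert.prems by (auto simp: null_def)
  have later: "\<exists>v\<in>carrier (K (p - 1)). \<tau> (i + j) x = d (n + (i + j)) v"
    if "x \<in> carrier (K p)" "v \<in> carrier (K (p - 1))" "\<tau> i x = d (n + i) v" for i j x v
    using that d_\<tau>[of v "p - 1" "n + i" j] \<tau>_\<tau>[of x p j i]
    by (intro bexI[of _ "\<tau> j v"]) (simp_all add: add.assoc)
  have "\<exists>v\<in>carrier (K (p - 1)). \<tau> (m + k) (w s) = d (n + (m + k)) v"
    using later[of "w s" u k m] k insert.prems by (simp add: add.commute)
  moreover have "\<forall>s\<in>S. \<exists>v\<in>carrier (K (p - 1)). \<tau> (m + k) (w s) = d (n + (m + k)) v"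
    using later[of _ _ m k] m insert.prems by blast
  ultimately show ?case by blast
qed simp

lemma null_\<tau>D: "w \<in> carrier (K p) \<Longrightarrow> null p (n + m) (\<tau> m w) \<Longrightarrow> null p n w"
  unfolding null_def by (force simp: \<tau>_\<tau> add.assoc)

lemma null_add:
  assumes "v \<in> carrier (K p)" "w \<in> carrier (K p)" "null p n v" "null p n w"
  shows "null p n (v \<oplus>\<^bsub>K p\<^esub> w)"
proof -
  obtain k a where a: "a \<in> carrier (K (p - 1))" "\<tau> k v = d (n + k) a"
    using assms(3) by (auto simp: null_def)
  obtain l b where b: "b \<in> carrier (K (p - 1))" "\<tau> l w = d (n + l) b"
    using assms(4) by (auto simp: null_def)
  have "\<tau> (k + l) v = \<tau> l (\<tau> k v)" "\<tau> (k + l) w = \<tau> k (\<tau> l w)"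
    using assms(1,2) by (simp_all add: \<tau>_\<tau> add.commute)
  then have "\<tau> (k + l) v = d (n + (k + l)) (\<tau> l a)" "\<tau> (k + l) w = d (n + (k + l)) (\<tau> k b)"
    using d_\<tau>[OF a(1), of "n + k" l] d_\<tau>[OF b(1), of "n + l" k] a b by (simp_all add: add_ac)
  then have "\<tau> (k + l) (v \<oplus>\<^bsub>K p\<^esub> w) = d (n + (k + l)) (\<tau> l a \<oplus>\<^bsub>K (p - 1)\<^esub> \<tau> k b)"
    using assms(1,2) d.add[of "\<tau> l a" "p - 1" "\<tau> k b"] a b by simp
  moreover have "\<tau> l a \<oplus>\<^bsub>K (p - 1)\<^esub> \<tau> k b \<in> carrier (K (p - 1))" using a(1) b(1) by simp
  ultimately show ?thesis by (intro nullI)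
qed

end

locale short_exact_systems =
  A: complex_system R KA dA \<tau>A + B: complex_system R KB dB \<tau>B + C: complex_system R KC dC \<tau>C
  for R :: "('r, 'x) ring_scheme" (structure) and KA :: "int \<Rightarrow> ('r, 'a) module" and dA \<tau>A
    and KB :: "int \<Rightarrow> ('r, 'b) module" and dB \<tau>B and KC :: "int \<Rightarrow> ('r, 'c) module" and dC \<tau>C +
  fixes i :: "'a \<Rightarrow> 'b" and g :: "'b \<Rightarrow> 'c"
  assumes i_hom: "i \<in> mod_hom R (KA p) (KB p)" and g_hom: "g \<in> mod_hom R (KB p) (KC p)"
    and i_inj: "inj_on i (carrier (KA p))" and g_surj: "g ` carrier (KB p) = carrier (KC p)"
    and exact: "i ` carrier (KA p) = {b \<in> carrier (KB p). g b = \<zero>\<^bsub>KC p\<^esub>}"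
    and i_d: "a \<in> carrier (KA p) \<Longrightarrow> i (dA n a) = dB n (i a)"
    and i_\<tau>: "a \<in> carrier (KA p) \<Longrightarrow> i (\<tau>A m a) = \<tau>B m (i a)"
    and g_d: "b \<in> carrier (KB p) \<Longrightarrow> g (dB n b) = dC n (g b)"
    and g_\<tau>: "b \<in> carrier (KB p) \<Longrightarrow> g (\<tau>B m b) = \<tau>C m (g b)"
begin

sublocale i: module_homomorphism R "KA p" "KB p" i for p
  by unfold_locales (rule i_hom)

sublocale g: module_homomorphism R "KB p" "KC p" g for p
  by unfold_locales (rule g_hom)

lemma g_i [simp]: "a \<in> carrier (KA p) \<Longrightarrow> g (i a) = \<zero>\<^bsub>KC p\<^esub>"
  using exact[of p] by blast

lemma i_cocycles: "a \<in> A.cocycles p n \<Longrightarrow> i a \<in> B.cocycles p n"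
  by (auto simp: A.cocycles_def B.cocycles_def simp flip: i_d)

lemma i_cocyclesD:
  assumes a: "a \<in> carrier (KA p)" and "dB n (i a) = \<zero>\<^bsub>KB (p + 1)\<^esub>"
  shows "a \<in> A.cocycles p n"
  using i.inj_on_iff[THEN iffD1, OF i_inj, rule_format, of "dA n a" "p + 1"] assms
  by (simp add: A.cocycles_def i_d[OF a])

lemma g_cocycles: "b \<in> B.cocycles p n \<Longrightarrow> g b \<in> C.cocycles p n"
  by (auto simp: B.cocycles_def C.cocycles_def simp flip: g_d)

lemma lift:
  assumes "c \<in> carrier (KC p)"
  obtains b where "b \<in> carrier (KB p)" "g b = c"
  using assms unfolding g_surj[symmetric] by blast

lemma kernel_preimage:
  assumes "b \<in> carrier (KB p)" "g b = \<zero>\<^bsub>KC p\<^esub>"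
  obtains a where "a \<in> carrier (KA p)" "i a = b"
  using assms exact[of p] by (metis (mono_tags, lifting) imageE mem_Collect_eq)

lemma g_null:
  assumes "b \<in> carrier (KB p)" "B.null p n b"
  shows "C.null p n (g b)"
proof -
  obtain m v where v: "v \<in> carrier (KB (p - 1))" "\<tau>B m b = dB (n + m) v"
    using assms(2) by (auto simp: B.null_def)
  then show ?thesis
    using assms(1) by (intro C.nullI[of "g v" p m]) (simp_all flip: g_\<tau> g_d)
qed

definition cohomology_surjective :: "int \<Rightarrow> bool"
  where "cohomology_surjective p \<longleftrightarrow> (\<forall>n. \<forall>c\<in>C.cocycles p n. \<exists>m. \<exists>b\<in>B.cocycles p (n + m).
    C.null p (n + m) (\<tau>C m c \<ominus>\<^bsub>KC p\<^esub> g b))"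

lemma acyclic_left_imp_surjective:
  assumes "A.acyclic (p + 1)"
  shows "cohomology_surjective p"
  unfolding cohomology_surjective_def
proof (intro allI ballI)
  fix n c assume c: "c \<in> C.cocycles p n"
  obtain b where b: "b \<in> carrier (KB p)" "g b = c" using lift[OF C.cocycles_closed[OF c]] by blast
  have "g (dB n b) = \<zero>\<^bsub>KC (p + 1)\<^esub>" using C.cocycles_d[OF c] b by (simp add: g_d)
  then obtain a where a: "a \<in> carrier (KA (p + 1))" "i a = dB n b"
    using kernel_preimage[OF B.d.closed[OF b(1)]] by blast
  have "a \<in> A.cocycles (p + 1) n" using a B.d_d[OF b(1)] by (intro i_cocyclesD) simp_all
  then obtain m a' where a': "a' \<in> carrier (KA p)" "\<tau>A m a = dA (n + m) a'"
    using A.acyclicD[OF assms] by (metis add_diff_cancel_right')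
  have "dB (n + m) (\<tau>B m b) = \<tau>B m (i a)" using a(2) b(1) by (simp add: B.d_\<tau>)
  also have "\<dots> = i (dA (n + m) a')" using a(1) a'(2) by (simp flip: i_\<tau>)
  also have "\<dots> = dB (n + m) (i a')" using a'(1) by (rule i_d)
  finally have "dB (n + m) (\<tau>B m b) = dB (n + m) (i a')" .
  then have "\<tau>B m b \<ominus>\<^bsub>KB p\<^esub> i a' \<in> B.cocycles p (n + m)"
    using a'(1) b(1) by (simp add: B.cocycles_def)
  moreover have "C.null p (n + m) (\<tau>C m c \<ominus>\<^bsub>KC p\<^esub> g (\<tau>B m b \<ominus>\<^bsub>KB p\<^esub> i a'))"
    using a'(1) b C.cocycles_closed[OF c] C.null_zero by (simp add: g_\<tau>)
  ultimately show "\<exists>m. \<exists>b\<in>B.cocycles p (n + m). C.null p (n + m) (\<tau>C m c \<ominus>\<^bsub>KC p\<^esub> g b)" by blast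
qed

lemma surjective_imp_acyclic_left:
  assumes "cohomology_surjective p" "B.acyclic (p + 1)"
  shows "A.acyclic (p + 1)"
proof (rule A.acyclicI)
  fix n a assume a: "a \<in> A.cocycles (p + 1) n"
  note aK = A.cocycles_closed[OF a]
  obtain k b where b: "b \<in> carrier (KB p)" "\<tau>B k (i a) = dB (n + k) b"
    using B.acyclicD[OF assms(2) i_cocycles[OF a]] by (metis add_diff_cancel_right')
  have "dC (n + k) (g b) = \<zero>\<^bsub>KC (p + 1)\<^esub>" 
    using b(1) i.closed[OF aK] aK by (simp add: g_\<tau>[of _ "p + 1"] g_d[symmetric] b(2)[symmetric])
  then have "g b \<in> C.cocycles p (n + k)" using b(1) by (simp add: C.cocycles_def)
  then obtain l b' where b': "b' \<in> B.cocycles p (n + k + l)"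
    and null: "C.null p (n + k + l) (\<tau>C l (g b) \<ominus>\<^bsub>KC p\<^esub> g b')"
    using assms(1) unfolding cohomology_surjective_def by blast
  note b'K = B.cocycles_closed[OF b']
  obtain m v where v: "v \<in> carrier (KC (p - 1))"
    "\<tau>C m (\<tau>C l (g b) \<ominus>\<^bsub>KC p\<^esub> g b') = dC (n + k + l + m) v"
    using null by (auto simp: C.null_def)
  obtain v' where v': "v' \<in> carrier (KB (p - 1))" "g v' = v" using lift[OF v(1)] by blast
  let ?N = "n + k + l + m" and ?e = "\<tau>B l b \<ominus>\<^bsub>KB p\<^esub> b'"
  let ?u = "\<tau>B m ?e \<ominus>\<^bsub>KB p\<^esub> dB ?N v'"
  note cob = B.coboundary_closed[OF v'(1), of ?N] B.cocycles_d[OF B.coboundary_cocycle[OF v'(1)]]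
  have u: "?u \<in> carrier (KB p)" using b(1) b'K cob by simp
  have "g (\<tau>B m ?e) = \<tau>C m (g ?e)" using b(1) b'K by (intro g_\<tau>[of _ p]) simp
  also have "g ?e = \<tau>C l (g b) \<ominus>\<^bsub>KC p\<^esub> g b'" using b(1) b'K by (simp add: g_\<tau>)
  also have "\<tau>C m \<dots> = g (dB ?N v')" using v(2) v' by (simp only: g_d)
  finally have "g (\<tau>B m ?e) = g (dB ?N v')" .
  then have "g ?u = \<zero>\<^bsub>KC p\<^esub>" using b(1) b'K cob(1) by simp
  then obtain a' where a': "a' \<in> carrier (KA p)" "i a' = ?u" using kernel_preimage[OF u] by blast
  have "i (dA ?N a') = dB ?N (\<tau>B m ?e)" using a' b(1) b'K cob by (simp add: i_d)
  also have "\<dots> = \<tau>B m (dB (n + k + l) ?e)" using b(1) b'K by (intro B.d_\<tau>[of _ p]) simp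
  also have "dB (n + k + l) ?e = \<tau>B l (\<tau>B k (i a))"
    using b b'K B.cocycles_d[OF b'] by (simp add: B.d_\<tau>)
  also have "\<tau>B m (\<tau>B l (\<tau>B k (i a))) = i (\<tau>A (k + l + m) a)"
    using aK by (simp add: i_\<tau> B.\<tau>_\<tau>[of _ "p + 1"])
  finally have "\<tau>A (k + l + m) a = dA (n + (k + l + m)) a'"
    using inj_onD[OF i_inj[of "p + 1"]] aK a'(1) by (simp add: add.assoc)
  then show "A.null (p + 1) n a" using a'(1) by (intro A.nullI[of a' _ "k + l + m"]) simp_all
qed

lemma acyclic_right_imp_surjective:
  assumes "C.acyclic p"
  shows "cohomology_surjective p"
  unfolding cohomology_surjective_def
proof (intro allI ballI)
  fix n c assume c: "c \<in> C.cocycles p n"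
  then have "C.null p (n + 0) (\<tau>C 0 c)"
    using assms C.cocycles_closed by (intro C.null_\<tau>) (auto simp: C.acyclic_def)
  then have "C.null p (n + 0) (\<tau>C 0 c \<ominus>\<^bsub>KC p\<^esub> g \<zero>\<^bsub>KB p\<^esub>)" using C.cocycles_closed[OF c] by simp
  moreover have "\<zero>\<^bsub>KB p\<^esub> \<in> B.cocycles p (n + 0)" by (simp add: B.cocycles_def)
  ultimately show "\<exists>m. \<exists>b\<in>B.cocycles p (n + m). C.null p (n + m) (\<tau>C m c \<ominus>\<^bsub>KC p\<^esub> g b)" by blast
qed

lemma surjective_imp_acyclic_right:
  assumes "cohomology_surjective p" "B.acyclic p"
  shows "C.acyclic p"
proof (rule C.acyclicI)
  fix n c assume c: "c \<in> C.cocycles p n"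
  note cK = C.cocycles_closed[OF c]
  obtain m b where b: "b \<in> B.cocycles p (n + m)"
    and null: "C.null p (n + m) (\<tau>C m c \<ominus>\<^bsub>KC p\<^esub> g b)"
    using assms(1) c unfolding cohomology_surjective_def by blast
  note bK = B.cocycles_closed[OF b]
  have "C.null p (n + m) (g b)"
    using assms(2) b by (intro g_null[OF bK]) (simp add: B.acyclic_def)
  then have "C.null p (n + m) ((\<tau>C m c \<ominus>\<^bsub>KC p\<^esub> g b) \<oplus>\<^bsub>KC p\<^esub> g b)"
    using cK bK null by (intro C.null_add) simp_all
  then have "C.null p (n + m) (\<tau>C m c)" using cK bK by simp
  then show "C.null p n c" by (rule C.null_\<tau>D[OF cK])
qed

lemma acyclic_middle:
  assumes "A.acyclic p" "C.acyclic p"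
  shows "B.acyclic p"
proof (rule B.acyclicI)
  fix n b assume b: "b \<in> B.cocycles p n"
  note bK = B.cocycles_closed[OF b]
  obtain m v where v: "v \<in> carrier (KC (p - 1))" "\<tau>C m (g b) = dC (n + m) v"
    using C.acyclicD[OF assms(2) g_cocycles[OF b]] by blast
  obtain v' where v': "v' \<in> carrier (KB (p - 1))" "g v' = v" using lift[OF v(1)] by blast
  let ?u = "\<tau>B m b \<ominus>\<^bsub>KB p\<^esub> dB (n + m) v'"
  note cob = B.coboundary_cocycle[OF v'(1), of "n + m"] B.coboundary_closed[OF v'(1), of "n + m"]
  have u: "?u \<in> B.cocycles p (n + m)" using B.cocycles_diff B.cocycles_\<tau>[OF b] cob(1) by blast
  have "g (\<tau>B m b) = g (dB (n + m) v')" using bK v v' by (simp add: g_\<tau> g_d)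
  then have "g ?u = \<zero>\<^bsub>KC p\<^esub>" using bK cob(2) by simp
  then obtain a where a: "a \<in> carrier (KA p)" "i a = ?u"
    using kernel_preimage[OF B.cocycles_closed[OF u]] by blast
  have "a \<in> A.cocycles p (n + m)" using a B.cocycles_d[OF u] by (intro i_cocyclesD) simp_all
  then obtain k w where w: "w \<in> carrier (KA (p - 1))" "\<tau>A k a = dA (n + m + k) w"
    using A.acyclicD[OF assms(1)] by blast
  have "\<tau>B k ?u = i (\<tau>A k a)" unfolding a(2)[symmetric] by (rule i_\<tau>[OF a(1), symmetric])
  then have "\<tau>B k ?u = dB (n + m + k) (i w)" using w by (simp add: i_d)
  then have "B.null p (n + m) ?u" using w(1) by (intro B.nullI[of "i w"]) simp_all
  then have "B.null p (n + m) (?u \<oplus>\<^bsub>KB p\<^esub> dB (n + m) v')"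
    using B.cocycles_closed[OF u] cob(2) v'(1) by (intro B.null_add B.null_coboundary) simp_all
  then have "B.null p (n + m) (\<tau>B m b)" using bK cob(2) by simp
  then show "B.null p n b" by (rule B.null_\<tau>D[OF bK])
qed

end

section \<open>Koszul complexes\<close>

definition function_module :: "('r, 'm, 'y) module_scheme \<Rightarrow> 'i set \<Rightarrow> ('r, 'i \<Rightarrow> 'm) module"
  where "function_module M X =
    \<lparr>carrier = {w. (\<forall>i. w i \<in> carrier M) \<and> (\<forall>i. i \<notin> X \<longrightarrow> w i = \<zero>\<^bsub>M\<^esub>)},
     monoid.mult = undefined, one = undefined, ring.zero = (\<lambda>_. \<zero>\<^bsub>M\<^esub>),
     add = (\<lambda>v w i. v i \<oplus>\<^bsub>M\<^esub> w i), smult = (\<lambda>r w i. r \<odot>\<^bsub>M\<^esub> w i)\<rparr>"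

lemma function_module_simps [simp]:
  "\<zero>\<^bsub>function_module M X\<^esub> = (\<lambda>_. \<zero>\<^bsub>M\<^esub>)"
  "v \<oplus>\<^bsub>function_module M X\<^esub> w = (\<lambda>i. v i \<oplus>\<^bsub>M\<^esub> w i)"
  "r \<odot>\<^bsub>function_module M X\<^esub> w = (\<lambda>i. r \<odot>\<^bsub>M\<^esub> w i)"
  by (simp_all add: function_module_def)

lemma function_module_carrier:
  "w \<in> carrier (function_module M X) \<longleftrightarrow>
    (\<forall>i. w i \<in> carrier M) \<and> (\<forall>i. i \<notin> X \<longrightarrow> w i = \<zero>\<^bsub>M\<^esub>)"
  by (simp add: function_module_def)

lemma function_module_value: "w \<in> carrier (function_module M X) \<Longrightarrow> w i \<in> carrier M"
  and function_module_outside: "w \<in> carrier (function_module M X) \<Longrightarrow> i \<notin> X \<Longrightarrow> w i = \<zero>\<^bsub>M\<^esub>"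
  by (simp_all add: function_module_carrier)

lemma (in module) function_module: "module R (function_module M X)"
proof (intro moduleI abelian_groupI R.is_cring)
  fix w assume w: "w \<in> carrier (function_module M X)"
  have "(\<lambda>i. \<ominus>\<^bsub>M\<^esub> w i) \<in> carrier (function_module M X)"
    using w by (simp add: function_module_carrier)
  moreover have "(\<lambda>i. \<ominus>\<^bsub>M\<^esub> w i) \<oplus>\<^bsub>function_module M X\<^esub> w = \<zero>\<^bsub>function_module M X\<^esub>"
    using function_module_value[OF w] by (simp add: M.l_neg)
  ultimately show "\<exists>v\<in>carrier (function_module M X). v \<oplus>\<^bsub>function_module M X\<^esub> w =
      \<zero>\<^bsub>function_module M X\<^esub>"
    by blast
qed (auto simp: function_module_carrier fun_eq_iff M.a_ac smult_l_distr smult_r_distr smult_assoc1)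

lemma (in module) function_module_diff:
  assumes "v \<in> carrier (function_module M X)" "w \<in> carrier (function_module M X)"
  shows "v \<ominus>\<^bsub>function_module M X\<^esub> w = (\<lambda>i. v i \<ominus>\<^bsub>M\<^esub> w i)"
proof -
  interpret F: module R "function_module M X" by (rule function_module)
  have "(v \<ominus>\<^bsub>function_module M X\<^esub> w) i \<oplus>\<^bsub>M\<^esub> w i = v i" for i
    using F.diff_add_cancel[OF assms] by (simp add: fun_eq_iff)
  then have "(v \<ominus>\<^bsub>function_module M X\<^esub> w) i = v i \<ominus>\<^bsub>M\<^esub> w i" for i
    using assms F.M.minus_closed[OF assms] function_module_value by (metis add_diff_cancel)
  then show ?thesis by (simp add: fun_eq_iff)
qed

abbreviation weight :: "bool list \<Rightarrow> nat"
  where "weight bs \<equiv> count_list bs True"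

text \<open>A Koszul cochain for a sequence of length \<open>t\<close> is a function on bool lists of length \<open>t\<close>; such
  a list is the characteristic function of a basis element of the exterior algebra, of degree its
  weight.\<close>

definition koszul_cochains :: "('r, 'm, 'y) module_scheme \<Rightarrow> nat \<Rightarrow> int \<Rightarrow> ('r, bool list \<Rightarrow> 'm) module"
  where "koszul_cochains M t p = function_module M {bs. length bs = t \<and> int (weight bs) = p}"

primrec koszul_d ::
  "('r, 'm, 'y) module_scheme \<Rightarrow> 'r list \<Rightarrow> (bool list \<Rightarrow> 'm) \<Rightarrow> bool list \<Rightarrow> 'm"
  where
    "koszul_d M [] w bs = \<zero>\<^bsub>M\<^esub>"
  | "koszul_d M (z # zs) w bs = (case bs of [] \<Rightarrow> \<zero>\<^bsub>M\<^esub> | b # cs \<Rightarrow>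
      if b then z \<odot>\<^bsub>M\<^esub> w (False # cs) \<ominus>\<^bsub>M\<^esub> koszul_d M zs (\<lambda>cs. w (True # cs)) cs
      else koszul_d M zs (\<lambda>cs. w (False # cs)) cs)"

primrec koszul_prod :: "('r, 'x) ring_scheme \<Rightarrow> 'r list \<Rightarrow> bool list \<Rightarrow> 'r"
  where
    "koszul_prod R [] bs = \<one>\<^bsub>R\<^esub>"
  | "koszul_prod R (z # zs) bs = (case bs of [] \<Rightarrow> \<one>\<^bsub>R\<^esub> | b # cs \<Rightarrow>
      (if b then z else \<one>\<^bsub>R\<^esub>) \<otimes>\<^bsub>R\<^esub> koszul_prod R zs cs)"

definition koszul_transition ::
  "('r, 'x) ring_scheme \<Rightarrow> ('r, 'm, 'y) module_scheme \<Rightarrow> 'r list \<Rightarrow> (bool list \<Rightarrow> 'm) \<Rightarrow> bool list \<Rightarrow> 'm"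
  where "koszul_transition R M xs w = (\<lambda>bs. koszul_prod R xs bs \<odot>\<^bsub>M\<^esub> w bs)"

definition powers :: "('r, 'x) ring_scheme \<Rightarrow> nat \<Rightarrow> 'r list \<Rightarrow> 'r list"
  where "powers R n ys = map (\<lambda>y. y [^]\<^bsub>R\<^esub> n) ys"

lemma length_powers [simp]: "length (powers R n ys) = length ys"
  and set_powers: "set (powers R n ys) = (\<lambda>y. y [^]\<^bsub>R\<^esub> n) ` set ys"
  and powers_simps [simp]: "powers R n [] = []" "powers R n (y # ys) = (y [^]\<^bsub>R\<^esub> n) # powers R n ys"
  by (simp_all add: powers_def)

lemma (in ring) powers_closed [simp]: "set ys \<subseteq> carrier R \<Longrightarrow> set (powers R n ys) \<subseteq> carrier R"
  by (auto simp: powers_def)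

lemma (in ring) powers_add:
  "set ys \<subseteq> carrier R \<Longrightarrow> powers R (n + m) ys = map2 (\<otimes>) (powers R n ys) (powers R m ys)"
  by (induction ys) (auto simp: nat_pow_mult)

lemma (in ring) koszul_prod_closed [simp]: "set zs \<subseteq> carrier R \<Longrightarrow> koszul_prod R zs bs \<in> carrier R"
  by (induction zs arbitrary: bs) (auto split: list.split)

lemma (in monoid) map2_mult_one: "set xs \<subseteq> carrier G \<Longrightarrow> map2 (\<otimes>) xs (replicate (length xs) \<one>) = xs"
  by (induction xs) auto

context module begin

lemma koszul_d_closed [simp]:
  "set zs \<subseteq> carrier R \<Longrightarrow> (\<And>bs. w bs \<in> carrier M) \<Longrightarrow> koszul_d M zs w bs \<in> carrier M"
  by (induction zs arbitrary: w bs) (auto split: list.split)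

lemma koszul_d_add:
  assumes "set zs \<subseteq> carrier R" "\<And>bs. v bs \<in> carrier M" "\<And>bs. w bs \<in> carrier M"
  shows "koszul_d M zs (\<lambda>bs. v bs \<oplus>\<^bsub>M\<^esub> w bs) bs = koszul_d M zs v bs \<oplus>\<^bsub>M\<^esub> koszul_d M zs w bs"
  using assms
proof (induction zs arbitrary: v w bs)
  case (Cons z zs)
  have "(a \<oplus>\<^bsub>M\<^esub> b) \<ominus>\<^bsub>M\<^esub> (a' \<oplus>\<^bsub>M\<^esub> b') = (a \<ominus>\<^bsub>M\<^esub> a') \<oplus>\<^bsub>M\<^esub> (b \<ominus>\<^bsub>M\<^esub> b')"
    if "a \<in> carrier M" "b \<in> carrier M" "a' \<in> carrier M" "b' \<in> carrier M" for a b a' b'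
    using that by (simp add: a_minus_def M.minus_add M.a_ac)
  then show ?case using Cons by (auto simp: smult_r_distr split: list.split)
qed simp

lemma koszul_d_smult:
  assumes "set zs \<subseteq> carrier R" "r \<in> carrier R" "\<And>bs. w bs \<in> carrier M"
  shows "koszul_d M zs (\<lambda>bs. r \<odot>\<^bsub>M\<^esub> w bs) bs = r \<odot>\<^bsub>M\<^esub> koszul_d M zs w bs"
  using assms
  by (induction zs arbitrary: w bs)
    (auto simp: smult_r_diff smult_left_commute split: list.split)

lemma koszul_d_eq_zero:
  assumes "set zs \<subseteq> carrier R"
    and "\<And>cs. length cs = length bs \<Longrightarrow> Suc (weight cs) = weight bs \<Longrightarrow> w cs = \<zero>\<^bsub>M\<^esub>"
  shows "koszul_d M zs w bs = \<zero>\<^bsub>M\<^esub>"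
  using assms
proof (induction zs arbitrary: w bs)
  case (Cons z zs)
  show ?case
  proof (cases bs)
    case bs: (Cons b cs)
    have "koszul_d M zs (\<lambda>cs. w (b # cs)) cs = \<zero>\<^bsub>M\<^esub>"
      by (rule Cons.IH) (use Cons.prems bs in auto)
    then show ?thesis using Cons.prems bs by auto
  qed simp
qed simp

lemma koszul_d_zero [simp]: "set zs \<subseteq> carrier R \<Longrightarrow> koszul_d M zs (\<lambda>_. \<zero>\<^bsub>M\<^esub>) bs = \<zero>\<^bsub>M\<^esub>"
  by (rule koszul_d_eq_zero) simp_all

lemma koszul_d_hom:
  assumes zs: "set zs \<subseteq> carrier R"
    and index: "\<And>bs cs. cs \<in> X \<Longrightarrow> length bs = length cs \<Longrightarrow> weight bs = Suc (weight cs) \<Longrightarrow> bs \<in> Y"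
  shows "koszul_d M zs \<in> mod_hom R (function_module M X) (function_module M Y)"
proof -
  have "koszul_d M zs w \<in> carrier (function_module M Y)"
    if w: "w \<in> carrier (function_module M X)" for w
  proof -
    have "koszul_d M zs w bs = \<zero>\<^bsub>M\<^esub>" if "bs \<notin> Y" for bs
    proof (rule koszul_d_eq_zero[OF zs])
      fix cs :: "bool list" assume "length cs = length bs" "Suc (weight cs) = weight bs"
      then have "cs \<notin> X" using index[of cs bs] that by auto
      then show "w cs = \<zero>\<^bsub>M\<^esub>" using w by (rule function_module_outside[rotated])
    qed
    then show ?thesis using zs function_module_value[OF w] by (simp add: function_module_carrier)
  qed
  then show ?thesis
    using zs by (auto simp: mod_hom_def fun_eq_iff function_module_value koszul_d_add
        koszul_d_smult)
qed

lemma koszul_d_diff: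
  assumes zs: "set zs \<subseteq> carrier R" and "\<And>bs. v bs \<in> carrier M" "\<And>bs. w bs \<in> carrier M"
  shows "koszul_d M zs (\<lambda>bs. v bs \<ominus>\<^bsub>M\<^esub> w bs) bs = koszul_d M zs v bs \<ominus>\<^bsub>M\<^esub> koszul_d M zs w bs"
proof -
  let ?F = "function_module M UNIV"
  interpret F: module R ?F by (rule function_module)
  interpret d: module_homomorphism R ?F ?F "koszul_d M zs"
    by unfold_locales (rule koszul_d_hom[OF zs], simp)
  have "v \<in> carrier ?F" "w \<in> carrier ?F" using assms by (simp_all add: function_module_carrier)
  then show ?thesis
    using d.diff[of v w] d.closed[of v] d.closed[of w]
    by (simp add: function_module_diff fun_eq_iff)
qed

lemma koszul_d_koszul_d:
  assumes "set zs \<subseteq> carrier R" "\<And>bs. w bs \<in> carrier M"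
  shows "koszul_d M zs (koszul_d M zs w) bs = \<zero>\<^bsub>M\<^esub>"
  using assms
proof (induction zs arbitrary: w bs)
  case (Cons z zs)
  then show ?case
    by (auto simp: koszul_d_diff koszul_d_smult split: list.split)
qed simp

lemma koszul_prod_map2:
  assumes "length xs = length zs" "set xs \<subseteq> carrier R" "set zs \<subseteq> carrier R"
  shows "koszul_prod R (map2 (\<otimes>) xs zs) bs = koszul_prod R xs bs \<otimes> koszul_prod R zs bs"
  using assms
  by (induction xs zs arbitrary: bs rule: list_induct2) (auto simp: R.m_ac split: list.split)

lemma koszul_d_transition:
  assumes "length zs = length xs" "set zs \<subseteq> carrier R" "set xs \<subseteq> carrier R" "\<And>bs. w bs \<in> carrier M"
  shows "koszul_d M (map2 (\<otimes>) zs xs) (koszul_transition R M xs w) bs =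
    koszul_transition R M xs (koszul_d M zs w) bs"
  unfolding koszul_transition_def using assms
proof (induction zs xs arbitrary: w bs rule: list_induct2)
  case (Cons z zs x xs)
  show ?case
  proof (cases bs)
    case bs: (Cons b cs)
    have products: "set (map2 (\<otimes>) zs xs) \<subseteq> carrier R"
      using Cons.prems by (auto simp: set_zip subset_iff)
    have closed [simp]: "z \<in> carrier R" "x \<in> carrier R" "set zs \<subseteq> carrier R" "set xs \<subseteq> carrier R"
      "w cs \<in> carrier M" for cs
      using Cons.prems by auto
    have IH: "koszul_d M (map2 (\<otimes>) zs xs) (\<lambda>cs. koszul_prod R xs cs \<odot>\<^bsub>M\<^esub> w (c # cs)) cs =
      koszul_prod R xs cs \<odot>\<^bsub>M\<^esub> koszul_d M zs (\<lambda>cs. w (c # cs)) cs" for c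
      by (rule Cons.IH) simp_all
    have "koszul_d M (map2 (\<otimes>) zs xs) (\<lambda>cs. (x \<otimes> koszul_prod R xs cs) \<odot>\<^bsub>M\<^esub> w (True # cs)) cs =
      x \<odot>\<^bsub>M\<^esub> (koszul_prod R xs cs \<odot>\<^bsub>M\<^esub> koszul_d M zs (\<lambda>cs. w (True # cs)) cs)"
      by (simp add: smult_assoc1 koszul_d_smult[OF products] IH)
    moreover have "(z \<otimes> x) \<odot>\<^bsub>M\<^esub> (koszul_prod R xs cs \<odot>\<^bsub>M\<^esub> w (False # cs)) =
      (x \<otimes> koszul_prod R xs cs) \<odot>\<^bsub>M\<^esub> (z \<odot>\<^bsub>M\<^esub> w (False # cs))"
      by (simp add: R.m_ac flip: smult_assoc1)
    ultimately show ?thesis using bs by (auto simp: IH smult_r_diff smult_assoc1)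
  qed (use Cons.prems in simp)
qed simp

lemma koszul_transition_hom:
  assumes "set xs \<subseteq> carrier R"
  shows "koszul_transition R M xs \<in> mod_hom R (function_module M X) (function_module M X)"
  using assms
  by (auto simp: mod_hom_def function_module_carrier koszul_transition_def fun_eq_iff smult_r_distr
      smult_left_commute function_module_value)

lemma koszul_transition_transition:
  assumes "length xs = length zs" "set xs \<subseteq> carrier R" "set zs \<subseteq> carrier R" "\<And>bs. w bs \<in> carrier M"
  shows "koszul_transition R M zs (koszul_transition R M xs w) =
    koszul_transition R M (map2 (\<otimes>) xs zs) w"
  using assms
  by (simp add: koszul_transition_def fun_eq_iff koszul_prod_map2 R.m_comm[of "koszul_prod R xs _"]
      flip: smult_assoc1)

text \<open>The powers of \<open>ys\<close> vary in the directed system, the elements of \<open>xs\<close> are kept.\<close>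

theorem koszul_system:
  assumes ys: "set ys \<subseteq> carrier R" and xs: "set xs \<subseteq> carrier R"
  shows "complex_system R (koszul_cochains M (length ys + length xs))
    (\<lambda>n. koszul_d M (powers R n ys @ xs))
    (\<lambda>m. koszul_transition R M (powers R m ys @ replicate (length xs) \<one>))"
proof (rule complex_system.intro)
  let ?zs = "\<lambda>n. powers R n ys @ xs" and ?us = "\<lambda>m. powers R m ys @ replicate (length xs) \<one>"
  note [simp] = assms
  have [simp]: "set (replicate k \<one>) \<subseteq> carrier R" for k by auto
  have add: "?zs (n + m) = map2 (\<otimes>) (?zs n) (?us m)"
      "?us (n + m) = map2 (\<otimes>) (?us n) (?us m)" for n m
    using assms R.map2_mult_one[of "replicate (length xs) \<one>"]
    by (simp_all add: R.powers_add R.map2_mult_one)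
  fix p n m k
  show "module R (koszul_cochains M (length ys + length xs) p)"
    unfolding koszul_cochains_def by (rule function_module)
  show "koszul_d M (?zs n) \<in> mod_hom R (koszul_cochains M (length ys + length xs) p)
      (koszul_cochains M (length ys + length xs) (p + 1))"
    unfolding koszul_cochains_def by (rule koszul_d_hom) auto
  show "koszul_transition R M (?us m) \<in> mod_hom R (koszul_cochains M (length ys + length xs) p)
      (koszul_cochains M (length ys + length xs) p)"
    unfolding koszul_cochains_def by (rule koszul_transition_hom) simp
  fix w assume "w \<in> carrier (koszul_cochains M (length ys + length xs) p)"
  then have w: "w bs \<in> carrier M" for bs
    unfolding koszul_cochains_def by (rule function_module_value)
  show "koszul_d M (?zs n) (koszul_d M (?zs n) w) =
      \<zero>\<^bsub>koszul_cochains M (length ys + length xs) (p + 1 + 1)\<^esub>"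
    using w by (simp add: koszul_cochains_def fun_eq_iff koszul_d_koszul_d)
  show "koszul_d M (?zs (n + m)) (koszul_transition R M (?us m) w) =
      koszul_transition R M (?us m) (koszul_d M (?zs n) w)"
    unfolding add fun_eq_iff using w by (intro allI koszul_d_transition) simp_all
  show "koszul_transition R M (?us m) (koszul_transition R M (?us k) w) =
      koszul_transition R M (?us (k + m)) w"
    unfolding add using w by (intro koszul_transition_transition) simp_all
qed

end

context module_homomorphism begin

lemma koszul_d_comp:
  assumes "set zs \<subseteq> carrier R" "\<And>bs. w bs \<in> carrier M"
  shows "f (koszul_d M zs w bs) = koszul_d N zs (f \<circ> w) bs"
  using assms
proof (induction zs arbitrary: w bs)
  case (Cons z zs)
  have "f (koszul_d M zs (\<lambda>cs. w (b # cs)) cs) = koszul_d N zs (\<lambda>cs. f (w (b # cs))) cs" for b cs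
    using Cons.IH[of "\<lambda>cs. w (b # cs)"] Cons.prems by (simp add: comp_def)
  then show ?case using Cons.prems by (auto split: list.split)
qed simp

lemma koszul_transition_comp:
  assumes "set xs \<subseteq> carrier R" "\<And>bs. w bs \<in> carrier M"
  shows "f (koszul_transition R M xs w bs) = koszul_transition R N xs (f \<circ> w) bs"
  using assms by (simp add: koszul_transition_def)

lemma comp_hom: "(\<circ>) f \<in> mod_hom R (function_module M X) (function_module N X)"
  by (auto simp: mod_hom_def function_module_carrier fun_eq_iff function_module_value)

end

locale short_exact = i: module_homomorphism R A B i + g: module_homomorphism R B C g
  for R (structure) and A B C i g +
  assumes inj: "inj_on i (carrier A)" and surj: "g ` carrier B = carrier C"
    and exact: "i ` carrier A = {b \<in> carrier B. g b = \<zero>\<^bsub>C\<^esub>}"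
begin

lemma lift_function:
  assumes "c \<in> carrier (function_module C X)"
  obtains b where "b \<in> carrier (function_module B X)" "g \<circ> b = c"
proof -
  have "\<forall>j. \<exists>b. b \<in> carrier B \<and> (j \<notin> X \<longrightarrow> b = \<zero>\<^bsub>B\<^esub>) \<and> g b = c j"
  proof
    fix j
    have "c j \<in> g ` carrier B" using assms unfolding surj by (rule function_module_value)
    then show "\<exists>b. b \<in> carrier B \<and> (j \<notin> X \<longrightarrow> b = \<zero>\<^bsub>B\<^esub>) \<and> g b = c j"
      using function_module_outside[OF assms, of j] by (cases "j \<in> X") auto
  qed
  then obtain b
    where "\<forall>j. b j \<in> carrier B \<and> (j \<notin> X \<longrightarrow> b j = \<zero>\<^bsub>B\<^esub>) \<and> g (b j) = c j" by metis
  then show thesis using that[of b] by (auto simp: function_module_carrier fun_eq_iff)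
qed

lemma inj_function: "inj_on ((\<circ>) i) (carrier (function_module A X))"
proof (rule inj_onI)
  fix v w assume vw: "v \<in> carrier (function_module A X)" "w \<in> carrier (function_module A X)"
    and eq: "i \<circ> v = i \<circ> w"
  have "v j = w j" for j
    by (rule inj_onD[OF inj]) (use fun_cong[OF eq, of j] vw in \<open>auto intro: function_module_value\<close>)
  then show "v = w" by (rule ext)
qed

lemma surj_function: "((\<circ>) g) ` carrier (function_module B X) = carrier (function_module C X)"
proof (intro equalityI subsetI)
  fix c assume "c \<in> carrier (function_module C X)"
  then show "c \<in> ((\<circ>) g) ` carrier (function_module B X)" by (metis lift_function imageI)
qed (auto simp: function_module_carrier)

lemma kernel_function:
  assumes "b \<in> carrier (function_module B X)" "g \<circ> b = (\<lambda>_. \<zero>\<^bsub>C\<^esub>)"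
  obtains a where "a \<in> carrier (function_module A X)" "i \<circ> a = b"
proof -
  have "\<forall>j. \<exists>a. a \<in> carrier A \<and> (j \<notin> X \<longrightarrow> a = \<zero>\<^bsub>A\<^esub>) \<and> i a = b j"
  proof
    fix j
    have "b j \<in> i ` carrier A"
      unfolding exact using assms function_module_value by (simp add: fun_eq_iff)
    then show "\<exists>a. a \<in> carrier A \<and> (j \<notin> X \<longrightarrow> a = \<zero>\<^bsub>A\<^esub>) \<and> i a = b j"
      using function_module_outside[OF assms(1), of j] by (cases "j \<in> X") auto
  qed
  then obtain a
    where "\<forall>j. a j \<in> carrier A \<and> (j \<notin> X \<longrightarrow> a j = \<zero>\<^bsub>A\<^esub>) \<and> i (a j) = b j" by metis
  then show thesis using that[of a] by (auto simp: function_module_carrier fun_eq_iff)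
qed

lemma exact_function:
  "((\<circ>) i) ` carrier (function_module A X) =
    {b \<in> carrier (function_module B X). g \<circ> b = \<zero>\<^bsub>function_module C X\<^esub>}"
proof (intro equalityI subsetI)
  fix b assume "b \<in> ((\<circ>) i) ` carrier (function_module A X)"
  then obtain a where a: "a \<in> carrier (function_module A X)" "b = i \<circ> a" by blast
  then have "g (i (a j)) = \<zero>\<^bsub>C\<^esub>" for j
    using exact function_module_value[OF a(1), of j] by blast
  then show "b \<in> {b \<in> carrier (function_module B X). g \<circ> b = \<zero>\<^bsub>function_module C X\<^esub>}"
    using a by (auto simp: function_module_carrier fun_eq_iff)
next
  fix b assume "b \<in> {b \<in> carrier (function_module B X). g \<circ> b = \<zero>\<^bsub>function_module C X\<^esub>}"
  then obtain a where "a \<in> carrier (function_module A X)" "i \<circ> a = b"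
    using kernel_function[of b X] by auto
  then show "b \<in> ((\<circ>) i) ` carrier (function_module A X)" by blast
qed

lemma short_exact_koszul_systems:
  assumes ys: "set ys \<subseteq> carrier R"
  shows "short_exact_systems R
    (koszul_cochains A (length ys)) (\<lambda>n. koszul_d A (powers R n ys))
    (\<lambda>m. koszul_transition R A (powers R m ys))
    (koszul_cochains B (length ys)) (\<lambda>n. koszul_d B (powers R n ys))
    (\<lambda>m. koszul_transition R B (powers R m ys))
    (koszul_cochains C (length ys)) (\<lambda>n. koszul_d C (powers R n ys))
    (\<lambda>m. koszul_transition R C (powers R m ys))
    ((\<circ>) i) ((\<circ>) g)"
proof (intro short_exact_systems.intro short_exact_systems_axioms.intro)
  note system = module.koszul_system[OF _ ys, of _ "[]", simplified]
  show "complex_system R (koszul_cochains A (length ys)) (\<lambda>n. koszul_d A (powers R n ys))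
      (\<lambda>m. koszul_transition R A (powers R m ys))"
    by (rule system[OF i.M.module_axioms])
  show "complex_system R (koszul_cochains B (length ys)) (\<lambda>n. koszul_d B (powers R n ys))
      (\<lambda>m. koszul_transition R B (powers R m ys))"
    by (rule system[OF i.N.module_axioms])
  show "complex_system R (koszul_cochains C (length ys)) (\<lambda>n. koszul_d C (powers R n ys))
      (\<lambda>m. koszul_transition R C (powers R m ys))"
    by (rule system[OF g.N.module_axioms])
next
  fix p
  show "(\<circ>) i \<in> mod_hom R (koszul_cochains A (length ys) p) (koszul_cochains B (length ys) p)"
    "(\<circ>) g \<in> mod_hom R (koszul_cochains B (length ys) p) (koszul_cochains C (length ys) p)"
    unfolding koszul_cochains_def by (rule i.comp_hom g.comp_hom)+
  show "inj_on ((\<circ>) i) (carrier (koszul_cochains A (length ys) p))"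
    unfolding koszul_cochains_def by (rule inj_function)
  show "((\<circ>) g) ` carrier (koszul_cochains B (length ys) p) =
      carrier (koszul_cochains C (length ys) p)"
    unfolding koszul_cochains_def by (rule surj_function)
  show "((\<circ>) i) ` carrier (koszul_cochains A (length ys) p) =
      {b \<in> carrier (koszul_cochains B (length ys) p). g \<circ> b = \<zero>\<^bsub>koszul_cochains C (length ys) p\<^esub>}"
    unfolding koszul_cochains_def by (rule exact_function)
next
  fix p n m a assume "a \<in> carrier (koszul_cochains A (length ys) p)"
  then have "a bs \<in> carrier A" for bs unfolding koszul_cochains_def by (rule function_module_value)
  then show "i \<circ> koszul_d A (powers R n ys) a = koszul_d B (powers R n ys) (i \<circ> a)"
    "i \<circ> koszul_transition R A (powers R m ys) a = koszul_transition R B (powers R m ys) (i \<circ> a)"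
    using ys by (simp_all add: fun_eq_iff i.koszul_d_comp i.koszul_transition_comp)
next
  fix p n m b assume "b \<in> carrier (koszul_cochains B (length ys) p)"
  then have "b bs \<in> carrier B" for bs unfolding koszul_cochains_def by (rule function_module_value)
  then show "g \<circ> koszul_d B (powers R n ys) b = koszul_d C (powers R n ys) (g \<circ> b)"
    "g \<circ> koszul_transition R B (powers R m ys) b = koszul_transition R C (powers R m ys) (g \<circ> b)"
    using ys by (simp_all add: fun_eq_iff g.koszul_d_comp g.koszul_transition_comp)
qed

end

text \<open>The degree \<open>p\<close> cohomology of the colimit over \<open>n\<close> of the Koszul complexes of \<open>ys\<^sup>n\<close> vanishes.\<close>

definition koszul_vanishes ::
  "('r, 'x) ring_scheme \<Rightarrow> 'r list \<Rightarrow> ('r, 'm, 'y) module_scheme \<Rightarrow> int \<Rightarrow> bool"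
  where "koszul_vanishes R ys M = complex_system.acyclic (koszul_cochains M (length ys))
    (\<lambda>n. koszul_d M (powers R n ys)) (\<lambda>m. koszul_transition R M (powers R m ys))"

locale koszul = module R M
  for R :: "('r, 'x) ring_scheme" (structure) and M :: "('r, 'm, 'y) module_scheme" +
  fixes ys :: "'r list"
  assumes ys: "set ys \<subseteq> carrier R"
begin

sublocale complex_system R "koszul_cochains M (length ys)" "\<lambda>n. koszul_d M (powers R n ys)"
  "\<lambda>m. koszul_transition R M (powers R m ys)"
  using koszul_system[OF ys, of "[]"] by simp

lemma cochain_value: "w \<in> carrier (koszul_cochains M (length ys) p) \<Longrightarrow> w bs \<in> carrier M"
  unfolding koszul_cochains_def by (rule function_module_value)

lemma cochain_outside:
  "w \<in> carrier (koszul_cochains M (length ys) p) \<Longrightarrow> length bs \<noteq> length ys \<or> int (weight bs) \<noteq> p \<Longrightarrow>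
    w bs = \<zero>\<^bsub>M\<^esub>"
  unfolding koszul_cochains_def by (auto elim: function_module_outside)

lemma cochain_zero [simp]: "\<zero>\<^bsub>koszul_cochains M t p\<^esub> = (\<lambda>_. \<zero>\<^bsub>M\<^esub>)"
  by (simp add: koszul_cochains_def)

lemma cocycles_iff:
  "w \<in> cocycles p n \<longleftrightarrow>
    w \<in> carrier (koszul_cochains M (length ys) p) \<and> (\<forall>bs. koszul_d M (powers R n ys) w bs = \<zero>\<^bsub>M\<^esub>)"
  by (simp add: cocycles_def fun_eq_iff)

end

lemma koszul_cochains_carrier:
  "w \<in> carrier (koszul_cochains M t p) \<longleftrightarrow> (\<forall>bs. w bs \<in> carrier M) \<and>
    (\<forall>bs. length bs \<noteq> t \<or> int (weight bs) \<noteq> p \<longrightarrow> w bs = \<zero>\<^bsub>M\<^esub>)"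
  by (auto simp: koszul_cochains_def function_module_carrier)

context module begin

lemma koszulI: "set ys \<subseteq> carrier R \<Longrightarrow> koszul R M ys"
  by unfold_locales

lemma koszul_vanishes_out_of_range:
  assumes ys: "set ys \<subseteq> carrier R" and "p < 0 \<or> int (length ys) < p"
  shows "koszul_vanishes R ys M p"
proof -
  interpret koszul R M ys by (rule koszulI[OF ys])
  show ?thesis
    unfolding koszul_vanishes_def
  proof (rule acyclicI)
    fix n w assume "w \<in> cocycles p n"
    moreover have "int (weight bs) \<noteq> p" if "length bs = length ys" for bs
      using that assms(2) count_le_length[of bs True] by auto
    ultimately have "w = (\<lambda>_. \<zero>\<^bsub>M\<^esub>)"
      by (auto simp: cocycles_iff koszul_cochains_carrier fun_eq_iff)
    then show "null p n w" using null_zero[of p n] by simp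
  qed
qed

end

subsection \<open>Degree zero\<close>

definition power_torsion :: "('r, 'x) ring_scheme \<Rightarrow> ('r, 'm, 'y) module_scheme \<Rightarrow> 'r set \<Rightarrow> 'm set"
  where "power_torsion R M Y =
    {x \<in> carrier M. \<exists>n::nat. \<forall>y\<in>Y. (y [^]\<^bsub>R\<^esub> n) \<odot>\<^bsub>M\<^esub> x = \<zero>\<^bsub>M\<^esub>}"

definition degree_zero_cochain :: "('r, 'm, 'y) module_scheme \<Rightarrow> nat \<Rightarrow> 'm \<Rightarrow> bool list \<Rightarrow> 'm"
  where "degree_zero_cochain M t x bs = (if bs = replicate t False then x else \<zero>\<^bsub>M\<^esub>)"

lemma weight_eq_0: "weight bs = 0 \<longleftrightarrow> bs = replicate (length bs) False"
  by (induction bs) auto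

lemma degree_zero_cochain_Cons [simp]:
  "degree_zero_cochain M (Suc t) x (b # cs) = (if b then \<zero>\<^bsub>M\<^esub> else degree_zero_cochain M t x cs)"
  by (simp add: degree_zero_cochain_def)

lemma degree_zero_cochain_eq_zero_iff [simp]:
  "degree_zero_cochain M t x = (\<lambda>_. \<zero>\<^bsub>M\<^esub>) \<longleftrightarrow> x = \<zero>\<^bsub>M\<^esub>"
  by (auto simp: degree_zero_cochain_def fun_eq_iff)

lemma degree_zero_cochain_eq_iff: "degree_zero_cochain M t x = degree_zero_cochain M t y \<longleftrightarrow> x = y"
  by (auto simp: degree_zero_cochain_def fun_eq_iff)

lemma (in module_homomorphism) degree_zero_cochain_comp:
  "f \<circ> degree_zero_cochain M t x = degree_zero_cochain N t (f x)"
  by (auto simp: degree_zero_cochain_def fun_eq_iff)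

lemma (in module) koszul_d_degree_zero:
  assumes "set zs \<subseteq> carrier R" "x \<in> carrier M"
  shows "(\<forall>bs. koszul_d M zs (degree_zero_cochain M (length zs) x) bs = \<zero>\<^bsub>M\<^esub>) \<longleftrightarrow>
    (\<forall>z\<in>set zs. z \<odot>\<^bsub>M\<^esub> x = \<zero>\<^bsub>M\<^esub>)"
  using assms(1)
proof (induction zs)
  case (Cons z zs)
  let ?c = "degree_zero_cochain M (length zs) x"
  have c: "?c cs \<in> carrier M" for cs using assms(2) by (simp add: degree_zero_cochain_def)
  have "(\<forall>bs. koszul_d M (z # zs) (degree_zero_cochain M (length (z # zs)) x) bs = \<zero>\<^bsub>M\<^esub>) \<longleftrightarrow>
    (\<forall>b cs. koszul_d M (z # zs) (degree_zero_cochain M (length (z # zs)) x) (b # cs) = \<zero>\<^bsub>M\<^esub>)"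
    (is "(\<forall>bs. ?d bs = _) \<longleftrightarrow> _")
  proof (intro iffI allI)
    fix bs assume "\<forall>b cs. ?d (b # cs) = \<zero>\<^bsub>M\<^esub>"
    then show "?d bs = \<zero>\<^bsub>M\<^esub>" by (cases bs) simp_all
  qed blast
  also have "\<dots> \<longleftrightarrow> (\<forall>cs. z \<odot>\<^bsub>M\<^esub> ?c cs = \<zero>\<^bsub>M\<^esub>) \<and> (\<forall>cs. koszul_d M zs ?c cs = \<zero>\<^bsub>M\<^esub>)"
    using Cons.prems c by (auto simp: all_bool_eq)
  also have "(\<forall>cs. z \<odot>\<^bsub>M\<^esub> ?c cs = \<zero>\<^bsub>M\<^esub>) \<longleftrightarrow> z \<odot>\<^bsub>M\<^esub> x = \<zero>\<^bsub>M\<^esub>"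
    using Cons.prems by (auto simp: degree_zero_cochain_def)
  finally show ?case using Cons by simp
qed simp

lemma (in module) koszul_prod_replicate_False [simp]:
  "set zs \<subseteq> carrier R \<Longrightarrow> koszul_prod R zs (replicate (length zs) False) = \<one>"
  by (induction zs) auto

context koszul begin

lemma degree_zero_closed:
  "x \<in> carrier M \<Longrightarrow> degree_zero_cochain M (length ys) x \<in> carrier (koszul_cochains M (length ys) 0)"
  by (auto simp: koszul_cochains_carrier degree_zero_cochain_def)

lemma degree_zero_cases:
  assumes "w \<in> carrier (koszul_cochains M (length ys) 0)"
  obtains x where "x \<in> carrier M" "w = degree_zero_cochain M (length ys) x"
proof (rule that)
  let ?F = "replicate (length ys) False"
  show "w ?F \<in> carrier M" using assms by (rule cochain_value)
  show "w = degree_zero_cochain M (length ys) (w ?F)"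
    using assms weight_eq_0
    by (auto simp: degree_zero_cochain_def koszul_cochains_carrier fun_eq_iff)
qed

lemma cocycles_0:
  "cocycles 0 n =
    degree_zero_cochain M (length ys) ` {x \<in> carrier M. \<forall>y\<in>set ys. (y [^] n) \<odot>\<^bsub>M\<^esub> x = \<zero>\<^bsub>M\<^esub>}"
    (is "_ = ?D ` ?X")
proof (intro equalityI subsetI)
  have cocycle_iff: "?D x \<in> cocycles 0 n \<longleftrightarrow> x \<in> ?X" if "x \<in> carrier M" for x
    using that koszul_d_degree_zero[OF R.powers_closed[OF ys] that, of n]
      degree_zero_closed[OF that]
    by (simp add: cocycles_iff set_powers)
  fix w
  show "w \<in> ?D ` ?X" if w: "w \<in> cocycles 0 n"
  proof -
    obtain x where "x \<in> carrier M" "w = ?D x"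
      using degree_zero_cases[OF cocycles_closed[OF w]] .
    then show ?thesis using w cocycle_iff by blast
  qed
  show "w \<in> cocycles 0 n" if "w \<in> ?D ` ?X" using that cocycle_iff by auto
qed

lemma transition_degree_zero:
  assumes "w \<in> carrier (koszul_cochains M (length ys) 0)"
  shows "koszul_transition R M (powers R m ys) w = w"
proof -
  obtain x where x: "x \<in> carrier M" "w = degree_zero_cochain M (length ys) x"
    using assms by (rule degree_zero_cases)
  have "koszul_prod R (powers R m ys) (replicate (length ys) False) = \<one>"
    using koszul_prod_replicate_False[OF R.powers_closed[OF ys], of m] by simp
  then show ?thesis
    using x ys by (auto simp: koszul_transition_def degree_zero_cochain_def fun_eq_iff)
qed

lemma null_0_iff:
  assumes "w \<in> carrier (koszul_cochains M (length ys) 0)"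
  shows "null 0 n w \<longleftrightarrow> w = (\<lambda>_. \<zero>\<^bsub>M\<^esub>)"
proof
  assume "null 0 n w"
  then obtain m v where "v \<in> carrier (koszul_cochains M (length ys) (-1))"
    "w = koszul_d M (powers R (n + m) ys) v"
    unfolding null_def transition_degree_zero[OF assms] by auto
  moreover from this have "v = (\<lambda>_. \<zero>\<^bsub>M\<^esub>)" by (auto simp: koszul_cochains_carrier fun_eq_iff)
  ultimately show "w = (\<lambda>_. \<zero>\<^bsub>M\<^esub>)" using ys by (simp add: fun_eq_iff)
qed (use null_zero[of 0 n] in simp)

theorem koszul_vanishes_0_iff: "koszul_vanishes R ys M 0 \<longleftrightarrow> power_torsion R M (set ys) \<subseteq> {\<zero>\<^bsub>M\<^esub>}"
proof -
  have "koszul_vanishes R ys M 0 \<longleftrightarrow> (\<forall>n. \<forall>w\<in>cocycles 0 n. w = (\<lambda>_. \<zero>\<^bsub>M\<^esub>))"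
    unfolding koszul_vanishes_def acyclic_def using null_0_iff cocycles_closed by blast
  also have "\<dots> \<longleftrightarrow> power_torsion R M (set ys) \<subseteq> {\<zero>\<^bsub>M\<^esub>}"
    by (auto simp: cocycles_0 power_torsion_def)
  finally show ?thesis .
qed

end

lemma (in module_homomorphism) power_torsion_hom:
  assumes "Y \<subseteq> carrier R" "x \<in> power_torsion R M Y"
  shows "f x \<in> power_torsion R N Y"
proof -
  obtain n :: nat where n: "x \<in> carrier M" "\<forall>y\<in>Y. (y [^] n) \<odot>\<^bsub>M\<^esub> x = \<zero>\<^bsub>M\<^esub>"
    using assms(2) by (auto simp: power_torsion_def)
  then have "(y [^] n) \<odot>\<^bsub>N\<^esub> f x = \<zero>\<^bsub>N\<^esub>" if "y \<in> Y" for y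
    using that assms(1) smult[of "y [^] n" x] by (simp add: subset_iff del: smult)
  then show ?thesis using n(1) by (auto simp: power_torsion_def)
qed

context module begin

lemma power_torsion_subset: "power_torsion R M Y \<subseteq> carrier M"
  by (auto simp: power_torsion_def)

lemma power_torsion_empty [simp]: "power_torsion R M {} = carrier M"
  by (simp add: power_torsion_def)

lemma power_torsion_antimono: "Y \<subseteq> Z \<Longrightarrow> power_torsion R M Z \<subseteq> power_torsion R M Y"
  unfolding power_torsion_def by blast

lemma power_torsion_submodule:
  assumes "Y \<subseteq> carrier R"
  shows "submodule (power_torsion R M Y) R M"
proof (rule submodule_closedI)
  note [simp] = subsetD[OF assms]
  show "\<zero>\<^bsub>M\<^esub> \<in> power_torsion R M Y" by (simp add: power_torsion_def)
  fix x z assume "x \<in> power_torsion R M Y" "z \<in> power_torsion R M Y"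
  then obtain n m :: nat where x: "x \<in> carrier M" "\<forall>y\<in>Y. (y [^] n) \<odot>\<^bsub>M\<^esub> x = \<zero>\<^bsub>M\<^esub>"
    and z: "z \<in> carrier M" "\<forall>y\<in>Y. (y [^] m) \<odot>\<^bsub>M\<^esub> z = \<zero>\<^bsub>M\<^esub>"
    by (auto simp: power_torsion_def)
  have "(y [^] (n + m)) \<odot>\<^bsub>M\<^esub> (x \<oplus>\<^bsub>M\<^esub> z) = \<zero>\<^bsub>M\<^esub>" if y: "y \<in> Y" for y
    using smult_power_mono_zero[of y x n "n + m"] smult_power_mono_zero[of y z m "n + m"] x z y
    by (simp add: smult_r_distr)
  then show "x \<oplus>\<^bsub>M\<^esub> z \<in> power_torsion R M Y" using x z by (auto simp: power_torsion_def)
next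
  fix r x assume r: "r \<in> carrier R" and "x \<in> power_torsion R M Y"
  then obtain n :: nat where x: "x \<in> carrier M" "\<forall>y\<in>Y. (y [^] n) \<odot>\<^bsub>M\<^esub> x = \<zero>\<^bsub>M\<^esub>"
    by (auto simp: power_torsion_def)
  then have "(y [^] n) \<odot>\<^bsub>M\<^esub> (r \<odot>\<^bsub>M\<^esub> x) = \<zero>\<^bsub>M\<^esub>" if "y \<in> Y" for y
    using that assms r smult_left_commute[of "y [^] n" r x] by (simp add: subsetD)
  then show "r \<odot>\<^bsub>M\<^esub> x \<in> power_torsion R M Y" using r x(1) by (auto simp: power_torsion_def)
qed (rule power_torsion_subset)

lemma power_torsion_insert:
  assumes "insert y Y \<subseteq> carrier R" "x \<in> power_torsion R M Y"
    and "(y [^] (k::nat)) \<odot>\<^bsub>M\<^esub> x \<in> power_torsion R M {y}"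
  shows "x \<in> power_torsion R M (insert y Y)"
proof -
  obtain n :: nat where n: "x \<in> carrier M" "\<forall>z\<in>Y. (z [^] n) \<odot>\<^bsub>M\<^esub> x = \<zero>\<^bsub>M\<^esub>"
    using assms(2) by (auto simp: power_torsion_def)
  obtain m :: nat where m: "(y [^] m) \<odot>\<^bsub>M\<^esub> ((y [^] k) \<odot>\<^bsub>M\<^esub> x) = \<zero>\<^bsub>M\<^esub>"
    using assms(3) by (auto simp: power_torsion_def)
  then have "(y [^] (m + k)) \<odot>\<^bsub>M\<^esub> x = \<zero>\<^bsub>M\<^esub>"
    using n(1) assms(1) by (simp add: smult_assoc1 flip: R.nat_pow_mult)
  then have "\<forall>z\<in>insert y Y. (z [^] (n + (m + k))) \<odot>\<^bsub>M\<^esub> x = \<zero>\<^bsub>M\<^esub>"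
    using n assms(1) by (auto intro: smult_power_mono_zero)
  then show ?thesis using n(1) by (auto simp: power_torsion_def)
qed

lemma ideals_set_simps:
  "\<one>\<^bsub>ideals_set R\<^esub> = carrier R" "I \<otimes>\<^bsub>ideals_set R\<^esub> J = ideal_prod R I J"
  by (simp_all add: ideals_set_def)

lemma ideal_ideals_set_pow: "ideal I R \<Longrightarrow> ideal (I [^]\<^bsub>ideals_set R\<^esub> (n::nat)) R"
  by (induction n) (auto simp: ideals_set_simps R.oneideal R.ideal_prod_is_ideal)

lemma pow_mem_ideals_set_pow:
  "ideal I R \<Longrightarrow> y \<in> I \<Longrightarrow> y [^] n \<in> I [^]\<^bsub>ideals_set R\<^esub> (n::nat)"
  by (induction n) (auto simp: ideals_set_simps intro: ideal_prod.prod)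

lemma ideal_annihilating:
  assumes "P \<subseteq> carrier R" "x \<in> carrier M"
  shows "ideal {r \<in> carrier R. \<forall>s\<in>P. s \<odot>\<^bsub>M\<^esub> (r \<odot>\<^bsub>M\<^esub> x) = \<zero>\<^bsub>M\<^esub>} R"
proof (rule R.ideal_closedI)
  fix a r assume a: "a \<in> {r \<in> carrier R. \<forall>s\<in>P. s \<odot>\<^bsub>M\<^esub> (r \<odot>\<^bsub>M\<^esub> x) = \<zero>\<^bsub>M\<^esub>}" and r: "r \<in> carrier R"
  have "s \<odot>\<^bsub>M\<^esub> ((r \<otimes> a) \<odot>\<^bsub>M\<^esub> x) = r \<odot>\<^bsub>M\<^esub> (s \<odot>\<^bsub>M\<^esub> (a \<odot>\<^bsub>M\<^esub> x))" if "s \<in> P" for s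
    using that assms a r by (auto simp: smult_assoc1 smult_left_commute[of s r])
  then show "r \<otimes> a \<in> {r \<in> carrier R. \<forall>s\<in>P. s \<odot>\<^bsub>M\<^esub> (r \<odot>\<^bsub>M\<^esub> x) = \<zero>\<^bsub>M\<^esub>}" using a r by simp
qed (use assms in \<open>auto simp: smult_l_distr smult_r_distr\<close>)

lemma ideals_set_pow_Suc_annihilates:
  assumes Y: "Y \<subseteq> carrier R" and x: "x \<in> carrier M"
    and "\<And>y s. y \<in> Y \<Longrightarrow> s \<in> (Idl Y) [^]\<^bsub>ideals_set R\<^esub> n \<Longrightarrow> s \<odot>\<^bsub>M\<^esub> (y \<odot>\<^bsub>M\<^esub> x) = \<zero>\<^bsub>M\<^esub>"
    and r: "r \<in> (Idl Y) [^]\<^bsub>ideals_set R\<^esub> Suc n"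
  shows "r \<odot>\<^bsub>M\<^esub> x = \<zero>\<^bsub>M\<^esub>"
proof -
  let ?P = "(Idl Y) [^]\<^bsub>ideals_set R\<^esub> n"
  have I: "ideal (Idl Y) R" by (rule R.genideal_ideal[OF Y])
  have P: "ideal ?P R" by (rule ideal_ideals_set_pow[OF I])
  have Pc: "?P \<subseteq> carrier R" using ideal.Icarr[OF P] by blast
  have "Idl Y \<subseteq> {r \<in> carrier R. \<forall>s\<in>?P. s \<odot>\<^bsub>M\<^esub> (r \<odot>\<^bsub>M\<^esub> x) = \<zero>\<^bsub>M\<^esub>}"
    by (rule R.genideal_minimal[OF ideal_annihilating[OF Pc x]]) (use assms(3) Y in auto)
  then have products: "(s \<otimes> a) \<odot>\<^bsub>M\<^esub> x = \<zero>\<^bsub>M\<^esub>" if "s \<in> ?P" "a \<in> Idl Y" for s a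
    using that x subsetD[OF Pc that(1)] ideal.Icarr[OF I that(2)] by (auto simp: smult_assoc1)
  have "r \<in> ideal_prod R ?P (Idl Y)" using r by (simp add: ideals_set_simps)
  then show ?thesis
  proof (induction rule: ideal_prod.induct)
    case (prod s a)
    then show ?case by (rule products)
  next
    case (sum r s)
    then have "r \<in> carrier R" "s \<in> carrier R" using R.ideal_prod_in_carrier[OF P I] by auto
    then show ?case using sum x by (simp add: smult_l_distr)
  qed
qed

lemma ideals_set_pow_annihilates:
  assumes Y: "Y \<subseteq> carrier R" "finite Y" and "x \<in> carrier M"
    and "\<And>y. y \<in> Y \<Longrightarrow> (y [^] (e y :: nat)) \<odot>\<^bsub>M\<^esub> x = \<zero>\<^bsub>M\<^esub>"
    and "r \<in> (Idl Y) [^]\<^bsub>ideals_set R\<^esub> Suc (\<Sum>y\<in>Y. e y)"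
  shows "r \<odot>\<^bsub>M\<^esub> x = \<zero>\<^bsub>M\<^esub>"
  using assms(3-5)
proof (induction "\<Sum>y\<in>Y. e y" arbitrary: x e r)
  case (0 e x r)
  then have "y \<odot>\<^bsub>M\<^esub> x = \<zero>\<^bsub>M\<^esub>" if "y \<in> Y" for y using that Y by fastforce
  then show ?case
    using 0 ideals_set_pow_Suc_annihilates[OF Y(1), of x 0 r] by (auto simp: ideals_set_simps)
next
  case (Suc N e x r)
  have "s \<odot>\<^bsub>M\<^esub> (y \<odot>\<^bsub>M\<^esub> x) = \<zero>\<^bsub>M\<^esub>"
    if y: "y \<in> Y" and s: "s \<in> (Idl Y) [^]\<^bsub>ideals_set R\<^esub> (\<Sum>y\<in>Y. e y)" for y s
  proof (cases "e y")
    case 0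
    have "s \<in> carrier R"
      using ideal.Icarr[OF ideal_ideals_set_pow[OF R.genideal_ideal[OF Y(1)]] s] .
    then show ?thesis using Suc.prems(1) Suc.prems(2)[OF y] 0 y Y(1) by auto
  next
    case e: (Suc k)
    have sum: "(\<Sum>z\<in>Y. e z) = Suc (\<Sum>z\<in>Y. (e(y := k)) z)" using e y Y(2) by (simp add: sum.remove)
    have "(z [^] (e(y := k)) z) \<odot>\<^bsub>M\<^esub> (y \<odot>\<^bsub>M\<^esub> x) = \<zero>\<^bsub>M\<^esub>" if z: "z \<in> Y" for z
    proof (cases "z = y")
      case True
      then show ?thesis using Suc.prems(1) Suc.prems(2)[OF y] e y Y(1) by (auto simp: smult_assoc1)
    next
      case False
      then show ?thesis using Suc.prems(1) Suc.prems(2)[OF z] z y Y(1)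
        by (simp add: subsetD smult_left_commute[of _ y])
    qed
    then show ?thesis
      using Suc.hyps(1)[of "e(y := k)" "y \<odot>\<^bsub>M\<^esub> x" s] Suc.hyps(2) sum s Suc.prems(1) y Y(1) by auto
  qed
  then show ?case using ideals_set_pow_Suc_annihilates[OF Y(1) Suc.prems(1) _ Suc.prems(3)] by blast
qed

theorem torsion_part_eq_power_torsion:
  assumes Y: "Y \<subseteq> carrier R" "finite Y"
  shows "torsion_part R (Idl Y) M = power_torsion R M Y"
proof (intro equalityI subsetI)
  fix x assume "x \<in> torsion_part R (Idl Y) M"
  then obtain n :: nat
    where x: "x \<in> carrier M" "\<forall>r \<in> (Idl Y) [^]\<^bsub>ideals_set R\<^esub> n. r \<odot>\<^bsub>M\<^esub> x = \<zero>\<^bsub>M\<^esub>"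
    by (auto simp: torsion_part_def)
  have "y [^] n \<in> (Idl Y) [^]\<^bsub>ideals_set R\<^esub> n" if "y \<in> Y" for y
    using that R.genideal_self[OF Y(1)] by (intro pow_mem_ideals_set_pow R.genideal_ideal Y) auto
  then show "x \<in> power_torsion R M Y" using x by (auto simp: power_torsion_def)
next
  fix x assume "x \<in> power_torsion R M Y"
  then obtain n :: nat where x: "x \<in> carrier M" "\<forall>y\<in>Y. (y [^] n) \<odot>\<^bsub>M\<^esub> x = \<zero>\<^bsub>M\<^esub>"
    by (auto simp: power_torsion_def)
  then have "\<forall>r\<in>(Idl Y) [^]\<^bsub>ideals_set R\<^esub> Suc (\<Sum>y\<in>Y. n). r \<odot>\<^bsub>M\<^esub> x = \<zero>\<^bsub>M\<^esub>"
    using ideals_set_pow_annihilates[OF Y x(1), of "\<lambda>_. n"] by blast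
  then show "x \<in> torsion_part R (Idl Y) M" using x(1) unfolding torsion_part_def by blast
qed

end

lemma (in module_homomorphism) power_torsion_subset_image_iff:
  assumes Y: "Y \<subseteq> carrier R"
  shows "power_torsion R N Y \<subseteq> f ` power_torsion R M Y \<longleftrightarrow>
    (\<forall>n. \<forall>z\<in>carrier N. (\<forall>y\<in>Y. (y [^] (n::nat)) \<odot>\<^bsub>N\<^esub> z = \<zero>\<^bsub>N\<^esub>) \<longrightarrow>
      (\<exists>m. \<exists>x\<in>carrier M. (\<forall>y\<in>Y. (y [^] (n + m)) \<odot>\<^bsub>M\<^esub> x = \<zero>\<^bsub>M\<^esub>) \<and> f x = z))" (is "_ \<longleftrightarrow> ?lift")
proof
  assume image: "power_torsion R N Y \<subseteq> f ` power_torsion R M Y"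
  show ?lift
  proof (intro allI ballI impI)
    fix n :: nat and z assume "z \<in> carrier N" "\<forall>y\<in>Y. (y [^] n) \<odot>\<^bsub>N\<^esub> z = \<zero>\<^bsub>N\<^esub>"
    then have "z \<in> power_torsion R N Y" by (auto simp: power_torsion_def)
    then obtain x where "x \<in> power_torsion R M Y" and z: "z = f x" using image by blast
    then obtain m :: nat where x: "x \<in> carrier M" "\<forall>y\<in>Y. (y [^] m) \<odot>\<^bsub>M\<^esub> x = \<zero>\<^bsub>M\<^esub>"
      by (auto simp: power_torsion_def)
    then have "(y [^] (n + m)) \<odot>\<^bsub>M\<^esub> x = \<zero>\<^bsub>M\<^esub>" if "y \<in> Y" for y
      using M.smult_power_mono_zero[of y x m "n + m"] that Y by auto
    then show "\<exists>m. \<exists>x\<in>carrier M. (\<forall>y\<in>Y. (y [^] (n + m)) \<odot>\<^bsub>M\<^esub> x = \<zero>\<^bsub>M\<^esub>) \<and> f x = z"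
      using x(1) z by blast
  qed
next
  assume lift: ?lift
  show "power_torsion R N Y \<subseteq> f ` power_torsion R M Y"
  proof
    fix z assume "z \<in> power_torsion R N Y"
    then obtain m x where "x \<in> carrier M" "\<forall>y\<in>Y. (y [^] (m::nat)) \<odot>\<^bsub>M\<^esub> x = \<zero>\<^bsub>M\<^esub>" "f x = z"
      using lift unfolding power_torsion_def by blast
    then show "z \<in> f ` power_torsion R M Y" unfolding power_torsion_def by blast
  qed
qed

subsection \<open>Dimension shifting\<close>

context short_exact begin

lemma koszul_vanishes_middle:
  assumes "set ys \<subseteq> carrier R" "koszul_vanishes R ys A p" "koszul_vanishes R ys C p"
  shows "koszul_vanishes R ys B p"
  using assms short_exact_systems.acyclic_middle[OF short_exact_koszul_systems]
  unfolding koszul_vanishes_def by blast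

theorem koszul_vanishes_dimension_shift:
  assumes "set ys \<subseteq> carrier R" "koszul_vanishes R ys B p" "koszul_vanishes R ys B (p + 1)"
  shows "koszul_vanishes R ys A (p + 1) \<longleftrightarrow> koszul_vanishes R ys C p"
proof -
  interpret short_exact_systems R
    "koszul_cochains A (length ys)" "\<lambda>n. koszul_d A (powers R n ys)"
    "\<lambda>m. koszul_transition R A (powers R m ys)"
    "koszul_cochains B (length ys)" "\<lambda>n. koszul_d B (powers R n ys)"
    "\<lambda>m. koszul_transition R B (powers R m ys)"
    "koszul_cochains C (length ys)" "\<lambda>n. koszul_d C (powers R n ys)"
    "\<lambda>m. koszul_transition R C (powers R m ys)"
    "(\<circ>) i" "(\<circ>) g"
    by (rule short_exact_koszul_systems[OF assms(1)])
  show ?thesis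
    using assms(2,3) acyclic_left_imp_surjective surjective_imp_acyclic_left
      acyclic_right_imp_surjective surjective_imp_acyclic_right
    unfolding koszul_vanishes_def by blast
qed

theorem koszul_vanishes_degree_one:
  assumes ys: "set ys \<subseteq> carrier R" and "koszul_vanishes R ys B 1"
  shows "koszul_vanishes R ys A 1 \<longleftrightarrow> power_torsion R C (set ys) \<subseteq> g ` power_torsion R B (set ys)"
proof -
  note degree_zero_comp = g.degree_zero_cochain_comp
    and image_iff = g.power_torsion_subset_image_iff[OF ys]
  interpret short_exact_systems R
    "koszul_cochains A (length ys)" "\<lambda>n. koszul_d A (powers R n ys)"
    "\<lambda>m. koszul_transition R A (powers R m ys)"
    "koszul_cochains B (length ys)" "\<lambda>n. koszul_d B (powers R n ys)"
    "\<lambda>m. koszul_transition R B (powers R m ys)"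
    "koszul_cochains C (length ys)" "\<lambda>n. koszul_d C (powers R n ys)"
    "\<lambda>m. koszul_transition R C (powers R m ys)"
    "(\<circ>) i" "(\<circ>) g"
    by (rule short_exact_koszul_systems[OF ys])
  interpret B: koszul R B ys by (rule i.N.koszulI[OF ys])
  interpret C: koszul R C ys by (rule g.N.koszulI[OF ys])
  let ?t = "length ys"
  have "koszul_vanishes R ys A 1 \<longleftrightarrow> cohomology_surjective 0"
    using acyclic_left_imp_surjective[of 0] surjective_imp_acyclic_left[of 0] assms(2)
    unfolding koszul_vanishes_def by auto
  also have "\<dots> \<longleftrightarrow> (\<forall>n. \<forall>c\<in>C.cocycles 0 n. \<exists>m. \<exists>b\<in>B.cocycles 0 (n + m). c = g \<circ> b)"
  proof -
    have "C.null 0 (n + m) (koszul_transition R C (powers R m ys) c \<ominus>\<^bsub>koszul_cochains C ?t 0\<^esub> (g \<circ> b))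
        \<longleftrightarrow> c = g \<circ> b" if "c \<in> C.cocycles 0 n" "b \<in> B.cocycles 0 (n + m)" for n m b c
    proof -
      have "c \<in> carrier (koszul_cochains C ?t 0)" "g \<circ> b \<in> carrier (koszul_cochains C ?t 0)"
        using that C.cocycles_closed B.cocycles_closed g.closed by blast+
      then show ?thesis
        using C.null_0_iff C.transition_degree_zero C.K.diff_eq_zero_iff[of c 0 "g \<circ> b"] by simp
    qed
    then show ?thesis unfolding cohomology_surjective_def by meson
  qed
  also have "\<dots> \<longleftrightarrow> (\<forall>n. \<forall>z\<in>carrier C. (\<forall>y\<in>set ys. (y [^] (n::nat)) \<odot>\<^bsub>C\<^esub> z = \<zero>\<^bsub>C\<^esub>) \<longrightarrow>
      (\<exists>m. \<exists>x\<in>carrier B. (\<forall>y\<in>set ys. (y [^] (n + m)) \<odot>\<^bsub>B\<^esub> x = \<zero>\<^bsub>B\<^esub>) \<and> g x = z))"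
  proof -
    have "(\<exists>b\<in>B.cocycles 0 (n + m). degree_zero_cochain C ?t z = g \<circ> b) \<longleftrightarrow>
        (\<exists>x\<in>carrier B. (\<forall>y\<in>set ys. (y [^] (n + m)) \<odot>\<^bsub>B\<^esub> x = \<zero>\<^bsub>B\<^esub>) \<and> g x = z)" for n m z
      unfolding B.cocycles_0 using degree_zero_comp by (auto simp: degree_zero_cochain_eq_iff)
    then show ?thesis by (simp add: C.cocycles_0 imp_conjL) (simp add: Ball_def)
  qed
  also have "\<dots> \<longleftrightarrow> power_torsion R C (set ys) \<subseteq> g ` power_torsion R B (set ys)"
    by (rule image_iff[symmetric])
  finally show ?thesis .
qed

end

section \<open>Koszul cohomology of injective modules\<close>

definition cons_cochain ::
  "('r, 'm, 'y) module_scheme \<Rightarrow> (bool list \<Rightarrow> 'm) \<Rightarrow> (bool list \<Rightarrow> 'm) \<Rightarrow> bool list \<Rightarrow> 'm"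
  where "cons_cochain M v w bs = (case bs of [] \<Rightarrow> \<zero>\<^bsub>M\<^esub> | b # cs \<Rightarrow> if b then w cs else v cs)"

lemma cons_cochain_simps [simp]:
  "cons_cochain M v w [] = \<zero>\<^bsub>M\<^esub>" "cons_cochain M v w (b # cs) = (if b then w cs else v cs)"
  by (simp_all add: cons_cochain_def)

lemma cons_cochain_eta: "c [] = \<zero>\<^bsub>M\<^esub> \<Longrightarrow> cons_cochain M (\<lambda>cs. c (False # cs)) (\<lambda>cs. c (True # cs)) = c"
  by (auto simp: cons_cochain_def fun_eq_iff split: list.split)

lemma all_list_iff: "(\<forall>xs. P xs) \<longleftrightarrow> P [] \<and> (\<forall>x xs. P (x # xs))"
  by (metis list.exhaust)

lemma fun_list_eq_iff: "f = g \<longleftrightarrow> f [] = g [] \<and> (\<forall>x xs. f (x # xs) = g (x # xs))"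
  unfolding fun_eq_iff by (rule all_list_iff)

lemma cons_cochain_eq_iff: "cons_cochain M v w = cons_cochain M v' w' \<longleftrightarrow> v = v' \<and> w = w'"
  unfolding fun_list_eq_iff[of "cons_cochain M v w"] by (auto simp: all_bool_eq fun_eq_iff)

lemma cons_cochain_eq_zero_iff:
  "cons_cochain M v w = (\<lambda>_. \<zero>\<^bsub>M\<^esub>) \<longleftrightarrow> (\<forall>cs. v cs = \<zero>\<^bsub>M\<^esub>) \<and> (\<forall>cs. w cs = \<zero>\<^bsub>M\<^esub>)"
  unfolding fun_list_eq_iff[of "cons_cochain M v w"] by (auto simp: all_bool_eq)

lemma (in module) cons_cochain_carrier:
  "cons_cochain M v w \<in> carrier (koszul_cochains M (Suc t) p) \<longleftrightarrow>
    v \<in> carrier (koszul_cochains M t p) \<and> w \<in> carrier (koszul_cochains M t (p - 1))"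
proof -
  have "int (Suc (weight cs)) = p \<longleftrightarrow> int (weight cs) = p - 1" for cs by auto
  then show ?thesis
    by (auto simp: koszul_cochains_carrier all_list_iff[of "\<lambda>bs. cons_cochain M v w bs \<in> carrier M"]
        all_list_iff[of "\<lambda>bs. _ bs \<longrightarrow> cons_cochain M v w bs = \<zero>\<^bsub>M\<^esub>"] all_bool_eq)
qed

lemma koszul_d_cons_cochain:
  "koszul_d M (z # zs) (cons_cochain M v w) =
    cons_cochain M (koszul_d M zs v) (\<lambda>cs. z \<odot>\<^bsub>M\<^esub> v cs \<ominus>\<^bsub>M\<^esub> koszul_d M zs w cs)"
  by (simp add: fun_list_eq_iff)

lemma (in koszul) cochain_cases:
  assumes "ys = z # zs" "c \<in> carrier (koszul_cochains M (length ys) p)"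
  obtains v w where "v \<in> carrier (koszul_cochains M (length zs) p)"
    "w \<in> carrier (koszul_cochains M (length zs) (p - 1))" "c = cons_cochain M v w"
proof -
  have "c [] = \<zero>\<^bsub>M\<^esub>" using assms by (intro cochain_outside[OF assms(2)]) simp
  then show thesis
    using that cons_cochain_carrier[of _ _ "length zs" p] assms cons_cochain_eta
    by (metis length_Cons)
qed

lemma (in module) koszul_transition_cons_cochain:
  assumes "z \<in> carrier R" "set zs \<subseteq> carrier R" "\<And>cs. v cs \<in> carrier M" "\<And>cs. w cs \<in> carrier M"
  shows "koszul_transition R M (z # zs) (cons_cochain M v w) =
    cons_cochain M (koszul_transition R M zs v) (\<lambda>cs. z \<odot>\<^bsub>M\<^esub> koszul_transition R M zs w cs)"
  using assms by (auto simp: fun_list_eq_iff koszul_transition_def smult_assoc1)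

context module begin

lemma bij_betw_power:
  assumes "y \<in> carrier R" and bij: "bij_betw (\<lambda>x. y \<odot>\<^bsub>M\<^esub> x) (carrier M) (carrier M)"
  shows "bij_betw (\<lambda>x. (y [^] (n::nat)) \<odot>\<^bsub>M\<^esub> x) (carrier M) (carrier M)"
proof (induction n)
  case 0
  show ?case using bij_betw_id[of "carrier M"] by (rule bij_betw_cong[THEN iffD1, rotated]) simp
next
  case (Suc n)
  have "(y [^] Suc n) \<odot>\<^bsub>M\<^esub> x = (y [^] n) \<odot>\<^bsub>M\<^esub> (y \<odot>\<^bsub>M\<^esub> x)" if "x \<in> carrier M" for x
    using assms(1) that by (simp add: smult_assoc1)
  then show ?case
    using bij_betw_trans[OF bij Suc] by (subst bij_betw_cong) (auto simp: comp_def)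
qed

text \<open>The complex is the cone of the bijection \<open>y\<^sup>n\<close> on the complex of \<open>ys\<^sup>n\<close>.\<close>

lemma koszul_vanishes_bijective:
  assumes ys: "set (y # ys) \<subseteq> carrier R"
    and bij: "bij_betw (\<lambda>x. y \<odot>\<^bsub>M\<^esub> x) (carrier M) (carrier M)"
  shows "koszul_vanishes R (y # ys) M p"
proof -
  interpret koszul R M "y # ys" by (rule koszulI[OF ys])
  interpret tail: koszul R M ys by (rule koszulI) (use ys in simp)
  have yR [simp]: "y \<in> carrier R" and ysR [simp]: "set ys \<subseteq> carrier R" using ys by auto
  show ?thesis
    unfolding koszul_vanishes_def
  proof (rule acyclicI)
    fix n c assume c: "c \<in> cocycles p n"
    obtain v w where v: "v \<in> carrier (koszul_cochains M (length ys) p)"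
      and w: "w \<in> carrier (koszul_cochains M (length ys) (p - 1))" and cvw: "c = cons_cochain M v w"
      using cochain_cases[OF refl cocycles_closed[OF c]] .
    note closed [simp] = tail.cochain_value[OF v] tail.cochain_value[OF w]
    let ?z = "y [^] n" and ?zs = "powers R n ys"
    note bij_power = bij_betw_power[OF yR bij, of n]
    let ?h = "inv_into (carrier M) (\<lambda>x. ?z \<odot>\<^bsub>M\<^esub> x)"
    have h [simp]: "?h x \<in> carrier M" "?z \<odot>\<^bsub>M\<^esub> ?h x = x" if "x \<in> carrier M" for x
      using bij_betwE[OF bij_betw_inv_into[OF bij_power]] bij_betw_inv_into_right[OF bij_power] that
      by simp_all
    have "?h \<zero>\<^bsub>M\<^esub> = \<zero>\<^bsub>M\<^esub>" using bij_betw_inv_into_left[OF bij_power, of "\<zero>\<^bsub>M\<^esub>"] by simp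
    then have hw: "(\<lambda>cs. ?h (w cs)) \<in> carrier (koszul_cochains M (length ys) (p - 1))"
      using w by (simp add: koszul_cochains_carrier)
    have "koszul_d M (?z # ?zs) c = (\<lambda>_. \<zero>\<^bsub>M\<^esub>)" using cocycles_d[OF c] by simp
    then have cocycle: "?z \<odot>\<^bsub>M\<^esub> v cs = koszul_d M ?zs w cs" for cs
      unfolding cvw koszul_d_cons_cochain cons_cochain_eq_zero_iff by (simp add: diff_eq_zero_iff)
    have "koszul_d M ?zs (\<lambda>cs. ?h (w cs)) cs = v cs" for cs
    proof -
      have "?z \<odot>\<^bsub>M\<^esub> koszul_d M ?zs (\<lambda>cs. ?h (w cs)) cs = ?z \<odot>\<^bsub>M\<^esub> v cs"
        by (simp add: cocycle flip: koszul_d_smult)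
      then show ?thesis
        using inj_onD[OF bij_betw_imp_inj_on[OF bij_power]] by simp
    qed
    then have "koszul_d M (?z # ?zs) (cons_cochain M (\<lambda>cs. ?h (w cs)) (\<lambda>_. \<zero>\<^bsub>M\<^esub>)) = c"
      unfolding cvw koszul_d_cons_cochain cons_cochain_eq_iff by (simp add: fun_eq_iff)
    moreover have "cons_cochain M (\<lambda>cs. ?h (w cs)) (\<lambda>_. \<zero>\<^bsub>M\<^esub>) \<in>
        carrier (koszul_cochains M (length (y # ys)) (p - 1))"
      using hw by (simp add: cons_cochain_carrier) (simp add: koszul_cochains_carrier)
    ultimately show "null p n c" using null_coboundary[of _ p n] by force
  qed
qed

lemma power_torsion_cochain:
  assumes "power_torsion R M {y} = carrier M" "y \<in> carrier R"
    and w: "w \<in> carrier (koszul_cochains M t p)"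
  shows "\<exists>m::nat. \<forall>bs. (y [^] m) \<odot>\<^bsub>M\<^esub> w bs = \<zero>\<^bsub>M\<^esub>"
proof -
  have wM: "w bs \<in> carrier M" for bs using w by (simp add: koszul_cochains_carrier)
  then have "w bs \<in> power_torsion R M {y}" for bs using assms(1) by blast
  then have "\<exists>m::nat. (y [^] m) \<odot>\<^bsub>M\<^esub> w bs = \<zero>\<^bsub>M\<^esub>" for bs by (simp add: power_torsion_def)
  then obtain k :: "bool list \<Rightarrow> nat" where k: "(y [^] k bs) \<odot>\<^bsub>M\<^esub> w bs = \<zero>\<^bsub>M\<^esub>" for bs by metis
  have fin: "finite {bs :: bool list. length bs = t}"
    using finite_lists_length_eq[of "UNIV :: bool set" t] by simp
  have "(y [^] (\<Sum>cs | length cs = t. k cs)) \<odot>\<^bsub>M\<^esub> w bs = \<zero>\<^bsub>M\<^esub>" for bs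
  proof (cases "length bs = t")
    case True
    then have "k bs \<le> (\<Sum>cs | length cs = t. k cs)" by (intro member_le_sum fin) auto
    then show ?thesis by (rule smult_power_mono_zero[OF assms(2) wM k])
  qed (use w assms(2) in \<open>simp add: koszul_cochains_carrier\<close>)
  then show ?thesis by blast
qed

lemma koszul_transition_cons_cochain_torsion:
  assumes "set (y # ys) \<subseteq> carrier R" "\<And>cs. v cs \<in> carrier M" "\<And>cs. w cs \<in> carrier M"
    and "\<And>cs. (y [^] m) \<odot>\<^bsub>M\<^esub> w cs = \<zero>\<^bsub>M\<^esub>"
  shows "koszul_transition R M (powers R m (y # ys)) (cons_cochain M v w) =
    cons_cochain M (koszul_transition R M (powers R m ys) v) (\<lambda>_. \<zero>\<^bsub>M\<^esub>)"
  unfolding powers_simps using assms smult_left_commute[of "y [^] m" _ "w _"]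
  by (subst koszul_transition_cons_cochain) 
    (simp_all add: cons_cochain_eq_iff koszul_transition_def)

lemma koszul_d_cons_cochain_torsion:
  assumes "set ys \<subseteq> carrier R" "\<And>cs. (y [^] n) \<odot>\<^bsub>M\<^esub> v cs = \<zero>\<^bsub>M\<^esub>"
  shows "koszul_d M (powers R n (y # ys)) (cons_cochain M v (\<lambda>_. \<zero>\<^bsub>M\<^esub>)) =
    cons_cochain M (koszul_d M (powers R n ys) v) (\<lambda>_. \<zero>\<^bsub>M\<^esub>)"
  unfolding powers_simps koszul_d_cons_cochain using assms by (simp add: cons_cochain_eq_iff)

lemma koszul_vanishes_torsion:
  assumes ys: "set (y # ys) \<subseteq> carrier R" and torsion: "power_torsion R M {y} = carrier M"
    and vanishes: "koszul_vanishes R ys M p"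
  shows "koszul_vanishes R (y # ys) M p"
proof -
  interpret koszul R M "y # ys" by (rule koszulI[OF ys])
  interpret tail: koszul R M ys by (rule koszulI) (use ys in simp)
  have yR [simp]: "y \<in> carrier R" and ysR [simp]: "set ys \<subseteq> carrier R" using ys by auto
  let ?\<tau> = "\<lambda>m. koszul_transition R M (powers R m ys)"
  have zero_cochain: "(\<lambda>_. \<zero>\<^bsub>M\<^esub>) \<in> carrier (koszul_cochains M t q)" for t q
    by (simp add: koszul_cochains_carrier)
  show ?thesis
    unfolding koszul_vanishes_def
  proof (rule acyclicI)
    fix n c assume c: "c \<in> cocycles p n"
    obtain v w where v: "v \<in> carrier (koszul_cochains M (length ys) p)"
      and w: "w \<in> carrier (koszul_cochains M (length ys) (p - 1))" and cvw: "c = cons_cochain M v w"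
      using cochain_cases[OF refl cocycles_closed[OF c]] .
    obtain m :: nat where m: "(y [^] m) \<odot>\<^bsub>M\<^esub> w cs = \<zero>\<^bsub>M\<^esub>" for cs
      using power_torsion_cochain[OF torsion yR w] by blast
    have "koszul_d M (powers R n ys) v = (\<lambda>_. \<zero>\<^bsub>M\<^esub>)"
      using cocycles_d[OF c] unfolding cvw powers_simps koszul_d_cons_cochain cochain_zero
        cons_cochain_eq_zero_iff by blast
    then have "v \<in> tail.cocycles p n" using v by (simp add: tail.cocycles_def)
    then obtain l u where u: "u \<in> carrier (koszul_cochains M (length ys) (p - 1))"
      and \<tau>v: "?\<tau> l (?\<tau> m v) = koszul_d M (powers R (n + m + l) ys) u"
      using vanishes tail.acyclicD tail.cocycles_\<tau> unfolding koszul_vanishes_def by metis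
    obtain k :: nat where k: "(y [^] k) \<odot>\<^bsub>M\<^esub> u cs = \<zero>\<^bsub>M\<^esub>" for cs
      using power_torsion_cochain[OF torsion yR u] by blast
    let ?m = "m + l + k" and ?n = "n + (m + l + k)"
    have "koszul_transition R M (powers R ?m (y # ys)) c = cons_cochain M (?\<tau> ?m v) (\<lambda>_. \<zero>\<^bsub>M\<^esub>)"
      unfolding cvw using smult_power_mono_zero[OF yR _ m, of _ ?m] tail.cochain_value[OF v]
        tail.cochain_value[OF w]
      by (intro koszul_transition_cons_cochain_torsion[OF ys]) simp_all
    also have "?\<tau> ?m v = ?\<tau> k (koszul_d M (powers R (n + m + l) ys) u)"
      unfolding \<tau>v[symmetric] using v by (simp add: tail.\<tau>_\<tau>)
    also have "\<dots> = koszul_d M (powers R ?n ys) (?\<tau> k u)"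
      using tail.d_\<tau>[OF u, of "n + m + l" k] by (simp add: add.assoc)
    also have "cons_cochain M \<dots> (\<lambda>_. \<zero>\<^bsub>M\<^esub>) =
        koszul_d M (powers R ?n (y # ys)) (cons_cochain M (?\<tau> k u) (\<lambda>_. \<zero>\<^bsub>M\<^esub>))"
    proof -
      have "(y [^] ?n) \<odot>\<^bsub>M\<^esub> ?\<tau> k u cs = \<zero>\<^bsub>M\<^esub>" for cs
        using smult_power_mono_zero[OF yR _ k, of cs ?n] tail.cochain_value[OF u]
          smult_left_commute[of "y [^] ?n" _ "u cs"]
        by (simp add: koszul_transition_def)
      then show ?thesis by (rule koszul_d_cons_cochain_torsion[OF ysR, symmetric])
    qed
    finally show "null p n c"
      using tail.\<tau>.closed[OF u] zero_cochain
      by (intro nullI[of "cons_cochain M (?\<tau> k u) (\<lambda>_. \<zero>\<^bsub>M\<^esub>)" p ?m])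
        (simp_all add: cons_cochain_carrier)
  qed
qed

end

lemma quotient_short_exact:
  assumes "module R M" "submodule G R M"
  shows "short_exact R (M\<lparr>carrier := G\<rparr>) M (quotient_module M G) (\<lambda>x. x) (\<lambda>x. G +>\<^bsub>M\<^esub> x)"
proof (rule short_exact.intro)
  interpret M: module R M by fact
  interpret G: module R "M\<lparr>carrier := G\<rparr>" by (rule M.submodule_module[OF assms(2)])
  show "module_homomorphism R (M\<lparr>carrier := G\<rparr>) M (\<lambda>x. x)"
    by unfold_locales (rule mod_hom_inclusion, rule M.submoduleE(1)[OF assms(2)])
  show "module_homomorphism R M (quotient_module M G) (\<lambda>x. G +>\<^bsub>M\<^esub> x)"
    by (rule quotient_module_hom[OF assms])
  show "short_exact_axioms (M\<lparr>carrier := G\<rparr>) M (quotient_module M G) (\<lambda>x. x) (\<lambda>x. G +>\<^bsub>M\<^esub> x)"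
    using M.submoduleE(1)[OF assms(2)] quotient_module_zero_iff[OF assms]
      quotient_module_surj[of M G]
    by (auto simp: short_exact_axioms_def)
qed

context module begin

lemma power_annihilator_stable:
  assumes noeth: "noetherian_ring R" and y: "y \<in> carrier R" and u: "u \<in> carrier M"
  shows "\<exists>k::nat. \<forall>r\<in>carrier R. r \<odot>\<^bsub>M\<^esub> ((y [^] Suc k) \<odot>\<^bsub>M\<^esub> u) = \<zero>\<^bsub>M\<^esub> \<longrightarrow>
    r \<odot>\<^bsub>M\<^esub> ((y [^] k) \<odot>\<^bsub>M\<^esub> u) = \<zero>\<^bsub>M\<^esub>"
proof -
  define I where "I k = {r \<in> carrier R. r \<odot>\<^bsub>M\<^esub> ((y [^] (k::nat)) \<odot>\<^bsub>M\<^esub> u) = \<zero>\<^bsub>M\<^esub>}" for k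
  have I_eq: "I k = {r \<in> carrier R. (y [^] k) \<odot>\<^bsub>M\<^esub> (r \<odot>\<^bsub>M\<^esub> u) = \<zero>\<^bsub>M\<^esub>}" for k
    using y u smult_left_commute[of _ "y [^] k" u] by (auto simp: I_def)
  have "ideal (I k) R" for k
    using ideal_annihilating[of "{y [^] k}" u] y u by (simp add: I_eq)
  moreover have mono: "I k \<subseteq> I l" if "k \<le> l" for k l
    using smult_power_mono_zero[OF y _ _ that] u by (auto simp: I_eq)
  then have "I k \<subseteq> I l \<or> I l \<subseteq> I k" for k l using nat_le_linear by blast
  ultimately have "subset.chain {I. ideal I R} (range I)" by (auto simp: subset_chain_def)
  then have "\<Union>(range I) \<in> range I"
    by (rule noetherian_ring.ideal_chain_is_trivial[OF noeth, rotated]) simp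
  then obtain k where "I (Suc k) \<subseteq> I k" by blast
  then show ?thesis by (intro exI[of _ k]) (auto simp: I_def)
qed

end

lemma injective_cyclic_extension:
  assumes E: "injective_module R E" and x: "x \<in> carrier E" and z: "z \<in> carrier E"
    and annihilator: "\<And>r. r \<in> carrier R \<Longrightarrow> r \<odot>\<^bsub>E\<^esub> x = \<zero>\<^bsub>E\<^esub> \<Longrightarrow> r \<odot>\<^bsub>E\<^esub> z = \<zero>\<^bsub>E\<^esub>"
  obtains g where "g \<in> mod_hom R E E" "g x = z"
proof -
  interpret E: module R E using E by (simp add: injective_module_def)
  define A where "A = (\<lambda>r. r \<odot>\<^bsub>E\<^esub> x) ` carrier R"
  define f where "f w = (SOME r. r \<in> carrier R \<and> w = r \<odot>\<^bsub>E\<^esub> x) \<odot>\<^bsub>E\<^esub> z" for w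
  have f: "f (r \<odot>\<^bsub>E\<^esub> x) = r \<odot>\<^bsub>E\<^esub> z" if r: "r \<in> carrier R" for r
  proof -
    define s where "s = (SOME s. s \<in> carrier R \<and> r \<odot>\<^bsub>E\<^esub> x = s \<odot>\<^bsub>E\<^esub> x)"
    have s: "s \<in> carrier R \<and> r \<odot>\<^bsub>E\<^esub> x = s \<odot>\<^bsub>E\<^esub> x"
      unfolding s_def by (rule someI[of _ r]) (simp add: r)
    then have "(s \<ominus>\<^bsub>R\<^esub> r) \<odot>\<^bsub>E\<^esub> z = \<zero>\<^bsub>E\<^esub>"
      using r x by (intro annihilator) (simp_all add: E.smult_l_diff E.diff_eq_zero_iff)
    then have "s \<odot>\<^bsub>E\<^esub> z = r \<odot>\<^bsub>E\<^esub> z" using r s z by (simp add: E.smult_l_diff E.diff_eq_zero_iff)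
    then show ?thesis unfolding f_def s_def .
  qed
  have "f \<in> mod_hom R (E\<lparr>carrier := A\<rparr>) E"
  proof -
    have "f (r \<odot>\<^bsub>E\<^esub> x \<oplus>\<^bsub>E\<^esub> s \<odot>\<^bsub>E\<^esub> x) = f (r \<odot>\<^bsub>E\<^esub> x) \<oplus>\<^bsub>E\<^esub> f (s \<odot>\<^bsub>E\<^esub> x)"
      "f (r \<odot>\<^bsub>E\<^esub> (s \<odot>\<^bsub>E\<^esub> x)) = r \<odot>\<^bsub>E\<^esub> f (s \<odot>\<^bsub>E\<^esub> x)" if "r \<in> carrier R" "s \<in> carrier R" for r s
      using f[of "r \<oplus>\<^bsub>R\<^esub> s"] f[of "r \<otimes>\<^bsub>R\<^esub> s"] f[OF that(1)] f[OF that(2)] that x z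
      by (simp_all add: E.smult_l_distr E.smult_assoc1)
    then show ?thesis using f z by (auto simp: mod_hom_def A_def)
  qed
  moreover have "submodule A R E" unfolding A_def by (rule E.cyclic_submodule[OF x])
  ultimately obtain g where g: "g \<in> mod_hom R E E" "\<And>w. w \<in> A \<Longrightarrow> g w = f w"
    using E unfolding injective_module_def by blast
  have "g x = z" using g(2)[of x] f[of "\<one>\<^bsub>R\<^esub>"] x z by (force simp: A_def)
  then show thesis using that g(1) by blast
qed

text \<open>If \<open>k\<close> is large, \<open>y\<^sup>k\<^sup>+\<^sup>1 u \<mapsto> y\<^sup>k u\<close> extends to an endomorphism of \<open>E\<close>. It sends \<open>u\<close> to an element
  \<open>v\<close> with \<open>y\<^sup>k (y v - u) = 0\<close>.\<close>

lemma injective_torsion_divisible: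
  assumes "noetherian_ring R" and E: "injective_module R E"
    and W: "insert y W \<subseteq> carrier R" and u: "u \<in> power_torsion R E W"
  obtains v where "v \<in> power_torsion R E W"
    "y \<odot>\<^bsub>E\<^esub> v \<ominus>\<^bsub>E\<^esub> u \<in> power_torsion R E (insert y W)"
proof -
  interpret E: module R E using E by (simp add: injective_module_def)
  have y: "y \<in> carrier R" and uE: "u \<in> carrier E" using W u by (auto simp: power_torsion_def)
  obtain k :: nat
    where k: "\<forall>r\<in>carrier R. r \<odot>\<^bsub>E\<^esub> ((y [^]\<^bsub>R\<^esub> Suc k) \<odot>\<^bsub>E\<^esub> u) = \<zero>\<^bsub>E\<^esub> \<longrightarrow>
      r \<odot>\<^bsub>E\<^esub> ((y [^]\<^bsub>R\<^esub> k) \<odot>\<^bsub>E\<^esub> u) = \<zero>\<^bsub>E\<^esub>"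
    using E.power_annihilator_stable[OF assms(1) y uE] by blast
  obtain g where g: "g \<in> mod_hom R E E"
    and gu: "g ((y [^]\<^bsub>R\<^esub> Suc k) \<odot>\<^bsub>E\<^esub> u) = (y [^]\<^bsub>R\<^esub> k) \<odot>\<^bsub>E\<^esub> u"
    by (rule injective_cyclic_extension[OF E, of "(y [^]\<^bsub>R\<^esub> Suc k) \<odot>\<^bsub>E\<^esub> u" "(y [^]\<^bsub>R\<^esub> k) \<odot>\<^bsub>E\<^esub> u"])
      (use k y uE in auto)
  interpret g: module_homomorphism R E E g by unfold_locales (rule g)
  have "(y [^]\<^bsub>R\<^esub> k) \<odot>\<^bsub>E\<^esub> (y \<odot>\<^bsub>E\<^esub> g u) = (y [^]\<^bsub>R\<^esub> k) \<odot>\<^bsub>E\<^esub> u"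
    using gu y uE by (simp add: E.smult_assoc1)
  then have "(y [^]\<^bsub>R\<^esub> k) \<odot>\<^bsub>E\<^esub> (y \<odot>\<^bsub>E\<^esub> g u \<ominus>\<^bsub>E\<^esub> u) \<in> power_torsion R E {y}"
    using y uE by (simp add: E.smult_r_diff power_torsion_def)
  moreover have v: "g u \<in> power_torsion R E W" using g.power_torsion_hom[of W u] W u by simp
  moreover have "y \<odot>\<^bsub>E\<^esub> g u \<ominus>\<^bsub>E\<^esub> u \<in> power_torsion R E W"
    using E.submodule_diff E.submoduleE(4)[OF _ y v] E.power_torsion_submodule[of W] u W by blast
  ultimately show thesis using that E.power_torsion_insert[OF W] by blast
qed

lemma injective_torsion_quotient_bijective:
  assumes "noetherian_ring R" and E: "injective_module R E" and yW: "insert y W \<subseteq> carrier R"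
  defines "Q \<equiv> quotient_module (E\<lparr>carrier := power_torsion R E W\<rparr>) (power_torsion R E (insert y W))"
  shows "bij_betw (\<lambda>c. y \<odot>\<^bsub>Q\<^esub> c) (carrier Q) (carrier Q)"
proof -
  interpret E: module R E using E by (simp add: injective_module_def)
  let ?T = "power_torsion R E W" and ?G = "power_torsion R E (insert y W)"
  let ?B = "E\<lparr>carrier := ?T\<rparr>"
  have y: "y \<in> carrier R" and W: "W \<subseteq> carrier R" using yW by auto
  note T = E.power_torsion_submodule[OF W] and G = E.power_torsion_submodule[OF yW]
  have GB: "submodule ?G R ?B"
    by (rule E.submodule_of_submodule[OF G T E.power_torsion_antimono]) blast
  interpret B: module R ?B by (rule E.submodule_module[OF T])
  interpret q: module_homomorphism R ?B Q "\<lambda>x. ?G +>\<^bsub>?B\<^esub> x"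
    unfolding Q_def by (rule quotient_module_hom[OF B.module_axioms GB])
  note q_zero_iff = quotient_module_zero_iff[OF B.module_axioms GB, folded Q_def]
    and q_surj = quotient_module_surj[of ?B ?G, folded Q_def]
  interpret mult: module_homomorphism R Q Q "\<lambda>c. y \<odot>\<^bsub>Q\<^esub> c"
    by unfold_locales (use y in \<open>auto simp: mod_hom_def q.N.smult_r_distr q.N.smult_left_commute\<close>)
  have "c = \<zero>\<^bsub>Q\<^esub>" if c: "c \<in> carrier Q" "y \<odot>\<^bsub>Q\<^esub> c = \<zero>\<^bsub>Q\<^esub>" for c
  proof -
    obtain x where x: "x \<in> ?T" "c = ?G +>\<^bsub>?B\<^esub> x" using c(1) unfolding q_surj[symmetric] by auto
    then have "y \<odot>\<^bsub>E\<^esub> x \<in> ?G" using c(2) q.smult[of y x] q_zero_iff[of "y \<odot>\<^bsub>E\<^esub> x"] y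
        E.submoduleE(4)[OF T y x(1)] by simp
    then have "(y [^]\<^bsub>R\<^esub> (1::nat)) \<odot>\<^bsub>E\<^esub> x \<in> power_torsion R E {y}"
      using y E.power_torsion_antimono[of "{y}" "insert y W"] by auto
    then have "x \<in> ?G" by (rule E.power_torsion_insert[OF yW x(1)])
    then show ?thesis using q_zero_iff x by simp
  qed
  moreover have "c \<in> (\<lambda>c. y \<odot>\<^bsub>Q\<^esub> c) ` carrier Q" if c: "c \<in> carrier Q" for c
  proof -
    obtain u where u: "u \<in> ?T" "c = ?G +>\<^bsub>?B\<^esub> u" using c unfolding q_surj[symmetric] by auto
    obtain v where v: "v \<in> ?T" "y \<odot>\<^bsub>E\<^esub> v \<ominus>\<^bsub>E\<^esub> u \<in> ?G"
      using injective_torsion_divisible[OF assms(1) E yW u(1)] .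
    define w where "w = y \<odot>\<^bsub>E\<^esub> v \<ominus>\<^bsub>E\<^esub> u"
    have w: "w \<in> ?G" "w \<in> ?T"
      using v(2) E.power_torsion_antimono[of W "insert y W"] by (auto simp: w_def)
    have "w \<oplus>\<^bsub>E\<^esub> u = y \<odot>\<^bsub>E\<^esub> v" using u(1) v(1) y by (simp add: w_def power_torsion_def)
    then have "y \<odot>\<^bsub>Q\<^esub> (?G +>\<^bsub>?B\<^esub> v) = (?G +>\<^bsub>?B\<^esub> w) \<oplus>\<^bsub>Q\<^esub> (?G +>\<^bsub>?B\<^esub> u)"
      using q.add[of w u] q.smult[OF y, of v] w(2) u(1) v(1) by simp
    also have "\<dots> = c" using q_zero_iff[of w] w u c by simp
    finally show ?thesis using v(1) q.closed[of v] by force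
  qed
  ultimately show ?thesis
    unfolding bij_betw_def mult.inj_on_iff using mult.closed by blast
qed

lemma koszul_vanishes_injective_torsion:
  assumes noeth: "noetherian_ring R" and E: "injective_module R E" and "0 < p"
    and "W \<union> set ys \<subseteq> carrier R"
  shows "koszul_vanishes R ys (E\<lparr>carrier := power_torsion R E W\<rparr>) p"
  using assms(4)
proof (induction ys arbitrary: W)
  interpret E: module R E using E by (simp add: injective_module_def)
  case Nil
  then show ?case
    using \<open>0 < p\<close>
    by (intro module.koszul_vanishes_out_of_range E.submodule_module E.power_torsion_submodule) auto
next
  interpret E: module R E using E by (simp add: injective_module_def)
  case (Cons y ys)
  let ?T = "power_torsion R E W" and ?G = "power_torsion R E (insert y W)"
  let ?B = "E\<lparr>carrier := ?T\<rparr>" and ?A = "E\<lparr>carrier := ?G\<rparr>"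
  have W: "W \<subseteq> carrier R" and yW: "insert y W \<subseteq> carrier R" and ys: "set (y # ys) \<subseteq> carrier R"
    using Cons.prems by auto
  then have y: "y \<in> carrier R" by simp
  note T = E.power_torsion_submodule[OF W] and G = E.power_torsion_submodule[OF yW]
  have GT: "?G \<subseteq> ?T" by (rule E.power_torsion_antimono) auto
  have GB: "submodule ?G R ?B" by (rule E.submodule_of_submodule[OF G T GT])
  interpret A: module R ?A by (rule E.submodule_module[OF G])
  interpret B: module R ?B by (rule E.submodule_module[OF T])
  interpret short_exact R ?A ?B "quotient_module ?B ?G" "\<lambda>x. x" "\<lambda>x. ?G +>\<^bsub>?B\<^esub> x"
    using quotient_short_exact[OF B.module_axioms GB] by simp
  have "koszul_vanishes R (y # ys) ?A p"
  proof (rule A.koszul_vanishes_torsion[OF ys])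
    show "power_torsion R ?A {y} = carrier ?A" by (auto simp: power_torsion_def)
    show "koszul_vanishes R ys ?A p" by (rule Cons.IH) (use Cons.prems in auto)
  qed
  moreover have "koszul_vanishes R (y # ys) (quotient_module ?B ?G) p"
    by (rule g.N.koszul_vanishes_bijective[OF ys])
      (rule injective_torsion_quotient_bijective[OF noeth E yW])
  ultimately show ?case by (rule koszul_vanishes_middle[OF ys])
qed

theorem koszul_vanishes_injective:
  assumes "noetherian_ring R" "injective_module R E" "0 < p" "set ys \<subseteq> carrier R"
  shows "koszul_vanishes R ys E p"
proof -
  interpret E: module R E using assms(2) by (simp add: injective_module_def)
  show ?thesis using koszul_vanishes_injective_torsion[OF assms(1-3), of "{}" ys] assms(4) by simp
qed

section \<open>Divisible groups\<close>

definition divisible_group :: "('a, 'b) monoid_scheme \<Rightarrow> bool"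
  where "divisible_group G \<longleftrightarrow>
    comm_group G \<and> (\<forall>n::nat. \<forall>x\<in>carrier G. 0 < n \<longrightarrow> (\<exists>y\<in>carrier G. y [^]\<^bsub>G\<^esub> n = x))"

lemma divisible_group_int_root:
  assumes "divisible_group G" "x \<in> carrier G" "(n::int) \<noteq> 0"
  obtains y where "y \<in> carrier G" "y [^]\<^bsub>G\<^esub> n = x"
proof -
  interpret comm_group G using assms(1) by (simp add: divisible_group_def)
  have root: "\<exists>y\<in>carrier G. y [^]\<^bsub>G\<^esub> m = z" if "z \<in> carrier G" "0 < m" for z and m :: int
    using assms(1) that unfolding divisible_group_def by (metis zero_less_imp_eq_int int_pow_int)
  show thesis
  proof (cases "0 < n")
    case True
    then show ?thesis using root[OF assms(2)] that by blast
  next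
    case False
    then obtain y where "y \<in> carrier G" "y [^]\<^bsub>G\<^esub> (- n) = inv\<^bsub>G\<^esub> x"
      using root[of "inv\<^bsub>G\<^esub> x" "- n"] assms(2,3) by auto
    then have "inv\<^bsub>G\<^esub> (y [^]\<^bsub>G\<^esub> n) = inv\<^bsub>G\<^esub> x" "y \<in> carrier G" by (simp_all add: int_pow_neg)
    then show ?thesis using that assms(2) by (metis inv_inv int_pow_closed)
  qed
qed

definition partial_hom :: "('a, 'c) monoid_scheme \<Rightarrow> ('b, 'd) monoid_scheme \<Rightarrow> ('a \<times> 'b) set \<Rightarrow> bool"
  where "partial_hom B D G \<longleftrightarrow> subgroup G (B \<times>\<times> D) \<and> (\<forall>z. (\<one>\<^bsub>B\<^esub>, z) \<in> G \<longrightarrow> z = \<one>\<^bsub>D\<^esub>)"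

lemma (in group) subgroup_chain_Union:
  assumes "\<C> \<noteq> {}" "subset.chain {H. subgroup H G} \<C>"
  shows "subgroup (\<Union>\<C>) G"
proof (rule subgroupI)
  have sub: "subgroup H G" if "H \<in> \<C>" for H using assms(2) that by (auto simp: subset_chain_def)
  show "\<Union>\<C> \<subseteq> carrier G" using subgroup.subset[OF sub] by auto
  show "\<Union>\<C> \<noteq> {}" using assms(1) subgroup.one_closed[OF sub] by auto
  show "inv x \<in> \<Union>\<C>" if "x \<in> \<Union>\<C>" for x using that by (auto dest: sub intro: subgroup.m_inv_closed)
  fix x y assume "x \<in> \<Union>\<C>" "y \<in> \<Union>\<C>"
  then obtain H K where HK: "H \<in> \<C>" "K \<in> \<C>" "x \<in> H" "y \<in> K" by blast
  then have "H \<subseteq> K \<or> K \<subseteq> H" using assms(2) by (simp add: subset_chain_def)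
  then obtain L where "L \<in> \<C>" "x \<in> L" "y \<in> L" using HK by blast
  then show "x \<otimes> y \<in> \<Union>\<C>" using subgroup.m_closed[OF sub] by blast
qed

locale comm_group_pair = B: comm_group B + D: comm_group D for B and D
begin

sublocale product: comm_group "B \<times>\<times> D"
proof (rule group.group_comm_groupI)
  show "group (B \<times>\<times> D)" by (intro DirProd_group B.is_group D.is_group)
qed (auto simp: B.m_comm D.m_comm)

lemma DirProd_int_pow:
  assumes "b \<in> carrier B" "d \<in> carrier D"
  shows "(b, d) [^]\<^bsub>B \<times>\<times> D\<^esub> (k::int) = (b [^]\<^bsub>B\<^esub> k, d [^]\<^bsub>D\<^esub> k)"
proof -
  have "fst \<in> hom (B \<times>\<times> D) B" "snd \<in> hom (B \<times>\<times> D) D" by (auto simp: hom_def)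
  then have "fst ((b, d) [^]\<^bsub>B \<times>\<times> D\<^esub> k) = b [^]\<^bsub>B\<^esub> k" "snd ((b, d) [^]\<^bsub>B \<times>\<times> D\<^esub> k) = d [^]\<^bsub>D\<^esub> k"
    using hom_int_pow[of fst "B \<times>\<times> D" B "(b, d)" k] hom_int_pow[of snd "B \<times>\<times> D" D "(b, d)" k] assms
    by (auto simp: product.is_group B.is_group D.is_group)
  then show ?thesis by (metis prod.collapse)
qed

context
  fixes G assumes G: "partial_hom B D G"
begin

lemma partial_hom_subgroup: "subgroup G (B \<times>\<times> D)"
  using G by (simp add: partial_hom_def)

lemma partial_hom_closed: "(x, u) \<in> G \<Longrightarrow> x \<in> carrier B" "(x, u) \<in> G \<Longrightarrow> u \<in> carrier D"
  using subgroup.subset[OF partial_hom_subgroup] by auto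

lemma partial_hom_int_pow: "(x, u) \<in> G \<Longrightarrow> (x [^]\<^bsub>B\<^esub> (k::int), u [^]\<^bsub>D\<^esub> k) \<in> G"
  using product.subgroup_int_pow_closed[OF partial_hom_subgroup, of "(x, u)" k]
  by (simp add: DirProd_int_pow partial_hom_closed)

lemma partial_hom_mult: "(x, u) \<in> G \<Longrightarrow> (y, v) \<in> G \<Longrightarrow> (x \<otimes>\<^bsub>B\<^esub> y, u \<otimes>\<^bsub>D\<^esub> v) \<in> G"
  using subgroup.m_closed[OF partial_hom_subgroup] by force

lemma partial_hom_inv: "(x, u) \<in> G \<Longrightarrow> (inv\<^bsub>B\<^esub> x, inv\<^bsub>D\<^esub> u) \<in> G"
  using subgroup.m_inv_closed[OF partial_hom_subgroup, of "(x, u)"]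
  by (simp add: inv_DirProd B.is_group D.is_group partial_hom_closed)

lemma partial_hom_unique:
  assumes "(x, u) \<in> G" "(x, v) \<in> G"
  shows "u = v"
proof -
  note [simp] = partial_hom_closed[OF assms(1)] partial_hom_closed[OF assms(2)]
  have "(\<one>\<^bsub>B\<^esub>, u \<otimes>\<^bsub>D\<^esub> inv\<^bsub>D\<^esub> v) \<in> G"
    using partial_hom_mult[OF assms(1) partial_hom_inv[OF assms(2)]] by (simp add: B.r_inv)
  then have "u \<otimes>\<^bsub>D\<^esub> inv\<^bsub>D\<^esub> v = \<one>\<^bsub>D\<^esub>" using G by (simp add: partial_hom_def)
  then show ?thesis by (simp add: D.inv_solve_right')
qed

lemma partial_hom_value_candidate:
  assumes "divisible_group D" and b: "b \<in> carrier B"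
  obtains d where "d \<in> carrier D" "\<And>k v. (b [^]\<^bsub>B\<^esub> (k::int), v) \<in> G \<Longrightarrow> v = d [^]\<^bsub>D\<^esub> k"
proof -
  define I where "I = {k::int. \<exists>v. (b [^]\<^bsub>B\<^esub> k, v) \<in> G}"
  have "group_closure I = I"
  proof (intro equalityI subsetI)
    fix k assume "k \<in> group_closure I"
    then show "k \<in> I"
    proof induction
      case (base s)
      have "(\<one>\<^bsub>B\<^esub>, \<one>\<^bsub>D\<^esub>) \<in> G" using subgroup.one_closed[OF partial_hom_subgroup] by simp
      then show ?case using base by (auto simp: I_def)
    next
      case (diff s t)
      then obtain u v where uv: "(b [^]\<^bsub>B\<^esub> s, u) \<in> G" "(b [^]\<^bsub>B\<^esub> t, v) \<in> G" by (auto simp: I_def)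
      have "(b [^]\<^bsub>B\<^esub> (s - t), u \<otimes>\<^bsub>D\<^esub> inv\<^bsub>D\<^esub> v) \<in> G"
        using partial_hom_mult[OF uv(1) partial_hom_inv[OF uv(2)]] b by (simp add: B.int_pow_diff)
      then show ?case by (auto simp: I_def)
    qed
  qed (auto intro: group_closure.base)
  then have gcd: "Gcd I \<in> I" using Gcd_in_group_closure[of I] by simp
  then obtain v\<^sub>0 where v\<^sub>0: "(b [^]\<^bsub>B\<^esub> Gcd I, v\<^sub>0) \<in> G" by (auto simp: I_def)
  obtain d where d: "d \<in> carrier D" "d [^]\<^bsub>D\<^esub> Gcd I = v\<^sub>0"
  proof (cases "Gcd I = 0")
    case True
    have "(\<one>\<^bsub>B\<^esub>, v\<^sub>0) \<in> G" using v\<^sub>0 unfolding True by simp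
    then have "v\<^sub>0 = \<one>\<^bsub>D\<^esub>" using G by (simp add: partial_hom_def)
    then show ?thesis using that[of "\<one>\<^bsub>D\<^esub>"] unfolding True by simp
  qed (use divisible_group_int_root[OF assms(1) partial_hom_closed(2)[OF v\<^sub>0]] that in blast)
  have "v = d [^]\<^bsub>D\<^esub> k" if v: "(b [^]\<^bsub>B\<^esub> (k::int), v) \<in> G" for k v
  proof -
    have "Gcd I dvd k" using v by (intro Gcd_dvd) (auto simp: I_def)
    then obtain q where q: "k = Gcd I * q" ..
    have "(b [^]\<^bsub>B\<^esub> k, v\<^sub>0 [^]\<^bsub>D\<^esub> q) \<in> G"
      using partial_hom_int_pow[OF v\<^sub>0, of q] b by (simp add: q B.int_pow_pow)
    then have "v = v\<^sub>0 [^]\<^bsub>D\<^esub> q" using partial_hom_unique v by blast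
    also have "\<dots> = d [^]\<^bsub>D\<^esub> k" unfolding q d(2)[symmetric] by (rule D.int_pow_pow[OF d(1)])
    finally show ?thesis .
  qed
  then show thesis using that d(1) by blast
qed

lemma partial_hom_adjoin:
  assumes "divisible_group D" and b: "b \<in> carrier B"
  obtains G' d where "partial_hom B D G'" "G \<subseteq> G'" "(b, d) \<in> G'"
proof -
  obtain d where d: "d \<in> carrier D" "\<And>k v. (b [^]\<^bsub>B\<^esub> (k::int), v) \<in> G \<Longrightarrow> v = d [^]\<^bsub>D\<^esub> k"
    using partial_hom_value_candidate[OF assms] by metis
  let ?C = "range (\<lambda>k::int. (b [^]\<^bsub>B\<^esub> k, d [^]\<^bsub>D\<^esub> k))"
  have bd: "(b, d) \<in> carrier (B \<times>\<times> D)" using b d(1) by simp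
  have "?C = generate (B \<times>\<times> D) {(b, d)}"
    unfolding product.generate_pow[OF bd] DirProd_int_pow[OF b d(1)] by auto
  then have C: "subgroup ?C (B \<times>\<times> D)" using product.generate_is_subgroup[of "{(b, d)}"] bd by simp
  let ?G' = "G <#>\<^bsub>B \<times>\<times> D\<^esub> ?C"
  have memI: "(x \<otimes>\<^bsub>B\<^esub> b [^]\<^bsub>B\<^esub> k, u \<otimes>\<^bsub>D\<^esub> d [^]\<^bsub>D\<^esub> k) \<in> ?G'" if "(x, u) \<in> G" for x u and k :: int
    using that unfolding set_mult_def by force
  show thesis
  proof (rule that[of ?G' d])
    have "z = \<one>\<^bsub>D\<^esub>" if z: "(\<one>\<^bsub>B\<^esub>, z) \<in> ?G'" for z
    proof -
      obtain x u k where xu: "(x, u) \<in> G" "\<one>\<^bsub>B\<^esub> = x \<otimes>\<^bsub>B\<^esub> b [^]\<^bsub>B\<^esub> k" "z = u \<otimes>\<^bsub>D\<^esub> d [^]\<^bsub>D\<^esub> (k::int)"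
        using z unfolding set_mult_def by auto
      have "x = b [^]\<^bsub>B\<^esub> (- k)"
        using B.inv_equality[of x "b [^]\<^bsub>B\<^esub> k"] xu(2) partial_hom_closed(1)[OF xu(1)] b
        by (simp add: B.int_pow_neg)
      then have "u = d [^]\<^bsub>D\<^esub> (- k)" using d(2) xu(1) by blast
      then show ?thesis using xu(3) d(1) by (simp flip: D.int_pow_mult)
    qed
    then show "partial_hom B D ?G'"
      using product.mult_subgroups[OF partial_hom_subgroup C] by (simp add: partial_hom_def)
    show "G \<subseteq> ?G'"
    proof clarify
      fix x u assume "(x, u) \<in> G"
      then show "(x, u) \<in> ?G'" using memI[of x u 0] partial_hom_closed by simp
    qed
    have "(\<one>\<^bsub>B\<^esub>, \<one>\<^bsub>D\<^esub>) \<in> G" using subgroup.one_closed[OF partial_hom_subgroup] by simp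
    then show "(b, d) \<in> ?G'" using memI[of "\<one>\<^bsub>B\<^esub>" "\<one>\<^bsub>D\<^esub>" 1] b d(1) by simp
  qed
qed

end

lemma partial_hom_graph:
  assumes A: "subgroup A B" and f: "f \<in> hom (B\<lparr>carrier := A\<rparr>) D"
  shows "partial_hom B D ((\<lambda>a. (a, f a)) ` A)"
proof -
  interpret A: group "B\<lparr>carrier := A\<rparr>" by (rule B.subgroup_imp_group[OF A])
  interpret f: group_hom "B\<lparr>carrier := A\<rparr>" D f
    by (intro group_hom.intro group_hom_axioms.intro A.is_group D.is_group f)
  let ?graph = "(\<lambda>a. (a, f a)) ` A"
  have f_inv: "f (inv\<^bsub>B\<^esub> a) = inv\<^bsub>D\<^esub> f a" if "a \<in> A" for a
    using f.hom_inv[of a] B.m_inv_consistent[OF A that] that by simp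
  have "subgroup ?graph (B \<times>\<times> D)"
  proof (rule product.subgroupI)
    show "?graph \<noteq> {}" using subgroup.one_closed[OF A] by blast
    show "inv\<^bsub>B \<times>\<times> D\<^esub> x \<in> ?graph" if "x \<in> ?graph" for x
      using that subgroup.mem_carrier[OF A] f.hom_closed subgroup.m_inv_closed[OF A]
      by (auto simp: inv_DirProd B.is_group D.is_group simp flip: f_inv)
    show "x \<otimes>\<^bsub>B \<times>\<times> D\<^esub> y \<in> ?graph" if "x \<in> ?graph" "y \<in> ?graph" for x y
      using that f.hom_mult subgroup.m_closed[OF A] by (auto intro!: image_eqI)
  qed (use subgroup.mem_carrier[OF A] f.hom_closed in auto)
  moreover have "f \<one>\<^bsub>B\<^esub> = \<one>\<^bsub>D\<^esub>" using f.hom_one by simp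
  ultimately show ?thesis by (auto simp: partial_hom_def)
qed

lemma partial_hom_maximal:
  assumes "partial_hom B D H"
  obtains G where "partial_hom B D G" "H \<subseteq> G" "\<And>G'. partial_hom B D G' \<Longrightarrow> G \<subseteq> G' \<Longrightarrow> G' = G"
proof -
  let ?\<G> = "{G. partial_hom B D G \<and> H \<subseteq> G}"
  have "\<exists>G\<in>?\<G>. \<forall>G'\<in>?\<G>. G \<subseteq> G' \<longrightarrow> G' = G"
  proof (rule subset_Zorn_nonempty)
    fix \<C> assume "\<C> \<noteq> {}" and chain: "subset.chain ?\<G> \<C>"
    have "subset.chain {H. subgroup H (B \<times>\<times> D)} \<C>" and "\<C> \<subseteq> ?\<G>" using chain
      by (auto simp: subset_chain_def partial_hom_def)
    have "subgroup (\<Union>\<C>) (B \<times>\<times> D)"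
      by (rule product.subgroup_chain_Union) fact+
    moreover have "H \<subseteq> \<Union>\<C>" using \<open>\<C> \<noteq> {}\<close> \<open>\<C> \<subseteq> ?\<G>\<close> by auto
    moreover have "z = \<one>\<^bsub>D\<^esub>" if z: "(\<one>\<^bsub>B\<^esub>, z) \<in> \<Union>\<C>" for z
    proof -
      obtain G where "G \<in> \<C>" "(\<one>\<^bsub>B\<^esub>, z) \<in> G" using z by blast
      moreover from this have "partial_hom B D G" using \<open>\<C> \<subseteq> ?\<G>\<close> by auto
      ultimately show ?thesis by (simp add: partial_hom_def)
    qed
    ultimately show "\<Union>\<C> \<in> ?\<G>" by (simp add: partial_hom_def)
  qed (use assms in blast)
  then obtain G where "G \<in> ?\<G>" "\<forall>G'\<in>?\<G>. G \<subseteq> G' \<longrightarrow> G' = G" by (rule bexE)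
  then show thesis using that[of G] by auto
qed

theorem divisible_group_extension:
  assumes D: "divisible_group D" and A: "subgroup A B" and f: "f \<in> hom (B\<lparr>carrier := A\<rparr>) D"
  obtains g where "g \<in> hom B D" "\<And>a. a \<in> A \<Longrightarrow> g a = f a"
proof -
  obtain G where G: "partial_hom B D G" "(\<lambda>a. (a, f a)) ` A \<subseteq> G"
    and maximal: "\<And>G'. partial_hom B D G' \<Longrightarrow> G \<subseteq> G' \<Longrightarrow> G' = G"
    by (rule partial_hom_maximal[OF partial_hom_graph[OF A f]]) blast
  have "\<exists>d. (b, d) \<in> G" if b: "b \<in> carrier B" for b
  proof -
    obtain G' d where "partial_hom B D G'" "G \<subseteq> G'" "(b, d) \<in> G'"
      using partial_hom_adjoin[OF G(1) D b] .
    then show ?thesis using maximal by blast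
  qed
  then obtain g where g: "\<And>b. b \<in> carrier B \<Longrightarrow> (b, g b) \<in> G" by metis
  show thesis
  proof (rule that[of g])
    show "g \<in> hom B D"
    proof (rule homI)
      show "g x \<in> carrier D" if "x \<in> carrier B" for x
        using partial_hom_closed(2)[OF G(1) g[OF that]] .
      show "g (x \<otimes>\<^bsub>B\<^esub> y) = g x \<otimes>\<^bsub>D\<^esub> g y" if "x \<in> carrier B" "y \<in> carrier B" for x y
        using that by (intro partial_hom_unique[OF G(1) g] partial_hom_mult[OF G(1) g g]) simp_all
    qed
    show "g a = f a" if "a \<in> A" for a
      by (rule partial_hom_unique[OF G(1) g[OF subgroup.mem_carrier[OF A that]]])
        (use that G(2) in blast)
  qed
qed

end

section \<open>Divisible hulls\<close>

definition rational_space :: "('a \<Rightarrow>\<^sub>0 rat) monoid"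
  where "rational_space = \<lparr>carrier = UNIV, monoid.mult = (+), one = 0\<rparr>"

lemma rational_space_simps [simp]:
  "carrier rational_space = UNIV" "p \<otimes>\<^bsub>rational_space\<^esub> q = p + q" "\<one>\<^bsub>rational_space\<^esub> = 0"
  by (simp_all add: rational_space_def)

lemma divisible_rational_space: "divisible_group (rational_space :: ('a \<Rightarrow>\<^sub>0 rat) monoid)"
  unfolding divisible_group_def
proof (intro conjI allI ballI impI)
  show "comm_group (rational_space :: ('a \<Rightarrow>\<^sub>0 rat) monoid)"
    by (rule comm_groupI) (auto simp: algebra_simps intro: exI[of _ "- _"])
  fix n :: nat and p :: "'a \<Rightarrow>\<^sub>0 rat" assume "0 < n"
  have power: "Poly_Mapping.lookup (q [^]\<^bsub>rational_space\<^esub> k) i = of_nat k * Poly_Mapping.lookup q i"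
    for q :: "'a \<Rightarrow>\<^sub>0 rat" and k :: nat and i
    by (induction k) (simp_all add: nat_pow_def lookup_add algebra_simps)
  have "Poly_Mapping.map (\<lambda>x. x / of_nat n) p [^]\<^bsub>rational_space\<^esub> n = p"
    using \<open>0 < n\<close> by (intro poly_mapping_eqI) (simp add: power Poly_Mapping.map.rep_eq when_def)
  then show "\<exists>q\<in>carrier rational_space. q [^]\<^bsub>rational_space\<^esub> n = p" by auto
qed

lemma divisible_FactGroup:
  assumes "divisible_group G" "subgroup N G"
  shows "divisible_group (G Mod N)"
proof -
  interpret comm_group G using assms(1) by (simp add: divisible_group_def)
  have N: "N \<lhd> G" using assms(2) by (simp add: normal_iff_subgroup)
  interpret Q: comm_group "G Mod N" by (rule abelian_FactGroup[OF assms(2)])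
  interpret q: group_hom G "G Mod N" "\<lambda>x. N #>\<^bsub>G\<^esub> x"
    by (intro group_hom.intro group_hom_axioms.intro is_group Q.is_group
        normal.r_coset_hom_Mod[OF N])
  have "\<exists>y\<in>carrier (G Mod N). y [^]\<^bsub>G Mod N\<^esub> n = c"
    if n: "0 < n" and c: "c \<in> carrier (G Mod N)" for n :: nat and c
  proof -
    obtain x where x: "x \<in> carrier G" "c = N #>\<^bsub>G\<^esub> x"
      using c by (auto simp: FactGroup_def RCOSETS_def)
    then obtain y where "y \<in> carrier G" "y [^]\<^bsub>G\<^esub> n = x"
      using assms(1) n by (auto simp: divisible_group_def)
    then show ?thesis using x(2) q.hom_nat_pow[of y n] q.hom_closed[of y] by metis
  qed
  then show ?thesis using Q.comm_group_axioms by (simp add: divisible_group_def)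
qed

lemma group_hom_eq_iff:
  assumes "group_hom G H h" "x \<in> carrier G" "y \<in> carrier G"
  shows "h x = h y \<longleftrightarrow> x \<otimes>\<^bsub>G\<^esub> inv\<^bsub>G\<^esub> y \<in> kernel G H h"
proof -
  interpret group_hom G H h by fact
  have "h x \<otimes>\<^bsub>H\<^esub> inv\<^bsub>H\<^esub> h y = \<one>\<^bsub>H\<^esub> \<longleftrightarrow> h x = h y"
    using assms(2,3) H.inv_solve_right'[of "\<one>\<^bsub>H\<^esub>" "h x" "h y"] by auto
  then show ?thesis using assms(2,3) by (simp add: kernel_def)
qed

lemma image_kernel_rcos_eq_iff:
  assumes V: "comm_group V" and e: "group_hom F V e" and inj: "inj_on e (carrier F)"
    and h: "group_hom F X h" and p: "p \<in> carrier F" "p' \<in> carrier F"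
  shows "e ` kernel F X h #>\<^bsub>V\<^esub> e p = e ` kernel F X h #>\<^bsub>V\<^esub> e p' \<longleftrightarrow> h p = h p'"
proof -
  interpret V: comm_group V by (rule V)
  interpret e: group_hom F V e by (rule e)
  interpret h: group_hom F X h by (rule h)
  let ?K = "e ` kernel F X h"
  have K: "subgroup ?K V" by (intro e.subgroup_img_is_subgroup h.subgroup_kernel)
  interpret q: group_hom F "V Mod ?K" "\<lambda>p. ?K #>\<^bsub>V\<^esub> e p"
    using hom_compose[OF e.homh normal.r_coset_hom_Mod[of ?K V]] K
    by (intro group_hom.intro group_hom_axioms.intro e.G.is_group comm_group.axioms(2)
        V.abelian_FactGroup[OF K])
      (simp add: comp_def V.normal_iff_subgroup)
  have "?K #>\<^bsub>V\<^esub> e p = ?K \<longleftrightarrow> p \<in> kernel F X h" if "p \<in> carrier F" for p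
  proof -
    have "?K #>\<^bsub>V\<^esub> e p = ?K \<longleftrightarrow> e p \<in> ?K"
      using V.rcos_self[OF e.hom_closed[OF that] K] V.coset_join2[OF e.hom_closed[OF that] K]
      by blast
    also have "\<dots> \<longleftrightarrow> p \<in> kernel F X h"
      using inj_on_image_mem_iff[OF inj that, of "kernel F X h"] by (auto simp: kernel_def)
    finally show ?thesis .
  qed
  then have "kernel F (V Mod ?K) (\<lambda>p. ?K #>\<^bsub>V\<^esub> e p) = kernel F X h" by (auto simp: kernel_def)
  then show ?thesis
    using group_hom_eq_iff[OF h p] group_hom_eq_iff[OF q.group_hom_axioms p] by simp
qed

lemma free_Abelian_group_rational_embedding:
  fixes A :: "'a set"
  shows "\<exists>e. group_hom (free_Abelian_group A) (rational_space :: ('a \<Rightarrow>\<^sub>0 rat) monoid) e \<and> inj e"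
proof -
  let ?V = "rational_space :: ('a \<Rightarrow>\<^sub>0 rat) monoid"
  interpret V: comm_group ?V
    using divisible_rational_space[where 'a = 'a] by (simp add: divisible_group_def)
  define e :: "('a \<Rightarrow>\<^sub>0 int) \<Rightarrow> ('a \<Rightarrow>\<^sub>0 rat)" where "e = Poly_Mapping.map of_int"
  have lookup_e: "Poly_Mapping.lookup (e p) i = of_int (Poly_Mapping.lookup p i)" for p i
    by (simp add: e_def Poly_Mapping.map.rep_eq when_def)
  have "inj e" by (rule injI) (metis lookup_e of_int_eq_iff poly_mapping_eqI)
  moreover have "group_hom (free_Abelian_group A) ?V e"
    by (intro group_hom.intro group_hom_axioms.intro group_free_Abelian_group V.is_group homI)
      (auto intro: poly_mapping_eqI simp: lookup_e lookup_add)
  ultimately show ?thesis by blast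
qed

text \<open>\<open>X\<close> is the free abelian group on its elements modulo relations. Enlarging the free group to a
  rational vector space keeps the relations.\<close>

theorem divisible_hull:
  fixes X :: "('a, 'b) monoid_scheme"
  assumes "comm_group X"
  obtains D :: "('a \<Rightarrow>\<^sub>0 rat) set monoid" and \<delta>
  where "divisible_group D" "\<delta> \<in> hom X D" "inj_on \<delta> (carrier X)"
    "\<And>c. c \<in> carrier D \<Longrightarrow> c \<noteq> {}" "\<And>c c'. c \<in> carrier D \<Longrightarrow> c' \<in> carrier D \<Longrightarrow> c \<inter> c' \<noteq> {} \<Longrightarrow> c = c'"
proof -
  interpret X: comm_group X by fact
  let ?F = "free_Abelian_group (carrier X)" and ?V = "rational_space :: ('a \<Rightarrow>\<^sub>0 rat) monoid"
  interpret V: comm_group ?V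
    using divisible_rational_space[where 'a = 'a] by (simp add: divisible_group_def)
  obtain h where h: "h \<in> hom ?F X" "\<And>x. x \<in> carrier X \<Longrightarrow> h (frag_of x) = x"
    using X.free_Abelian_group_universal[of "\<lambda>x. x" "carrier X"] by auto
  interpret h: group_hom ?F X h
    by (intro group_hom.intro group_hom_axioms.intro group_free_Abelian_group X.is_group h(1))
  obtain e where "group_hom ?F ?V e" and inj: "inj e"
    using free_Abelian_group_rational_embedding by blast
  then interpret e: group_hom ?F ?V e by simp
  define K where "K = e ` kernel ?F X h"
  have K: "subgroup K ?V"
    unfolding K_def by (intro e.subgroup_img_is_subgroup h.subgroup_kernel)
  have eq_iff: "K #>\<^bsub>?V\<^esub> e p = K #>\<^bsub>?V\<^esub> e p' \<longleftrightarrow> h p = h p'"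
    if "p \<in> carrier ?F" "p' \<in> carrier ?F" for p p'
    unfolding K_def using that
    by (intro image_kernel_rcos_eq_iff V.comm_group_axioms e.group_hom_axioms h.group_hom_axioms
        inj_on_subset[OF inj]) simp_all
  let ?\<delta> = "\<lambda>x. K #>\<^bsub>?V\<^esub> e (frag_of x)"
  show thesis
  proof (rule that[of "?V Mod K" ?\<delta>])
    show "divisible_group (?V Mod K)" by (rule divisible_FactGroup[OF divisible_rational_space K])
    have frag: "frag_of x \<in> carrier ?F" if "x \<in> carrier X" for x using that by simp
    have rcos_hom: "(\<lambda>v. K #>\<^bsub>?V\<^esub> v) \<in> hom ?V (?V Mod K)"
      using K by (intro normal.r_coset_hom_Mod) (simp add: V.normal_iff_subgroup)
    show "?\<delta> \<in> hom X (?V Mod K)"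
    proof (rule homI)
      fix x y assume xy: "x \<in> carrier X" "y \<in> carrier X"
      have "?\<delta> (x \<otimes>\<^bsub>X\<^esub> y) = K #>\<^bsub>?V\<^esub> e (frag_of x \<otimes>\<^bsub>?F\<^esub> frag_of y)"
        using xy h(2) h.hom_mult[OF frag frag, of x y] h.G.m_closed[OF frag frag, of x y]
        by (subst eq_iff) (simp_all add: frag)
      also have "\<dots> = ?\<delta> x \<otimes>\<^bsub>?V Mod K\<^esub> ?\<delta> y"
        using hom_mult[OF rcos_hom, of "e (frag_of x)" "e (frag_of y)"] e.hom_mult[OF frag frag] xy
        by simp
      finally show "?\<delta> (x \<otimes>\<^bsub>X\<^esub> y) = ?\<delta> x \<otimes>\<^bsub>?V Mod K\<^esub> ?\<delta> y" .
    qed (use hom_in_carrier[OF rcos_hom] in simp)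
    show "inj_on ?\<delta> (carrier X)" by (rule inj_onI) (metis eq_iff frag h(2))
    show "c \<noteq> {}" if "c \<in> carrier (?V Mod K)" for c
      using that V.rcosets_part_G K subgroup.rcosets_non_empty[OF K] by (simp add: FactGroup_def)
    show "c = c'" if "c \<in> carrier (?V Mod K)" "c' \<in> carrier (?V Mod K)" "c \<inter> c' \<noteq> {}" for c c'
      using that V.rcos_disjoint[OF K] by (auto simp: FactGroup_def pairwise_def disjnt_def)
  qed
qed

section \<open>Existence of injective resolutions\<close>

definition coinduced_module ::
    "('r, 'x) ring_scheme \<Rightarrow> ('d, 'y) monoid_scheme \<Rightarrow> ('r, 'r \<Rightarrow> 'd) module"
  where "coinduced_module R D =
    \<lparr>carrier = {\<phi> \<in> hom (add_monoid R) D. \<forall>r. r \<notin> carrier R \<longrightarrow> \<phi> r = \<one>\<^bsub>D\<^esub>},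
     monoid.mult = undefined, one = undefined, ring.zero = (\<lambda>_. \<one>\<^bsub>D\<^esub>),
     add = (\<lambda>\<phi> \<psi> r. \<phi> r \<otimes>\<^bsub>D\<^esub> \<psi> r),
     smult = (\<lambda>a \<phi> r. if r \<in> carrier R then \<phi> (r \<otimes>\<^bsub>R\<^esub> a) else \<one>\<^bsub>D\<^esub>)\<rparr>"

lemma coinduced_module_simps [simp]:
  "\<zero>\<^bsub>coinduced_module R D\<^esub> = (\<lambda>_. \<one>\<^bsub>D\<^esub>)"
  "\<phi> \<oplus>\<^bsub>coinduced_module R D\<^esub> \<psi> = (\<lambda>r. \<phi> r \<otimes>\<^bsub>D\<^esub> \<psi> r)"
  "a \<odot>\<^bsub>coinduced_module R D\<^esub> \<phi> = (\<lambda>r. if r \<in> carrier R then \<phi> (r \<otimes>\<^bsub>R\<^esub> a) else \<one>\<^bsub>D\<^esub>)"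
  by (simp_all add: coinduced_module_def)

lemma coinduced_module_carrier:
  "\<phi> \<in> carrier (coinduced_module R D) \<longleftrightarrow>
    (\<forall>r\<in>carrier R. \<phi> r \<in> carrier D) \<and> (\<forall>r. r \<notin> carrier R \<longrightarrow> \<phi> r = \<one>\<^bsub>D\<^esub>) \<and>
    (\<forall>r\<in>carrier R. \<forall>s\<in>carrier R. \<phi> (r \<oplus>\<^bsub>R\<^esub> s) = \<phi> r \<otimes>\<^bsub>D\<^esub> \<phi> s)"
  by (auto simp: coinduced_module_def hom_def)

locale coinduced = cring R + D: comm_group D
  for R :: "('r, 'x) ring_scheme" (structure) and D :: "('d, 'y) monoid_scheme"
begin

abbreviation "E \<equiv> coinduced_module R D"

lemma coinduced_closed: "\<phi> \<in> carrier E \<Longrightarrow> \<phi> r \<in> carrier D"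
  by (cases "r \<in> carrier R") (auto simp: coinduced_module_carrier)

lemma coinduced_module: "module R E"
proof (intro moduleI abelian_groupI is_cring)
  fix \<phi> assume \<phi>: "\<phi> \<in> carrier E"
  have "(\<lambda>r. inv\<^bsub>D\<^esub> \<phi> r) \<in> carrier E"
    using \<phi> by (auto simp: coinduced_module_carrier D.inv_mult)
  moreover have "(\<lambda>r. inv\<^bsub>D\<^esub> \<phi> r) \<oplus>\<^bsub>E\<^esub> \<phi> = \<zero>\<^bsub>E\<^esub>"
    using coinduced_closed[OF \<phi>] by (simp add: fun_eq_iff)
  ultimately show "\<exists>\<psi>\<in>carrier E. \<psi> \<oplus>\<^bsub>E\<^esub> \<phi> = \<zero>\<^bsub>E\<^esub>" by blast
  show "\<zero>\<^bsub>E\<^esub> \<oplus>\<^bsub>E\<^esub> \<phi> = \<phi>" using coinduced_closed[OF \<phi>] by simp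
next
  fix \<phi> \<psi> \<chi> assume "\<phi> \<in> carrier E" "\<psi> \<in> carrier E" "\<chi> \<in> carrier E"
  note closed [simp] = this[THEN coinduced_closed]
  show "\<phi> \<oplus>\<^bsub>E\<^esub> \<psi> \<oplus>\<^bsub>E\<^esub> \<chi> = \<phi> \<oplus>\<^bsub>E\<^esub> (\<psi> \<oplus>\<^bsub>E\<^esub> \<chi>)" by (simp add: D.m_assoc)
next
  fix \<phi> \<psi> assume \<phi>\<psi>: "\<phi> \<in> carrier E" "\<psi> \<in> carrier E"
  note closed [simp] = \<phi>\<psi>[THEN coinduced_closed]
  show "\<phi> \<oplus>\<^bsub>E\<^esub> \<psi> \<in> carrier E"
    using \<phi>\<psi> by (simp add: coinduced_module_carrier D.m_ac)
  show "\<phi> \<oplus>\<^bsub>E\<^esub> \<psi> = \<psi> \<oplus>\<^bsub>E\<^esub> \<phi>" by (simp add: D.m_comm)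
qed (auto simp: coinduced_module_carrier fun_eq_iff l_distr r_distr m_ac)

lemma coinduced_hom:
  assumes "module R B" and g: "g \<in> hom (add_monoid B) D"
  shows "(\<lambda>b r. if r \<in> carrier R then g (r \<odot>\<^bsub>B\<^esub> b) else \<one>\<^bsub>D\<^esub>) \<in> mod_hom R B E"
proof -
  interpret B: module R B by fact
  have g: "g x \<in> carrier D" "g (x \<oplus>\<^bsub>B\<^esub> y) = g x \<otimes>\<^bsub>D\<^esub> g y" if "x \<in> carrier B" "y \<in> carrier B" for x y
    using g that by (auto simp: hom_def)
  show ?thesis
    by (auto simp: mod_hom_def coinduced_module_carrier fun_eq_iff g B.smult_l_distr B.smult_r_distr
        B.smult_assoc1)
qed

lemma coinduced_module_extension:
  assumes "divisible_group D" and B: "module R B" and A: "submodule A R B"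
    and f: "f \<in> mod_hom R (B\<lparr>carrier := A\<rparr>) E"
  obtains h where "h \<in> mod_hom R B E" "\<And>x. x \<in> A \<Longrightarrow> h x = f x"
proof -
  interpret B: module R B by fact
  interpret comm_group_pair "add_monoid B" D
    by (intro comm_group_pair.intro B.M.a_comm_group D.comm_group_axioms)
  note fD = f[unfolded mod_hom_def, simplified] and AE = B.submoduleE[OF A]
  have "subgroup A (add_monoid B)" by (rule submodule.axioms(1)[OF A])
  moreover have "(\<lambda>x. f x \<one>) \<in> hom (add_monoid B\<lparr>carrier := A\<rparr>) D"
    using fD by (auto simp: hom_def Pi_def intro: coinduced_closed)
  ultimately obtain g where g: "g \<in> hom (add_monoid B) D" "\<And>x. x \<in> A \<Longrightarrow> g x = f x \<one>"
    using divisible_group_extension[OF assms(1)] by metis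
  let ?h = "\<lambda>b r. if r \<in> carrier R then g (r \<odot>\<^bsub>B\<^esub> b) else \<one>\<^bsub>D\<^esub>"
  show thesis
  proof (rule that[of ?h])
    show "?h \<in> mod_hom R B E" by (rule coinduced_hom[OF B g(1)])
    fix x assume x: "x \<in> A"
    then have "f x \<in> carrier E" using fD by blast
    moreover have "g (r \<odot>\<^bsub>B\<^esub> x) = f x r" if r: "r \<in> carrier R" for r
      using g(2)[OF AE(4)[OF r x]] fD r x by simp
    ultimately show "?h x = f x" by (auto simp: coinduced_module_carrier)
  qed
qed

end

subsection \<open>Coding in a fixed type\<close>

lemma infinite_imp_inj_lists:
  assumes "infinite (UNIV :: 'a set)"
  obtains f :: "'a list \<Rightarrow> 'a" where "inj f"
proof -
  obtain f :: "'a list \<Rightarrow> 'a" where "bij_betw f (lists (UNIV :: 'a set)) UNIV"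
    using lists_infinite_bij_betw[OF assms] by blast
  then show thesis using that by (auto simp: bij_betw_def)
qed

lemma infinite_imp_inj_poly_mapping_rat:
  assumes "infinite (UNIV :: 'a set)"
  obtains f :: "('a \<Rightarrow>\<^sub>0 rat) \<Rightarrow> 'a" where "inj f"
proof -
  have "(UNIV :: ('a \<Rightarrow>\<^sub>0 rat) set) \<lesssim>
      {f :: 'a \<Rightarrow> rat. f ` UNIV \<subseteq> UNIV \<and> {x. f x \<noteq> 0} \<subseteq> UNIV \<and> finite {x. f x \<noteq> 0}}"
    unfolding lepoll_def
    by (intro exI[of _ Poly_Mapping.lookup]) (auto intro: inj_onI simp: poly_mapping_eqI)
  also have "\<dots> \<lesssim> Fpow ((UNIV :: 'a set) \<times> (UNIV :: rat set))"
    by (rule lepoll_restricted_funspace)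
  also have "\<dots> \<approx> (UNIV :: 'a set) \<times> (UNIV :: rat set)"
    by (rule eqpoll_Fpow) (use assms finite_cartesian_productD1 in blast)
  also have "\<dots> \<lesssim> (UNIV :: 'a set)"
  proof -
    have "|UNIV :: rat set| \<le>o |UNIV :: 'a set|"
      using infinite_iff_card_of_countable[of "UNIV :: rat set" "UNIV :: 'a set"] assms
      by (simp add: infinite_UNIV_char_0)
    then show ?thesis
      unfolding lepoll_def card_of_ordLeq
      by (intro card_of_Times_ordLeq_infinite card_of_mono1 subset_refl assms)
  qed
  finally show thesis using that by (auto simp: lepoll_def)
qed

lemma infinite_imp_inj_fun_fun:
  assumes "infinite (UNIV :: 'k set)"
  obtains f :: "('r \<Rightarrow> 'r \<Rightarrow> 'k) \<Rightarrow> 'r \<Rightarrow> 'k" where "inj f"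
proof (cases "finite (UNIV :: 'r set)")
  case True
  obtain l :: "'k list \<Rightarrow> 'k" where l: "inj l" using infinite_imp_inj_lists[OF assms] .
  obtain xs where xs: "set xs = (UNIV :: 'r set)" using finite_list[OF True] by blast
  have "inj (\<lambda>(g :: 'r \<Rightarrow> 'r \<Rightarrow> 'k) r. l (map (g r) xs))"
  proof (rule injI)
    fix g h :: "'r \<Rightarrow> 'r \<Rightarrow> 'k" assume "(\<lambda>r. l (map (g r) xs)) = (\<lambda>r. l (map (h r) xs))"
    then have "map (g r) xs = map (h r) xs" for r by (meson fun_cong injD[OF l])
    then show "g = h" using xs by (auto simp: fun_eq_iff)
  qed
  then show ?thesis by (rule that)
next
  case False
  obtain l :: "'r list \<Rightarrow> 'r" where l: "inj l" using infinite_imp_inj_lists[OF False] .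
  have "inj (\<lambda>(g :: 'r \<Rightarrow> 'r \<Rightarrow> 'k) x. g (inv_into UNIV l x ! 0) (inv_into UNIV l x ! 1))"
  proof (rule injI)
    fix g h :: "'r \<Rightarrow> 'r \<Rightarrow> 'k"
    assume eq: "(\<lambda>x. g (inv_into UNIV l x ! 0) (inv_into UNIV l x ! 1)) =
      (\<lambda>x. h (inv_into UNIV l x ! 0) (inv_into UNIV l x ! 1))"
    have "g a b = h a b" for a b using fun_cong[OF eq, of "l [a, b]"] l by simp
    then show "g = h" by (simp add: fun_eq_iff)
  qed
  then show ?thesis by (rule that)
qed

lemma injective_module_image:
  fixes c :: "'d \<Rightarrow> 'u" and E :: "('r, 'd) module"
  assumes E: "module R E" and c: "inj_on c (carrier E)"
    and ext: "\<And>(B :: ('r, 'u) module) A f. module R B \<Longrightarrow> submodule A R B \<Longrightarrow>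
      f \<in> mod_hom R (B\<lparr>carrier := A\<rparr>) E \<Longrightarrow> \<exists>g\<in>mod_hom R B E. \<forall>x\<in>A. g x = f x"
  shows "injective_module R (image_module E c)"
  unfolding injective_module_def
proof (intro conjI allI impI)
  interpret c: module_homomorphism R E "image_module E c" c by (rule image_module(1)[OF E c])
  show "module R (image_module E c)" by (rule c.N.module_axioms)
  note bij = image_module(2)[OF E c]
  fix B :: "('r, 'u) module" and A f
  assume "module R B \<and> submodule A R B \<and> f \<in> mod_hom R (B\<lparr>carrier := A\<rparr>) (image_module E c)"
  then have B: "module R B" "submodule A R B"
    and f: "f \<in> mod_hom R (B\<lparr>carrier := A\<rparr>) (image_module E c)"
    by auto
  have "\<exists>g\<in>mod_hom R B E. \<forall>x\<in>A. g x = inv_into (carrier E) c (f x)"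
    by (rule ext[OF B mod_hom_comp[OF f mod_hom_inv_into[OF E c.hom bij]]])
  then obtain g where g: "g \<in> mod_hom R B E" "\<And>x. x \<in> A \<Longrightarrow> g x = inv_into (carrier E) c (f x)"
    by auto
  have "c (g x) = f x" if "x \<in> A" for x
  proof -
    have "f x \<in> carrier (image_module E c)" using f that by (auto simp: mod_hom_def)
    then show ?thesis using g(2)[OF that] bij_betw_inv_into_right[OF bij] by simp
  qed
  then show "\<exists>g\<in>mod_hom R B (image_module E c). \<forall>x\<in>A. g x = f x"
    using mod_hom_comp[OF g(1) c.hom] by (intro bexI[of _ "\<lambda>x. c (g x)"]) simp_all
qed

lemma injective_embedding:
  fixes X :: "('r, 'u) module" and code :: "('r \<Rightarrow> ('u \<Rightarrow>\<^sub>0 rat)) \<Rightarrow> 'u"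
  assumes X: "module R X" and code: "inj code"
  obtains E :: "('r, 'u) module" and e
  where "injective_module R E" "e \<in> mod_hom R X E" "inj_on e (carrier X)"
proof -
  interpret X: module R X by fact
  obtain D :: "('u \<Rightarrow>\<^sub>0 rat) set monoid" and \<delta>
    where D: "divisible_group D" and \<delta>: "\<delta> \<in> hom (add_monoid X) D" "inj_on \<delta> (carrier X)"
      and nonempty: "\<And>c. c \<in> carrier D \<Longrightarrow> c \<noteq> {}"
      and disjoint: "\<And>c c'. c \<in> carrier D \<Longrightarrow> c' \<in> carrier D \<Longrightarrow> c \<inter> c' \<noteq> {} \<Longrightarrow> c = c'"
    using divisible_hull[OF X.M.a_comm_group] by auto
  interpret coinduced R D
    using D by (intro coinduced.intro X.R.is_cring) (simp add: divisible_group_def)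
  let ?c = "\<lambda>\<phi>. code (\<lambda>r. SOME p. p \<in> \<phi> r)"
  have c: "inj_on ?c (carrier E)"
  proof (rule inj_onI)
    fix \<phi> \<psi> assume \<phi>\<psi>: "\<phi> \<in> carrier E" "\<psi> \<in> carrier E" and "?c \<phi> = ?c \<psi>"
    then have "(\<lambda>r. SOME p. p \<in> \<phi> r) = (\<lambda>r. SOME p. p \<in> \<psi> r)" by (intro injD[OF code])
    then have "(SOME p. p \<in> \<phi> r) = (SOME p. p \<in> \<psi> r)" for r by (rule fun_cong)
    moreover have "(SOME p. p \<in> \<phi> r) \<in> \<phi> r" if "\<phi> \<in> carrier E" for \<phi> r
      using nonempty[OF coinduced_closed[OF that]] some_in_eq by blast
    ultimately have "\<phi> r \<inter> \<psi> r \<noteq> {}" for r using \<phi>\<psi> by (metis disjoint_iff)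
    then show "\<phi> = \<psi>" using disjoint coinduced_closed \<phi>\<psi> by (intro ext) blast
  qed
  interpret c: module_homomorphism R E "image_module E ?c" ?c
    by (rule image_module(1)[OF coinduced_module c])
  let ?e = "\<lambda>x r. if r \<in> carrier R then \<delta> (r \<odot>\<^bsub>X\<^esub> x) else \<one>\<^bsub>D\<^esub>"
  have e: "?e \<in> mod_hom R X E" by (rule coinduced_hom[OF X \<delta>(1)])
  show thesis
  proof (rule that)
    show "injective_module R (image_module E ?c)"
      by (rule injective_module_image[OF coinduced_module c])
        (metis coinduced_module_extension[OF D])
    show "(\<lambda>x. ?c (?e x)) \<in> mod_hom R X (image_module E ?c)" by (rule mod_hom_comp[OF e c.hom])
    show "inj_on (\<lambda>x. ?c (?e x)) (carrier X)"
    proof (rule inj_onI)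
      fix x y assume xy: "x \<in> carrier X" "y \<in> carrier X" and eq: "?c (?e x) = ?c (?e y)"
      have "?e x \<in> carrier E" "?e y \<in> carrier E" using e xy unfolding mod_hom_def by blast+
      then have "?e x = ?e y" using eq by (intro inj_onD[OF c])
      then have "\<delta> x = \<delta> y" using fun_cong[of "?e x" "?e y" "\<one>\<^bsub>R\<^esub>"] xy by simp
      then show "x = y" using inj_onD[OF \<delta>(2)] xy by blast
    qed
  qed
qed

lemma quotient_on_representatives:
  fixes E :: "('r, 'u) module"
  assumes E: "module R E" and G: "submodule G R E"
  obtains C :: "('r, 'u) module" and q
  where "module_homomorphism R E C q" "q ` carrier E = carrier C" "G = {x \<in> carrier E. q x = \<zero>\<^bsub>C\<^esub>}"
proof -
  interpret E: module R E by fact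
  interpret G: abelian_subgroup G E
    by (rule abelian_subgroupI3[OF additive_subgroup.intro[OF submodule.axioms(1)[OF G]]
          E.M.abelian_group_axioms])
  let ?Q = "quotient_module E G" and ?\<pi> = "\<lambda>x. G +>\<^bsub>E\<^esub> x" and ?rep = "\<lambda>K. SOME x. x \<in> K"
  interpret \<pi>: module_homomorphism R E ?Q ?\<pi> by (rule quotient_module_hom[OF E G])
  have rep: "?\<pi> (?rep (?\<pi> x)) = ?\<pi> x" if "x \<in> carrier E" for x
    using G.a_repr_independence'[OF someI[of "\<lambda>z. z \<in> ?\<pi> x", OF G.a_rcos_self[OF that]] that]
    by simp
  have inj: "inj_on ?rep (carrier ?Q)"
  proof (rule inj_onI)
    fix K K' assume "K \<in> carrier ?Q" "K' \<in> carrier ?Q" and eq: "?rep K = ?rep K'"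
    then obtain x y where "x \<in> carrier E" "K = ?\<pi> x" "y \<in> carrier E" "K' = ?\<pi> y"
      unfolding quotient_module_surj[symmetric] by blast
    then show "K = K'" using rep eq by metis
  qed
  interpret rep: module_homomorphism R ?Q "image_module ?Q ?rep" ?rep
    by (rule image_module(1)[OF \<pi>.N.module_axioms inj])
  have zero_iff: "?rep (?\<pi> x) = \<zero>\<^bsub>image_module ?Q ?rep\<^esub> \<longleftrightarrow> x \<in> G" if "x \<in> carrier E" for x
    using rep.inj_on_iff inj rep.zero \<pi>.closed[OF that] quotient_module_zero_iff[OF E G that]
    by metis
  show thesis
  proof (rule that[of "image_module ?Q ?rep" "\<lambda>x. ?rep (?\<pi> x)"])
    show "module_homomorphism R E (image_module ?Q ?rep) (\<lambda>x. ?rep (?\<pi> x))"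
      by (intro module_homomorphism.intro module_homomorphism_axioms.intro E rep.N.module_axioms
          mod_hom_comp[OF \<pi>.hom rep.hom])
    show "(\<lambda>x. ?rep (?\<pi> x)) ` carrier E = carrier (image_module ?Q ?rep)"
    proof -
      have "?rep ` carrier ?Q = carrier (image_module ?Q ?rep)"
        using image_module(2)[OF \<pi>.N.module_axioms inj] by (simp add: bij_betw_def)
      then show ?thesis unfolding quotient_module_surj[of E G, symmetric] image_image .
    qed
    show "G = {x \<in> carrier E. ?rep (?\<pi> x) = \<zero>\<^bsub>image_module ?Q ?rep\<^esub>}"
      using zero_iff E.submodule_subset[OF G] by blast
  qed
qed

lemma resolution_univ_code:
  obtains code :: "('r \<Rightarrow> (('r, 'm) resolution_univ \<Rightarrow>\<^sub>0 rat)) \<Rightarrow> ('r, 'm) resolution_univ"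
      where "inj code"
proof -
  have "inj (\<lambda>n :: nat. (n, undefined :: 'm))" by (simp add: inj_def)
  then have infinite: "infinite (UNIV :: (nat \<times> 'm) set)"
    by (rule infinite_super[OF subset_UNIV range_inj_infinite])
  have "inj (\<lambda>n :: nat. \<lambda>_ :: 'r. (n, undefined :: 'm))" by (simp add: inj_def fun_eq_iff)
  then have "infinite (UNIV :: ('r, 'm) resolution_univ set)"
    by (rule infinite_super[OF subset_UNIV range_inj_infinite])
  then obtain a :: "(('r, 'm) resolution_univ \<Rightarrow>\<^sub>0 rat) \<Rightarrow> ('r, 'm) resolution_univ" where a: "inj a"
    by (rule infinite_imp_inj_poly_mapping_rat)
  obtain b :: "('r \<Rightarrow> ('r, 'm) resolution_univ) \<Rightarrow> ('r, 'm) resolution_univ" where b: "inj b"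
    using infinite_imp_inj_fun_fun[OF infinite] .
  show thesis
  proof (rule that[of "\<lambda>\<phi>. b (\<lambda>r. a (\<phi> r))"], rule injI)
    fix \<phi> \<psi> :: "'r \<Rightarrow> (('r, 'm) resolution_univ \<Rightarrow>\<^sub>0 rat)" assume "b (\<lambda>r. a (\<phi> r)) = b (\<lambda>r. a (\<psi> r))"
    then have "(\<lambda>r. a (\<phi> r)) = (\<lambda>r. a (\<psi> r))" by (rule injD[OF b])
    then have "a (\<phi> r) = a (\<psi> r)" for r by (rule fun_cong)
    then have "\<phi> r = \<psi> r" for r by (intro injD[OF a])
    then show "\<phi> = \<psi>" by (rule ext)
  qed
qed

definition injective_step ::
  "('r, 'x) ring_scheme \<Rightarrow> ('r, 'u) module \<Rightarrow> ('r, 'u) module \<Rightarrow> ('u \<Rightarrow> 'u) \<Rightarrow> ('r, 'u) module \<Rightarrow>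
    ('u \<Rightarrow> 'u) \<Rightarrow> bool"
  where "injective_step R X E e C q \<longleftrightarrow> injective_module R E \<and> short_exact R X E C e q"

lemma injective_step_exists:
  fixes X :: "('r, 'u) module" and code :: "('r \<Rightarrow> ('u \<Rightarrow>\<^sub>0 rat)) \<Rightarrow> 'u"
  assumes X: "module R X" and "inj code"
  shows "\<exists>E e C q. injective_step R X E e C q"
proof -
  obtain E :: "('r, 'u) module" and e
    where E: "injective_module R E" and e: "e \<in> mod_hom R X E" "inj_on e (carrier X)"
    using injective_embedding[OF assms] .
  interpret e: module_homomorphism R X E e
    by (intro module_homomorphism.intro module_homomorphism_axioms.intro X e)
      (use E in \<open>simp add: injective_module_def\<close>)
  obtain C :: "('r, 'u) module" and q
    where q: "module_homomorphism R E C q" "q ` carrier E = carrier C"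
      "e ` carrier X = {x \<in> carrier E. q x = \<zero>\<^bsub>C\<^esub>}"
    using quotient_on_representatives[OF e.N.module_axioms e.image_submodule[OF e.M.carrier_is_submodule]] .
  have "short_exact R X E C e q"
    by (intro short_exact.intro short_exact_axioms.intro e.module_homomorphism_axioms q e(2))
  then show ?thesis using E by (auto simp: injective_step_def)
qed

lemma injective_resolution_splice:
  assumes M: "module R M" and h: "h \<in> mod_hom R M (X 0)" "bij_betw h (carrier M) (carrier (X 0))"
    and E: "\<And>i. injective_module R (E i)"
    and exact: "\<And>i. short_exact R (X i) (E i) (X (Suc i)) (e i) (q i)"
  shows "injective_resolution R M E (\<lambda>x. e 0 (h x)) (\<lambda>i x. e (Suc i) (q i x))"
proof -
  interpret s: short_exact R "X i" "E i" "X (Suc i)" "e i" "q i" for i by (rule exact)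
  have h_image: "h ` carrier M = carrier (X 0)" using h(2) by (simp add: bij_betw_def)
  have "e i x = \<zero>\<^bsub>E i\<^esub> \<longleftrightarrow> x = \<zero>\<^bsub>X i\<^esub>" if "x \<in> carrier (X i)" for i x
    using s.i.inj_on_iff s.inj s.i.zero that by metis
  then have kernel: "{x \<in> carrier (E i). e (Suc i) (q i x) = \<zero>\<^bsub>E (Suc i)\<^esub>} =
      e i ` carrier (X i)" for i
    unfolding s.exact using s.g.closed by blast
  show ?thesis
    unfolding injective_resolution_def
  proof (intro conjI allI E)
    show "(\<lambda>x. e 0 (h x)) \<in> mod_hom R M (E 0)" by (rule mod_hom_comp[OF h(1) s.i.hom])
    show "(\<lambda>x. e (Suc i) (q i x)) \<in> mod_hom R (E i) (E (Suc i))" for i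
      by (rule mod_hom_comp[OF s.g.hom s.i.hom])
    show "inj_on (\<lambda>x. e 0 (h x)) (carrier M)"
      using comp_inj_on[of h "carrier M" "e 0"] h(2) s.inj[of 0]
      by (simp add: bij_betw_def comp_def)
    show "(\<lambda>x. e 0 (h x)) ` carrier M = {x \<in> carrier (E 0). e (Suc 0) (q 0 x) = \<zero>\<^bsub>E 1\<^esub>}"
      unfolding kernel[of 0, folded One_nat_def] One_nat_def[symmetric] h_image[symmetric]
        image_image ..
    show "(\<lambda>x. e (Suc i) (q i x)) ` carrier (E i) =
        {x \<in> carrier (E (Suc i)). e (Suc (Suc i)) (q (Suc i) x) = \<zero>\<^bsub>E (Suc (Suc i))\<^esub>}" for i
      unfolding kernel s.surj[symmetric] image_image ..
  qed
qed

theorem injective_resolution_exists: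
  fixes M :: "('r, 'm, 'y) module_scheme"
  assumes M: "module R M"
  shows "\<exists>(I :: nat \<Rightarrow> ('r, ('r, 'm) resolution_univ) module) e d. injective_resolution R M I e d"
proof -
  obtain code :: "('r \<Rightarrow> (('r, 'm) resolution_univ \<Rightarrow>\<^sub>0 rat)) \<Rightarrow> ('r, 'm) resolution_univ"
    where "inj code" by (rule resolution_univ_code)
  then have "\<forall>X :: ('r, ('r, 'm) resolution_univ) module. \<exists>E e C q.
      module R X \<longrightarrow> injective_step R X E e C q"
    using injective_step_exists by blast
  then obtain E e C q where step:
    "\<And>X :: ('r, ('r, 'm) resolution_univ) module. module R X \<Longrightarrow>
    injective_step R X (E X) (e X) (C X) (q X)"
    by metis
  let ?h = "\<lambda>x (_ :: 'r). (0 :: nat, x :: 'm)"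
  have h: "inj_on ?h (carrier M)" by (auto simp: inj_on_def fun_eq_iff)
  interpret h: module_homomorphism R M "image_module M ?h" ?h by (rule image_module(1)[OF M h])
  define X where "X i = (C ^^ i) (image_module M ?h)" for i
  have X_Suc: "X (Suc i) = C (X i)" for i by (simp add: X_def)
  have "module R (X i)" for i
  proof (induction i)
    case 0
    show ?case using h.N.module_axioms by (simp add: X_def)
  next
    case (Suc i)
    then interpret short_exact R "X i" "E (X i)" "C (X i)" "e (X i)" "q (X i)"
      using step by (simp add: injective_step_def)
    show ?case unfolding X_Suc by (rule g.N.module_axioms)
  qed
  then have step_X: "injective_module R (E (X i))"
      "short_exact R (X i) (E (X i)) (X (Suc i)) (e (X i)) (q (X i))" for i
    using step[of "X i"] by (simp_all add: injective_step_def X_Suc)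
  have "?h \<in> mod_hom R M (X 0)" "bij_betw ?h (carrier M) (carrier (X 0))"
    using h.hom image_module(2)[OF M h] by (simp_all add: X_def)
  from injective_resolution_splice[OF M this step_X] show ?thesis by blast
qed

section \<open>Local cohomology and Koszul cohomology\<close>

lemma (in module) koszul_vanishes_zero_module:
  assumes "zero_module M" "set ys \<subseteq> carrier R"
  shows "koszul_vanishes R ys M p"
proof -
  interpret koszul R M ys by (rule koszulI[OF assms(2)])
  show ?thesis
    unfolding koszul_vanishes_def
  proof (rule acyclicI)
    fix n w assume "w \<in> cocycles p n"
    then have "w = (\<lambda>_. \<zero>\<^bsub>M\<^esub>)"
      using assms(1) cochain_value[OF cocycles_closed] by (auto simp: zero_module_def fun_eq_iff)
    then show "null p n w" using null_zero[of p n] by simp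
  qed
qed

lemma koszul_vanishes_bij:
  assumes M: "module R M" and N: "module R N"
    and f: "f \<in> mod_hom R M N" "bij_betw f (carrier M) (carrier N)"
    and ys: "set ys \<subseteq> carrier R" and vanishes: "koszul_vanishes R ys M p"
  shows "koszul_vanishes R ys N p"
proof -
  let ?Z = "N\<lparr>carrier := {\<zero>\<^bsub>N\<^esub>}\<rparr>"
  interpret N: module R N by fact
  interpret Z: module R ?Z by (rule N.submodule_module[OF N.zero_submodule])
  have Z_vanishes: "koszul_vanishes R ys ?Z p"
    by (rule Z.koszul_vanishes_zero_module[OF _ ys]) (simp add: zero_module_def)
  interpret short_exact R M N ?Z f "\<lambda>_. \<zero>\<^bsub>N\<^esub>"
  proof (intro short_exact.intro module_homomorphism.intro M N Z.module_axioms
        module_homomorphism_axioms.intro short_exact_axioms.intro f(1))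
    show "(\<lambda>_. \<zero>\<^bsub>N\<^esub>) \<in> mod_hom R N ?Z" by (simp add: mod_hom_def)
    show "(\<lambda>_. \<zero>\<^bsub>N\<^esub>) ` carrier N = carrier ?Z" using N.M.zero_closed by auto
  qed (use f(2) in \<open>simp_all add: bij_betw_def\<close>)
  show ?thesis by (rule koszul_vanishes_middle[OF ys vanishes Z_vanishes])
qed

lemma koszul_vanishes_bij_iff:
  assumes "module R M" "module R N" "f \<in> mod_hom R M N" "bij_betw f (carrier M) (carrier N)"
    and "set ys \<subseteq> carrier R"
  shows "koszul_vanishes R ys M p \<longleftrightarrow> koszul_vanishes R ys N p"
  using koszul_vanishes_bij[OF assms] koszul_vanishes_bij[OF assms(2,1)
      mod_hom_inv_into[OF assms(1,3,4)] bij_betw_inv_into[OF assms(4)] assms(5)] by blast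

locale injective_resolution_koszul = module R M
  for R :: "('r, 'x) ring_scheme" (structure) and M :: "('r, 'm, 'y) module_scheme" +
  fixes ys :: "'r list" and I :: "nat \<Rightarrow> ('r, 'u) module" and e d
  assumes noetherian: "noetherian_ring R" and ys: "set ys \<subseteq> carrier R"
    and resolution: "injective_resolution R M I e d"
begin

lemma injective: "injective_module R (I i)"
  using resolution by (simp add: injective_resolution_def)

sublocale d: module_homomorphism R "I i" "I (Suc i)" "d i" for i
proof (intro module_homomorphism.intro module_homomorphism_axioms.intro)
  show "module R (I i)" "module R (I (Suc i))"
    using injective by (simp_all add: injective_module_def)
  show "d i \<in> mod_hom R (I i) (I (Suc i))" using resolution by (simp add: injective_resolution_def)
qed

definition kernel_module :: "nat \<Rightarrow> ('r, 'u) module"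
  where "kernel_module i = (I i)\<lparr>carrier := {x \<in> carrier (I i). d i x = \<zero>\<^bsub>I (Suc i)\<^esub>}\<rparr>"

lemma kernel_submodule: "submodule {x \<in> carrier (I i). d i x = \<zero>\<^bsub>I (Suc i)\<^esub>} R (I i)"
  using d.preimage_submodule[OF d.M.carrier_is_submodule d.M.zero_submodule, of i] by simp

lemma power_torsion_kernel_module:
  "power_torsion R (kernel_module i) Y = {x \<in> power_torsion R (I i) Y. d i x = \<zero>\<^bsub>I (Suc i)\<^esub>}"
  by (auto simp: power_torsion_def kernel_module_def)

lemma image: "d i ` carrier (I i) = {x \<in> carrier (I (Suc i)). d (Suc i) x = \<zero>\<^bsub>I (Suc (Suc i))\<^esub>}"
  using resolution by (simp add: injective_resolution_def)

lemma short_exact_kernel_modules: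
  "short_exact R (kernel_module i) (I i) (kernel_module (Suc i)) (\<lambda>x. x) (d i)"
proof -
  have "d i \<in> mod_hom R (I i) (kernel_module (Suc i))"
    using image d.hom[of i] by (auto simp: mod_hom_def kernel_module_def)
  moreover have "module R (kernel_module i)" for i
    unfolding kernel_module_def by (rule d.M.submodule_module[OF kernel_submodule])
  ultimately show ?thesis
    using image mod_hom_inclusion[of "carrier (kernel_module i)" "I i" R]
    by (intro short_exact.intro module_homomorphism.intro module_homomorphism_axioms.intro
        short_exact_axioms.intro d.M.module_axioms) (auto simp: kernel_module_def)
qed

lemma koszul_vanishes_kernel_iff:
  "koszul_vanishes R ys (kernel_module 0) p \<longleftrightarrow> koszul_vanishes R ys M p"
proof -
  have e: "e \<in> mod_hom R M (I 0)" "inj_on e (carrier M)" "e ` carrier M = carrier (kernel_module 0)"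
    using resolution by (auto simp: injective_resolution_def kernel_module_def)
  then have "e \<in> mod_hom R M (kernel_module 0)" by (auto simp: mod_hom_def kernel_module_def)
  moreover have "module R (kernel_module 0)"
    unfolding kernel_module_def by (rule d.M.submodule_module[OF kernel_submodule])
  ultimately show ?thesis
    using e koszul_vanishes_bij_iff[OF module_axioms _ _ _ ys, of "kernel_module 0" e p]
    by (simp add: bij_betw_def)
qed

lemma koszul_vanishes_kernel_shift:
  "koszul_vanishes R ys (kernel_module (i + k)) (int j + 1) \<longleftrightarrow>
    koszul_vanishes R ys (kernel_module i) (int (j + k) + 1)"
proof (induction k arbitrary: i)
  case (Suc k)
  interpret short_exact R "kernel_module i" "I i" "kernel_module (Suc i)" "\<lambda>x. x" "d i"
    by (rule short_exact_kernel_modules)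
  have "koszul_vanishes R ys (kernel_module i) (int (j + k) + 1 + 1) \<longleftrightarrow>
      koszul_vanishes R ys (kernel_module (Suc i)) (int (j + k) + 1)"
    by (intro koszul_vanishes_dimension_shift koszul_vanishes_injective noetherian injective ys)
      simp_all
  then show ?case using Suc[of "Suc i"] by (simp add: add.commute)
qed simp

definition torsion_cocycles :: "nat \<Rightarrow> 'u set"
  where "torsion_cocycles i = {x \<in> torsion_part R (Idl (set ys)) (I i). d i x = \<zero>\<^bsub>I (Suc i)\<^esub>}"

definition torsion_coboundaries :: "nat \<Rightarrow> 'u set"
  where "torsion_coboundaries i =
    (if i = 0 then {\<zero>\<^bsub>I 0\<^esub>} else d (i - 1) ` torsion_part R (Idl (set ys)) (I (i - 1)))"

lemma torsion_eq: "torsion_part R (Idl (set ys)) (I i) = power_torsion R (I i) (set ys)"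
  by (rule d.M.torsion_part_eq_power_torsion[OF ys finite_set])

lemma torsion_cocycles_eq: "torsion_cocycles i = power_torsion R (kernel_module i) (set ys)"
  by (simp add: torsion_cocycles_def torsion_eq power_torsion_kernel_module)

lemma torsion_cocycles_submodule: "submodule (torsion_cocycles i) R (I i)"
  unfolding torsion_cocycles_def torsion_eq
  using d.preimage_submodule[OF d.M.power_torsion_submodule[OF ys] d.M.zero_submodule, of i] by simp

lemma cohomology_zero_iff_0:
  "zero_module (quotient_module ((I 0)\<lparr>carrier := torsion_cocycles 0\<rparr>) (torsion_coboundaries 0)) \<longleftrightarrow>
    koszul_vanishes R ys M 0"
proof -
  interpret short_exact R "kernel_module 0" "I 0" "kernel_module (Suc 0)" "\<lambda>x. x" "d 0"
    by (rule short_exact_kernel_modules)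
  have "torsion_coboundaries 0 \<subseteq> torsion_cocycles 0" "submodule (torsion_coboundaries 0) R (I 0)"
    using d.M.submodule_zero[OF torsion_cocycles_submodule] d.M.zero_submodule
    by (simp_all add: torsion_coboundaries_def)
  then have "zero_module
      (quotient_module ((I 0)\<lparr>carrier := torsion_cocycles 0\<rparr>) (torsion_coboundaries 0)) \<longleftrightarrow>
      torsion_cocycles 0 \<subseteq> torsion_coboundaries 0"
    using zero_module_quotient_iff[OF d.M.module_axioms torsion_cocycles_submodule] by blast
  also have "\<dots> \<longleftrightarrow> power_torsion R (kernel_module 0) (set ys) \<subseteq> {\<zero>\<^bsub>kernel_module 0\<^esub>}"
    by (simp add: torsion_cocycles_eq torsion_coboundaries_def)
  also have "\<dots> \<longleftrightarrow> koszul_vanishes R ys (kernel_module 0) 0"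
    using koszul.koszul_vanishes_0_iff[OF i.M.koszulI[OF ys]] by simp
  finally show ?thesis by (simp add: koszul_vanishes_kernel_iff)
qed

lemma cohomology_zero_iff_Suc:
  "zero_module (quotient_module ((I (Suc k))\<lparr>carrier := torsion_cocycles (Suc k)\<rparr>)
      (torsion_coboundaries (Suc k))) \<longleftrightarrow>
    koszul_vanishes R ys M (int (Suc k))"
proof -
  have coboundaries: "torsion_coboundaries (Suc k) = d k ` power_torsion R (I k) (set ys)"
    by (simp add: torsion_coboundaries_def torsion_eq)
  have "submodule (torsion_coboundaries (Suc k)) R (I (Suc k))"
    unfolding coboundaries by (rule d.image_submodule[OF d.M.power_torsion_submodule[OF ys]])
  moreover have "torsion_coboundaries (Suc k) \<subseteq> torsion_cocycles (Suc k)"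
    using d.power_torsion_hom[OF ys, of _ k] image[of k] d.M.power_torsion_subset[of k]
    unfolding coboundaries torsion_cocycles_def torsion_eq by blast
  ultimately have "zero_module (quotient_module ((I (Suc k))\<lparr>carrier := torsion_cocycles (Suc k)\<rparr>)
      (torsion_coboundaries (Suc k))) \<longleftrightarrow> torsion_cocycles (Suc k) \<subseteq> torsion_coboundaries (Suc k)"
    by (rule zero_module_quotient_iff[OF d.M.module_axioms torsion_cocycles_submodule])
  also have "\<dots> \<longleftrightarrow> koszul_vanishes R ys (kernel_module k) 1"
    unfolding torsion_cocycles_eq coboundaries
    by (intro short_exact.koszul_vanishes_degree_one[symmetric, OF short_exact_kernel_modules ys]
        koszul_vanishes_injective[OF noetherian injective _ ys]) simp
  also have "\<dots> \<longleftrightarrow> koszul_vanishes R ys M (int (Suc k))"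
    using koszul_vanishes_kernel_shift[of 0 k 0]
    by (simp add: koszul_vanishes_kernel_iff add.commute)
  finally show ?thesis .
qed

theorem resolution_cohomology_zero_iff:
  "zero_module (quotient_module ((I i)\<lparr>carrier := torsion_cocycles i\<rparr>) (torsion_coboundaries i)) \<longleftrightarrow>
    koszul_vanishes R ys M (int i)"
  using cohomology_zero_iff_0 cohomology_zero_iff_Suc by (cases i) simp_all

end

theorem local_cohomology_zero_iff:
  fixes R :: "('r, 'x) ring_scheme" and M :: "('r, 'm, 'y) module_scheme"
  assumes "noetherian_ring R" and M: "module R M" and ys: "set ys \<subseteq> carrier R"
  shows "zero_module (local_cohomology R (Idl\<^bsub>R\<^esub> (set ys)) M i) \<longleftrightarrow> koszul_vanishes R ys M (int i)"
proof -
  define resolution where "resolution =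
      (SOME (I :: nat \<Rightarrow> ('r, ('r, 'm) resolution_univ) module, e, d).
    injective_resolution R M I e d)"
  obtain I e d where Ied: "resolution = (I, e, d)" by (cases resolution)
  have "case resolution of (I, e, d) \<Rightarrow> injective_resolution R M I e d"
    unfolding resolution_def by (rule someI_ex) (use injective_resolution_exists[OF M] in auto)
  then interpret injective_resolution_koszul R M ys I e d
    using assms
    by (intro injective_resolution_koszul.intro injective_resolution_koszul_axioms.intro)
      (simp_all add: Ied)
  show ?thesis
    using resolution_cohomology_zero_iff[of i]
    unfolding torsion_cocycles_def torsion_coboundaries_def local_cohomology_def
      resolution_def[symmetric] Ied Let_def
    by simp
qed

section \<open>Vanishing of homomorphisms\<close>

subsection \<open>Contractions of Koszul complexes\<close>

primrec koszul_contraction ::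
  "('r, 'm, 'y) module_scheme \<Rightarrow> nat \<Rightarrow> (bool list \<Rightarrow> 'm) \<Rightarrow> bool list \<Rightarrow> 'm"
  where
    "koszul_contraction M 0 w bs = (case bs of [] \<Rightarrow> \<zero>\<^bsub>M\<^esub> | b # cs \<Rightarrow> if b then \<zero>\<^bsub>M\<^esub> else w (True # cs))"
  | "koszul_contraction M (Suc i) w bs = (case bs of [] \<Rightarrow> \<zero>\<^bsub>M\<^esub> | b # cs \<Rightarrow>
      if b then \<ominus>\<^bsub>M\<^esub> koszul_contraction M i (\<lambda>cs. w (True # cs)) cs
      else koszul_contraction M i (\<lambda>cs. w (False # cs)) cs)"

context module begin

lemma koszul_contraction_closed [simp]:
  "(\<And>bs. w bs \<in> carrier M) \<Longrightarrow> koszul_contraction M i w bs \<in> carrier M"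
  by (induction i arbitrary: w bs) (auto split: list.split)

lemma koszul_contraction_zero [simp]: "koszul_contraction M i (\<lambda>_. \<zero>\<^bsub>M\<^esub>) bs = \<zero>\<^bsub>M\<^esub>"
  by (induction i arbitrary: bs) (auto split: list.split)

lemma koszul_contraction_smult_diff:
  assumes "r \<in> carrier R" "\<And>bs. v bs \<in> carrier M" "\<And>bs. w bs \<in> carrier M"
  shows "koszul_contraction M i (\<lambda>bs. r \<odot>\<^bsub>M\<^esub> v bs \<ominus>\<^bsub>M\<^esub> w bs) bs =
    r \<odot>\<^bsub>M\<^esub> koszul_contraction M i v bs \<ominus>\<^bsub>M\<^esub> koszul_contraction M i w bs"
  using assms
  by (induction i arbitrary: v w bs)
    (auto simp: a_minus_def M.minus_add smult_r_minus split: list.split)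

lemma koszul_contraction_cochain:
  assumes "w \<in> carrier (koszul_cochains M t p)" "i < t"
  shows "koszul_contraction M i w \<in> carrier (koszul_cochains M t (p - 1))"
  using assms
proof (induction i arbitrary: w t p)
  case 0
  then obtain t' where t: "t = Suc t'" by (cases t) auto
  interpret koszul R M "replicate t \<zero>" by (rule koszulI) auto
  obtain v u where "v \<in> carrier (koszul_cochains M t' p)"
      "u \<in> carrier (koszul_cochains M t' (p - 1))"
    "w = cons_cochain M v u"
    using cochain_cases[of \<zero> "replicate t' \<zero>" w p] 0(1) by (auto simp: t)
  moreover have "koszul_contraction M 0 (cons_cochain M v u) = cons_cochain M u (\<lambda>_. \<zero>\<^bsub>M\<^esub>)"
    by (simp add: fun_list_eq_iff)
  ultimately show ?case by (simp add: t cons_cochain_carrier) (simp add: koszul_cochains_carrier)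
next
  case (Suc i)
  then obtain t' where t: "t = Suc t'" by (cases t) auto
  interpret koszul R M "replicate t \<zero>" by (rule koszulI) auto
  obtain v u where vu: "v \<in> carrier (koszul_cochains M t' p)"
      "u \<in> carrier (koszul_cochains M t' (p - 1))"
    "w = cons_cochain M v u"
    using cochain_cases[of \<zero> "replicate t' \<zero>" w p] Suc.prems(1) by (auto simp: t)
  have "koszul_contraction M (Suc i) w =
      cons_cochain M (koszul_contraction M i v) (\<lambda>cs. \<ominus>\<^bsub>M\<^esub> koszul_contraction M i u cs)"
    by (simp add: vu(3) fun_list_eq_iff)
  moreover have "koszul_contraction M i v \<in> carrier (koszul_cochains M t' (p - 1))"
    "koszul_contraction M i u \<in> carrier (koszul_cochains M t' (p - 1 - 1))"
    by (rule Suc.IH[OF vu(1)] Suc.IH[OF vu(2)], use Suc.prems(2) t in simp)+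
  ultimately show ?case by (simp add: t cons_cochain_carrier) (simp add: koszul_cochains_carrier)
qed

lemma koszul_d_contraction:
  assumes "set zs \<subseteq> carrier R" "i < length zs" "length bs = length zs" "\<And>bs. w bs \<in> carrier M"
  shows "koszul_d M zs (koszul_contraction M i w) bs =
    (zs ! i) \<odot>\<^bsub>M\<^esub> w bs \<ominus>\<^bsub>M\<^esub> koszul_contraction M i (koszul_d M zs w) bs"
  using assms
proof (induction i arbitrary: zs w bs)
  case 0
  then obtain z zs' where zs: "zs = z # zs'" by (cases zs) auto
  obtain b cs where bs: "bs = b # cs" using 0(3) zs by (cases bs) auto
  have [simp]: "z \<in> carrier R" "set zs' \<subseteq> carrier R" "w bs \<in> carrier M" for bs using 0 zs by auto
  have "x \<ominus>\<^bsub>M\<^esub> (x \<ominus>\<^bsub>M\<^esub> y) = y" if "x \<in> carrier M" "y \<in> carrier M" for x y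
    using that by (simp add: a_minus_def M.minus_add flip: M.a_assoc) (simp add: M.r_neg)
  then show ?case by (simp add: zs bs)
next
  case (Suc i)
  then obtain z zs' where zs: "zs = z # zs'" by (cases zs) auto
  obtain b cs where bs: "bs = b # cs" using Suc.prems(3) zs by (cases bs) auto
  have closed [simp]: "z \<in> carrier R" "set zs' \<subseteq> carrier R" "zs' ! i \<in> carrier R"
      "w bs \<in> carrier M" for bs
    using Suc.prems zs by auto
  have IH: "koszul_d M zs' (koszul_contraction M i (\<lambda>cs. w (c # cs))) cs =
      (zs' ! i) \<odot>\<^bsub>M\<^esub> w (c # cs) \<ominus>\<^bsub>M\<^esub>
      koszul_contraction M i (koszul_d M zs' (\<lambda>cs. w (c # cs))) cs" for c
    by (rule Suc.IH) (use Suc.prems zs bs in auto)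
  have neg: "koszul_d M zs' (\<lambda>cs. \<ominus>\<^bsub>M\<^esub> koszul_contraction M i (\<lambda>cs. w (True # cs)) cs) cs =
      \<ominus>\<^bsub>M\<^esub> koszul_d M zs' (koszul_contraction M i (\<lambda>cs. w (True # cs))) cs"
    using koszul_d_diff[of zs' "\<lambda>_. \<zero>\<^bsub>M\<^esub>" "koszul_contraction M i (\<lambda>cs. w (True # cs))" cs]
    by (simp add: a_minus_def)
  have "x \<ominus>\<^bsub>M\<^esub> \<ominus>\<^bsub>M\<^esub> (y \<ominus>\<^bsub>M\<^esub> u) = y \<ominus>\<^bsub>M\<^esub> \<ominus>\<^bsub>M\<^esub> (x \<ominus>\<^bsub>M\<^esub> u)"
    if "x \<in> carrier M" "y \<in> carrier M" "u \<in> carrier M" for x y u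
    using that by (simp add: a_minus_def M.a_ac)
  then show ?case by (simp add: zs bs IH neg koszul_contraction_smult_diff)
qed

lemma count_list_replicate: "count_list (replicate n x) x = n"
  by (induction n) simp_all

subsection \<open>Koszul complexes of two sequences\<close>

lemma koszul_d_append_zero:
  assumes "set zs \<subseteq> carrier R" "set xs \<subseteq> carrier R" "length t = length zs" "\<And>s. w (t @ s) = \<zero>\<^bsub>M\<^esub>"
  shows "koszul_d M (zs @ xs) w (t @ s) = koszul_d M zs (\<lambda>t. w (t @ s)) t"
  using assms
proof (induction zs arbitrary: t w)
  case Nil
  then have "w = (\<lambda>_. \<zero>\<^bsub>M\<^esub>)" by (simp add: fun_eq_iff)
  then show ?case using Nil by simp
next
  case (Cons z zs)
  then obtain b t' where t: "t = b # t'" "length t' = length zs" by (cases t) auto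
  have "koszul_d M (zs @ xs) (\<lambda>cs. w (b # cs)) (t' @ s) = koszul_d M zs (\<lambda>t. w (b # t @ s)) t'"
    using Cons.IH[of t' "\<lambda>cs. w (b # cs)"] Cons.prems t by simp
  then show ?case using t by (cases b) simp_all
qed

lemma koszul_cochains_diff:
  "v \<in> carrier (koszul_cochains M t p) \<Longrightarrow> w \<in> carrier (koszul_cochains M t p) \<Longrightarrow>
    v \<ominus>\<^bsub>koszul_cochains M t p\<^esub> w = (\<lambda>bs. v bs \<ominus>\<^bsub>M\<^esub> w bs)"
  unfolding koszul_cochains_def by (rule function_module_diff)

lemma koszul_d_cong_weight:
  assumes "set zs \<subseteq> carrier R" "\<And>bs. v bs \<in> carrier M" "\<And>bs. w bs \<in> carrier M"
    and eq: "\<And>cs. length cs = length bs \<Longrightarrow> Suc (weight cs) = weight bs \<Longrightarrow> v cs = w cs"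
  shows "koszul_d M zs v bs = koszul_d M zs w bs"
proof -
  have "koszul_d M zs (\<lambda>cs. v cs \<ominus>\<^bsub>M\<^esub> w cs) bs = \<zero>\<^bsub>M\<^esub>"
    by (rule koszul_d_eq_zero[OF assms(1)]) (use eq assms(3) in simp)
  then show ?thesis using assms by (simp add: koszul_d_diff diff_eq_zero_iff)
qed

lemma koszul_d_append_False:
  "koszul_d M (zs @ xs) w (replicate (length zs) False @ s) =
    koszul_d M xs (\<lambda>s. w (replicate (length zs) False @ s)) s"
  by (induction zs arbitrary: w) simp_all

lemma koszul_d_in_submodule:
  assumes H: "submodule H R M" and "set zs \<subseteq> carrier R" "\<And>bs. w bs \<in> carrier M"
    and zH: "\<And>z x. z \<in> set zs \<Longrightarrow> x \<in> carrier M \<Longrightarrow> z \<odot>\<^bsub>M\<^esub> x \<in> H"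
  shows "koszul_d M zs w bs \<in> H"
  using assms(2-4)
proof (induction zs arbitrary: w bs)
  case (Cons z zs)
  have "koszul_d M zs (\<lambda>cs. w (b # cs)) cs \<in> H" for b cs
    by (rule Cons.IH) (use Cons.prems in auto)
  then show ?case
    using Cons.prems submodule_zero[OF H] submodule_diff[OF H] by (auto split: list.split)
qed (simp add: submodule_zero[OF H])

lemma koszul_d_top_degree:
  assumes xs: "set xs \<subseteq> carrier R"
    and c: "c \<in> carrier (koszul_cochains M (length xs) (int (length xs)))"
  shows "koszul_d M xs c bs = \<zero>\<^bsub>M\<^esub>"
proof -
  interpret koszul R M xs by (rule koszulI[OF xs])
  have "koszul_d M xs \<in> mod_hom R (koszul_cochains M (length xs) (int (length xs)))
      (koszul_cochains M (length xs) (int (length xs) + 1))"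
    unfolding koszul_cochains_def by (rule koszul_d_hom[OF xs]) auto
  then have "koszul_d M xs c \<in> carrier (koszul_cochains M (length xs) (int (length xs) + 1))"
    using c by (auto simp: mod_hom_def)
  then show ?thesis
    by (rule cochain_outside) (use count_le_length[of bs True] in auto)
qed

lemma koszul_d_contraction_cocycle:
  assumes zs: "set zs \<subseteq> carrier R" and c: "c \<in> carrier (koszul_cochains M (length zs) p)"
    and d: "\<And>bs. koszul_d M zs c bs = \<zero>\<^bsub>M\<^esub>" and i: "i < length zs"
  shows "koszul_d M zs (koszul_contraction M i c) bs = zs ! i \<odot>\<^bsub>M\<^esub> c bs"
proof -
  have cM: "c bs \<in> carrier M" for bs using c by (simp add: koszul_cochains_carrier)
  have zi: "zs ! i \<in> carrier R" using zs i by auto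
  show ?thesis
  proof (cases "length bs = length zs")
    case True
    have "koszul_d M zs c = (\<lambda>_. \<zero>\<^bsub>M\<^esub>)" using d by (simp add: fun_eq_iff)
    then show ?thesis using koszul_d_contraction[of zs i bs c] i zs zi cM True by simp
  next
    case False
    have "koszul_contraction M i c \<in> carrier (koszul_cochains M (length zs) (p - 1))"
      using c i by (rule koszul_contraction_cochain)
    then have "koszul_d M zs (koszul_contraction M i c) bs = \<zero>\<^bsub>M\<^esub>"
      using zs False by (intro koszul_d_eq_zero) (simp_all add: koszul_cochains_carrier)
    moreover have "c bs = \<zero>\<^bsub>M\<^esub>" using c False by (simp add: koszul_cochains_carrier)
    ultimately show ?thesis using zi by simp
  qed
qed

lemma cocycle_lift:
  assumes xs: "set xs \<subseteq> carrier R" and w: "w \<in> carrier M" and "set zs \<subseteq> set xs"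
  obtains c where "c \<in> carrier (koszul_cochains M (length zs + length xs) (int (length xs)))"
    "\<And>bs. koszul_d M (zs @ xs) c bs = \<zero>\<^bsub>M\<^esub>"
    "c (replicate (length zs) False @ replicate (length xs) True) = w"
  using assms(3)
proof (induction zs arbitrary: thesis)
  case Nil
  let ?c = "\<lambda>bs. if bs = replicate (length xs) True then w else \<zero>\<^bsub>M\<^esub>"
  have "?c \<in> carrier (koszul_cochains M (length xs) (int (length xs)))"
    using w by (auto simp: koszul_cochains_carrier count_list_replicate)
  then show ?case using Nil(1)[of ?c] koszul_d_top_degree[OF xs] by simp
next
  case (Cons z zs)
  obtain c where c: "c \<in> carrier (koszul_cochains M (length zs + length xs) (int (length xs)))"
    and d: "\<And>bs. koszul_d M (zs @ xs) c bs = \<zero>\<^bsub>M\<^esub>"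
    and cw: "c (replicate (length zs) False @ replicate (length xs) True) = w"
    using Cons.IH Cons.prems(2) by auto
  let ?L = "zs @ xs"
  have LR: "set ?L \<subseteq> carrier R" "z \<in> carrier R" using Cons.prems(2) xs by auto
  obtain i where i: "i < length ?L" "?L ! i = z"
    using Cons.prems(2) by (metis in_set_conv_nth insert_subset list.simps(15) set_append UnCI)
  have cM: "c bs \<in> carrier M" for bs using c by (simp add: koszul_cochains_carrier)
  let ?u = "koszul_contraction M i c"
  have u: "?u \<in> carrier (koszul_cochains M (length ?L) (int (length xs) - 1))"
    using c i(1) by (intro koszul_contraction_cochain) simp_all
  have "koszul_d M ?L ?u bs = z \<odot>\<^bsub>M\<^esub> c bs" for bs
    using koszul_d_contraction_cocycle[OF LR(1) _ d i(1)] c i(2) by simp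
  then have "koszul_d M (z # ?L) (cons_cochain M c ?u) = (\<lambda>_. \<zero>\<^bsub>M\<^esub>)"
    unfolding koszul_d_cons_cochain cons_cochain_eq_zero_iff using d cM LR by simp
  moreover have "cons_cochain M c ?u \<in> carrier
      (koszul_cochains M (length (z # ?L)) (int (length xs)))"
    using c u by (simp add: cons_cochain_carrier)
  ultimately show ?case using Cons.prems(1)[of "cons_cochain M c ?u"] cw by simp
qed

end

locale double_koszul = module R M
  for R :: "('r, 'x) ring_scheme" (structure) and M :: "('r, 'm, 'y) module_scheme" +
  fixes ys xs :: "'r list"
  assumes ys: "set ys \<subseteq> carrier R" and xs: "set xs \<subseteq> carrier R"
begin

sublocale complex_system R "koszul_cochains M (length ys + length xs)"
    "\<lambda>n. koszul_d M (powers R n ys @ xs)"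
  "\<lambda>m. koszul_transition R M (powers R m ys @ replicate (length xs) \<one>)"
  by (rule koszul_system[OF ys xs])

sublocale first: koszul R M ys
  by (rule koszulI[OF ys])

definition supported_below :: "nat \<Rightarrow> (bool list \<Rightarrow> 'm) \<Rightarrow> bool"
  where "supported_below k c \<longleftrightarrow> (\<forall>t s. length t = length ys \<and> k \<le> weight t \<longrightarrow> c (t @ s) = \<zero>\<^bsub>M\<^esub>)"

lemma supported_below_top: "length ys < k \<Longrightarrow> supported_below k c"
  unfolding supported_below_def
proof (intro allI impI)
  fix t s assume "length ys < k" "length t = length ys \<and> k \<le> weight t"
  then show "c (t @ s) = \<zero>\<^bsub>M\<^esub>" using count_le_length[of t True] by simp
qed

lemma supported_below_0_imp_zero:
  assumes "c \<in> carrier (koszul_cochains M (length ys + length xs) p)" "supported_below 0 c"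
  shows "c = (\<lambda>_. \<zero>\<^bsub>M\<^esub>)"
proof
  fix bs
  show "c bs = \<zero>\<^bsub>M\<^esub>"
  proof (cases "length bs = length ys + length xs")
    case True
    then have "c (take (length ys) bs @ drop (length ys) bs) = \<zero>\<^bsub>M\<^esub>"
      by (intro assms(2)[unfolded supported_below_def, rule_format]) simp
    then show ?thesis by simp
  qed (use assms(1) in \<open>simp add: koszul_cochains_carrier\<close>)
qed

lemma koszul_prod_append:
  "length t = length zs \<Longrightarrow> set (zs @ us) \<subseteq> carrier R \<Longrightarrow>
    koszul_prod R (zs @ us) (t @ s) = koszul_prod R zs t \<otimes> koszul_prod R us s"
proof (induction zs arbitrary: t)
  case (Cons z zs)
  then obtain b t' where "t = b # t'" "length t' = length zs" by (cases t) auto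
  then show ?case using Cons by (auto simp: R.m_assoc)
qed simp

lemma koszul_prod_ones: "koszul_prod R (replicate k \<one>) s = \<one>"
  by (induction k arbitrary: s) (auto split: list.split)

lemma transition_append:
  assumes "length t = length ys"
  shows "koszul_transition R M (powers R m ys @ replicate (length xs) \<one>) c (t @ s) =
    koszul_transition R M (powers R m ys) (\<lambda>t. c (t @ s)) t"
proof -
  have "set (powers R m ys @ replicate (length xs) \<one>) \<subseteq> carrier R" using ys by auto
  then show ?thesis
    using assms ys by (simp add: koszul_transition_def koszul_prod_append koszul_prod_ones)
qed

definition weight_component :: "nat \<Rightarrow> (bool list \<Rightarrow> 'm) \<Rightarrow> bool list \<Rightarrow> bool list \<Rightarrow> 'm"
  where "weight_component q c s t = (if weight t = q \<and> length t = length ys then c (t @ s) else \<zero>\<^bsub>M\<^esub>)"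

lemma weight_component_cocycle:
  assumes c: "c \<in> cocycles p n" and support: "supported_below (Suc q) c"
  shows "weight_component q c s \<in> first.cocycles (int q) n"
proof -
  let ?w = "weight_component q c s"
  have powers: "set (powers R n ys) \<subseteq> carrier R" using ys by simp
  have cM: "c bs \<in> carrier M" for bs
    using cocycles_closed[OF c] by (simp add: koszul_cochains_carrier)
  have "koszul_d M (powers R n ys) ?w t = \<zero>\<^bsub>M\<^esub>" for t
  proof (cases "weight t = Suc q \<and> length t = length ys")
    case True
    have "koszul_d M (powers R n ys) ?w t = koszul_d M (powers R n ys) (\<lambda>t. c (t @ s)) t"
      using powers cM True by (intro koszul_d_cong_weight) (auto simp: weight_component_def)
    also have "\<dots> = koszul_d M (powers R n ys @ xs) c (t @ s)"
      using support True powers xs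
      by (intro koszul_d_append_zero[symmetric]) (auto simp: supported_below_def)
    also have "\<dots> = \<zero>\<^bsub>M\<^esub>" using cocycles_d[OF c] by (simp add: fun_eq_iff)
    finally show ?thesis .
  next
    case False
    then show ?thesis using powers by (intro koszul_d_eq_zero) (auto simp: weight_component_def)
  qed
  then show ?thesis
    using cM by (simp add: first.cocycles_iff koszul_cochains_carrier weight_component_def)
qed

definition assemble :: "int \<Rightarrow> (bool list \<Rightarrow> bool list \<Rightarrow> 'm) \<Rightarrow> bool list \<Rightarrow> 'm"
  where "assemble r v bs = (let t = take (length ys) bs; s = drop (length ys) bs in
    if length s = length xs \<and> int (weight s) = r then v s t else \<zero>\<^bsub>M\<^esub>)"

lemma assemble_append:
  "length t = length ys \<Longrightarrow>
    assemble r v (t @ s) = (if length s = length xs \<and> int (weight s) = r then v s t else \<zero>\<^bsub>M\<^esub>)"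
  by (simp add: assemble_def)

lemma assemble_carrier:
  assumes "\<And>s. length s = length xs \<Longrightarrow> v s \<in> carrier (koszul_cochains M (length ys) q)"
  shows "assemble r v \<in> carrier (koszul_cochains M (length ys + length xs) (q + r))"
proof -
  have "assemble r v bs \<in> carrier M" for bs
    using assms by (simp add: assemble_def Let_def koszul_cochains_carrier)
  moreover have "assemble r v bs = \<zero>\<^bsub>M\<^esub>"
    if bs: "length bs \<noteq> length ys + length xs \<or> int (weight bs) \<noteq> q + r" for bs
  proof -
    define t s where "t = take (length ys) bs" and "s = drop (length ys) bs"
    then have "bs = t @ s" by simp
    then have "length bs = length t + length s" "weight bs = weight t + weight s" by simp_all
    then have "v s t = \<zero>\<^bsub>M\<^esub>" if "length s = length xs" "int (weight s) = r"
      using that bs assms[OF that(1)] by (auto simp: koszul_cochains_carrier)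
    then show ?thesis by (simp add: assemble_def Let_def t_def s_def)
  qed
  ultimately show ?thesis by (simp add: koszul_cochains_carrier)
qed

lemma koszul_d_assemble:
  assumes v: "\<And>s. length s = length xs \<Longrightarrow> v s \<in> carrier (koszul_cochains M (length ys) (int q - 1))"
    and t: "length t = length ys" "q \<le> weight t"
  shows "koszul_d M (powers R n ys @ xs) (assemble r v) (t @ s) =
    (if weight t = q \<and> length s = length xs \<and> int (weight s) = r
     then koszul_d M (powers R n ys) (v s) t else \<zero>\<^bsub>M\<^esub>)"
proof -
  have powers: "set (powers R n ys) \<subseteq> carrier R" using ys by simp
  have v_zero: "v s t = \<zero>\<^bsub>M\<^esub>"
    if "length s = length xs" "length t \<noteq> length ys \<or> Suc (weight t) \<noteq> q" for s t
    using that v[of s] by (auto simp: koszul_cochains_carrier)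
  have "koszul_d M (powers R n ys @ xs) (assemble r v) (t @ s) =
      koszul_d M (powers R n ys) (\<lambda>t. assemble r v (t @ s)) t"
    using t v_zero powers xs by (intro koszul_d_append_zero) (auto simp: assemble_append)
  also have "\<dots> = (if weight t = q \<and> length s = length xs \<and> int (weight s) = r
      then koszul_d M (powers R n ys) (v s) t else \<zero>\<^bsub>M\<^esub>)"
  proof (cases "weight t = q \<and> length s = length xs \<and> int (weight s) = r")
    case True
    have "assemble r v bs \<in> carrier M" "v s bs \<in> carrier M" for bs
      using assemble_carrier[OF v] v[of s] True by (simp_all add: koszul_cochains_carrier)
    then have "koszul_d M (powers R n ys) (\<lambda>t. assemble r v (t @ s)) t =
        koszul_d M (powers R n ys) (v s) t"
      using True t powers by (intro koszul_d_cong_weight) (auto simp: assemble_append)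
    then show ?thesis using True by simp
  next
    case False
    then have "koszul_d M (powers R n ys) (\<lambda>t. assemble r v (t @ s)) t = \<zero>\<^bsub>M\<^esub>"
      using t v_zero powers by (intro koszul_d_eq_zero) (auto simp: assemble_append)
    then show ?thesis unfolding if_not_P[OF False] .
  qed
  finally show ?thesis .
qed

lemma transition_eq_koszul_d_assemble:
  assumes c: "c \<in> carrier (koszul_cochains M (length ys + length xs) p)" "supported_below (Suc q) c"
    and v: "\<And>s. length s = length xs \<Longrightarrow> v s \<in> carrier (koszul_cochains M (length ys) (int q - 1))"
    and dv: "\<And>s. length s = length xs \<Longrightarrow>
      koszul_transition R M (powers R m ys) (weight_component q c s) =
      koszul_d M (powers R n ys) (v s)"
    and t: "length t = length ys" "q \<le> weight t"
  shows "koszul_transition R M (powers R m ys @ replicate (length xs) \<one>) c (t @ s) =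
    koszul_d M (powers R n ys @ xs) (assemble (p - int q) v) (t @ s)"
proof -
  have d_assemble: "koszul_d M (powers R n ys @ xs) (assemble (p - int q) v) (t @ s) =
    (if weight t = q \<and> length s = length xs \<and> int (weight s) = p - int q
     then koszul_d M (powers R n ys) (v s) t else \<zero>\<^bsub>M\<^esub>)"
    by (rule koszul_d_assemble) (use v t in simp_all)
  show ?thesis
  proof (cases "weight t = q \<and> length s = length xs \<and> int (weight s) = p - int q")
    case True
    have "koszul_transition R M (powers R m ys) (\<lambda>t. c (t @ s)) t =
        koszul_transition R M (powers R m ys) (weight_component q c s) t"
      using True t by (simp add: koszul_transition_def weight_component_def)
    then show ?thesis using True dv[of s] by (simp add: d_assemble transition_append[OF t(1)])
  next
    case False
    then consider "Suc q \<le> weight t" | "length s \<noteq> length xs \<or> int (weight (t @ s)) \<noteq> p"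
      using t(2) by fastforce
    then have "c (t @ s) = \<zero>\<^bsub>M\<^esub>"
      using c t by cases (simp_all add: koszul_cochains_carrier supported_below_def)
    then have "koszul_transition R M (powers R m ys) (\<lambda>t. c (t @ s)) t = \<zero>\<^bsub>M\<^esub>"
      using ys by (simp add: koszul_transition_def)
    then show ?thesis
      unfolding d_assemble transition_append[OF t(1)] if_not_P[OF False] .
  qed
qed

lemma reduce_support:
  assumes vanishes: "koszul_vanishes R ys M (int q)" and c: "c \<in> cocycles p n"
    and support: "supported_below (Suc q) c"
  obtains m \<alpha> where "\<alpha> \<in> carrier (koszul_cochains M (length ys + length xs) (p - 1))"
    "supported_below q (koszul_transition R M (powers R m ys @ replicate (length xs) \<one>) c
      \<ominus>\<^bsub>koszul_cochains M (length ys + length xs) p\<^esub> koszul_d M (powers R (n + m) ys @ xs) \<alpha>)"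
proof -
  let ?w = "weight_component q c" and ?S = "{s :: bool list. length s = length xs}"
  have powers: "set (powers R n ys) \<subseteq> carrier R" for n using ys by simp
  have "finite ?S" using finite_lists_length_eq[of "UNIV :: bool set" "length xs"] by simp
  have "\<forall>s\<in>?S. ?w s \<in> carrier (koszul_cochains M (length ys) (int q)) \<and> first.null (int q) n (?w s)"
    using weight_component_cocycle[OF c support] first.cocycles_closed vanishes
    by (auto simp: koszul_vanishes_def first.acyclic_def)
  then obtain m where "\<forall>s\<in>?S. \<exists>v\<in>carrier (koszul_cochains M (length ys) (int q - 1)).
      koszul_transition R M (powers R m ys) (?w s) = koszul_d M (powers R (n + m) ys) v"
    using first.null_uniform[OF \<open>finite ?S\<close>, of ?w "int q" n] by blast
  then obtain v where v: "\<And>s. length s = length xs \<Longrightarrow>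
      v s \<in> carrier (koszul_cochains M (length ys) (int q - 1))"
    and dv: "\<And>s. length s = length xs \<Longrightarrow>
      koszul_transition R M (powers R m ys) (?w s) = koszul_d M (powers R (n + m) ys) (v s)"
    unfolding Ball_def mem_Collect_eq by metis
  let ?\<alpha> = "assemble (p - int q) v"
    and ?\<tau> = "koszul_transition R M (powers R m ys @ replicate (length xs) \<one>)"
  have \<alpha>: "?\<alpha> \<in> carrier (koszul_cochains M (length ys + length xs) (p - 1))"
    using assemble_carrier[of v "int q - 1" "p - int q"] v by simp
  have cK: "c \<in> carrier (koszul_cochains M (length ys + length xs) p)"
    by (rule cocycles_closed[OF c])
  have "?\<tau> c (t @ s) = koszul_d M (powers R (n + m) ys @ xs) ?\<alpha> (t @ s)"
    if "length t = length ys" "q \<le> weight t" for t s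
    by (rule transition_eq_koszul_d_assemble[OF cK support]) (use v dv that in simp_all)
  then have "supported_below q (?\<tau> c \<ominus>\<^bsub>koszul_cochains M (length ys + length xs) p\<^esub>
      koszul_d M (powers R (n + m) ys @ xs) ?\<alpha>)"
    using cK \<alpha> coboundary_closed[OF \<alpha>] \<tau>.closed[OF cK, of m] powers xs
    by (simp add: supported_below_def koszul_cochains_diff koszul_cochains_carrier[of ?\<alpha>])
  then show thesis using that \<alpha> by blast
qed

lemma transition_0:
  assumes "c \<in> carrier (koszul_cochains M (length ys + length xs) p)"
  shows "koszul_transition R M (powers R 0 ys @ replicate (length xs) \<one>) c = c"
proof -
  have "powers R 0 ys @ replicate (length xs) \<one> = replicate (length ys + length xs) \<one>"
    by (simp add: powers_def map_replicate_const replicate_add)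
  then show ?thesis using assms
    by (simp add: koszul_transition_def koszul_prod_ones koszul_cochains_carrier)
qed

lemma clear_support:
  assumes "j \<le> k" and "\<forall>q\<in>{j..<k}. koszul_vanishes R ys M (int q)"
    and "c \<in> cocycles p n" "supported_below k c"
  shows "\<exists>m. \<exists>c'\<in>cocycles p (n + m). supported_below j c' \<and>
    null p (n + m) (koszul_transition R M (powers R m ys @ replicate (length xs) \<one>) c
      \<ominus>\<^bsub>koszul_cochains M (length ys + length xs) p\<^esub> c')"
  using assms
proof (induction k arbitrary: c n rule: dec_induct)
  case base
  then show ?case
    using null_zero[of p n] cocycles_closed[OF base(2)]
    by (intro exI[of _ 0] bexI[of _ c]) (simp_all add: transition_0)
next
  case (step k)
  let ?K = "koszul_cochains M (length ys + length xs)"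
    and ?\<tau> = "\<lambda>m. koszul_transition R M (powers R m ys @ replicate (length xs) \<one>)"
    and ?d = "\<lambda>n. koszul_d M (powers R n ys @ xs)"
  note cK = cocycles_closed[OF step.prems(2)]
  have vanishes: "koszul_vanishes R ys M (int k)" using step.prems(1) step.hyps by simp
  obtain m \<alpha> where \<alpha>: "\<alpha> \<in> carrier (?K (p - 1))"
    and supp: "supported_below k (?\<tau> m c \<ominus>\<^bsub>?K p\<^esub> ?d (n + m) \<alpha>)"
    using reduce_support[OF vanishes step.prems(2,3)] by blast
  let ?c = "?\<tau> m c \<ominus>\<^bsub>?K p\<^esub> ?d (n + m) \<alpha>"
  have c: "?c \<in> cocycles p (n + m)"
    by (intro cocycles_diff cocycles_\<tau> step.prems coboundary_cocycle \<alpha>)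
  obtain l c' where c': "c' \<in> cocycles p (n + m + l)" "supported_below j c'"
    and null: "null p (n + m + l) (?\<tau> l ?c \<ominus>\<^bsub>?K p\<^esub> c')"
    using step.IH[OF _ c supp] step.prems(1) by auto
  note closed = coboundary_closed[OF \<alpha>, of "n + m"] cocycles_closed[OF c'(1)]
  have "null p (n + m + l) ((?\<tau> l ?c \<ominus>\<^bsub>?K p\<^esub> c') \<oplus>\<^bsub>?K p\<^esub> ?\<tau> l (?d (n + m) \<alpha>))"
    using cK closed null by (intro null_add null_\<tau> null_coboundary \<alpha>) simp_all
  also have "(?\<tau> l ?c \<ominus>\<^bsub>?K p\<^esub> c') \<oplus>\<^bsub>?K p\<^esub> ?\<tau> l (?d (n + m) \<alpha>) = ?\<tau> (m + l) c \<ominus>\<^bsub>?K p\<^esub> c'"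
  proof -
    have "(?\<tau> l ?c \<ominus>\<^bsub>?K p\<^esub> c') \<oplus>\<^bsub>?K p\<^esub> ?\<tau> l (?d (n + m) \<alpha>) =
        (?\<tau> l ?c \<oplus>\<^bsub>?K p\<^esub> ?\<tau> l (?d (n + m) \<alpha>)) \<ominus>\<^bsub>?K p\<^esub> c'"
      using cK closed \<tau>.closed[of ?c p l] K.M.minus_closed by (simp add: a_minus_def K.M.a_ac)
    also have "?\<tau> l ?c \<oplus>\<^bsub>?K p\<^esub> ?\<tau> l (?d (n + m) \<alpha>) = ?\<tau> l (?c \<oplus>\<^bsub>?K p\<^esub> ?d (n + m) \<alpha>)"
      using cK closed by (intro \<tau>.add[symmetric]) simp_all
    finally show ?thesis using cK closed by (simp add: \<tau>_\<tau>)
  qed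
  finally show ?case using c' by (intro exI[of _ "m + l"] bexI[of _ c']) (simp_all add: add.assoc)
qed

end

locale double_koszul_homomorphism = module_homomorphism R N Q f
  for R :: "('r, 'x) ring_scheme" (structure) and N :: "('r, 'n, 'y) module_scheme"
    and Q :: "('r, 'q, 'z) module_scheme" and f +
  fixes ys xs :: "'r list"
  assumes ys: "set ys \<subseteq> carrier R" and xs: "set xs \<subseteq> carrier R"
begin

sublocale N: double_koszul R N ys xs
  by (intro double_koszul.intro double_koszul_axioms.intro M.module_axioms ys xs)

sublocale Q: double_koszul R Q ys xs
  by (intro double_koszul.intro double_koszul_axioms.intro N.module_axioms ys xs)

sublocale comp: module_homomorphism R "koszul_cochains N (length ys + length xs) p"
  "koszul_cochains Q (length ys + length xs) p" "(\<circ>) f" for p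
proof (intro module_homomorphism.intro module_homomorphism_axioms.intro N.K.module_axioms
    Q.K.module_axioms)
  show "(\<circ>) f \<in> mod_hom R (koszul_cochains N (length ys + length xs) p)
      (koszul_cochains Q (length ys + length xs) p)"
    unfolding koszul_cochains_def by (rule comp_hom)
qed

lemma comp_d:
  assumes "w \<in> carrier (koszul_cochains N (length ys + length xs) p)"
  shows "f \<circ> koszul_d N (powers R n ys @ xs) w = koszul_d Q (powers R n ys @ xs) (f \<circ> w)"
  using assms ys xs by (simp add: fun_eq_iff koszul_d_comp koszul_cochains_carrier)

lemma comp_transition:
  assumes "w \<in> carrier (koszul_cochains N (length ys + length xs) p)"
  shows "f \<circ> koszul_transition R N (powers R m ys @ replicate (length xs) \<one>) w =
    koszul_transition R Q (powers R m ys @ replicate (length xs) \<one>) (f \<circ> w)"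
proof -
  have "set (powers R m ys @ replicate (length xs) \<one>) \<subseteq> carrier R" using ys by auto
  then show ?thesis using assms
    by (simp add: fun_eq_iff koszul_transition_comp koszul_cochains_carrier)
qed

lemma comp_cocycles:
  assumes "w \<in> N.cocycles p n"
  shows "f \<circ> w \<in> Q.cocycles p n"
  using N.cocycles_closed[OF assms] N.cocycles_d[OF assms] comp.zero[of "p + 1"]
  by (simp add: Q.cocycles_def flip: comp_d)

lemma comp_null:
  assumes "w \<in> carrier (koszul_cochains N (length ys + length xs) p)" "N.null p n w"
  shows "Q.null p n (f \<circ> w)"
proof -
  obtain m v where v: "v \<in> carrier (koszul_cochains N (length ys + length xs) (p - 1))"
    "koszul_transition R N (powers R m ys @ replicate (length xs) \<one>) w =
    koszul_d N (powers R (n + m) ys @ xs) v"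
    using assms(2) unfolding N.null_def by blast
  then show ?thesis
    using comp_transition[OF assms(1), of m] comp_d[OF v(1), of "n + m"]
    by (intro Q.nullI[of "f \<circ> v" p m]) simp_all
qed

text \<open>Over \<open>N\<close> the components of weight at least \<open>j\<close> can be removed, over \<open>Q\<close> those below \<open>j\<close>.\<close>

lemma comp_cocycle_null:
  assumes N_vanishes: "\<forall>q\<ge>j. koszul_vanishes R ys N (int q)"
    and Q_vanishes: "\<forall>q<j. koszul_vanishes R ys Q (int q)"
    and c: "c \<in> N.cocycles p n"
  shows "Q.null p n (f \<circ> c)"
proof -
  let ?t = "length ys + length xs"
  let ?\<tau>N = "\<lambda>m. koszul_transition R N (powers R m ys @ replicate (length xs) \<one>)"
    and ?\<tau>Q = "\<lambda>m. koszul_transition R Q (powers R m ys @ replicate (length xs) \<one>)"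
  note cK = N.cocycles_closed[OF c]
  have "N.supported_below (max j (Suc (length ys))) c" by (rule N.supported_below_top) simp
  then obtain m c' where c': "c' \<in> N.cocycles p (n + m)" "N.supported_below j c'"
    and null: "N.null p (n + m) (?\<tau>N m c \<ominus>\<^bsub>koszul_cochains N ?t p\<^esub> c')"
    using N.clear_support[OF max.cobounded1 _ c, of j "Suc (length ys)"] N_vanishes by auto
  note c'K = N.cocycles_closed[OF c'(1)]
  have "Q.supported_below j (f \<circ> c')"
    using c'(2) by (simp add: N.supported_below_def Q.supported_below_def)
  then obtain l c'' where c'': "c'' \<in> Q.cocycles p (n + m + l)" "Q.supported_below 0 c''"
    and "Q.null p (n + m + l) (?\<tau>Q l (f \<circ> c') \<ominus>\<^bsub>koszul_cochains Q ?t p\<^esub> c'')"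
    using Q.clear_support[OF le0 _ comp_cocycles[OF c'(1)], of j] Q_vanishes by auto
  moreover have "c'' = (\<lambda>_. \<zero>\<^bsub>Q\<^esub>)"
    using Q.cocycles_closed[OF c''(1)] c''(2) by (rule Q.supported_below_0_imp_zero)
  ultimately have "Q.null p (n + m + l) (?\<tau>Q l (f \<circ> c'))"
    using Q.K.diff_zero[OF Q.\<tau>.closed[OF comp.closed[OF c'K]], of l] by simp
  then have "Q.null p (n + m) (f \<circ> c')"
    using c'K by (intro Q.null_\<tau>D[of "f \<circ> c'" p "n + m" l]) simp_all
  moreover have "Q.null p (n + m) (f \<circ> (?\<tau>N m c \<ominus>\<^bsub>koszul_cochains N ?t p\<^esub> c'))"
    using cK c'K null by (intro comp_null) simp_all
  ultimately have "Q.null p (n + m) ((f \<circ> (?\<tau>N m c \<ominus>\<^bsub>koszul_cochains N ?t p\<^esub> c'))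
      \<oplus>\<^bsub>koszul_cochains Q ?t p\<^esub> (f \<circ> c'))"
    using cK c'K by (intro Q.null_add) simp_all
  then have "Q.null p (n + m) (?\<tau>Q m (f \<circ> c))" using cK c'K by (simp add: comp_transition)
  then show ?thesis using cK by (intro Q.null_\<tau>D[of "f \<circ> c" p n m]) simp_all
qed

lemma image_in_koszul_image:
  assumes "\<forall>q\<ge>j. koszul_vanishes R ys N (int q)" "\<forall>q<j. koszul_vanishes R ys Q (int q)"
    and subset: "set (powers R n ys) \<subseteq> set xs" and w: "w \<in> carrier N"
  obtains v where "\<And>bs. v bs \<in> carrier Q" "f w = koszul_d Q xs v (replicate (length xs) True)"
proof -
  let ?t = "length ys + length xs"
  let ?F = "replicate (length ys) False" and ?T = "replicate (length xs) True"
  obtain c where c: "c \<in> carrier (koszul_cochains N ?t (int (length xs)))"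
    and d: "\<And>bs. koszul_d N (powers R n ys @ xs) c bs = \<zero>\<^bsub>N\<^esub>" and cw: "c (?F @ ?T) = w"
    using M.cocycle_lift[OF xs w subset] by auto
  then have "c \<in> N.cocycles (int (length xs)) n"
    by (simp add: N.cocycles_def fun_eq_iff koszul_cochains_def)
  then have "Q.null (int (length xs)) n (f \<circ> c)" by (rule comp_cocycle_null[OF assms(1,2)])
  then obtain m v where v: "v \<in> carrier (koszul_cochains Q ?t (int (length xs) - 1))"
    and eq: "koszul_transition R Q (powers R m ys @ replicate (length xs) \<one>) (f \<circ> c) =
      koszul_d Q (powers R (n + m) ys @ xs) v"
    unfolding Q.null_def by blast
  have "f w = koszul_transition R Q (powers R m ys) (\<lambda>t. f (c (t @ ?T))) ?F"
    using N.koszul_prod_replicate_False[of "powers R m ys"] ys cw w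
    by (simp add: koszul_transition_def)
  also have "\<dots> = koszul_d Q (powers R (n + m) ys @ xs) v (?F @ ?T)"
    unfolding eq[symmetric] using Q.transition_append[of ?F m "f \<circ> c" ?T] by simp
  also have "\<dots> = koszul_d Q xs (\<lambda>s. v (?F @ s)) ?T"
    using N.koszul_d_append_False[of "powers R (n + m) ys" xs v ?T] by simp
  finally show thesis using v
    by (intro that[of "\<lambda>s. v (?F @ s)"]) (simp_all add: koszul_cochains_carrier)
qed

end

theorem (in module_homomorphism) koszul_vanishes_imp_zero_hom:
  assumes noeth: "noetherian_submodule R N (carrier N)" and ys: "set ys \<subseteq> jacobson_radical R"
    and "\<forall>q\<ge>j. koszul_vanishes R ys M (int q)" "\<forall>q<j. koszul_vanishes R ys N (int q)"
    and w: "w \<in> carrier M"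
  shows "f w = \<zero>\<^bsub>N\<^esub>"
proof -
  have ysR: "set ys \<subseteq> carrier R" using ys by (auto simp: jacobson_radical_def)
  have "f ` carrier M = {\<zero>\<^bsub>N\<^esub>}"
  proof (rule N.krull_intersection[OF noeth finite_set ys])
    show "submodule (f ` carrier M) R N" by (rule image_submodule[OF M.carrier_is_submodule])
    fix n H assume H: "submodule H R N"
      "\<And>y x. y \<in> set ys \<Longrightarrow> x \<in> carrier N \<Longrightarrow> (y [^] (n::nat)) \<odot>\<^bsub>N\<^esub> x \<in> H"
    have powers: "set (powers R n ys) \<subseteq> carrier R" using ysR by simp
    interpret double_koszul_homomorphism R M N f ys "powers R n ys"
      by unfold_locales (use ysR powers in auto)
    show "f ` carrier M \<subseteq> H"
    proof clarify
      fix x assume "x \<in> carrier M"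
      then obtain v where "\<And>bs. v bs \<in> carrier N"
        "f x = koszul_d N (powers R n ys) v (replicate (length (powers R n ys)) True)"
        using image_in_koszul_image[OF assms(3,4) subset_refl] by metis
      moreover have "z \<odot>\<^bsub>N\<^esub> x \<in> H" if "z \<in> set (powers R n ys)" "x \<in> carrier N" for z x
        using H(2) that by (auto simp: set_powers)
      ultimately show "f x \<in> H" using N.koszul_d_in_submodule[OF H(1) powers] by simp
    qed
  qed
  then show ?thesis using w by blast
qed

corollary (in module) koszul_vanishes_imp_zero_module:
  assumes "noetherian_submodule R M (carrier M)" "set ys \<subseteq> jacobson_radical R"
    and "\<forall>q. koszul_vanishes R ys M (int q)"
  shows "zero_module M"
proof -
  have "(\<lambda>x. x) \<in> mod_hom R M M" by (simp add: mod_hom_def)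
  then have "module_homomorphism R M M (\<lambda>x. x)"
    by (intro module_homomorphism.intro module_homomorphism_axioms.intro module_axioms)
  then have "w = \<zero>\<^bsub>M\<^esub>" if "w \<in> carrier M" for w
    by (rule module_homomorphism.koszul_vanishes_imp_zero_hom[OF _ assms(1,2), of _ _ 0])
      (use assms(3) that in simp_all)
  then show ?thesis by (auto simp: zero_module_def)
qed

section \<open>Localization of modules\<close>

text \<open>\<open>N'\<close> is the localization of \<open>N\<close> at \<open>S\<close>, regarded as a module over \<open>R\<close>.\<close>

locale localization_map = module_homomorphism R N N' \<iota>
  for R :: "('r, 'x) ring_scheme" (structure) and N :: "('r, 'm, 'y) module_scheme"
    and N' :: "('r, 'n, 'z) module_scheme" and \<iota> +
  fixes S
  assumes S_subset: "S \<subseteq> carrier R" and S_one: "\<one> \<in> S"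
    and S_mult: "s \<in> S \<Longrightarrow> t \<in> S \<Longrightarrow> s \<otimes> t \<in> S"
    and bij: "s \<in> S \<Longrightarrow> bij_betw (\<lambda>x. s \<odot>\<^bsub>N'\<^esub> x) (carrier N') (carrier N')"
    and denominator: "x' \<in> carrier N' \<Longrightarrow> \<exists>s\<in>S. s \<odot>\<^bsub>N'\<^esub> x' \<in> \<iota> ` carrier N"
    and torsion: "x \<in> carrier N \<Longrightarrow> \<iota> x = \<zero>\<^bsub>N'\<^esub> \<Longrightarrow> \<exists>s\<in>S. s \<odot>\<^bsub>N\<^esub> x = \<zero>\<^bsub>N\<^esub>"
begin

lemma S_closed [simp]: "s \<in> S \<Longrightarrow> s \<in> carrier R"
  using S_subset by blast

lemma S_cancel:
  assumes "s \<in> S" "x' \<in> carrier N'" "y' \<in> carrier N'" "s \<odot>\<^bsub>N'\<^esub> x' = s \<odot>\<^bsub>N'\<^esub> y'"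
  shows "x' = y'"
  using inj_onD[OF bij_betw_imp_inj_on[OF bij]] assms by blast

lemma S_cancel_zero:
  assumes "s \<in> S" "x' \<in> carrier N'" "s \<odot>\<^bsub>N'\<^esub> x' = \<zero>\<^bsub>N'\<^esub>"
  shows "x' = \<zero>\<^bsub>N'\<^esub>"
  by (rule S_cancel[OF assms(1)]) (use assms in simp_all)

lemma divideE:
  assumes "s \<in> S" "x' \<in> carrier N'"
  obtains y' where "y' \<in> carrier N'" "s \<odot>\<^bsub>N'\<^esub> y' = x'"
  using bij_betw_imp_surj_on[OF bij[OF assms(1)]] assms(2) by (metis imageE)

lemma common_multiple:
  assumes "finite X" "\<And>i. i \<in> X \<Longrightarrow> \<exists>s\<in>S. P i s"
    and multiple: "\<And>i s t. i \<in> X \<Longrightarrow> s \<in> S \<Longrightarrow> t \<in> S \<Longrightarrow> P i s \<Longrightarrow> P i (s \<otimes> t)"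
  shows "\<exists>s\<in>S. \<forall>i\<in>X. P i s"
  using assms
proof (induction X rule: finite_induct)
  case empty
  show ?case using S_one by blast
next
  case (insert i X)
  obtain s where s: "s \<in> S" "\<forall>i\<in>X. P i s" using insert by auto
  obtain t where t: "t \<in> S" "P i t" using insert.prems by blast
  have "P j (s \<otimes> t)" if "j \<in> insert i X" for j
    using that insert.prems(2)[of j s t] insert.prems(2)[of i t s] s t M.R.m_comm[of s t] by auto
  then show ?case using S_mult[OF s(1) t(1)] by blast
qed

lemma function_module_bij:
  assumes s: "s \<in> S"
  shows "bij_betw (\<lambda>w. s \<odot>\<^bsub>function_module N' X\<^esub> w) (carrier (function_module N' X))
    (carrier (function_module N' X))"
  unfolding bij_betw_def
proof (intro conjI equalityI subsetI inj_onI)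
  fix v w assume vw: "v \<in> carrier (function_module N' X)" "w \<in> carrier (function_module N' X)"
    and eq: "s \<odot>\<^bsub>function_module N' X\<^esub> v = s \<odot>\<^bsub>function_module N' X\<^esub> w"
  have "v i = w i" for i
    by (rule S_cancel[OF s]) (use fun_cong[OF eq, of i] vw in \<open>simp_all add: function_module_value\<close>)
  then show "v = w" by (rule ext)
next
  fix w assume w: "w \<in> carrier (function_module N' X)"
  have "\<forall>i. \<exists>x. x \<in> carrier N' \<and> s \<odot>\<^bsub>N'\<^esub> x = w i"
    using divideE[OF s function_module_value[OF w]] by metis
  then obtain v where v: "\<forall>i. v i \<in> carrier N' \<and> s \<odot>\<^bsub>N'\<^esub> v i = w i" by metis
  have "v i = \<zero>\<^bsub>N'\<^esub>" if "i \<notin> X" for i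
  proof (rule S_cancel_zero[OF s])
    show "v i \<in> carrier N'" "s \<odot>\<^bsub>N'\<^esub> v i = \<zero>\<^bsub>N'\<^esub>"
      using v function_module_outside[OF w that] by simp_all
  qed
  then have "v \<in> carrier (function_module N' X)" using v by (simp add: function_module_carrier)
  moreover have "w = s \<odot>\<^bsub>function_module N' X\<^esub> v" using v by (simp add: fun_eq_iff)
  ultimately show "w \<in> (\<lambda>w. s \<odot>\<^bsub>function_module N' X\<^esub> w) ` carrier (function_module N' X)"
    by blast
qed (use s in \<open>auto simp: function_module_carrier\<close>)

lemma function_module_denominator:
  assumes "finite X" and w': "w' \<in> carrier (function_module N' X)"
  shows "\<exists>s\<in>S. s \<odot>\<^bsub>function_module N' X\<^esub> w' \<in> (\<circ>) \<iota> ` carrier (function_module N X)"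
proof -
  note [simp] = function_module_value[OF w']
  have "\<exists>s\<in>S. \<forall>i\<in>X. s \<odot>\<^bsub>N'\<^esub> w' i \<in> \<iota> ` carrier N"
  proof (rule common_multiple[OF \<open>finite X\<close>])
    fix i s t assume st: "s \<in> S" "t \<in> S" "s \<odot>\<^bsub>N'\<^esub> w' i \<in> \<iota> ` carrier N"
    then obtain x where "x \<in> carrier N" "s \<odot>\<^bsub>N'\<^esub> w' i = \<iota> x" by blast
    then have "(s \<otimes> t) \<odot>\<^bsub>N'\<^esub> w' i = \<iota> (t \<odot>\<^bsub>N\<^esub> x)"
      using st by (simp add: M.R.m_comm[of s t] N.smult_assoc1)
    then show "(s \<otimes> t) \<odot>\<^bsub>N'\<^esub> w' i \<in> \<iota> ` carrier N" using st \<open>x \<in> carrier N\<close>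
      by (intro image_eqI[of _ _ "t \<odot>\<^bsub>N\<^esub> x"]) simp_all
  qed (rule denominator, simp)
  then obtain s where s: "s \<in> S" "\<And>i. i \<in> X \<Longrightarrow> s \<odot>\<^bsub>N'\<^esub> w' i \<in> \<iota> ` carrier N" by blast
  have "\<forall>i. \<exists>x. x \<in> carrier N \<and> \<iota> x = s \<odot>\<^bsub>N'\<^esub> w' i \<and> (i \<notin> X \<longrightarrow> x = \<zero>\<^bsub>N\<^esub>)"
  proof
    fix i
    show "\<exists>x. x \<in> carrier N \<and> \<iota> x = s \<odot>\<^bsub>N'\<^esub> w' i \<and> (i \<notin> X \<longrightarrow> x = \<zero>\<^bsub>N\<^esub>)"
    proof (cases "i \<in> X")
      case True
      then show ?thesis using s(2)[OF True] by auto
    next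
      case False
      then show ?thesis
        using function_module_outside[OF w' False] s(1) by (intro exI[of _ "\<zero>\<^bsub>N\<^esub>"]) simp
    qed
  qed
  then obtain w where "\<forall>i. w i \<in> carrier N \<and> \<iota> (w i) = s \<odot>\<^bsub>N'\<^esub> w' i \<and> (i \<notin> X \<longrightarrow> w i = \<zero>\<^bsub>N\<^esub>)"
    by metis
  then have "s \<odot>\<^bsub>function_module N' X\<^esub> w' \<in> (\<circ>) \<iota> ` carrier (function_module N X)"
    by (intro image_eqI[of _ _ w]) (simp_all add: function_module_carrier fun_eq_iff)
  then show ?thesis using s(1) by blast
qed

lemma function_module_torsion:
  assumes "finite X" and w: "w \<in> carrier (function_module N X)"
    and zero: "\<iota> \<circ> w = \<zero>\<^bsub>function_module N' X\<^esub>"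
  shows "\<exists>s\<in>S. s \<odot>\<^bsub>function_module N X\<^esub> w = \<zero>\<^bsub>function_module N X\<^esub>"
proof -
  note [simp] = function_module_value[OF w]
  have "\<exists>s\<in>S. \<forall>i\<in>X. s \<odot>\<^bsub>N\<^esub> w i = \<zero>\<^bsub>N\<^esub>"
  proof (rule common_multiple[OF \<open>finite X\<close>])
    show "\<exists>s\<in>S. s \<odot>\<^bsub>N\<^esub> w i = \<zero>\<^bsub>N\<^esub>" for i
      using fun_cong[OF zero, of i] by (intro torsion) simp_all
    show "(s \<otimes> t) \<odot>\<^bsub>N\<^esub> w i = \<zero>\<^bsub>N\<^esub>" if "s \<in> S" "t \<in> S" "s \<odot>\<^bsub>N\<^esub> w i = \<zero>\<^bsub>N\<^esub>" for i s t
      using that by (simp add: M.R.m_comm[of s t] M.smult_assoc1)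
  qed
  then obtain s where s: "s \<in> S" "\<And>i. i \<in> X \<Longrightarrow> s \<odot>\<^bsub>N\<^esub> w i = \<zero>\<^bsub>N\<^esub>" by blast
  have "s \<odot>\<^bsub>N\<^esub> w i = \<zero>\<^bsub>N\<^esub>" for i
    using s function_module_outside[OF w, of i] by (cases "i \<in> X") simp_all
  then show ?thesis using s(1) by (intro bexI[of _ s]) simp_all
qed

lemma localization_function_module:
  assumes "finite X"
  shows "localization_map R (function_module N X) (function_module N' X) ((\<circ>) \<iota>) S"
  by (intro localization_map.intro module_homomorphism.intro module_homomorphism_axioms.intro
      localization_map_axioms.intro S_subset S_one S_mult M.function_module N.function_module
      comp_hom
      function_module_bij function_module_denominator[OF assms] function_module_torsion[OF assms])

lemma localization_koszul_cochains:
  "localization_map R (koszul_cochains N t p) (koszul_cochains N' t p) ((\<circ>) \<iota>) S"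
proof -
  have "finite {bs :: bool list. length bs = t}"
    using finite_lists_length_eq[of "UNIV :: bool set" t] by simp
  then have "finite {bs. length bs = t \<and> int (weight bs) = p}" by (rule rev_finite_subset) blast
  then show ?thesis unfolding koszul_cochains_def by (rule localization_function_module)
qed

theorem koszul_vanishes_localization:
  assumes ys: "set ys \<subseteq> carrier R" and vanishes: "koszul_vanishes R ys N p"
  shows "koszul_vanishes R ys N' p"
proof -
  let ?K = "koszul_cochains N (length ys)" and ?K' = "koszul_cochains N' (length ys)"
  interpret K: koszul R N ys by (rule M.koszulI[OF ys])
  interpret K': koszul R N' ys by (rule N.koszulI[OF ys])
  interpret L: localization_map R "?K q" "?K' q" "(\<circ>) \<iota>" S for q
    by (rule localization_koszul_cochains)
  have powers: "set (powers R n ys) \<subseteq> carrier R" for n using ys by simp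
  have \<iota>_d: "\<iota> \<circ> koszul_d N (powers R n ys) w = koszul_d N' (powers R n ys) (\<iota> \<circ> w)"
    and \<iota>_\<tau>: "\<iota> \<circ> koszul_transition R N (powers R n ys) w =
        koszul_transition R N' (powers R n ys) (\<iota> \<circ> w)"
    if "w \<in> carrier (?K q)" for w n q
    using that powers
    by (simp_all add: fun_eq_iff koszul_d_comp koszul_transition_comp koszul_cochains_carrier)
  show ?thesis
    unfolding koszul_vanishes_def
  proof (rule K'.acyclicI)
    fix n w' assume w': "w' \<in> K'.cocycles p n"
    note w'K = K'.cocycles_closed[OF w']
    obtain s w where s: "s \<in> S" and w: "w \<in> carrier (?K p)" "s \<odot>\<^bsub>?K' p\<^esub> w' = \<iota> \<circ> w"
      using L.denominator[OF w'K] by blast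
    have "\<iota> \<circ> koszul_d N (powers R n ys) w = \<zero>\<^bsub>?K' (p + 1)\<^esub>"
      using K'.cocycles_d[OF w'] s w'K K'.d.smult[of s w' p n] K'.K.smult_r_null[of s "p + 1"]
      by (simp add: \<iota>_d[OF w(1)] flip: w(2))
    then obtain t where t: "t \<in> S" "t \<odot>\<^bsub>?K (p + 1)\<^esub> koszul_d N (powers R n ys) w = \<zero>\<^bsub>?K (p + 1)\<^esub>"
      using L.torsion[OF K.d.closed[OF w(1)]] by blast
    have "t \<odot>\<^bsub>?K p\<^esub> w \<in> K.cocycles p n"
      using t w(1) K.d.smult[of t w p n] by (simp add: K.cocycles_def)
    then obtain m v where v: "v \<in> carrier (?K (p - 1))"
      "koszul_transition R N (powers R m ys) (t \<odot>\<^bsub>?K p\<^esub> w) = koszul_d N (powers R (n + m) ys) v"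
      using vanishes K.acyclicD unfolding koszul_vanishes_def by metis
    have ts: "t \<otimes> s \<in> S" using t s S_mult by blast
    then obtain v' where v': "v' \<in> carrier (?K' (p - 1))" "(t \<otimes> s) \<odot>\<^bsub>?K' (p - 1)\<^esub> v' = \<iota> \<circ> v"
      using L.divideE[OF ts L.closed[OF v(1)]] by blast
    have "(t \<otimes> s) \<odot>\<^bsub>?K' p\<^esub> koszul_transition R N' (powers R m ys) w' =
        koszul_transition R N' (powers R m ys) ((t \<otimes> s) \<odot>\<^bsub>?K' p\<^esub> w')"
      using ts w'K by (intro K'.\<tau>.smult[symmetric]) simp_all
    also have "(t \<otimes> s) \<odot>\<^bsub>?K' p\<^esub> w' = \<iota> \<circ> (t \<odot>\<^bsub>?K p\<^esub> w)"
      using t s w w'K L.smult[of t w p] by (simp add: K'.K.smult_assoc1)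
    also have "koszul_transition R N' (powers R m ys) \<dots> = \<iota> \<circ> koszul_d N (powers R (n + m) ys) v"
      using t w(1) \<iota>_\<tau>[of "t \<odot>\<^bsub>?K p\<^esub> w" p m] by (simp add: v(2))
    also have "\<dots> = koszul_d N' (powers R (n + m) ys) ((t \<otimes> s) \<odot>\<^bsub>?K' (p - 1)\<^esub> v')"
      using \<iota>_d[OF v(1)] by (simp add: v'(2))
    also have "\<dots> = (t \<otimes> s) \<odot>\<^bsub>?K' p\<^esub> koszul_d N' (powers R (n + m) ys) v'"
      using K'.d.smult[of "t \<otimes> s" v' "p - 1" "n + m"] ts v'(1) by simp
    finally have "koszul_transition R N' (powers R m ys) w' = koszul_d N' (powers R (n + m) ys) v'"
      using L.S_cancel[OF ts, of _ p] w'K K'.coboundary_closed[OF v'(1)] by simp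
    then show "K'.null p n w'" by (rule K'.nullI[OF v'(1)])
  qed
qed

definition localized_submodule :: "'m set \<Rightarrow> 'n set"
  where "localized_submodule G = {x' \<in> carrier N'. \<exists>s\<in>S. s \<odot>\<^bsub>N'\<^esub> x' \<in> \<iota> ` G}"

lemma localized_submoduleI:
  assumes "s \<in> S" "g \<in> G" "x' \<in> carrier N'" "s \<odot>\<^bsub>N'\<^esub> x' = \<iota> g"
  shows "x' \<in> localized_submodule G"
  unfolding localized_submodule_def by (intro CollectI conjI bexI image_eqI) (fact assms)+

lemma localized_submoduleE:
  assumes "x' \<in> localized_submodule G"
  obtains s g where "s \<in> S" "g \<in> G" "x' \<in> carrier N'" "s \<odot>\<^bsub>N'\<^esub> x' = \<iota> g"
  using assms unfolding localized_submodule_def by (elim CollectE conjE bexE imageE)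

lemma localized_submodule_mono: "G \<subseteq> H \<Longrightarrow> localized_submodule G \<subseteq> localized_submodule H"
  by (auto simp: localized_submodule_def)

lemma localized_submodule_carrier: "localized_submodule (carrier N) = carrier N'"
  using denominator by (auto simp: localized_submodule_def)

lemma localized_submodule_add:
  assumes G: "submodule G R N" and "x' \<in> localized_submodule G" "y' \<in> localized_submodule G"
  shows "x' \<oplus>\<^bsub>N'\<^esub> y' \<in> localized_submodule G"
proof -
  note GE = M.submoduleE[OF G] and GN = M.submodule_subset[OF G]
  obtain s x where x: "s \<in> S" "x \<in> G" "x' \<in> carrier N'" "s \<odot>\<^bsub>N'\<^esub> x' = \<iota> x"
    using assms(2) by (rule localized_submoduleE)
  obtain t y where y: "t \<in> S" "y \<in> G" "y' \<in> carrier N'" "t \<odot>\<^bsub>N'\<^esub> y' = \<iota> y"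
    using assms(3) by (rule localized_submoduleE)
  have "(t \<otimes> s) \<odot>\<^bsub>N'\<^esub> (x' \<oplus>\<^bsub>N'\<^esub> y') = t \<odot>\<^bsub>N'\<^esub> (s \<odot>\<^bsub>N'\<^esub> x') \<oplus>\<^bsub>N'\<^esub> s \<odot>\<^bsub>N'\<^esub> (t \<odot>\<^bsub>N'\<^esub> y')"
    using x y by (simp add: N.smult_r_distr N.smult_assoc1 N.smult_left_commute[of t s])
  also have "\<dots> = \<iota> (t \<odot>\<^bsub>N\<^esub> x \<oplus>\<^bsub>N\<^esub> s \<odot>\<^bsub>N\<^esub> y)" using x y GN by simp
  finally show ?thesis
    using x y by (intro localized_submoduleI[OF S_mult GE(5)]) (simp_all add: GE(4))
qed

lemma localized_submodule_submodule:
  assumes G: "submodule G R N"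
  shows "submodule (localized_submodule G) R N'"
proof (rule N.submodule_closedI[OF _ _ localized_submodule_add[OF G]])
  show "\<zero>\<^bsub>N'\<^esub> \<in> localized_submodule G"
    by (rule localized_submoduleI[OF S_one M.submodule_zero[OF G]]) simp_all
  fix a x' assume a: "a \<in> carrier R" and "x' \<in> localized_submodule G"
  from this(2) obtain s x where x: "s \<in> S" "x \<in> G" "x' \<in> carrier N'" "s \<odot>\<^bsub>N'\<^esub> x' = \<iota> x"
    by (rule localized_submoduleE)
  have "s \<odot>\<^bsub>N'\<^esub> (a \<odot>\<^bsub>N'\<^esub> x') = a \<odot>\<^bsub>N'\<^esub> (s \<odot>\<^bsub>N'\<^esub> x')"
    using x a by (intro N.smult_left_commute) simp_all
  also have "\<dots> = \<iota> (a \<odot>\<^bsub>N\<^esub> x)" using a x M.submodule_subset[OF G] by simp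
  finally show "a \<odot>\<^bsub>N'\<^esub> x' \<in> localized_submodule G"
    using x a by (intro localized_submoduleI[OF x(1) M.submoduleE(4)[OF G a x(2)]]) simp_all
qed (simp add: localized_submodule_def)

lemma localized_submodule_divide:
  assumes "s \<in> S" "x' \<in> carrier N'" "s \<odot>\<^bsub>N'\<^esub> x' \<in> localized_submodule G"
  shows "x' \<in> localized_submodule G"
proof -
  obtain t g where "t \<in> S" "g \<in> G" "t \<odot>\<^bsub>N'\<^esub> (s \<odot>\<^bsub>N'\<^esub> x') = \<iota> g"
    using assms(3) by (rule localized_submoduleE)
  then show ?thesis
    using assms by (intro localized_submoduleI[OF S_mult[of t s]]) (simp_all add: N.smult_assoc1)
qed

lemma \<iota>_mem_localized_submodule_iff:
  assumes G: "submodule G R N" and x: "x \<in> carrier N"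
  shows "\<iota> x \<in> localized_submodule G \<longleftrightarrow> (\<exists>s\<in>S. s \<odot>\<^bsub>N\<^esub> x \<in> G)"
proof
  assume "\<iota> x \<in> localized_submodule G"
  then obtain s g where s: "s \<in> S" "g \<in> G" "s \<odot>\<^bsub>N'\<^esub> \<iota> x = \<iota> g" by (rule localized_submoduleE)
  have gN: "g \<in> carrier N" by (rule M.submodule_subset[OF G s(2)])
  have "\<iota> (s \<odot>\<^bsub>N\<^esub> x \<ominus>\<^bsub>N\<^esub> g) = \<zero>\<^bsub>N'\<^esub>" using s x gN by simp
  then obtain t where t: "t \<in> S" "t \<odot>\<^bsub>N\<^esub> (s \<odot>\<^bsub>N\<^esub> x \<ominus>\<^bsub>N\<^esub> g) = \<zero>\<^bsub>N\<^esub>"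
    using torsion[of "s \<odot>\<^bsub>N\<^esub> x \<ominus>\<^bsub>N\<^esub> g"] s x gN M.M.minus_closed by auto
  then have "(t \<otimes> s) \<odot>\<^bsub>N\<^esub> x = t \<odot>\<^bsub>N\<^esub> g"
    using s x gN by (simp add: M.smult_r_diff M.smult_assoc1 M.diff_eq_zero_iff)
  then have "(t \<otimes> s) \<odot>\<^bsub>N\<^esub> x \<in> G" using t s M.submoduleE(4)[OF G] by simp
  then show "\<exists>s\<in>S. s \<odot>\<^bsub>N\<^esub> x \<in> G" using S_mult[OF t(1) s(1)] by (rule rev_bexI[rotated])
next
  assume "\<exists>s\<in>S. s \<odot>\<^bsub>N\<^esub> x \<in> G"
  then obtain s where "s \<in> S" "s \<odot>\<^bsub>N\<^esub> x \<in> G" ..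
  then show "\<iota> x \<in> localized_submodule G"
    by (rule localized_submoduleI) (use x \<open>s \<in> S\<close> in simp_all)
qed

lemma localization_submodule:
  assumes G: "submodule G R N"
  shows "localization_map R (N\<lparr>carrier := G\<rparr>) (N'\<lparr>carrier := localized_submodule G\<rparr>) \<iota> S"
proof (intro localization_map.intro module_homomorphism.intro module_homomorphism_axioms.intro
    localization_map_axioms.intro S_subset S_one S_mult)
  note G' = localized_submodule_submodule[OF G] and GN = M.submodule_subset[OF G]
  have \<iota>_G: "\<iota> x \<in> localized_submodule G" if "x \<in> G" for x
    by (rule localized_submoduleI[OF S_one that]) (use that GN in simp_all)
  show "module R (N\<lparr>carrier := G\<rparr>)" "module R (N'\<lparr>carrier := localized_submodule G\<rparr>)"
    using M.submodule_module[OF G] N.submodule_module[OF G'] by simp_all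
  show "\<iota> \<in> mod_hom R (N\<lparr>carrier := G\<rparr>) (N'\<lparr>carrier := localized_submodule G\<rparr>)"
    using \<iota>_G GN by (auto simp: mod_hom_def)
  show "\<exists>s\<in>S. s \<odot>\<^bsub>N'\<lparr>carrier := localized_submodule G\<rparr>\<^esub> x' \<in> \<iota> ` carrier (N\<lparr>carrier := G\<rparr>)"
    if "x' \<in> carrier (N'\<lparr>carrier := localized_submodule G\<rparr>)" for x'
    using that by (auto simp: localized_submodule_def)
  show "\<exists>s\<in>S. s \<odot>\<^bsub>N\<lparr>carrier := G\<rparr>\<^esub> x = \<zero>\<^bsub>N\<lparr>carrier := G\<rparr>\<^esub>"
    if "x \<in> carrier (N\<lparr>carrier := G\<rparr>)" "\<iota> x = \<zero>\<^bsub>N'\<lparr>carrier := localized_submodule G\<rparr>\<^esub>" for x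
    using that torsion GN by simp
  fix s assume s: "s \<in> S"
  have "inj_on (\<lambda>x. s \<odot>\<^bsub>N'\<^esub> x) (localized_submodule G)"
    using bij_betw_imp_inj_on[OF bij[OF s]] N.submoduleE(1)[OF G'] by (rule inj_on_subset)
  moreover have "x' \<in> (\<lambda>x. s \<odot>\<^bsub>N'\<^esub> x) ` localized_submodule G"
    if x': "x' \<in> localized_submodule G" for x'
  proof -
    obtain y' where "y' \<in> carrier N'" "s \<odot>\<^bsub>N'\<^esub> y' = x'"
      using divideE[OF s] N.submodule_subset[OF G' x'] by blast
    then show ?thesis using localized_submodule_divide[OF s] x' by blast
  qed
  ultimately show "bij_betw (\<lambda>x. s \<odot>\<^bsub>N'\<lparr>carrier := localized_submodule G\<rparr>\<^esub> x)
      (carrier (N'\<lparr>carrier := localized_submodule G\<rparr>))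
      (carrier (N'\<lparr>carrier := localized_submodule G\<rparr>))"
    using N.submoduleE(4)[OF G'] s by (auto simp: bij_betw_def)
qed

end

lemma (in module_homomorphism) hom_through_surjection:
  assumes surj: "f ` carrier M = carrier N" and h: "module_homomorphism R M P h"
    and kernel: "\<forall>x\<in>carrier M. f x = \<zero>\<^bsub>N\<^esub> \<longrightarrow> h x = \<zero>\<^bsub>P\<^esub>"
  shows "\<exists>g. module_homomorphism R N P g \<and> (\<forall>x\<in>carrier M. g (f x) = h x)"
proof -
  interpret h: module_homomorphism R M P h by (rule h)
  have eq: "h x = h y" if "x \<in> carrier M" "y \<in> carrier M" "f x = f y" for x y
  proof -
    have "h (x \<ominus>\<^bsub>M\<^esub> y) = \<zero>\<^bsub>P\<^esub>"
      by (rule kernel[rule_format]) (use that in \<open>simp_all add: N.diff_eq_zero_iff\<close>)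
    then show ?thesis using that by (simp add: h.N.diff_eq_zero_iff)
  qed
  define g where "g c = h (inv_into (carrier M) f c)" for c
  have g: "g (f x) = h x" if "x \<in> carrier M" for x
    unfolding g_def
    by (rule eq) (use that in \<open>simp_all add: inv_into_into f_inv_into_f\<close>)
  have all: "(\<forall>c\<in>carrier N. Q c) \<longleftrightarrow> (\<forall>x\<in>carrier M. Q (f x))" for Q
    unfolding surj[symmetric] by blast
  have "g (f x \<oplus>\<^bsub>N\<^esub> f y) = g (f x) \<oplus>\<^bsub>P\<^esub> g (f y)" if "x \<in> carrier M" "y \<in> carrier M" for x y
    using that g[of "x \<oplus>\<^bsub>M\<^esub> y"] by (simp add: g)
  moreover have "g (r \<odot>\<^bsub>N\<^esub> f x) = r \<odot>\<^bsub>P\<^esub> g (f x)" if "r \<in> carrier R" "x \<in> carrier M" for r x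
    using that g[of "r \<odot>\<^bsub>M\<^esub> x"] by (simp add: g)
  ultimately have "g \<in> mod_hom R N P"
    by (simp add: mod_hom_def Pi_iff flip: Ball_def) (simp add: all g)
  then have "module_homomorphism R N P g"
    by (intro module_homomorphism.intro module_homomorphism_axioms.intro N.module_axioms
        h.N.module_axioms)
  then show ?thesis using g by blast
qed

lemma (in localization_map) smult_bij_image:
  assumes \<pi>: "module_homomorphism R N' Q \<pi>" "\<pi> ` carrier N' = carrier Q" and s: "s \<in> S"
    and cancel: "\<And>x'. x' \<in> carrier N' \<Longrightarrow> \<pi> (s \<odot>\<^bsub>N'\<^esub> x') = \<zero>\<^bsub>Q\<^esub> \<Longrightarrow> \<pi> x' = \<zero>\<^bsub>Q\<^esub>"
  shows "bij_betw (\<lambda>c. s \<odot>\<^bsub>Q\<^esub> c) (carrier Q) (carrier Q)"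
proof -
  interpret \<pi>: module_homomorphism R N' Q \<pi> by (rule \<pi>(1))
  interpret mult: module_homomorphism R Q Q "\<lambda>c. s \<odot>\<^bsub>Q\<^esub> c"
    by unfold_locales
      (use s in \<open>simp_all add: mod_hom_def \<pi>.N.smult_r_distr \<pi>.N.smult_left_commute[of s]\<close>)
  have preimage: "\<exists>x'\<in>carrier N'. c = \<pi> x'" if "c \<in> carrier Q" for c using that \<pi>(2) by blast
  have "inj_on (\<lambda>c. s \<odot>\<^bsub>Q\<^esub> c) (carrier Q)"
    unfolding mult.inj_on_iff
  proof (intro ballI impI)
    fix c assume c: "c \<in> carrier Q" "s \<odot>\<^bsub>Q\<^esub> c = \<zero>\<^bsub>Q\<^esub>"
    obtain x' where "x' \<in> carrier N'" "c = \<pi> x'" using preimage[OF c(1)] by blast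
    then show "c = \<zero>\<^bsub>Q\<^esub>" using cancel[of x'] c(2) s by simp
  qed
  moreover have "c \<in> (\<lambda>c. s \<odot>\<^bsub>Q\<^esub> c) ` carrier Q" if c: "c \<in> carrier Q" for c
  proof -
    obtain x' where x': "x' \<in> carrier N'" "c = \<pi> x'" using preimage[OF c] by blast
    obtain y' where y': "y' \<in> carrier N'" "s \<odot>\<^bsub>N'\<^esub> y' = x'" using s x'(1) by (rule divideE)
    show ?thesis
      by (rule image_eqI[of _ _ "\<pi> y'"]) (use s x' y' \<pi>.smult[of s y'] in simp_all)
  qed
  ultimately show ?thesis using s by (auto simp: bij_betw_def)
qed

lemma (in localization_map) localization_of_surjections:
  assumes \<pi>: "module_homomorphism R N Q \<pi>" "\<pi> ` carrier N = carrier Q"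
    and \<pi>': "module_homomorphism R N' Q' \<pi>'" "\<pi>' ` carrier N' = carrier Q'"
    and kernel: "\<And>x. x \<in> carrier N \<Longrightarrow> \<pi>' (\<iota> x) = \<zero>\<^bsub>Q'\<^esub> \<longleftrightarrow> (\<exists>s\<in>S. \<pi> (s \<odot>\<^bsub>N\<^esub> x) = \<zero>\<^bsub>Q\<^esub>)"
    and cancel: "\<And>s x'. s \<in> S \<Longrightarrow> x' \<in> carrier N' \<Longrightarrow> \<pi>' (s \<odot>\<^bsub>N'\<^esub> x') = \<zero>\<^bsub>Q'\<^esub> \<Longrightarrow> \<pi>' x' = \<zero>\<^bsub>Q'\<^esub>"
  shows "\<exists>\<iota>'. localization_map R Q Q' \<iota>' S"
proof -
  interpret \<pi>: module_homomorphism R N Q \<pi> by (rule \<pi>(1))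
  interpret \<pi>': module_homomorphism R N' Q' \<pi>' by (rule \<pi>'(1))
  have "module_homomorphism R N Q' (\<lambda>x. \<pi>' (\<iota> x))"
    by (intro module_homomorphism.intro module_homomorphism_axioms.intro M.module_axioms
        \<pi>'.N.module_axioms mod_hom_comp[OF hom \<pi>'.hom])
  moreover have "\<forall>x\<in>carrier N. \<pi> x = \<zero>\<^bsub>Q\<^esub> \<longrightarrow> \<pi>' (\<iota> x) = \<zero>\<^bsub>Q'\<^esub>"
    using kernel S_one M.smult_one by metis
  ultimately obtain \<iota>' where \<iota>': "module_homomorphism R Q Q' \<iota>'" "\<forall>x\<in>carrier N. \<iota>' (\<pi> x) = \<pi>' (\<iota> x)"
    using \<pi>.hom_through_surjection[OF \<pi>(2)] by metis
  have "localization_map R Q Q' \<iota>' S"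
  proof (intro localization_map.intro localization_map_axioms.intro \<iota>'(1) S_subset S_one S_mult)
    show "bij_betw (\<lambda>c. s \<odot>\<^bsub>Q'\<^esub> c) (carrier Q') (carrier Q')" if "s \<in> S" for s
      by (rule smult_bij_image[OF \<pi>' that cancel[OF that]])
  next
    fix c assume "c \<in> carrier Q'"
    then obtain x' where x': "x' \<in> carrier N'" "c = \<pi>' x'" unfolding \<pi>'(2)[symmetric] by blast
    obtain s x where s: "s \<in> S" "x \<in> carrier N" "s \<odot>\<^bsub>N'\<^esub> x' = \<iota> x"
      using denominator[OF x'(1)] by blast
    have "s \<odot>\<^bsub>Q'\<^esub> c = \<iota>' (\<pi> x)" using \<pi>'.smult[of s x'] x' s \<iota>'(2) by simp
    then show "\<exists>s\<in>S. s \<odot>\<^bsub>Q'\<^esub> c \<in> \<iota>' ` carrier Q"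
      using s by (intro bexI[of _ s] image_eqI[of _ _ "\<pi> x"]) simp_all
  next
    fix c assume c: "c \<in> carrier Q" "\<iota>' c = \<zero>\<^bsub>Q'\<^esub>"
    obtain x where x: "x \<in> carrier N" "c = \<pi> x" using c(1) unfolding \<pi>(2)[symmetric] by blast
    then obtain s where "s \<in> S" "\<pi> (s \<odot>\<^bsub>N\<^esub> x) = \<zero>\<^bsub>Q\<^esub>" using kernel c(2) \<iota>'(2) by auto
    then show "\<exists>s\<in>S. s \<odot>\<^bsub>Q\<^esub> c = \<zero>\<^bsub>Q\<^esub>" using x by (intro bexI[of _ s]) simp_all
  qed
  then show ?thesis by (rule exI[of _ \<iota>'])
qed

lemma (in localization_map) localization_quotient:
  assumes G: "submodule G R N"
  shows "\<exists>\<iota>'. localization_map R (quotient_module N G)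
    (quotient_module N' (localized_submodule G)) \<iota>' S"
proof (rule localization_of_surjections)
  let ?G' = "localized_submodule G"
  note G' = localized_submodule_submodule[OF G]
  note \<pi>_zero_iff = quotient_module_zero_iff[OF M.module_axioms G]
    and \<pi>'_zero_iff = quotient_module_zero_iff[OF N.module_axioms G']
  show "module_homomorphism R N (quotient_module N G) (\<lambda>x. G +>\<^bsub>N\<^esub> x)"
    "(\<lambda>x. G +>\<^bsub>N\<^esub> x) ` carrier N = carrier (quotient_module N G)"
    by (rule quotient_module_hom[OF M.module_axioms G] quotient_module_surj)+
  show "module_homomorphism R N' (quotient_module N' ?G') (\<lambda>x'. ?G' +>\<^bsub>N'\<^esub> x')"
    "(\<lambda>x'. ?G' +>\<^bsub>N'\<^esub> x') ` carrier N' = carrier (quotient_module N' ?G')"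
    by (rule quotient_module_hom[OF N.module_axioms G'] quotient_module_surj)+
  show "?G' +>\<^bsub>N'\<^esub> \<iota> x = \<zero>\<^bsub>quotient_module N' ?G'\<^esub> \<longleftrightarrow> (\<exists>s\<in>S. G +>\<^bsub>N\<^esub> (s \<odot>\<^bsub>N\<^esub> x) = \<zero>\<^bsub>quotient_module N G\<^esub>)"
    if "x \<in> carrier N" for x
    using \<pi>'_zero_iff[OF closed[OF that]] \<iota>_mem_localized_submodule_iff[OF G that] \<pi>_zero_iff that
    by simp
  show "?G' +>\<^bsub>N'\<^esub> x' = \<zero>\<^bsub>quotient_module N' ?G'\<^esub>"
    if "s \<in> S" "x' \<in> carrier N'" "?G' +>\<^bsub>N'\<^esub> (s \<odot>\<^bsub>N'\<^esub> x') = \<zero>\<^bsub>quotient_module N' ?G'\<^esub>" for s x'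
    using that localized_submodule_divide[of s x' G] \<pi>'_zero_iff[of x'] \<pi>'_zero_iff[of "s \<odot>\<^bsub>N'\<^esub> x'"]
    by simp
qed

section \<open>Change of rings\<close>

definition restrict_scalars :: "('r \<Rightarrow> 's) \<Rightarrow> ('s, 'm, 'y) module_scheme \<Rightarrow> ('r, 'm) module"
  where "restrict_scalars h M =
    \<lparr>carrier = carrier M, monoid.mult = undefined, one = undefined, ring.zero = \<zero>\<^bsub>M\<^esub>, add = add M,
     smult = (\<lambda>r x. h r \<odot>\<^bsub>M\<^esub> x)\<rparr>"

lemma restrict_scalars_simps [simp]:
  "carrier (restrict_scalars h M) = carrier M"
  "\<zero>\<^bsub>restrict_scalars h M\<^esub> = \<zero>\<^bsub>M\<^esub>"
  "x \<oplus>\<^bsub>restrict_scalars h M\<^esub> y = x \<oplus>\<^bsub>M\<^esub> y"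
  "r \<odot>\<^bsub>restrict_scalars h M\<^esub> x = h r \<odot>\<^bsub>M\<^esub> x"
  by (simp_all add: restrict_scalars_def)

lemma restrict_scalars_diff [simp]: "x \<ominus>\<^bsub>restrict_scalars h M\<^esub> y = x \<ominus>\<^bsub>M\<^esub> y"
  by (simp add: restrict_scalars_def a_minus_def a_inv_def m_inv_def)

lemma restrict_scalars_submodule:
  "(restrict_scalars h M)\<lparr>carrier := G\<rparr> = restrict_scalars h (M\<lparr>carrier := G\<rparr>)"
  by (simp add: restrict_scalars_def)

lemma restrict_scalars_quotient:
  "quotient_module (restrict_scalars h M) G = restrict_scalars h (quotient_module M G)"
  by (simp add: restrict_scalars_def quotient_module_def A_RCOSETS_def RCOSETS_def set_add_def
      set_mult_def[abs_def] a_r_coset_def r_coset_def)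

lemma koszul_d_restrict_scalars:
  "koszul_d (restrict_scalars h M) zs w bs = koszul_d M (map h zs) w bs"
  by (induction zs arbitrary: w bs) (simp_all split: list.split)

lemma restrict_scalars_koszul_cochains:
  "koszul_cochains (restrict_scalars h M) t p = restrict_scalars h (koszul_cochains M t p)"
  by (simp add: koszul_cochains_def function_module_def restrict_scalars_def)

context ring_hom_cring begin

lemma restrict_scalars_module:
  assumes "module S M"
  shows "module R (restrict_scalars h M)"
proof -
  interpret M: module S M by fact
  show ?thesis
    by (intro moduleI abelian_groupI R.is_cring)
      (auto simp: M.M.a_ac M.smult_l_distr M.smult_r_distr M.smult_assoc1
        intro: bexI[of _ "\<ominus>\<^bsub>M\<^esub> _"] M.M.l_neg)
qed

lemma map_powers: "set ys \<subseteq> carrier R \<Longrightarrow> map h (powers R n ys) = powers S n (map h ys)"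
  by (induction ys) (simp_all add: ring.hom_nat_pow)

lemma hom_koszul_prod: "set xs \<subseteq> carrier R \<Longrightarrow> h (koszul_prod R xs bs) = koszul_prod S (map h xs) bs"
proof (induction xs arbitrary: bs)
  case (Cons x xs)
  have "koszul_prod R xs cs \<in> carrier R" for cs using Cons.prems by simp
  then show ?case using Cons by (simp split: list.split)
qed simp

theorem koszul_vanishes_restrict_scalars:
  assumes M: "module S M" and ys: "set ys \<subseteq> carrier R"
  shows "koszul_vanishes R ys (restrict_scalars h M) p \<longleftrightarrow> koszul_vanishes S (map h ys) M p"
proof -
  interpret M: module S M by (rule M)
  interpret N: module R "restrict_scalars h M" by (rule restrict_scalars_module[OF M])
  interpret M: koszul S M "map h ys" by (rule M.koszulI) (use ys in auto)
  interpret N: koszul R "restrict_scalars h M" ys by (rule N.koszulI[OF ys])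
  have d: "koszul_d (restrict_scalars h M) (powers R n ys) =
      koszul_d M (powers S n (map h ys))" for n
    by (simp add: fun_eq_iff koszul_d_restrict_scalars map_powers[OF ys])
  have \<tau>: "koszul_transition R (restrict_scalars h M) (powers R n ys) =
      koszul_transition S M (powers S n (map h ys))" for n
    by (simp add: fun_eq_iff koszul_transition_def hom_koszul_prod map_powers ys)
  show ?thesis
    unfolding koszul_vanishes_def N.acyclic_def N.null_def N.cocycles_def
      M.acyclic_def M.null_def M.cocycles_def
    by (simp add: d \<tau> restrict_scalars_koszul_cochains)
qed

lemma genideal_image:
  assumes "A \<subseteq> carrier R"
  shows "Idl\<^bsub>S\<^esub> (h ` (Idl\<^bsub>R\<^esub> A)) = Idl\<^bsub>S\<^esub> (h ` A)"
proof (rule subset_antisym)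
  have hA: "h ` A \<subseteq> carrier S" using assms by auto
  have "ideal {r \<in> carrier R. h r \<in> Idl\<^bsub>S\<^esub> (h ` A)} R"
    by (rule ring.ideal_vimage[OF S.genideal_ideal[OF hA]])
  then have "Idl\<^bsub>R\<^esub> A \<subseteq> {r \<in> carrier R. h r \<in> Idl\<^bsub>S\<^esub> (h ` A)}"
    by (rule R.genideal_minimal) (use assms S.genideal_self[OF hA] in blast)
  then show "Idl\<^bsub>S\<^esub> (h ` (Idl\<^bsub>R\<^esub> A)) \<subseteq> Idl\<^bsub>S\<^esub> (h ` A)"
    by (intro S.genideal_minimal[OF S.genideal_ideal[OF hA]]) blast
  have "h ` (Idl\<^bsub>R\<^esub> A) \<subseteq> carrier S"
    using ideal.Icarr[OF R.genideal_ideal[OF assms]] by auto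
  then show "Idl\<^bsub>S\<^esub> (h ` A) \<subseteq> Idl\<^bsub>S\<^esub> (h ` (Idl\<^bsub>R\<^esub> A))"
    using R.genideal_self[OF assms] by (intro S.subset_Idl_subset) (simp_all add: image_mono)
qed

end

section \<open>Localization of rings\<close>

locale ring_localization = ring_hom_cring R R' \<phi>
  for R :: "('r, 'x) ring_scheme" (structure) and R' :: "('s, 'w) ring_scheme" (structure) and \<phi> +
  fixes S
  assumes denominators_subset: "S \<subseteq> carrier R"
    and denominator_unit: "s \<in> S \<Longrightarrow> \<phi> s \<in> Units R'"
    and numerator: "x \<in> carrier R' \<Longrightarrow> \<exists>s\<in>S. \<exists>r\<in>carrier R. \<phi> s \<otimes>\<^bsub>R'\<^esub> x = \<phi> r"
begin

lemma numeratorE: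
  assumes "x \<in> carrier R'"
  obtains s r where "s \<in> S" "s \<in> carrier R" "r \<in> carrier R" "\<phi> s \<otimes>\<^bsub>R'\<^esub> x = \<phi> r"
  using numerator[OF assms] denominators_subset by blast

lemma noetherian_localization:
  assumes "noetherian_ring R"
  shows "noetherian_ring R'"
proof (intro noetherian_ring.intro noetherian_ring_axioms.intro S.ring_axioms)
  interpret noetherian_ring R by fact
  fix I assume I: "ideal I R'"
  interpret I: ideal I R' by (rule I)
  let ?J = "{r \<in> carrier R. \<phi> r \<in> I}"
  obtain A where A: "A \<subseteq> carrier R" "finite A" "?J = Idl A"
    using finetely_gen[OF ring.ideal_vimage[OF I]] by blast
  have \<phi>A: "\<phi> ` A \<subseteq> carrier R'" using A(1) by auto
  interpret K: ideal "Idl\<^bsub>R'\<^esub> (\<phi> ` A)" R' by (rule S.genideal_ideal[OF \<phi>A])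
  have "I \<subseteq> Idl\<^bsub>R'\<^esub> (\<phi> ` A)"
  proof
    fix x assume x: "x \<in> I"
    obtain s r where s: "s \<in> S" "s \<in> carrier R" "r \<in> carrier R" "\<phi> s \<otimes>\<^bsub>R'\<^esub> x = \<phi> r"
      using I.Icarr[OF x] by (rule numeratorE)
    have "\<phi> r \<in> I" using I.I_l_closed[OF x, of "\<phi> s"] s by simp
    then have "\<phi> r \<in> \<phi> ` (Idl A)" using s(3) A(3) by blast
    moreover have "\<phi> ` (Idl A) \<subseteq> Idl\<^bsub>R'\<^esub> (\<phi> ` (Idl A))"
      by (rule S.genideal_self) (use A(3) in auto)
    ultimately have "\<phi> r \<in> Idl\<^bsub>R'\<^esub> (\<phi> ` A)" unfolding genideal_image[OF A(1)] by blast
    moreover have "x = inv\<^bsub>R'\<^esub> \<phi> s \<otimes>\<^bsub>R'\<^esub> \<phi> r"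
      using denominator_unit[OF s(1)] I.Icarr[OF x]
      by (simp add: S.m_assoc[symmetric] S.Units_closed flip: s(4))
    ultimately show "x \<in> Idl\<^bsub>R'\<^esub> (\<phi> ` A)"
      using K.I_l_closed denominator_unit[OF s(1)] by simp
  qed
  moreover have "Idl\<^bsub>R'\<^esub> (\<phi> ` A) \<subseteq> I"
    by (rule S.genideal_minimal[OF I]) (use R.genideal_self[OF A(1)] A(3) in blast)
  ultimately show "\<exists>B\<subseteq>carrier R'. finite B \<and> I = Idl\<^bsub>R'\<^esub> B"
    using \<phi>A A(2) by (intro exI[of _ "\<phi> ` A"]) simp
qed

lemma prime_in_jacobson_radical:
  assumes "primeideal \<pp> R" and S: "S = carrier R - \<pp>" and y: "y \<in> \<pp>"
  shows "\<phi> y \<in> jacobson_radical R'"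
proof -
  interpret \<pp>: primeideal \<pp> R by fact
  note yR = \<pp>.Icarr[OF y]
  have "\<one>\<^bsub>R'\<^esub> \<ominus>\<^bsub>R'\<^esub> x \<otimes>\<^bsub>R'\<^esub> \<phi> y \<in> Units R'" if x: "x \<in> carrier R'" for x
  proof -
    obtain s r where s: "s \<in> S" "s \<in> carrier R" "r \<in> carrier R" "\<phi> s \<otimes>\<^bsub>R'\<^esub> x = \<phi> r"
      using x by (rule numeratorE)
    have ry: "r \<otimes> y \<in> \<pp>" using y s(3) by (rule \<pp>.I_l_closed)
    have "s \<ominus> r \<otimes> y \<notin> \<pp>"
    proof
      assume "s \<ominus> r \<otimes> y \<in> \<pp>"
      then have "(s \<ominus> r \<otimes> y) \<oplus> r \<otimes> y \<in> \<pp>" using ry by (rule \<pp>.a_closed)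
      then show False using s yR S by (simp add: a_minus_def R.a_assoc R.l_neg)
    qed
    then have "\<phi> (s \<ominus> r \<otimes> y) \<in> Units R'" using s yR S by (intro denominator_unit) simp
    also have "\<phi> (s \<ominus> r \<otimes> y) = (\<one>\<^bsub>R'\<^esub> \<ominus>\<^bsub>R'\<^esub> x \<otimes>\<^bsub>R'\<^esub> \<phi> y) \<otimes>\<^bsub>R'\<^esub> \<phi> s"
    proof -
      have "\<phi> (s \<ominus> r \<otimes> y) = \<phi> s \<ominus>\<^bsub>R'\<^esub> \<phi> r \<otimes>\<^bsub>R'\<^esub> \<phi> y" using s(2,3) yR by simp
      also have "\<phi> r \<otimes>\<^bsub>R'\<^esub> \<phi> y = x \<otimes>\<^bsub>R'\<^esub> \<phi> y \<otimes>\<^bsub>R'\<^esub> \<phi> s"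
        unfolding s(4)[symmetric] using s(2) yR x by (simp add: S.m_ac)
      also have "\<phi> s \<ominus>\<^bsub>R'\<^esub> x \<otimes>\<^bsub>R'\<^esub> \<phi> y \<otimes>\<^bsub>R'\<^esub> \<phi> s = (\<one>\<^bsub>R'\<^esub> \<ominus>\<^bsub>R'\<^esub> x \<otimes>\<^bsub>R'\<^esub> \<phi> y) \<otimes>\<^bsub>R'\<^esub> \<phi> s"
        using s(2) yR x by (simp add: a_minus_def S.l_distr S.l_minus)
      finally show ?thesis .
    qed
    finally show ?thesis by (rule S.unit_factor) (use x yR s(2) in simp_all)
  qed
  then show ?thesis using yR by (simp add: jacobson_radical_def)
qed

end

locale module_localization = ring: ring_localization R R' \<phi> S + L: module R' N' +
  localization_map R N "restrict_scalars \<phi> N'" \<iota> S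
  for R :: "('r, 'x) ring_scheme" (structure) and R' :: "('s, 'w) ring_scheme" and \<phi> S
    and N :: "('r, 'm, 'y) module_scheme" and N' :: "('s, 'n, 'z) module_scheme" and \<iota>
begin

lemma submodule_extend_scalars:
  assumes G: "submodule G R N"
  shows "submodule (localized_submodule G) R' N'"
proof (rule L.submodule_closedI)
  note GL = localized_submodule_submodule[OF G]
  show "localized_submodule G \<subseteq> carrier N'" "\<zero>\<^bsub>N'\<^esub> \<in> localized_submodule G"
    using N.submoduleE(1)[OF GL] N.submodule_zero[OF GL] by simp_all
  show "x \<oplus>\<^bsub>N'\<^esub> y \<in> localized_submodule G"
    if "x \<in> localized_submodule G" "y \<in> localized_submodule G" for x y
    using N.submoduleE(5)[OF GL that] by simp
  fix a x assume a: "a \<in> carrier R'" and x: "x \<in> localized_submodule G"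
  have xN': "x \<in> carrier N'" using N.submodule_subset[OF GL x] by simp
  obtain s r where s: "s \<in> S" "s \<in> carrier R" "r \<in> carrier R" "\<phi> s \<otimes>\<^bsub>R'\<^esub> a = \<phi> r"
    using a by (rule ring.numeratorE)
  have "\<phi> s \<odot>\<^bsub>N'\<^esub> (a \<odot>\<^bsub>N'\<^esub> x) = \<phi> r \<odot>\<^bsub>N'\<^esub> x"
    using a s(2) xN' by (simp add: L.smult_assoc1 flip: s(4))
  also have "\<dots> \<in> localized_submodule G" using N.submoduleE(4)[OF GL s(3) x] by simp
  finally show "a \<odot>\<^bsub>N'\<^esub> x \<in> localized_submodule G"
    using localized_submodule_divide[OF s(1), of "a \<odot>\<^bsub>N'\<^esub> x" G] L.smult_closed[OF a xN']
    unfolding restrict_scalars_simps by blast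
qed

lemma module_localization_submodule:
  assumes "submodule G R N"
  shows "module_localization R R' \<phi> S (N\<lparr>carrier := G\<rparr>) (N'\<lparr>carrier := localized_submodule G\<rparr>) \<iota>"
  using localization_submodule[OF assms] L.submodule_module[OF submodule_extend_scalars[OF assms]]
  by (intro module_localization.intro ring.ring_localization_axioms)
    (simp_all add: restrict_scalars_submodule)

lemma module_localization_quotient:
  assumes G: "submodule G R N"
  shows "\<exists>\<iota>'. module_localization R R' \<phi> S (quotient_module N G)
      (quotient_module N' (localized_submodule G)) \<iota>'"
proof -
  obtain \<iota>' where "localization_map R (quotient_module N G)
      (quotient_module (restrict_scalars \<phi> N') (localized_submodule G)) \<iota>' S"
    using localization_quotient[OF G] by (rule exE)
  moreover have "module R' (quotient_module N' (localized_submodule G))"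
    by (rule module_homomorphism.axioms(2)[OF quotient_module_hom])
      (rule L.module_axioms, rule submodule_extend_scalars[OF G])
  ultimately have "module_localization R R' \<phi> S (quotient_module N G)
      (quotient_module N' (localized_submodule G)) \<iota>'"
    by (intro module_localization.intro ring.ring_localization_axioms)
      (simp_all add: restrict_scalars_quotient)
  then show ?thesis by (rule exI[of _ \<iota>'])
qed

lemma module_localization_subquotient:
  assumes G: "submodule G R N" and H: "submodule H R N" and "G \<subseteq> H"
  shows "\<exists>\<iota>'. module_localization R R' \<phi> S (quotient_module (N\<lparr>carrier := H\<rparr>) G)
    (quotient_module (N'\<lparr>carrier := localized_submodule H\<rparr>) (localized_submodule G)) \<iota>'"
proof -
  interpret H: module_localization R R' \<phi> S "N\<lparr>carrier := H\<rparr>"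
      "N'\<lparr>carrier := localized_submodule H\<rparr>" \<iota>
    by (rule module_localization_submodule[OF H])
  have "H.localized_submodule G = localized_submodule G"
    using localized_submodule_mono[OF \<open>G \<subseteq> H\<close>] L.submoduleE(1)[OF submodule_extend_scalars[OF H]]
    by (auto simp: H.localized_submodule_def localized_submodule_def[of G] subset_iff)
  then show ?thesis
    using H.module_localization_quotient[OF M.submodule_of_submodule[OF G H \<open>G \<subseteq> H\<close>]] by simp
qed

lemma finitely_generated_localization:
  assumes "finitely_generated R N"
  shows "finitely_generated R' N'"
proof -
  obtain A where A: "finite A" "A \<subseteq> carrier N" "\<Inter>{H. submodule H R N \<and> A \<subseteq> H} = carrier N"
    using assms by (auto simp: finitely_generated_def)
  have \<iota>A: "\<iota> ` A \<subseteq> carrier N'" using A(2) closed by auto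
  have "carrier N' \<subseteq> H" if H: "submodule H R' N'" "\<iota> ` A \<subseteq> H" for H
  proof
    have "submodule H R (restrict_scalars \<phi> N')"
      by (rule N.submodule_closedI)
        (use L.submoduleE[OF H(1)] L.submodule_zero[OF H(1)] in auto)
    then have "submodule {x \<in> carrier N. \<iota> x \<in> H} R N"
      by (intro preimage_submodule M.carrier_is_submodule)
    then have G: "carrier N \<subseteq> {x \<in> carrier N. \<iota> x \<in> H}" using A(2,3) H(2) by blast
    fix x' assume x': "x' \<in> carrier N'"
    obtain s x where s: "s \<in> S" "x \<in> carrier N" "\<phi> s \<odot>\<^bsub>N'\<^esub> x' = \<iota> x"
      using denominator[of x'] x' by auto
    have unit: "\<phi> s \<in> Units R'" "\<phi> s \<in> carrier R'"
      using ring.denominator_unit[OF s(1)] by (simp_all add: ring.S.Units_closed)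
    have "\<phi> s \<odot>\<^bsub>N'\<^esub> x' \<in> H" using G s by auto
    then have "inv\<^bsub>R'\<^esub> \<phi> s \<odot>\<^bsub>N'\<^esub> (\<phi> s \<odot>\<^bsub>N'\<^esub> x') \<in> H"
      using L.submoduleE(4)[OF H(1)] ring.S.Units_inv_closed[OF unit(1)] by blast
    then show "x' \<in> H" using unit s(1) x' by (simp add: L.smult_assoc1[symmetric])
  qed
  then have "\<Inter>{H. submodule H R' N' \<and> \<iota> ` A \<subseteq> H} = carrier N'"
    using L.carrier_is_submodule \<iota>A by (intro subset_antisym Inter_lower Inter_greatest) auto
  then show ?thesis
    using A(1) \<iota>A L.module_axioms
    unfolding finitely_generated_def by (intro conjI exI[of _ "\<iota> ` A"]) simp_all
qed

theorem koszul_vanishes_localized: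
  assumes "set ys \<subseteq> carrier R" "koszul_vanishes R ys N p"
  shows "koszul_vanishes R' (map \<phi> ys) N' p"
  using koszul_vanishes_localization[OF assms]
  unfolding ring.koszul_vanishes_restrict_scalars[OF L.module_axioms assms(1)] .

end

section \<open>Rings and modules of fractions\<close>

lemma regular_module_simps [simp]:
  "carrier (regular_module R) = carrier R" "ring.zero (regular_module R) = \<zero>\<^bsub>R\<^esub>"
  "add (regular_module R) = add R" "smult (regular_module R) = monoid.mult R"
  by (simp_all add: regular_module_def)

lemma (in cring) regular_module: "module R (regular_module R)"
  by (intro moduleI abelian_groupI is_cring)
    (auto simp: a_ac l_distr r_distr m_assoc intro: l_neg bexI[of _ "\<ominus> _"])

lemma UN_UN_constant:
  assumes "(m, s) \<in> U" "(n, t) \<in> V"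
    and "\<And>m s n t. (m, s) \<in> U \<Longrightarrow> (n, t) \<in> V \<Longrightarrow> f m s n t = W"
  shows "(\<Union>(m, s)\<in>U. \<Union>(n, t)\<in>V. f m s n t) = W"
proof (intro equalityI subsetI)
  fix x assume "x \<in> (\<Union>(m, s)\<in>U. \<Union>(n, t)\<in>V. f m s n t)"
  then obtain m s n t where "(m, s) \<in> U" "(n, t) \<in> V" "x \<in> f m s n t" by auto
  then show "x \<in> W" using assms(3) by simp
next
  fix x assume "x \<in> W"
  then have "x \<in> f m s n t" using assms(3)[OF assms(1,2)] by simp
  then show "x \<in> (\<Union>(m, s)\<in>U. \<Union>(n, t)\<in>V. f m s n t)" using assms(1,2) by blast
qed

locale fractions = module R M
  for R :: "('r, 'x) ring_scheme" (structure) and M :: "('r, 'm, 'y) module_scheme" +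
  fixes S :: "'r set"
  assumes S_subset: "S \<subseteq> carrier R" and S_one [simp]: "\<one> \<in> S"
    and S_mult [simp]: "s \<in> S \<Longrightarrow> t \<in> S \<Longrightarrow> s \<otimes> t \<in> S"
begin

lemma S_closed [simp]: "s \<in> S \<Longrightarrow> s \<in> carrier R"
  using S_subset by blast

lemma fraction_mem_iff:
  "(n, t) \<in> fraction S M m s \<longleftrightarrow>
    n \<in> carrier M \<and> t \<in> S \<and> (\<exists>u\<in>S. u \<odot>\<^bsub>M\<^esub> (t \<odot>\<^bsub>M\<^esub> m) = u \<odot>\<^bsub>M\<^esub> (s \<odot>\<^bsub>M\<^esub> n))"
  by (simp add: fraction_def)

lemma fraction_self: "m \<in> carrier M \<Longrightarrow> s \<in> S \<Longrightarrow> (m, s) \<in> fraction S M m s"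
  using S_one by (auto simp: fraction_mem_iff)

lemma fraction_memE:
  assumes "(n, t) \<in> fraction S M m s"
  obtains u where "n \<in> carrier M" "t \<in> S" "u \<in> S" "u \<odot>\<^bsub>M\<^esub> (t \<odot>\<^bsub>M\<^esub> m) = u \<odot>\<^bsub>M\<^esub> (s \<odot>\<^bsub>M\<^esub> n)"
  using assms unfolding fraction_mem_iff by (elim conjE bexE)

lemma fraction_subset:
  assumes "m \<in> carrier M" "n \<in> carrier M" "s \<in> S" "t \<in> S" "u \<in> S"
    and eq: "u \<odot>\<^bsub>M\<^esub> (t \<odot>\<^bsub>M\<^esub> m) = u \<odot>\<^bsub>M\<^esub> (s \<odot>\<^bsub>M\<^esub> n)"
  shows "fraction S M m s \<subseteq> fraction S M n t"
proof (rule subrelI)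
  fix k w assume "(k, w) \<in> fraction S M m s"
  then obtain v where k: "k \<in> carrier M" "w \<in> S" "v \<in> S"
    and eq': "v \<odot>\<^bsub>M\<^esub> (w \<odot>\<^bsub>M\<^esub> m) = v \<odot>\<^bsub>M\<^esub> (s \<odot>\<^bsub>M\<^esub> k)"
    by (rule fraction_memE)
  note rearrange = smult_assoc1[symmetric] R.m_ac
  have "(u \<otimes> v \<otimes> s) \<odot>\<^bsub>M\<^esub> (w \<odot>\<^bsub>M\<^esub> n) = (v \<otimes> w) \<odot>\<^bsub>M\<^esub> (u \<odot>\<^bsub>M\<^esub> (s \<odot>\<^bsub>M\<^esub> n))"
    using assms(1-5) k by (simp add: rearrange)
  also have "\<dots> = (u \<otimes> t) \<odot>\<^bsub>M\<^esub> (v \<odot>\<^bsub>M\<^esub> (w \<odot>\<^bsub>M\<^esub> m))"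
    unfolding eq[symmetric] using assms(1-5) k by (simp add: rearrange)
  also have "\<dots> = (u \<otimes> v \<otimes> s) \<odot>\<^bsub>M\<^esub> (t \<odot>\<^bsub>M\<^esub> k)"
    unfolding eq' using assms(1-5) k by (simp add: rearrange)
  finally show "(k, w) \<in> fraction S M n t"
    unfolding fraction_mem_iff using assms(3-5) k by (intro conjI bexI[of _ "u \<otimes> v \<otimes> s"]) simp_all
qed

lemma fraction_eqI:
  assumes "m \<in> carrier M" "n \<in> carrier M" "s \<in> S" "t \<in> S" "u \<in> S"
    and "u \<odot>\<^bsub>M\<^esub> (t \<odot>\<^bsub>M\<^esub> m) = u \<odot>\<^bsub>M\<^esub> (s \<odot>\<^bsub>M\<^esub> n)"
  shows "fraction S M m s = fraction S M n t"
  using fraction_subset[OF assms] fraction_subset[OF assms(2,1,4,3,5) assms(6)[symmetric]]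
  by (rule subset_antisym)

lemma fraction_eqD:
  assumes "n \<in> carrier M" "t \<in> S" "fraction S M m s = fraction S M n t"
  shows "\<exists>u\<in>S. u \<odot>\<^bsub>M\<^esub> (t \<odot>\<^bsub>M\<^esub> m) = u \<odot>\<^bsub>M\<^esub> (s \<odot>\<^bsub>M\<^esub> n)"
  using fraction_self[OF assms(1,2)] by (simp add: fraction_mem_iff flip: assms(3))

lemma fraction_cross_eqI:
  assumes "m \<in> carrier M" "n \<in> carrier M" "s \<in> S" "t \<in> S" "t \<odot>\<^bsub>M\<^esub> m = s \<odot>\<^bsub>M\<^esub> n"
  shows "fraction S M m s = fraction S M n t"
  by (rule fraction_eqI[OF assms(1-4) S_one]) (simp only: assms(5))

abbreviation (input) "M' \<equiv> localized_module R S M"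

lemma fraction_closed [simp]: "m \<in> carrier M \<Longrightarrow> s \<in> S \<Longrightarrow> fraction S M m s \<in> carrier M'"
  by (auto simp: localized_module_def)

lemma localized_carrierE:
  assumes "x \<in> carrier M'"
  obtains m s where "m \<in> carrier M" "s \<in> S" "x = fraction S M m s"
  using assms by (auto simp: localized_module_def)

lemma localized_zero: "\<zero>\<^bsub>M'\<^esub> = fraction S M \<zero>\<^bsub>M\<^esub> \<one>"
  by (simp add: localized_module_def)

lemma fraction_add [simp]:
  assumes "m \<in> carrier M" "n \<in> carrier M" "s \<in> S" "t \<in> S"
  shows "fraction S M m s \<oplus>\<^bsub>M'\<^esub> fraction S M n t = fraction S M (t \<odot>\<^bsub>M\<^esub> m \<oplus>\<^bsub>M\<^esub> s \<odot>\<^bsub>M\<^esub> n) (s \<otimes> t)"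
  unfolding localized_module_def partial_object.simps monoid.simps ring.simps module.simps
proof (rule UN_UN_constant)
  show "(m, s) \<in> fraction S M m s" "(n, t) \<in> fraction S M n t"
    using assms by (simp_all add: fraction_self)
  fix m' s' n' t' assume m': "(m', s') \<in> fraction S M m s" and n': "(n', t') \<in> fraction S M n t"
  obtain u where u: "m' \<in> carrier M" "s' \<in> S" "u \<in> S" "u \<odot>\<^bsub>M\<^esub> (s' \<odot>\<^bsub>M\<^esub> m) = u \<odot>\<^bsub>M\<^esub> (s \<odot>\<^bsub>M\<^esub> m')"
    using m' by (rule fraction_memE)
  obtain v where v: "n' \<in> carrier M" "t' \<in> S" "v \<in> S" "v \<odot>\<^bsub>M\<^esub> (t' \<odot>\<^bsub>M\<^esub> n) = v \<odot>\<^bsub>M\<^esub> (t \<odot>\<^bsub>M\<^esub> n')"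
    using n' by (rule fraction_memE)
  note rearrange = smult_assoc1[symmetric] smult_r_distr R.m_ac
  have "(u \<otimes> v) \<odot>\<^bsub>M\<^esub> ((s \<otimes> t) \<odot>\<^bsub>M\<^esub> (t' \<odot>\<^bsub>M\<^esub> m' \<oplus>\<^bsub>M\<^esub> s' \<odot>\<^bsub>M\<^esub> n')) =
      (v \<otimes> t \<otimes> t') \<odot>\<^bsub>M\<^esub> (u \<odot>\<^bsub>M\<^esub> (s \<odot>\<^bsub>M\<^esub> m')) \<oplus>\<^bsub>M\<^esub> (u \<otimes> s \<otimes> s') \<odot>\<^bsub>M\<^esub> (v \<odot>\<^bsub>M\<^esub> (t \<odot>\<^bsub>M\<^esub> n'))"
    using assms u(1-3) v(1-3) by (simp add: rearrange)
  also have "\<dots> = (u \<otimes> v) \<odot>\<^bsub>M\<^esub> ((s' \<otimes> t') \<odot>\<^bsub>M\<^esub> (t \<odot>\<^bsub>M\<^esub> m \<oplus>\<^bsub>M\<^esub> s \<odot>\<^bsub>M\<^esub> n))"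
    unfolding u(4)[symmetric] v(4)[symmetric] using assms u(1-3) v(1-3) by (simp add: rearrange)
  finally show "fraction S M (t' \<odot>\<^bsub>M\<^esub> m' \<oplus>\<^bsub>M\<^esub> s' \<odot>\<^bsub>M\<^esub> n') (s' \<otimes> t') =
      fraction S M (t \<odot>\<^bsub>M\<^esub> m \<oplus>\<^bsub>M\<^esub> s \<odot>\<^bsub>M\<^esub> n) (s \<otimes> t)"
    using assms u(1-3) v(1-3) by (intro fraction_eqI[of _ _ _ _ "u \<otimes> v"]) simp_all
qed

lemma localized_abelian_group: "abelian_group M'"
proof (rule abelian_groupI)
  fix x assume "x \<in> carrier M'"
  then obtain m s where x: "m \<in> carrier M" "s \<in> S" "x = fraction S M m s"
    by (rule localized_carrierE)
  then show "\<zero>\<^bsub>M'\<^esub> \<oplus>\<^bsub>M'\<^esub> x = x" by (simp add: localized_zero)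
  have "fraction S M (\<ominus>\<^bsub>M\<^esub> m) s \<oplus>\<^bsub>M'\<^esub> x = fraction S M \<zero>\<^bsub>M\<^esub> (s \<otimes> s)"
    using x by (simp add: smult_r_minus M.l_neg)
  also have "\<dots> = \<zero>\<^bsub>M'\<^esub>"
    unfolding localized_zero using x by (intro fraction_cross_eqI) simp_all
  finally show "\<exists>y\<in>carrier M'. y \<oplus>\<^bsub>M'\<^esub> x = \<zero>\<^bsub>M'\<^esub>"
    by (rule bexI) (use x in simp)
  fix y assume "y \<in> carrier M'"
  then obtain n t where y: "n \<in> carrier M" "t \<in> S" "y = fraction S M n t"
    by (rule localized_carrierE)
  show "x \<oplus>\<^bsub>M'\<^esub> y \<in> carrier M'" "x \<oplus>\<^bsub>M'\<^esub> y = y \<oplus>\<^bsub>M'\<^esub> x"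
    using x y by (simp_all add: R.m_comm M.a_comm)
  fix z assume "z \<in> carrier M'"
  then obtain k w where "k \<in> carrier M" "w \<in> S" "z = fraction S M k w" by (rule localized_carrierE)
  then show "x \<oplus>\<^bsub>M'\<^esub> y \<oplus>\<^bsub>M'\<^esub> z = x \<oplus>\<^bsub>M'\<^esub> (y \<oplus>\<^bsub>M'\<^esub> z)"
    using x y by (simp add: smult_assoc1[symmetric] smult_r_distr R.m_ac M.a_ac)
qed (simp add: localized_zero)

lemma fractions_regular_module: "fractions R (regular_module R) S"
  by (intro fractions.intro fractions_axioms.intro R.regular_module S_subset S_one S_mult)

sublocale ring: fractions R "regular_module R" S
  by (rule fractions_regular_module)

abbreviation (input) "R' \<equiv> localized_ring R S"
abbreviation (input) "rfrac \<equiv> fraction S (regular_module R)"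

lemma rfrac_smult [simp]:
  assumes "r \<in> carrier R" "m \<in> carrier M" "s \<in> S" "t \<in> S"
  shows "rfrac r s \<odot>\<^bsub>M'\<^esub> fraction S M m t = fraction S M (r \<odot>\<^bsub>M\<^esub> m) (s \<otimes> t)"
  unfolding localized_module_def partial_object.simps monoid.simps ring.simps module.simps
proof (rule UN_UN_constant)
  show "(r, s) \<in> rfrac r s" "(m, t) \<in> fraction S M m t"
    using assms by (simp_all add: fraction_self ring.fraction_self)
  fix r' s' m' t' assume r': "(r', s') \<in> rfrac r s" and m': "(m', t') \<in> fraction S M m t"
  obtain u where u: "r' \<in> carrier R" "s' \<in> S" "u \<in> S" "u \<otimes> (s' \<otimes> r) = u \<otimes> (s \<otimes> r')"
    using ring.fraction_memE[OF r'] by (metis regular_module_simps(1,4))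
  obtain v where v: "m' \<in> carrier M" "t' \<in> S" "v \<in> S" "v \<odot>\<^bsub>M\<^esub> (t' \<odot>\<^bsub>M\<^esub> m) = v \<odot>\<^bsub>M\<^esub> (t \<odot>\<^bsub>M\<^esub> m')"
    using m' by (rule fraction_memE)
  note rearrange = smult_assoc1[symmetric] R.m_ac
  have "(u \<otimes> v) \<odot>\<^bsub>M\<^esub> ((s \<otimes> t) \<odot>\<^bsub>M\<^esub> (r' \<odot>\<^bsub>M\<^esub> m')) = (u \<otimes> (s \<otimes> r')) \<odot>\<^bsub>M\<^esub> (v \<odot>\<^bsub>M\<^esub> (t \<odot>\<^bsub>M\<^esub> m'))"
    using assms u(1-3) v(1-3) by (simp add: rearrange)
  also have "\<dots> = (u \<otimes> v) \<odot>\<^bsub>M\<^esub> ((s' \<otimes> t') \<odot>\<^bsub>M\<^esub> (r \<odot>\<^bsub>M\<^esub> m))"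
    unfolding u(4)[symmetric] v(4)[symmetric] using assms u(1-3) v(1-3) by (simp add: rearrange)
  finally show "fraction S M (r' \<odot>\<^bsub>M\<^esub> m') (s' \<otimes> t') = fraction S M (r \<odot>\<^bsub>M\<^esub> m) (s \<otimes> t)"
    using assms u(1-3) v(1-3) by (intro fraction_eqI[of _ _ _ _ "u \<otimes> v"]) simp_all
qed

lemma localized_ring_simps:
  "carrier R' = carrier (localized_module R S (regular_module R))"
  "\<zero>\<^bsub>R'\<^esub> = rfrac \<zero> \<one>" "\<one>\<^bsub>R'\<^esub> = rfrac \<one> \<one>"
  "add R' = add (localized_module R S (regular_module R))"
  "monoid.mult R' = smult (localized_module R S (regular_module R))"
  by (simp_all add: localized_ring_def localized_module_def)

lemma rfrac_closed [simp]: "r \<in> carrier R \<Longrightarrow> s \<in> S \<Longrightarrow> rfrac r s \<in> carrier R'"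
  by (simp add: localized_ring_simps)

lemma localized_ringE:
  assumes "x \<in> carrier R'"
  obtains r s where "r \<in> carrier R" "s \<in> S" "x = rfrac r s"
  using assms unfolding localized_ring_simps by (rule ring.localized_carrierE) simp

lemma rfrac_add [simp]:
  "r \<in> carrier R \<Longrightarrow> r' \<in> carrier R \<Longrightarrow> s \<in> S \<Longrightarrow> t \<in> S \<Longrightarrow>
    rfrac r s \<oplus>\<^bsub>R'\<^esub> rfrac r' t = rfrac (t \<otimes> r \<oplus> s \<otimes> r') (s \<otimes> t)"
  by (simp add: localized_ring_simps)

lemma rfrac_mult [simp]:
  "r \<in> carrier R \<Longrightarrow> r' \<in> carrier R \<Longrightarrow> s \<in> S \<Longrightarrow> t \<in> S \<Longrightarrow>
    rfrac r s \<otimes>\<^bsub>R'\<^esub> rfrac r' t = rfrac (r \<otimes> r') (s \<otimes> t)"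
  by (simp add: localized_ring_simps fractions.rfrac_smult[OF fractions_regular_module])

lemma rfrac_cross_eqI:
  "r \<in> carrier R \<Longrightarrow> r' \<in> carrier R \<Longrightarrow> s \<in> S \<Longrightarrow> t \<in> S \<Longrightarrow> t \<otimes> r = s \<otimes> r' \<Longrightarrow> rfrac r s = rfrac r' t"
  by (rule ring.fraction_cross_eqI) simp_all

lemma localized_ring_cring: "cring R'"
proof (rule cringI)
  let ?L = "localized_module R S (regular_module R)"
  interpret A: abelian_group ?L by (rule ring.localized_abelian_group)
  have "carrier R' = carrier ?L" "add R' = add ?L" "\<zero>\<^bsub>R'\<^esub> = \<zero>\<^bsub>?L\<^esub>"
    by (simp_all add: localized_ring_def Let_def)
  then show "abelian_group R'"
    by (intro abelian_groupI) (auto simp: A.a_ac intro: A.l_neg bexI[of _ "\<ominus>\<^bsub>?L\<^esub> _"])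
  fix x assume "x \<in> carrier R'"
  then obtain a s where x: "a \<in> carrier R" "s \<in> S" "x = rfrac a s" by (rule localized_ringE)
  fix y assume "y \<in> carrier R'"
  then obtain b t where y: "b \<in> carrier R" "t \<in> S" "y = rfrac b t" by (rule localized_ringE)
  fix z assume "z \<in> carrier R'"
  then obtain c u where z: "c \<in> carrier R" "u \<in> S" "z = rfrac c u" by (rule localized_ringE)
  have "rfrac ((t \<otimes> a \<oplus> s \<otimes> b) \<otimes> c) (s \<otimes> t \<otimes> u) =
      rfrac (t \<otimes> u \<otimes> (a \<otimes> c) \<oplus> s \<otimes> u \<otimes> (b \<otimes> c)) (s \<otimes> u \<otimes> (t \<otimes> u))"
    using x y z by (intro rfrac_cross_eqI) (simp_all add: R.l_distr R.r_distr R.m_ac)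
  then show "(x \<oplus>\<^bsub>R'\<^esub> y) \<otimes>\<^bsub>R'\<^esub> z = x \<otimes>\<^bsub>R'\<^esub> z \<oplus>\<^bsub>R'\<^esub> y \<otimes>\<^bsub>R'\<^esub> z"
    using x y z by simp
next
  show "Group.comm_monoid R'"
  proof (rule comm_monoidI)
    fix x assume "x \<in> carrier R'"
    then obtain a s where x: "a \<in> carrier R" "s \<in> S" "x = rfrac a s" by (rule localized_ringE)
    then show "\<one>\<^bsub>R'\<^esub> \<otimes>\<^bsub>R'\<^esub> x = x" by (simp add: localized_ring_simps(3))
    fix y assume "y \<in> carrier R'"
    then obtain b t where y: "b \<in> carrier R" "t \<in> S" "y = rfrac b t" by (rule localized_ringE)
    show "x \<otimes>\<^bsub>R'\<^esub> y \<in> carrier R'" "x \<otimes>\<^bsub>R'\<^esub> y = y \<otimes>\<^bsub>R'\<^esub> x"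
      using x y by (simp_all add: R.m_comm)
    fix z assume "z \<in> carrier R'"
    then obtain c u where "c \<in> carrier R" "u \<in> S" "z = rfrac c u" by (rule localized_ringE)
    then show "x \<otimes>\<^bsub>R'\<^esub> y \<otimes>\<^bsub>R'\<^esub> z = x \<otimes>\<^bsub>R'\<^esub> (y \<otimes>\<^bsub>R'\<^esub> z)" using x y by (simp add: R.m_assoc)
  qed (simp add: localized_ring_simps(3))
qed

lemma localized_module: "module R' M'"
proof (rule moduleI[OF localized_ring_cring localized_abelian_group])
  note rearrange = smult_assoc1[symmetric] smult_l_distr smult_r_distr R.r_distr R.m_ac
  fix x assume "x \<in> carrier M'"
  then obtain m w where x: "m \<in> carrier M" "w \<in> S" "x = fraction S M m w"
    by (rule localized_carrierE)
  then show "\<one>\<^bsub>R'\<^esub> \<odot>\<^bsub>M'\<^esub> x = x" by (simp add: localized_ring_simps(3))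
  fix a assume "a \<in> carrier R'"
  then obtain r s where a: "r \<in> carrier R" "s \<in> S" "a = rfrac r s" by (rule localized_ringE)
  show "a \<odot>\<^bsub>M'\<^esub> x \<in> carrier M'" using a x by simp
  {
    fix b assume "b \<in> carrier R'"
    then obtain r' t where b: "r' \<in> carrier R" "t \<in> S" "b = rfrac r' t" by (rule localized_ringE)
    show "(a \<otimes>\<^bsub>R'\<^esub> b) \<odot>\<^bsub>M'\<^esub> x = a \<odot>\<^bsub>M'\<^esub> (b \<odot>\<^bsub>M'\<^esub> x)"
      using a b x by (simp add: smult_assoc1 R.m_assoc)
    show "(a \<oplus>\<^bsub>R'\<^esub> b) \<odot>\<^bsub>M'\<^esub> x = a \<odot>\<^bsub>M'\<^esub> x \<oplus>\<^bsub>M'\<^esub> b \<odot>\<^bsub>M'\<^esub> x"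
      using a b x by simp (rule fraction_cross_eqI, simp_all add: rearrange)
  next
    fix y assume "y \<in> carrier M'"
    then obtain n u where y: "n \<in> carrier M" "u \<in> S" "y = fraction S M n u"
      by (rule localized_carrierE)
    show "a \<odot>\<^bsub>M'\<^esub> (x \<oplus>\<^bsub>M'\<^esub> y) = a \<odot>\<^bsub>M'\<^esub> x \<oplus>\<^bsub>M'\<^esub> a \<odot>\<^bsub>M'\<^esub> y"
      using a x y by simp (rule fraction_cross_eqI, simp_all add: rearrange)
  }
qed

lemma ring_localization: "ring_localization R R' (\<lambda>r. rfrac r \<one>) S"
proof (intro ring_localization.intro ring_hom_cring.intro ring_hom_cring_axioms.intro
    ring_localization_axioms.intro R.is_cring localized_ring_cring S_subset)
  show "(\<lambda>r. rfrac r \<one>) \<in> ring_hom R R'"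
    by (rule ring_hom_memI) (simp_all add: localized_ring_simps(3))
  show "rfrac s \<one> \<in> Units R'" if "s \<in> S" for s
  proof -
    have "rfrac s s = \<one>\<^bsub>R'\<^esub>"
      unfolding localized_ring_simps(3) using that by (intro rfrac_cross_eqI) simp_all
    then show ?thesis
      using that unfolding Units_def by (intro CollectI conjI bexI[of _ "rfrac \<one> s"]) simp_all
  qed
  fix x assume "x \<in> carrier R'"
  then obtain r s where x: "r \<in> carrier R" "s \<in> S" "x = rfrac r s" by (rule localized_ringE)
  have "rfrac (s \<otimes> r) s = rfrac r \<one>" using x by (intro rfrac_cross_eqI) simp_all
  then show "\<exists>s\<in>S. \<exists>r\<in>carrier R. rfrac s \<one> \<otimes>\<^bsub>R'\<^esub> x = rfrac r \<one>"
    using x by (intro bexI[of _ s] bexI[of _ r]) simp_all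
qed

theorem module_localization:
  "module_localization R R' (\<lambda>r. rfrac r \<one>) S M M' (\<lambda>m. fraction S M m \<one>)"
proof (intro module_localization.intro ring_localization localized_module localization_map.intro
    localization_map_axioms.intro module_homomorphism.intro module_homomorphism_axioms.intro
    module_axioms S_subset S_one S_mult)
  let ?\<phi> = "\<lambda>r. rfrac r \<one>" and ?\<iota> = "\<lambda>m. fraction S M m \<one>"
  interpret \<phi>: ring_localization R R' ?\<phi> S by (rule ring_localization)
  interpret M': module R' M' by (rule localized_module)
  show "module R (restrict_scalars ?\<phi> M')" by (rule \<phi>.restrict_scalars_module[OF localized_module])
  show "?\<iota> \<in> mod_hom R M (restrict_scalars ?\<phi> M')" by (simp add: mod_hom_def)
  show "bij_betw (\<lambda>x. s \<odot>\<^bsub>restrict_scalars ?\<phi> M'\<^esub> x) (carrier (restrict_scalars ?\<phi> M'))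
      (carrier (restrict_scalars ?\<phi> M'))" if "s \<in> S" for s
  proof (rule bij_betw_byWitness[where f' = "\<lambda>x. rfrac \<one> s \<odot>\<^bsub>M'\<^esub> x"])
    have "rfrac s s \<odot>\<^bsub>M'\<^esub> x = x" if "x \<in> carrier M'" for x
    proof -
      have "rfrac s s = \<one>\<^bsub>R'\<^esub>"
        unfolding localized_ring_simps(3) using \<open>s \<in> S\<close> by (intro rfrac_cross_eqI) simp_all
      then show ?thesis using that by simp
    qed
    moreover have "rfrac s \<one> \<otimes>\<^bsub>R'\<^esub> rfrac \<one> s = rfrac s s" "rfrac \<one> s \<otimes>\<^bsub>R'\<^esub> rfrac s \<one> = rfrac s s"
      using that by simp_all
    ultimately show "\<forall>x\<in>carrier (restrict_scalars ?\<phi> M').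
        rfrac \<one> s \<odot>\<^bsub>M'\<^esub> (s \<odot>\<^bsub>restrict_scalars ?\<phi> M'\<^esub> x) = x"
      "\<forall>x\<in>carrier (restrict_scalars ?\<phi> M'). s \<odot>\<^bsub>restrict_scalars ?\<phi> M'\<^esub> (rfrac \<one> s \<odot>\<^bsub>M'\<^esub> x) = x"
      using that by (simp_all flip: M'.smult_assoc1)
  qed (use that in auto)
  show "\<exists>s\<in>S. s \<odot>\<^bsub>restrict_scalars ?\<phi> M'\<^esub> x' \<in> ?\<iota> ` carrier M"
    if "x' \<in> carrier (restrict_scalars ?\<phi> M')" for x'
  proof -
    from that have "x' \<in> carrier M'" by simp
    then obtain m s where x': "m \<in> carrier M" "s \<in> S" "x' = fraction S M m s"
      by (rule localized_carrierE)
    have "fraction S M (s \<odot>\<^bsub>M\<^esub> m) s = ?\<iota> m" using x' by (intro fraction_cross_eqI) simp_all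
    then show ?thesis using x' by (intro bexI[of _ s]) simp_all
  qed
  show "\<exists>s\<in>S. s \<odot>\<^bsub>M\<^esub> x = \<zero>\<^bsub>M\<^esub>" if "x \<in> carrier M" "?\<iota> x = \<zero>\<^bsub>restrict_scalars ?\<phi> M'\<^esub>" for x
    using fraction_eqD[of "\<zero>\<^bsub>M\<^esub>" \<one> x \<one>] that by (simp add: localized_zero)
qed

end

lemma fractions_at_prime:
  assumes "module R M" "primeideal \<pp> R"
  shows "fractions R M (carrier R - \<pp>)"
proof (intro fractions.intro fractions_axioms.intro assms(1))
  interpret \<pp>: primeideal \<pp> R by fact
  show "\<one>\<^bsub>R\<^esub> \<in> carrier R - \<pp>" using \<pp>.I_notcarr \<pp>.one_imp_carrier by auto
  show "s \<otimes>\<^bsub>R\<^esub> t \<in> carrier R - \<pp>" if "s \<in> carrier R - \<pp>" "t \<in> carrier R - \<pp>" for s t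
    using that \<pp>.I_prime[of s t] by auto
qed simp

section \<open>Relative Cohen-Macaulay filtrations\<close>

context module begin

context
  fixes ys
  assumes noetherian: "noetherian_ring R" and ys: "set ys \<subseteq> carrier R"
begin

lemma cd_le_iff:
  "cd R (Idl (set ys)) M \<le> ereal (real k) \<longleftrightarrow> (\<forall>i>k. koszul_vanishes R ys M (int i))"
proof -
  have "cd R (Idl (set ys)) M \<le> ereal (real k) \<longleftrightarrow> (\<forall>i. \<not> koszul_vanishes R ys M (int i) \<longrightarrow> i \<le> k)"
    unfolding cd_def Sup_le_iff local_cohomology_zero_iff[OF noetherian module_axioms ys] by auto
  then show ?thesis by (meson not_le)
qed

lemma le_cd_iff:
  "ereal (real k) \<le> cd R (Idl (set ys)) M \<longleftrightarrow> (\<exists>i\<ge>k. \<not> koszul_vanishes R ys M (int i))"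
proof
  assume le: "ereal (real k) \<le> cd R (Idl (set ys)) M"
  show "\<exists>i\<ge>k. \<not> koszul_vanishes R ys M (int i)"
  proof (cases k)
    case 0
    have "\<exists>i. \<not> koszul_vanishes R ys M (int i)"
    proof (rule ccontr)
      assume "\<nexists>i. \<not> koszul_vanishes R ys M (int i)"
      then have "cd R (Idl (set ys)) M = -\<infinity>"
        by (simp add: cd_def local_cohomology_zero_iff[OF noetherian module_axioms ys]
            bot_ereal_def)
      then show False using le by simp
    qed
    then show ?thesis using 0 by simp
  next
    case (Suc j)
    have "\<not> cd R (Idl (set ys)) M \<le> ereal (real j)"
      using le Suc by (meson ereal_less_eq(3) not_less_eq_eq of_nat_le_iff order.refl order_trans)
    then show ?thesis unfolding cd_le_iff Suc by (auto simp: Suc_le_eq)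
  qed
next
  assume "\<exists>i\<ge>k. \<not> koszul_vanishes R ys M (int i)"
  then obtain i where i: "k \<le> i" "\<not> koszul_vanishes R ys M (int i)" by blast
  have "ereal (real i) \<le> cd R (Idl (set ys)) M"
    unfolding cd_def local_cohomology_zero_iff[OF noetherian module_axioms ys]
    using i(2) by (intro Sup_upper) blast
  then show "ereal (real k) \<le> cd R (Idl (set ys)) M"
    using i(1) by (meson ereal_less_eq(3) of_nat_le_iff order_trans)
qed

lemma relative_Cohen_Macaulay_iff:
  "relative_Cohen_Macaulay R (Idl (set ys)) M \<and> cd R (Idl (set ys)) M = ereal (real k) \<longleftrightarrow>
    finitely_generated R M \<and> (\<forall>i. koszul_vanishes R ys M (int i) \<longleftrightarrow> i \<noteq> k)" (is "?L \<longleftrightarrow> ?R")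
proof
  assume ?L
  then obtain j where "finitely_generated R M" and j: "\<forall>i. koszul_vanishes R ys M (int i) \<longleftrightarrow> i \<noteq> j"
    unfolding relative_Cohen_Macaulay_def local_cohomology_zero_iff[OF noetherian module_axioms ys]
    by metis
  moreover have "ereal (real j) \<le> ereal (real k)" "ereal (real k) \<le> ereal (real j)"
    using \<open>?L\<close> le_cd_iff[of j] cd_le_iff[of j] j by auto
  ultimately show ?R by simp
next
  assume ?R
  then have "cd R (Idl (set ys)) M = ereal (real k)"
    using le_cd_iff[of k] cd_le_iff[of k] by (intro order_antisym) auto
  then show ?L
    using \<open>?R\<close>
    unfolding relative_Cohen_Macaulay_def local_cohomology_zero_iff[OF noetherian module_axioms ys]
    by auto
qed

end

lemma submodule_subset_of_vanishing:
  assumes noetherian: "noetherian_ring R" and ys: "set ys \<subseteq> jacobson_radical R"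
    and G: "submodule G R M" and H: "submodule H R M" and X: "submodule X R M" and "G \<subseteq> H" "X \<subseteq> H"
    and Q: "finitely_generated R (quotient_module (M\<lparr>carrier := H\<rparr>) G)"
    and "\<forall>q\<ge>j. koszul_vanishes R ys (M\<lparr>carrier := X\<rparr>) (int q)"
    and "\<forall>q<j. koszul_vanishes R ys (quotient_module (M\<lparr>carrier := H\<rparr>) G) (int q)"
  shows "X \<subseteq> G"
proof
  let ?H = "M\<lparr>carrier := H\<rparr>"
  note moduleH = submodule_module[OF H] and GH = submodule_of_submodule[OF G H \<open>G \<subseteq> H\<close>]
  interpret \<pi>: module_homomorphism R ?H "quotient_module ?H G" "\<lambda>x. G +>\<^bsub>?H\<^esub> x"
    by (rule quotient_module_hom[OF moduleH GH])
  interpret X: module_homomorphism R "M\<lparr>carrier := X\<rparr>" "quotient_module ?H G" "\<lambda>x. G +>\<^bsub>?H\<^esub> x"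
    by (intro module_homomorphism.intro module_homomorphism_axioms.intro submodule_module[OF X]
        \<pi>.N.module_axioms mod_hom_restrict[OF \<pi>.hom \<open>X \<subseteq> H\<close>])
  fix x assume "x \<in> X"
  then have "G +>\<^bsub>?H\<^esub> x = \<zero>\<^bsub>quotient_module ?H G\<^esub>"
    using X.koszul_vanishes_imp_zero_hom[OF finitely_generated_noetherian[OF noetherian Q] ys]
      assms(9,10)
    by simp
  then show "x \<in> G"
    using quotient_module_zero_iff[OF moduleH GH] \<open>x \<in> X\<close> \<open>X \<subseteq> H\<close> by auto
qed

end

locale localized_cd_filtration = module_localization R R' \<phi> S N N' \<iota>
  for R :: "('r, 'x) ring_scheme" (structure) and R' :: "('s, 'w) ring_scheme" and \<phi> S
    and N :: "('r, 'm, 'y) module_scheme" and N' :: "('s, 'n, 'z) module_scheme" and \<iota> +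
  fixes ys F
  assumes noetherian: "noetherian_ring R" and ys: "set ys \<subseteq> carrier R"
    and radical: "\<phi> ` set ys \<subseteq> jacobson_radical R'"
    and finitely_generated: "finitely_generated R N"
    and filtration: "cd_filtration R (Idl (set ys)) N F"
    and quotient: "1 \<le> i \<Longrightarrow> ereal (real i) \<le> cd R (Idl (set ys)) N \<Longrightarrow>
      zero_module (quotient_module (N\<lparr>carrier := F i\<rparr>) (F (i - 1))) \<or>
      relative_Cohen_Macaulay R (Idl (set ys)) (quotient_module (N\<lparr>carrier := F i\<rparr>) (F (i - 1))) \<and>
      cd R (Idl (set ys)) (quotient_module (N\<lparr>carrier := F i\<rparr>) (F (i - 1))) = ereal (real i)"
begin

abbreviation "cd_N \<equiv> cd R (Idl (set ys)) N"

lemma le_cd_N_mono: "ereal (real j) \<le> cd_N \<Longrightarrow> i \<le> j \<Longrightarrow> ereal (real i) \<le> cd_N"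
  by (meson ereal_less_eq(3) of_nat_le_iff order_trans)

lemma filtration_submodule: "ereal (real i) \<le> cd_N \<Longrightarrow> submodule (F i) R N"
  using filtration by (simp add: cd_filtration_def)

lemma filtration_vanishes:
  assumes "ereal (real i) \<le> cd_N" "i < q"
  shows "koszul_vanishes R ys (N\<lparr>carrier := F i\<rparr>) (int q)"
proof -
  have "cd R (Idl (set ys)) (N\<lparr>carrier := F i\<rparr>) \<le> ereal (real i)"
    using filtration assms(1) by (simp add: cd_filtration_def)
  then show ?thesis
    using assms(2)
      module.cd_le_iff[OF M.submodule_module[OF filtration_submodule[OF assms(1)]] noetherian ys]
    by blast
qed

lemma filtration_maximal:
  assumes "ereal (real i) \<le> cd_N" "submodule X R N"
    and "\<forall>q>i. koszul_vanishes R ys (N\<lparr>carrier := X\<rparr>) (int q)"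
  shows "X \<subseteq> F i"
  using filtration assms module.cd_le_iff[OF M.submodule_module[OF assms(2)] noetherian ys]
  by (simp add: cd_filtration_def)

lemma filtration_mono: "ereal (real j) \<le> cd_N \<Longrightarrow> i \<le> j \<Longrightarrow> F i \<subseteq> F j"
  by (rule filtration_maximal) (auto intro: filtration_submodule filtration_vanishes le_cd_N_mono)

abbreviation "zs \<equiv> map \<phi> ys"
abbreviation "F' i \<equiv> localized_submodule (F i)"
abbreviation "Q' i \<equiv> quotient_module (N'\<lparr>carrier := F' i\<rparr>) (F' (i - 1))"

lemma noetherian_localized: "noetherian_ring R'"
  by (rule ring.noetherian_localization[OF noetherian])

lemma zs_closed: "set zs \<subseteq> carrier R'"
  using ys by auto

lemma quotient_concentrated:
  assumes "1 \<le> i" "ereal (real i) \<le> cd_N"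
  shows "finitely_generated R' (Q' i)" and "q \<noteq> i \<Longrightarrow> koszul_vanishes R' zs (Q' i) (int q)"
proof -
  note F_i = filtration_submodule[OF assms(2)]
    and F_pred = filtration_submodule[OF le_cd_N_mono[OF assms(2) diff_le_self]]
  let ?Q = "quotient_module (N\<lparr>carrier := F i\<rparr>) (F (i - 1))"
  obtain \<iota>' where "module_localization R R' \<phi> S ?Q (Q' i) \<iota>'"
    using module_localization_subquotient[OF F_pred F_i filtration_mono[OF assms(2) diff_le_self]]
    by (rule exE)
  then interpret Q: module_localization R R' \<phi> S ?Q "Q' i" \<iota>' .
  have Q: "finitely_generated R ?Q" "\<forall>q. q \<noteq> i \<longrightarrow> koszul_vanishes R ys ?Q (int q)"
    using quotient[OF assms] Q.M.zero_module_finitely_generated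
      Q.M.koszul_vanishes_zero_module[OF _ ys]
    unfolding Q.M.relative_Cohen_Macaulay_iff[OF noetherian ys] by blast+
  show "finitely_generated R' (Q' i)" by (rule Q.finitely_generated_localization[OF Q(1)])
  show "koszul_vanishes R' zs (Q' i) (int q)" if "q \<noteq> i"
    by (rule Q.koszul_vanishes_localized[OF ys]) (use Q(2) that in blast)
qed

lemma localized_filtration_maximal:
  assumes X: "submodule X R' N'"
  shows "ereal (real i) \<le> cd_N \<Longrightarrow> \<forall>q>i. koszul_vanishes R' zs (N'\<lparr>carrier := X\<rparr>) (int q) \<Longrightarrow> X \<subseteq> F' i"
proof (induction i rule: measure_induct_rule[where f = "\<lambda>i. length ys - i"])
  case (less i)
  show ?case
  proof (cases "ereal (real (Suc i)) \<le> cd_N")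
    case True
    then have "\<not> (\<forall>j>i. koszul_vanishes R ys N (int j))"
      unfolding M.le_cd_iff[OF noetherian ys] by (auto simp: Suc_le_eq)
    then have "i < length ys" using M.koszul_vanishes_out_of_range[OF ys] by force
    then have "X \<subseteq> F' (Suc i)" using less.IH[of "Suc i"] True less.prems(2) by simp
    moreover have "F i \<subseteq> F (Suc i)" by (rule filtration_mono[OF True]) simp
    ultimately show ?thesis
      using quotient_concentrated[OF _ True] less.prems
      by (intro L.submodule_subset_of_vanishing[OF noetherian_localized _
            submodule_extend_scalars[OF filtration_submodule]
            submodule_extend_scalars[OF filtration_submodule[OF True]]
            X localized_submodule_mono, of zs i "Suc i"])
        (use radical in \<open>auto simp: Suc_le_eq\<close>)
  next
    case False
    then have "carrier N \<subseteq> F i"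
      unfolding M.le_cd_iff[OF noetherian ys]
      by (intro filtration_maximal[OF less.prems(1) M.carrier_is_submodule]) (auto simp: Suc_le_eq)
    then have "carrier N' \<subseteq> F' i"
      using localized_submodule_mono[of "carrier N"] localized_submodule_carrier by simp
    then show ?thesis using L.submoduleE(1)[OF X] by simp
  qed
qed

lemma cd_localized_le: "cd R' (Idl\<^bsub>R'\<^esub> (set zs)) N' \<le> cd_N"
  unfolding cd_def local_cohomology_zero_iff[OF noetherian M.module_axioms ys]
    local_cohomology_zero_iff[OF noetherian_localized L.module_axioms zs_closed]
  using koszul_vanishes_localized[OF ys] by (intro Sup_subset_mono) blast

lemma cd_filtration_localized: "cd_filtration R' (Idl\<^bsub>R'\<^esub> (set zs)) N' F'"
  unfolding cd_filtration_def
proof (intro allI impI conjI)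
  fix i assume "ereal (real i) \<le> cd R' (Idl\<^bsub>R'\<^esub> (set zs)) N'"
  then have i: "ereal (real i) \<le> cd_N" using cd_localized_le by (rule order_trans)
  note cd_iff = module.cd_le_iff[OF L.submodule_module noetherian_localized zs_closed]
  show F': "submodule (F' i) R' N'"
    by (rule submodule_extend_scalars[OF filtration_submodule[OF i]])
  interpret F: module_localization R R' \<phi> S "N\<lparr>carrier := F i\<rparr>" "N'\<lparr>carrier := F' i\<rparr>" \<iota>
    by (rule module_localization_submodule[OF filtration_submodule[OF i]])
  show "cd R' (Idl\<^bsub>R'\<^esub> (set zs)) (N'\<lparr>carrier := F' i\<rparr>) \<le> ereal (real i)"
    unfolding cd_iff[OF F'] using F.koszul_vanishes_localized[OF ys] filtration_vanishes[OF i]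
    by blast
  fix X assume "submodule X R' N' \<and> cd R' (Idl\<^bsub>R'\<^esub> (set zs)) (N'\<lparr>carrier := X\<rparr>) \<le> ereal (real i)"
  then show "X \<subseteq> F' i" using localized_filtration_maximal[OF _ i] cd_iff by blast
qed

lemma RCMF_localized: "RCMF R' (Idl\<^bsub>R'\<^esub> (set zs)) N'"
proof -
  have "zero_module (Q' i) \<or>
      relative_Cohen_Macaulay R' (Idl\<^bsub>R'\<^esub> (set zs)) (Q' i) \<and>
      cd R' (Idl\<^bsub>R'\<^esub> (set zs)) (Q' i) = ereal (real i)"
    if "1 \<le> i" "ereal (real i) \<le> cd R' (Idl\<^bsub>R'\<^esub> (set zs)) N'" for i
  proof -
    note Q = quotient_concentrated[OF that(1) order_trans[OF that(2) cd_localized_le]]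
    interpret Q: module R' "Q' i" using Q(1) by (simp add: finitely_generated_def)
    have "zero_module (Q' i)" if "koszul_vanishes R' zs (Q' i) (int i)"
    proof (rule Q.koszul_vanishes_imp_zero_module)
      show "noetherian_submodule R' (Q' i) (carrier (Q' i))"
        by (rule finitely_generated_noetherian[OF noetherian_localized Q(1)])
      show "\<forall>q. koszul_vanishes R' zs (Q' i) (int q)" using Q(2) that by metis
    qed (use radical in simp)
    then show ?thesis
      unfolding Q.relative_Cohen_Macaulay_iff[OF noetherian_localized zs_closed] using Q by blast
  qed
  then show ?thesis
    unfolding RCMF_def Let_def
    using finitely_generated_localization[OF finitely_generated] cd_filtration_localized by blast
qed

end

theorem proposition2p25:
  fixes R :: "('r, 'x) ring_scheme" and \<aa> :: "'r set" and M :: "('r, 'm, 'y) module_scheme"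
  assumes "cring R" and "noetherian_ring R"
    and "ideal \<aa> R" and "\<aa> \<noteq> carrier R"
    and "RCMF R \<aa> M"
    and "\<pp> \<in> Supp R M \<inter> primes_containing R \<aa>"
  shows "RCMF (ring_at R \<pp>) (extended_ideal_at R \<pp> \<aa>) (module_at R \<pp> M)"
proof -
  interpret R: cring R by fact
  have \<pp>: "primeideal \<pp> R" "\<aa> \<subseteq> \<pp>" using assms(6) by (auto simp: primes_containing_def)
  obtain F where M: "finitely_generated R M" and F: "cd_filtration R \<aa> M F"
    and quotient: "\<And>i. 1 \<le> i \<and> ereal (real i) \<le> cd R \<aa> M \<longrightarrow>
      (let Q = quotient_module (M\<lparr>carrier := F i\<rparr>) (F (i - 1))
       in zero_module Q \<or> relative_Cohen_Macaulay R \<aa> Q \<and> cd R \<aa> Q = ereal (real i))"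
    using assms(5) unfolding RCMF_def by blast
  obtain ys where generators: "set ys \<subseteq> carrier R" "\<aa> = Idl\<^bsub>R\<^esub> (set ys)"
    using noetherian_ring.finetely_gen[OF assms(2,3)] finite_list by metis
  interpret fractions R M "carrier R - \<pp>"
    using M \<pp>(1) by (intro fractions_at_prime) (simp_all add: finitely_generated_def)
  let ?\<phi> = "\<lambda>r. rfrac r \<one>\<^bsub>R\<^esub>"
  interpret module_localization R R' ?\<phi> "carrier R - \<pp>" M M' "\<lambda>m. fraction (carrier R - \<pp>) M m \<one>\<^bsub>R\<^esub>"
    by (rule module_localization)
  have "?\<phi> ` set ys \<subseteq> jacobson_radical R'"
    using ring.prime_in_jacobson_radical[OF \<pp>(1) refl] \<pp>(2) generators(2)
      R.genideal_self[OF generators(1)]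
    by blast
  then interpret localized_cd_filtration R R' ?\<phi> "carrier R - \<pp>" M M'
      "\<lambda>m. fraction (carrier R - \<pp>) M m \<one>\<^bsub>R\<^esub>" ys F
    using assms(2) generators M F quotient
    by (intro localized_cd_filtration.intro localized_cd_filtration_axioms.intro
        module_localization_axioms)
      (simp_all add: Let_def)
  show ?thesis
    using RCMF_localized ring.genideal_image[OF generators(1)]
    by (simp add: ring_at_def module_at_def extended_ideal_at_def generators(2))
qed

end
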